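(* Let $k$ be a finite field with $|k|=q$ and let $Q$ be an acyclic quiver with vertex set $\{1,\dots,n\}$ whose underlying graph is bipartite (i.e. the graph admits an orientation for which every vertex is a sink or a source) and whose associated $n\times n$ matrix $B$ is of full rank. Let $\Lambda$ be an antisymmetric integer $n\times n$ matrix with $\Lambda(-B)=I_n$. Let $\mathcal{AH}_{|k|}(Q)$ be the algebra generated by all quantum cluster characters of objects of the cluster category $\mathcal{C}_Q$, and let $\mathcal{A}_{|k|}(Q)$ be the (coefficient-free) quantum cluster algebra with initial data $(\Lambda,B)$. Then $$\mathcal{AH}_{|k|}(Q)=\mathcal{A}_{|k|}(Q).$$
   Context: Matrices. $B=(b_{ij})$ is the $n\times n$ matrix with $b_{ij}=|\{\text{arrows } i\to j\}|-|\{\text{arrows } j\to i\}|$. $R=(r_{ij})$ is the $n\times n$ matrix with $r_{ij}=|\{\text{arrows } j\to i\}|=\dim_k\mathrm{Ext}^1_{kQ}(S_j,S_i)$, where $S_i$ is the simple module at $i$; $R^{tr}$ is its transpose, so $B=R^{tr}-R$. $I_n$ is the identity matrix. Put $\Lambda(c,d)=c^{T}\Lambda d$ for $c,d\in\mathbb{Z}^n$. Quantum torus. $q=|k|$ with a fixed square root $q^{1/2}$. $\mathcal{T}$ is the $\mathbb{Z}[q^{\pm1/2}]$-algebra with $\mathbb{Z}[q^{\pm1/2}]$-basis $\{X^{c}: c\in\mathbb{Z}^n\}$ and multiplication $X^{c}X^{d}=q^{\Lambda(c,d)/2}X^{c+d}$. It is an Ore domain with skew-field of fractions $\mathcal{F}$.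 Write $X_i=X^{e_i}$, with $e_1,\dots,e_n$ the standard basis of $\mathbb{Z}^n$. Quantum cluster algebra. A toric frame with antisymmetric form $\Lambda_M$ is given by elements $M(e_1),\dots,M(e_n)\in\mathcal{F}\setminus\{0\}$ and extended to $M:\mathbb{Z}^n\to\mathcal{F}\setminus\{0\}$ satisfying $M(c)M(d)=q^{\Lambda_M(c,d)/2}M(c+d)$ and $M(0)=1$. The initial seed is $(M,B)$ with $M(c)=X^{c}$, $\Lambda_M=\Lambda$. The mutation of a seed $(M,B)$ in direction $p\in\{1,\dots,n\}$ is the seed $(M',B')$, where $M'(e_i)=M(e_i)$ for $i\neq p$, $$M'(e_p)=M\Big(\sum_i[b_{ip}]_+e_i-e_p\Big)+M\Big(\sum_i[-b_{ip}]_+e_i-e_p\Big),\qquad [b]_+=\max(b,0),$$ $\Lambda_{M'}=E^{T}\Lambda_M E$ with $E=(e_{ij})$, $e_{ij}=\delta_{ij}$ if $j\ne p$, $e_{pp}=-1$, $e_{ip}=\max(0,-b_{ip})$ if $i\neq p$; and $b'_{ij}=-b_{ij}$ if $i=p$ or $j=p$, $b'_{ij}=b_{ij}+\mathrm{sgn}(b_{ip})[b_{ip}b_{pj}]_+$ otherwise. The cluster variables are all elements $M'(e_i)$, $1\le i\le n$, for seeds $(M',B')$ obtained from the initial seed by finite sequences of mutations. $\mathcal{A}_{|k|}(Q)$ is the $\mathbb{Z}[q^{\pm1/2}]$-subalgebra of $\mathcal{F}$ generated by all cluster variables. Quantum cluster characters. The cluster category $\mathcal{C}_Q$ is the orbit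 category of $\mathcal{D}^b(kQ)$ under $\tau\circ[-1]$ ($\tau$ the Auslander–Reiten translation). Each object is, up to isomorphism, uniquely of the form $M\oplus I[-1]$ with $M$ a finite-dimensional $kQ$-module and $I$ a finite-dimensional injective $kQ$-module. With $\underline{m},\underline{i}\in\mathbb{Z}^n$ the dimension vectors of $M,I$, its quantum cluster character is $$X_{M\oplus I[-1]}=\sum_{\underline{e}}|\mathrm{Gr}_{\underline{e}}M|\,q^{-\frac12\langle\underline{e},\underline{m}-\underline{e}-\underline{i}\rangle}X^{-B\underline{e}-(I_n-R^{tr})\underline{m}+\underline{\dim}\,\mathrm{soc}\,I}\in\mathcal{T},$$ where $\mathrm{Gr}_{\underline{e}}M$ is the (finite) set of submodules of $M$ of dimension vector $\underline{e}$ and $\langle M,N\rangle=\dim_k\mathrm{Hom}(M,N)-\dim_k\mathrm{Ext}^1(M,N)$ is the Euler form, which depends only on dimension vectors and is extended bilinearly to $\mathbb{Z}^n$. $\mathcal{AH}_{|k|}(Q)$ is the $\mathbb{Z}[q^{\pm1/2}]$-subalgebra of $\mathcal{F}$ generated by all $X_L$, $L\in\mathcal{C}_Q$. *)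

theory Defs
  imports
    "HOL-Analysis.Analysis"
    "HOL-Library.Poly_Mapping"
    "HOL-Library.Function_Algebras"
    "Graph_Theory.Digraph"
    "Graph_Theory.Arc_Walk"
begin

section \<open>Quivers\<close>

text \<open>A quiver is a digraph \<open>Q :: ('n::finite, 'a) pre_digraph\<close> of the AFP entry Graph_Theory
  (parallel arcs and loops allowed), with \<open>verts Q = UNIV\<close>: the index set \<open>{1..n}\<close> is the
  type \<open>'n\<close>.\<close>

definition acyclic_quiver :: "('n, 'a) pre_digraph \<Rightarrow> bool" where
  "acyclic_quiver Q \<longleftrightarrow> (\<nexists>p. pre_digraph.cycle Q p)"

definition reorient :: "'a set \<Rightarrow> ('n, 'a) pre_digraph \<Rightarrow> ('n, 'a) pre_digraph" where
  "reorient F Q = Q\<lparr>tail := (\<lambda>a. if a \<in> F then head Q a else tail Q a),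
                     head := (\<lambda>a. if a \<in> F then tail Q a else head Q a)\<rparr>"

definition is_sink :: "('n, 'a) pre_digraph \<Rightarrow> 'n \<Rightarrow> bool" where
  "is_sink Q i \<longleftrightarrow> out_arcs Q i = {}"

definition is_source :: "('n, 'a) pre_digraph \<Rightarrow> 'n \<Rightarrow> bool" where
  "is_source Q i \<longleftrightarrow> in_arcs Q i = {}"

definition bipartite_quiver :: "('n, 'a) pre_digraph \<Rightarrow> bool" where
  "bipartite_quiver Q \<longleftrightarrow>
     (\<exists>F\<subseteq>arcs Q. \<forall>i\<in>verts Q. is_sink (reorient F Q) i \<or> is_source (reorient F Q) i)"

definition num_arrows :: "('n, 'a) pre_digraph \<Rightarrow> 'n \<Rightarrow> 'n \<Rightarrow> nat" where
  "num_arrows Q i j = card {a \<in> arcs Q. tail Q a = i \<and> head Q a = j}"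

definition R_matrix :: "('n::finite, 'a) pre_digraph \<Rightarrow> int^'n^'n" where
  "R_matrix Q = (\<chi> i j. int (num_arrows Q j i))"

definition B_matrix :: "('n::finite, 'a) pre_digraph \<Rightarrow> int^'n^'n" where
  "B_matrix Q = (\<chi> i j. int (num_arrows Q i j) - int (num_arrows Q j i))"


section \<open>Finite-dimensional modules over the path algebra\<close>

text \<open>A finite-dimensional \<open>kQ\<close>-module is given as a representation of \<open>Q\<close>: for each vertex a
  finite-dimensional subspace of the \<open>k\<close>-vector space \<open>nat \<Rightarrow> k\<close>, and for each arrow a linear
  map from the space at its tail to the space at its head. The ambient space is
  infinite-dimensional, so every finite-dimensional module occurs up to isomorphism. With this
  (covariant) convention \<open>dim Ext\<^sup>1(S\<^sub>j, S\<^sub>i)\<close> is the number of arrows from \<open>j\<close> to \<open>i\<close>.\<close>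

type_synonym 'k kvec = "nat \<Rightarrow> 'k"

definition kscale :: "'k::field \<Rightarrow> 'k kvec \<Rightarrow> 'k kvec" where
  "kscale c v = (\<lambda>m. c * v m)"

global_interpretation kvec: vector_space "kscale :: 'k::field \<Rightarrow> 'k kvec \<Rightarrow> 'k kvec"
  by unfold_locales (auto simp: kscale_def fun_eq_iff algebra_simps)

definition linear_between :: "'k::field kvec set \<Rightarrow> 'k kvec set \<Rightarrow> ('k kvec \<Rightarrow> 'k kvec) \<Rightarrow> bool" where
  "linear_between V W f \<longleftrightarrow>
     f ` V \<subseteq> W \<and>
     (\<forall>x\<in>V. \<forall>y\<in>V. f (x + y) = f x + f y) \<and>
     (\<forall>c. \<forall>x\<in>V. f (kscale c x) = kscale c (f x))"

record ('n, 'a, 'k) rep =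
  space_at :: "'n \<Rightarrow> 'k kvec set"
  map_at :: "'a \<Rightarrow> 'k kvec \<Rightarrow> 'k kvec"

definition is_rep :: "('n, 'a) pre_digraph \<Rightarrow> ('n, 'a, 'k::field) rep \<Rightarrow> bool" where
  "is_rep Q M \<longleftrightarrow>
     (\<forall>i. \<exists>S. finite S \<and> space_at M i = kvec.span S) \<and>
     (\<forall>a\<in>arcs Q. linear_between (space_at M (tail Q a)) (space_at M (head Q a)) (map_at M a))"

definition dimvec :: "('n::finite \<Rightarrow> 'k::field kvec set) \<Rightarrow> int^'n" where
  "dimvec V = (\<chi> i. int (kvec.dim (V i)))"

abbreviation rep_dim :: "('n::finite, 'a, 'k::field) rep \<Rightarrow> int^'n" where
  "rep_dim M \<equiv> dimvec (space_at M)"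

definition submodule ::
    "('n, 'a) pre_digraph \<Rightarrow> ('n, 'a, 'k::field) rep \<Rightarrow> ('n \<Rightarrow> 'k kvec set) \<Rightarrow> bool" where
  "submodule Q M U \<longleftrightarrow>
     (\<forall>i. kvec.subspace (U i) \<and> U i \<subseteq> space_at M i) \<and>
     (\<forall>a\<in>arcs Q. map_at M a ` U (tail Q a) \<subseteq> U (head Q a))"

definition Gr ::
    "('n, 'a) pre_digraph \<Rightarrow> int^'n \<Rightarrow> ('n::finite, 'a, 'k::field) rep \<Rightarrow> ('n \<Rightarrow> 'k kvec set) set" where
  "Gr Q e M = {U. submodule Q M U \<and> dimvec U = e}"

definition simple_submodule ::
    "('n, 'a) pre_digraph \<Rightarrow> ('n, 'a, 'k::field) rep \<Rightarrow> ('n \<Rightarrow> 'k kvec set) \<Rightarrow> bool" where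
  "simple_submodule Q M U \<longleftrightarrow>
     submodule Q M U \<and> U \<noteq> (\<lambda>i. {0}) \<and>
     (\<forall>W. submodule Q M W \<and> (\<forall>i. W i \<subseteq> U i) \<longrightarrow> W = (\<lambda>i. {0}) \<or> W = U)"

definition soc :: "('n, 'a) pre_digraph \<Rightarrow> ('n, 'a, 'k::field) rep \<Rightarrow> 'n \<Rightarrow> 'k kvec set" where
  "soc Q M = (\<lambda>i. kvec.span (\<Union>U\<in>{U. simple_submodule Q M U}. U i))"

text \<open>Homomorphisms are set to zero outside the source module, so that distinct elements of
  \<open>Hom Q M N\<close> are distinct module homomorphisms and \<open>Hom Q M N\<close> is a \<open>k\<close>-vector space.\<close>

definition Hom ::
    "('n, 'a) pre_digraph \<Rightarrow> ('n, 'a, 'k::field) rep \<Rightarrow> ('n, 'a, 'k) rep \<Rightarrow>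
     ('n \<Rightarrow> 'k kvec \<Rightarrow> 'k kvec) set" where
  "Hom Q M N = {f.
     (\<forall>i. linear_between (space_at M i) (space_at N i) (f i) \<and> (\<forall>x. x \<notin> space_at M i \<longrightarrow> f i x = 0)) \<and>
     (\<forall>a\<in>arcs Q. \<forall>x\<in>space_at M (tail Q a).
        f (head Q a) (map_at M a x) = map_at N a (f (tail Q a) x))}"

definition comp_hom ::
    "('n \<Rightarrow> 'k kvec \<Rightarrow> 'k kvec) \<Rightarrow> ('n \<Rightarrow> 'k kvec \<Rightarrow> 'k kvec) \<Rightarrow> 'n \<Rightarrow> 'k kvec \<Rightarrow> 'k kvec" where
  "comp_hom g f = (\<lambda>i. g i \<circ> f i)"

definition mono_hom :: "('n, 'a, 'k::field) rep \<Rightarrow> ('n \<Rightarrow> 'k kvec \<Rightarrow> 'k kvec) \<Rightarrow> bool" where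
  "mono_hom M f \<longleftrightarrow> (\<forall>i. inj_on (f i) (space_at M i))"

definition epi_hom ::
    "('n, 'a, 'k::field) rep \<Rightarrow> ('n, 'a, 'k) rep \<Rightarrow> ('n \<Rightarrow> 'k kvec \<Rightarrow> 'k kvec) \<Rightarrow> bool" where
  "epi_hom M N f \<longleftrightarrow> (\<forall>i. f i ` space_at M i = space_at N i)"

text \<open>Since \<open>kQ\<close> is finite-dimensional for acyclic \<open>Q\<close>, it suffices to test
  injectivity and projectivity of a finite-dimensional module on finite-dimensional modules.\<close>

definition injective_rep :: "('n, 'a) pre_digraph \<Rightarrow> ('n, 'a, 'k::field) rep \<Rightarrow> bool" where
  "injective_rep Q I \<longleftrightarrow> is_rep Q I \<and>
     (\<forall>L N f g. is_rep Q L \<and> is_rep Q N \<and> f \<in> Hom Q L N \<and> mono_hom L f \<and> g \<in> Hom Q L I \<longrightarrow>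
        (\<exists>h\<in>Hom Q N I. comp_hom h f = g))"

definition projective_rep :: "('n, 'a) pre_digraph \<Rightarrow> ('n, 'a, 'k::field) rep \<Rightarrow> bool" where
  "projective_rep Q P \<longleftrightarrow> is_rep Q P \<and>
     (\<forall>L N f g. is_rep Q L \<and> is_rep Q N \<and> f \<in> Hom Q L N \<and> epi_hom L N f \<and> g \<in> Hom Q P N \<longrightarrow>
        (\<exists>h\<in>Hom Q P L. comp_hom f h = g))"

definition hscale ::
    "'k::field \<Rightarrow> ('n \<Rightarrow> 'k kvec \<Rightarrow> 'k kvec) \<Rightarrow> 'n \<Rightarrow> 'k kvec \<Rightarrow> 'k kvec" where
  "hscale c f = (\<lambda>i x. kscale c (f i x))"

global_interpretation hom: vector_space
  "hscale :: 'k::field \<Rightarrow> ('n \<Rightarrow> 'k kvec \<Rightarrow> 'k kvec) \<Rightarrow> 'n \<Rightarrow> 'k kvec \<Rightarrow> 'k kvec"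
  by unfold_locales (auto simp: hscale_def kscale_def fun_eq_iff algebra_simps)

definition short_exact ::
    "('n, 'a) pre_digraph \<Rightarrow> ('n, 'a, 'k::field) rep \<Rightarrow> ('n \<Rightarrow> 'k kvec \<Rightarrow> 'k kvec) \<Rightarrow>
     ('n, 'a, 'k) rep \<Rightarrow> ('n \<Rightarrow> 'k kvec \<Rightarrow> 'k kvec) \<Rightarrow> ('n, 'a, 'k) rep \<Rightarrow> bool" where
  "short_exact Q K f P g M \<longleftrightarrow>
     is_rep Q K \<and> is_rep Q P \<and> is_rep Q M \<and> f \<in> Hom Q K P \<and> g \<in> Hom Q P M \<and>
     mono_hom K f \<and> epi_hom P M g \<and>
     (\<forall>i. f i ` space_at K i = {x \<in> space_at P i. g i x = 0})"

text \<open>For a short exact sequence \<open>0 \<rightarrow> K \<rightarrow> P \<rightarrow> M \<rightarrow> 0\<close> with \<open>P\<close> projective,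
  \<open>Ext\<^sup>1(M, N)\<close> is the cokernel of \<open>Hom(P, N) \<rightarrow> Hom(K, N)\<close>; its dimension does not depend on
  the sequence.\<close>

definition ext1_dim ::
    "('n, 'a) pre_digraph \<Rightarrow> ('n, 'a, 'k::field) rep \<Rightarrow> ('n, 'a, 'k) rep \<Rightarrow> nat" where
  "ext1_dim Q M N = (THE d. \<exists>K f P g. short_exact Q K f P g M \<and> projective_rep Q P \<and>
     d = hom.dim (Hom Q K N) - hom.dim ((\<lambda>h. comp_hom h f) ` Hom Q P N))"

text \<open>The type argument carries the ground field, which is not visible in the type of the
  Euler form.\<close>

definition euler_form ::
    "'k::field itself \<Rightarrow> ('n::finite, 'a) pre_digraph \<Rightarrow> int^'n \<Rightarrow> int^'n \<Rightarrow> int" where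
  "euler_form _ Q = (THE \<beta>.
     (\<forall>x. Modules.additive (\<lambda>y. \<beta> x y)) \<and> (\<forall>y. Modules.additive (\<lambda>x. \<beta> x y)) \<and>
     (\<forall>M N :: ('n, 'a, 'k) rep. is_rep Q M \<and> is_rep Q N \<longrightarrow>
        \<beta> (rep_dim M) (rep_dim N) = int (hom.dim (Hom Q M N)) - int (ext1_dim Q M N)))"


section \<open>The quantum torus and its skew-field of fractions\<close>

inductive_set subring_gen :: "'r::ring_1 set \<Rightarrow> 'r set" for G where
  one: "1 \<in> subring_gen G"
| gen: "x \<in> G \<Longrightarrow> x \<in> subring_gen G"
| diff: "x \<in> subring_gen G \<Longrightarrow> y \<in> subring_gen G \<Longrightarrow> x - y \<in> subring_gen G"
| mult: "x \<in> subring_gen G \<Longrightarrow> y \<in> subring_gen G \<Longrightarrow> x * y \<in> subring_gen G"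

text \<open>Throughout, \<open>s\<close> is the chosen square root of \<open>q\<close>, so \<open>q\<close> to the power \<open>m/2\<close> is \<open>s powi m\<close>,
  and \<open>coeff_ring s\<close> is the subring \<open>\<int>[s, 1/s]\<close> of the reals.\<close>

definition coeff_ring :: "real \<Rightarrow> real set" where
  "coeff_ring s = subring_gen {s, inverse s}"

definition Lambda_form :: "int^'n^'n \<Rightarrow> int^'n \<Rightarrow> int^'n \<Rightarrow> int" where
  "Lambda_form \<Lambda> c d = (\<Sum>i\<in>UNIV. c $ i * (\<Lambda> *v d) $ i)"

text \<open>Elements of the torus are finitely supported functions: the basis element \<open>X\<^sup>c\<close> is
  \<open>Poly_Mapping.single c 1\<close>. Addition is that of \<open>\<Rightarrow>\<^sub>0\<close>; the product is the twisted one below, not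
  the product \<open>*\<close> of type \<open>\<Rightarrow>\<^sub>0\<close>.\<close>

type_synonym 'n torus = "(int^'n) \<Rightarrow>\<^sub>0 real"

definition torus_carrier :: "real \<Rightarrow> ('n::finite) torus set" where
  "torus_carrier s = {x. \<forall>c. Poly_Mapping.lookup x c \<in> coeff_ring s}"

definition torus_mult ::
    "real \<Rightarrow> int^'n^'n \<Rightarrow> ('n::finite) torus \<Rightarrow> 'n torus \<Rightarrow> 'n torus" where
  "torus_mult s \<Lambda> x y =
     (\<Sum>c\<in>Poly_Mapping.keys x. \<Sum>d\<in>Poly_Mapping.keys y.
        Poly_Mapping.single (c + d)
          (Poly_Mapping.lookup x c * Poly_Mapping.lookup y d * s powi Lambda_form \<Lambda> c d))"

text \<open>The skew-field of fractions of the Ore domain \<open>torus_carrier s\<close> is a division ring \<open>'f\<close>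
  together with an injective ring homomorphism \<open>\<iota>\<close> such that every element of \<open>'f\<close> is a
  fraction; these properties determine it up to unique isomorphism over the torus.\<close>

definition skew_field_of_fractions ::
    "real \<Rightarrow> int^'n^'n \<Rightarrow> (('n::finite) torus \<Rightarrow> 'f::division_ring) \<Rightarrow> bool" where
  "skew_field_of_fractions s \<Lambda> \<iota> \<longleftrightarrow>
     inj_on \<iota> (torus_carrier s) \<and>
     \<iota> (Poly_Mapping.single 0 1) = 1 \<and>
     (\<forall>x\<in>torus_carrier s. \<forall>y\<in>torus_carrier s.
        \<iota> (x + y) = \<iota> x + \<iota> y \<and> \<iota> (torus_mult s \<Lambda> x y) = \<iota> x * \<iota> y) \<and>
     (\<forall>z. \<exists>x\<in>torus_carrier s. \<exists>y\<in>torus_carrier s. y \<noteq> 0 \<and> z = \<iota> x * inverse (\<iota> y))"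

definition scalar :: "(('n::finite) torus \<Rightarrow> 'f) \<Rightarrow> real \<Rightarrow> 'f" where
  "scalar \<iota> r = \<iota> (Poly_Mapping.single 0 r)"

definition subalgebra_gen ::
    "real \<Rightarrow> (('n::finite) torus \<Rightarrow> 'f::division_ring) \<Rightarrow> 'f set \<Rightarrow> 'f set" where
  "subalgebra_gen s \<iota> G = subring_gen (scalar \<iota> ` coeff_ring s \<union> G)"


section \<open>The quantum cluster algebra\<close>

definition toric_frame ::
    "real \<Rightarrow> (('n::finite) torus \<Rightarrow> 'f::division_ring) \<Rightarrow> int^'n^'n \<Rightarrow> (int^'n \<Rightarrow> 'f) \<Rightarrow> bool" where
  "toric_frame s \<iota> \<Lambda> M \<longleftrightarrow>
     transpose \<Lambda> = - \<Lambda> \<and> (\<forall>c. M c \<noteq> 0) \<and> M 0 = 1 \<and>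
     (\<forall>c d. M c * M d = scalar \<iota> (s powi Lambda_form \<Lambda> c d) * M (c + d))"

definition mutate_B :: "'n \<Rightarrow> int^'n^'n \<Rightarrow> int^'n^'n" where
  "mutate_B p B = (\<chi> i j. if i = p \<or> j = p then - B $ i $ j
     else B $ i $ j + sgn (B $ i $ p) * max (B $ i $ p * B $ p $ j) 0)"

definition E_matrix :: "'n \<Rightarrow> int^'n^'n \<Rightarrow> int^'n^'n" where
  "E_matrix p B = (\<chi> i j. if j \<noteq> p then (if i = j then 1 else 0)
     else if i = p then - 1 else max 0 (- B $ i $ p))"

definition mutate_Lambda :: "('n::finite) \<Rightarrow> int^'n^'n \<Rightarrow> int^'n^'n \<Rightarrow> int^'n^'n" where
  "mutate_Lambda p B \<Lambda> = transpose (E_matrix p B) ** \<Lambda> ** E_matrix p B"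

text \<open>A seed is recorded as the triple \<open>(M, \<Lambda>\<^sub>M, B)\<close>. The mutated frame is specified by its values
  on the standard basis and by being a toric frame for the mutated form, which determines it.\<close>

type_synonym ('n, 'f) seed = "(int^'n \<Rightarrow> 'f) \<times> (int^'n^'n) \<times> (int^'n^'n)"

definition is_mutation ::
    "real \<Rightarrow> (('n::finite) torus \<Rightarrow> 'f::division_ring) \<Rightarrow> 'n \<Rightarrow> ('n, 'f) seed \<Rightarrow> ('n, 'f) seed \<Rightarrow> bool" where
  "is_mutation s \<iota> p = (\<lambda>(M, \<Lambda>, B) (M', \<Lambda>', B').
     \<Lambda>' = mutate_Lambda p B \<Lambda> \<and> B' = mutate_B p B \<and> toric_frame s \<iota> \<Lambda>' M' \<and>
     (\<forall>i. i \<noteq> p \<longrightarrow> M' (axis i 1) = M (axis i 1)) \<and>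
     M' (axis p 1) = M ((\<chi> i. max (B $ i $ p) 0) - axis p 1)
                   + M ((\<chi> i. max (- B $ i $ p) 0) - axis p 1))"

inductive_set seeds ::
    "real \<Rightarrow> (('n::finite) torus \<Rightarrow> 'f::division_ring) \<Rightarrow> int^'n^'n \<Rightarrow> int^'n^'n \<Rightarrow> ('n, 'f) seed set"
  for s \<iota> \<Lambda> B where
  initial: "(\<lambda>c. \<iota> (Poly_Mapping.single c 1), \<Lambda>, B) \<in> seeds s \<iota> \<Lambda> B"
| mutation: "S \<in> seeds s \<iota> \<Lambda> B \<Longrightarrow> is_mutation s \<iota> p S S' \<Longrightarrow> S' \<in> seeds s \<iota> \<Lambda> B"

definition cluster_variables ::
    "real \<Rightarrow> (('n::finite) torus \<Rightarrow> 'f::division_ring) \<Rightarrow> int^'n^'n \<Rightarrow> int^'n^'n \<Rightarrow> 'f set" where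
  "cluster_variables s \<iota> \<Lambda> B = {M (axis i 1) | M \<Lambda>' B' i. (M, \<Lambda>', B') \<in> seeds s \<iota> \<Lambda> B}"

definition quantum_cluster_algebra ::
    "real \<Rightarrow> (('n::finite) torus \<Rightarrow> 'f::division_ring) \<Rightarrow> int^'n^'n \<Rightarrow> int^'n^'n \<Rightarrow> 'f set" where
  "quantum_cluster_algebra s \<iota> \<Lambda> B = subalgebra_gen s \<iota> (cluster_variables s \<iota> \<Lambda> B)"


section \<open>Quantum cluster characters\<close>

text \<open>An object of the cluster category is, up to isomorphism, uniquely of the form \<open>M \<oplus> I[-1]\<close> with
  \<open>M\<close> a module and \<open>I\<close> an injective module; it is represented by the pair \<open>(M, I)\<close>.\<close>

definition cluster_objects ::
    "('n, 'a) pre_digraph \<Rightarrow> (('n, 'a, 'k::field) rep \<times> ('n, 'a, 'k) rep) set" where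
  "cluster_objects Q = {(M, I). is_rep Q M \<and> injective_rep Q I}"

text \<open>The sum runs over the finitely many dimension vectors \<open>e\<close> of submodules of \<open>M\<close>; all other
  terms vanish because \<open>Gr Q e M\<close> is empty.\<close>

definition qcc ::
    "real \<Rightarrow> ('n::finite, 'a) pre_digraph \<Rightarrow> ('n, 'a, 'k::field) rep \<times> ('n, 'a, 'k) rep \<Rightarrow> 'n torus" where
  "qcc s Q = (\<lambda>(M, I). \<Sum>e \<in> dimvec ` {U. submodule Q M U}.
     Poly_Mapping.single
       (- (B_matrix Q *v e) - ((mat 1 - transpose (R_matrix Q)) *v rep_dim M) + dimvec (soc Q I))
       (real (card (Gr Q e M)) *
        s powi (- euler_form TYPE('k) Q e (rep_dim M - e - rep_dim I))))"

definition cluster_character_algebra ::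
    "'k::field itself \<Rightarrow> real \<Rightarrow> (('n::finite) torus \<Rightarrow> 'f::division_ring) \<Rightarrow>
     ('n, 'a) pre_digraph \<Rightarrow> 'f set" where
  "cluster_character_algebra _ s \<iota> Q = subalgebra_gen s \<iota>
     ((\<lambda>L. \<iota> (qcc s Q L)) ` (cluster_objects Q :: (('n, 'a, 'k) rep \<times> ('n, 'a, 'k) rep) set))"

end

theory Submission
  imports Defs "HOL-Library.Multiset"
begin

text \<open>Both algebras coincide with the lower bound \<open>rng UNIV UNIV\<close>: the algebra generated by the initial
  variables and their once mutated neighbours. Call \<open>rng {k} {k}\<close>, which is the algebra generated by the variables, the
  inverses of all of them except the \<open>k\<close>th, and the mutation of the \<open>k\<close>th one, the \<open>k\<close>th local algebra;
  the upper bound is the intersection of these. As the quiver is acyclic, the upper bound is contained in the lower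
  bound, by adjoining the vertices one at a time along a linear order compatible with the arrows. The upper bound is
  invariant under mutation, so it contains every cluster variable. It also contains every cluster character:
  collecting the submodules with prescribed components away from \<open>k\<close>, the component at \<open>k\<close> runs over all
  subspaces between two given ones, and the \<open>q\<close>-binomial theorem turns the sum into a power of the mutated
  variable times monomials without the inverse of the \<open>k\<close>th variable. Conversely, the indecomposable injectives
  shifted by \<open>-1\<close> have the initial variables as characters, and the simple modules have the mutated ones.\<close>

section \<open>Quantum frames\<close>


text \<open>Two obstacles shape the argument. Two vertices can always be so ordered, and pairs are
  all that mutation invariance needs. The other obstacle is to cancel exchange binomials in
  noncommutative rings. Here the relation \<open>\<Lambda> ** (- B) = mat 1\<close> helps twice.
  Pairing with the all-ones vector is -1 on every column of \<open>B\<close>, so one linear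
  functional singles out a leading monomial in all mutated variables simultaneously. Pairing with
  the kth unit vector is -1 on column k and 0 on the others, which gives a grading that separates
  the two terms of the kth exchange binomial and no others. On the module side a summand
  \<open>I[-1]\<close> contributes only a monomial, because the Euler form against an injective
  module is the dot product with its socle. Dimension formulas over the finite field are obtained by
  counting elements.\<close>

lemma subring_gen_zero: "0 \<in> subring_gen G"
  using subring_gen.diff[OF subring_gen.one subring_gen.one] by simp

lemma subring_gen_uminus: "x \<in> subring_gen G \<Longrightarrow> - x \<in> subring_gen G"
  using subring_gen.diff[OF subring_gen_zero] by fastforce

lemma subring_gen_add: "x \<in> subring_gen G \<Longrightarrow> y \<in> subring_gen G \<Longrightarrow> x + y \<in> subring_gen G"
  using subring_gen.diff[of x G "- y"] subring_gen_uminus by fastforce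

lemma subring_gen_sum: "(\<And>i. i \<in> A \<Longrightarrow> f i \<in> subring_gen G) \<Longrightarrow> sum f A \<in> subring_gen G"
  by (induction A rule: infinite_finite_induct) (auto intro: subring_gen_zero subring_gen_add)

lemma subring_gen_power: "x \<in> subring_gen G \<Longrightarrow> x ^ n \<in> subring_gen G"
  by (induction n) (auto intro: subring_gen.intros)

lemma subring_gen_subset: "G \<subseteq> subring_gen H \<Longrightarrow> subring_gen G \<subseteq> subring_gen H"
proof
  fix x assume "G \<subseteq> subring_gen H" "x \<in> subring_gen G"
  from this(2,1) show "x \<in> subring_gen H"
    by (induction rule: subring_gen.induct) (auto intro: subring_gen.intros)
qed

inductive_set kspan :: "'r::ring_1 set \<Rightarrow> 'r set \<Rightarrow> 'r set" for K X where
  zero: "0 \<in> kspan K X"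
| step: "\<kappa> \<in> K \<Longrightarrow> x \<in> X \<Longrightarrow> y \<in> kspan K X \<Longrightarrow> \<kappa> * x + y \<in> kspan K X"

lemma kspan_add: "x \<in> kspan K X \<Longrightarrow> y \<in> kspan K X \<Longrightarrow> x + y \<in> kspan K X"
  by (induction rule: kspan.induct) (auto simp: add.assoc intro: kspan.intros)

lemma kspan_base: "\<kappa> \<in> K \<Longrightarrow> x \<in> X \<Longrightarrow> \<kappa> * x \<in> kspan K X"
  using kspan.step[OF _ _ kspan.zero] by force

lemma kspan_subsetI: "x \<in> kspan K X \<Longrightarrow> (\<And>x \<kappa>. x \<in> X \<Longrightarrow> \<kappa> \<in> K \<Longrightarrow> \<kappa> * x \<in> kspan K Y) \<Longrightarrow> x \<in> kspan K Y"
  by (induction rule: kspan.induct) (auto intro: kspan.zero kspan_add)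

lemma kspan_mono: "X \<subseteq> Y \<Longrightarrow> kspan K X \<subseteq> kspan K Y"
  by (meson kspan_base kspan_subsetI subsetD subsetI)

text \<open>Repeated uses of a generator are merged by adding their coefficients, so that each
  generator occurs once; the leading-term argument of \<open>kernel_divisible\<close> needs this
  form.\<close>

lemma kspan_sum:
  assumes "x \<in> kspan K X" "0 \<in> K" "\<And>a b. a \<in> K \<Longrightarrow> b \<in> K \<Longrightarrow> a + b \<in> K"
  shows "\<exists>A \<kappa>. finite A \<and> A \<subseteq> X \<and> (\<forall>a\<in>A. \<kappa> a \<in> K) \<and> x = (\<Sum>a\<in>A. \<kappa> a * a)"
  using assms(1)
proof induction
  case zero
  show ?case by (rule exI[of _ "{}"]) auto
next
  case (step k x y)
  then obtain A \<kappa> where A: "finite A" "A \<subseteq> X" "\<forall>a\<in>A. \<kappa> a \<in> K" "y = (\<Sum>a\<in>A. \<kappa> a * a)" by blast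
  show ?case
  proof (cases "x \<in> A")
    case True
    have "(\<Sum>a\<in>A. (\<kappa>(x := k + \<kappa> x)) a * a) = k * x + y"
      using A True by (simp add: sum.remove[of A x] distrib_right add.assoc)
    then show ?thesis
      using A step assms True by (intro exI[of _ A] exI[of _ "\<kappa>(x := k + \<kappa> x)"]) auto
  next
    case False
    have "(\<Sum>a\<in>insert x A. (\<kappa>(x := k)) a * a) = k * x + (\<Sum>a\<in>A. (\<kappa>(x := k)) a * a)"
      using False A by simp
    also have "(\<Sum>a\<in>A. (\<kappa>(x := k)) a * a) = y"
      unfolding A(4) by (rule sum.cong) (use False in auto)
    finally show ?thesis
      using A step by (intro exI[of _ "insert x A"] exI[of _ "\<kappa>(x := k)"]) auto
  qed
qed

definition pos :: "int^'n \<Rightarrow> int^'n" where "pos c = (\<chi> i. max (c $ i) 0)"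
definition neg :: "int^'n \<Rightarrow> int^'n" where "neg c = (\<chi> i. max (- c $ i) 0)"

lemma pos_nth [simp]: "pos c $ i = max (c $ i) 0" by (simp add: pos_def)
lemma neg_nth [simp]: "neg c $ i = max (- c $ i) 0" by (simp add: neg_def)

abbreviation unit_vec :: "'n \<Rightarrow> int^'n" where "unit_vec i \<equiv> axis i 1"

text \<open>A toric frame with a compatible exchange matrix: \<open>b k\<close> is the kth column,
  and \<open>L_b\<close> expresses \<open>\<Lambda> ** (- B) = mat 1\<close>. The division ring is
  arbitrary and the monomials are only required to be independent over the central ring
  \<open>K\<close>, so that every seed becomes an instance inside the same skew-field.\<close>

locale quantum_frame =
  fixes K :: "'f::division_ring set" and v :: 'f
    and L :: "int^'n::finite \<Rightarrow> int^'n \<Rightarrow> int" and b :: "'n \<Rightarrow> int^'n" and M :: "int^'n \<Rightarrow> 'f"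
  assumes K_one: "1 \<in> K"
    and K_diff: "x \<in> K \<Longrightarrow> y \<in> K \<Longrightarrow> x - y \<in> K"
    and K_mult: "x \<in> K \<Longrightarrow> y \<in> K \<Longrightarrow> x * y \<in> K"
    and K_comm: "x \<in> K \<Longrightarrow> z * x = x * z"
    and v_K: "v \<in> K" and inv_v_K: "inverse v \<in> K" and v_nz: "v \<noteq> 0"
    and L_add: "L (c + c') d = L c d + L c' d"
    and L_skew: "L c d = - L d c"
    and L_b: "L c (b k) = - (c $ k)"
    and M_mult: "M c * M d = v powi L c d * M (c + d)"
    and M_0: "M 0 = 1"
    and M_indep: "finite F \<Longrightarrow> (\<And>c. c \<in> F \<Longrightarrow> \<kappa> c \<in> K) \<Longrightarrow> (\<Sum>c\<in>F. \<kappa> c * M c) = 0 \<Longrightarrow> c \<in> F \<Longrightarrow> \<kappa> c = 0"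
begin

lemma K_zero: "0 \<in> K" using K_diff[OF K_one K_one] by simp
lemma K_uminus: "x \<in> K \<Longrightarrow> - x \<in> K" using K_diff[OF K_zero] by fastforce
lemma K_add: "x \<in> K \<Longrightarrow> y \<in> K \<Longrightarrow> x + y \<in> K" using K_diff[of x "- y"] K_uminus by fastforce
lemma K_power: "x \<in> K \<Longrightarrow> x ^ n \<in> K" by (induction n) (auto intro: K_one K_mult)
lemma vK [simp]: "v powi n \<in> K"
  by (cases "0 \<le> n") (auto simp: power_int_def intro!: K_power v_K inv_v_K)
declare v_nz [simp]

lemma v_comm: "z * v powi n = v powi n * z" by (rule K_comm) simp
lemma v_left: "x * (v powi n * z) = v powi n * (x * z)" by (metis v_comm mult.assoc)
lemma v_add: "v powi (m + n) = v powi m * v powi n" by (rule power_int_add) (simp add: v_nz)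
lemma v_add': "v powi m * (v powi n * z) = v powi (m + n) * z" by (simp add: v_add mult.assoc)
lemma K_left: "k \<in> K \<Longrightarrow> x * (k * z) = k * (x * z)" by (metis K_comm mult.assoc)

lemma L_zero [simp]: "L 0 d = 0" using L_add[of 0 0 d] by simp
lemma L_uminus: "L (- c) d = - L c d" using L_add[of c "- c" d] by simp
lemma L_diff: "L (c - c') d = L c d - L c' d" using L_add[of c "- c'" d] by (simp add: L_uminus)
lemma L_add2: "L c (d + d') = L c d + L c d'" using L_skew L_add by (metis minus_add_distrib)
lemma L_zero2 [simp]: "L d 0 = 0" using L_skew[of d 0] by simp
lemma L_uminus2: "L c (- d) = - L c d" using L_add2[of c d "- d"] by simp
lemma L_diff2: "L c (d - d') = L c d - L c d'" using L_add2[of c d "- d'"] by (simp add: L_uminus2)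
lemma L_b2: "L (b k) c = c $ k" using L_skew[of "b k" c] L_b by simp
lemma L_self [simp]: "L c c = 0" using L_skew[of c c] by simp
lemmas L_simps = L_add L_uminus L_diff L_add2 L_uminus2 L_diff2 L_b L_b2

lemma b_skew: "b j $ k = - (b k $ j)"
  using L_b[of "b j" k] L_b2[of j "b k"] by simp
lemma b_self [simp]: "b k $ k = 0" using b_skew[of k k] by simp

lemma M_mult2: "M c * (M d * z) = v powi L c d * (M (c + d) * z)"
  by (metis M_mult mult.assoc)
lemma M_inv: "M c * M (- c) = 1" "M (- c) * M c = 1"
  by (simp_all add: M_mult L_uminus L_uminus2 M_0)
lemma M_nz [simp]: "M c \<noteq> 0" using M_inv[of c] by auto
lemma M_comm: "M c * M d = v powi (2 * L c d) * (M d * M c)"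
proof -
  have "L d c = - L c d" by (rule L_skew)
  then show ?thesis by (simp add: M_mult v_add' add.commute[of d c])
qed

section \<open>Coefficients and supports with respect to the frame monomials\<close>

definition ev :: "(int^'n \<Rightarrow>\<^sub>0 'f) \<Rightarrow> 'f" where
  "ev f = (\<Sum>c\<in>Poly_Mapping.keys f. Poly_Mapping.lookup f c * M c)"

definition KP :: "(int^'n \<Rightarrow>\<^sub>0 'f) set" where
  "KP = {f. \<forall>c. Poly_Mapping.lookup f c \<in> K}"

lemma ev_sup: "finite F \<Longrightarrow> Poly_Mapping.keys f \<subseteq> F \<Longrightarrow> ev f = (\<Sum>c\<in>F. Poly_Mapping.lookup f c * M c)"
  unfolding ev_def by (rule sum.mono_neutral_left) (auto simp: in_keys_iff)

lemma ev_add: "ev (f + g) = ev f + ev g"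
proof -
  let ?F = "Poly_Mapping.keys f \<union> Poly_Mapping.keys g"
  have "Poly_Mapping.keys (f + g) \<subseteq> ?F" by (rule Poly_Mapping.keys_add)
  then show ?thesis
    by (simp add: ev_sup[of ?F] lookup_add distrib_right sum.distrib)
qed

lemma ev_single: "ev (Poly_Mapping.single c k) = k * M c"
  by (simp add: ev_sup[of "{c}"])

lemma KP_add: "f \<in> KP \<Longrightarrow> g \<in> KP \<Longrightarrow> f + g \<in> KP" by (auto simp: KP_def lookup_add K_add)
lemma KP_uminus: "f \<in> KP \<Longrightarrow> - f \<in> KP" by (auto simp: KP_def K_uminus)
lemma KP_zero: "0 \<in> KP" by (auto simp: KP_def K_zero)
lemma KP_single: "k \<in> K \<Longrightarrow> Poly_Mapping.single c k \<in> KP" by (auto simp: KP_def lookup_single when_def K_zero)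

lemma ev_zero: "ev 0 = 0" by (simp add: ev_def)
lemma ev_uminus: "ev (- f) = - ev f" using ev_add[of f "- f"] by (simp add: ev_zero eq_neg_iff_add_eq_0 add.commute)

lemma ev_eq_0:
  assumes "f \<in> KP" "ev f = 0"
  shows "f = 0"
proof (rule poly_mapping_eqI)
  fix c
  have "c \<notin> Poly_Mapping.keys f"
    using M_indep[OF finite_keys[of f], of "Poly_Mapping.lookup f" c] assms
    by (auto simp: KP_def ev_def in_keys_iff)
  then show "Poly_Mapping.lookup f c = Poly_Mapping.lookup 0 c" by (simp add: in_keys_iff)
qed

lemma ev_inj: "f \<in> KP \<Longrightarrow> g \<in> KP \<Longrightarrow> ev f = ev g \<Longrightarrow> f = g"
  using ev_eq_0[of "f + - g"] KP_add[of f "- g"] KP_uminus[of g]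
  by (simp add: ev_add ev_uminus del: add_uminus_conv_diff) (simp add: eq_neg_iff_add_eq_0)

definition T :: "'f set" where "T = kspan K (range M)"

lemma T_ev: "z \<in> T \<longleftrightarrow> (\<exists>f\<in>KP. ev f = z)"
proof
  assume "z \<in> T"
  then show "\<exists>f\<in>KP. ev f = z"
    unfolding T_def
  proof induction
    case zero
    then show ?case using ev_zero KP_zero by blast
  next
    case (step k x y)
    then show ?case by (metis ev_add ev_single KP_add KP_single imageE)
  qed
next
  assume "\<exists>f\<in>KP. ev f = z"
  then obtain f where f: "f \<in> KP" "ev f = z" by blast
  have "(\<Sum>c\<in>F. Poly_Mapping.lookup f c * M c) \<in> kspan K (range M)" if "finite F" for F
    using that by induction (use f in \<open>auto simp: KP_def intro!: kspan.intros\<close>)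
  then show "z \<in> T" using f by (auto simp: ev_def T_def)
qed

text \<open>The coefficients are unique by \<open>M_indep\<close>, by way of \<open>ev_inj\<close>;
  the value is meaningful only for arguments in \<open>T\<close>.\<close>

definition cf :: "'f \<Rightarrow> (int^'n \<Rightarrow>\<^sub>0 'f)" where "cf z = (THE f. f \<in> KP \<and> ev f = z)"

lemma cf_eq: "f \<in> KP \<Longrightarrow> ev f = z \<Longrightarrow> cf z = f"
  unfolding cf_def using ev_inj by blast

lemma cf_KP: "z \<in> T \<Longrightarrow> cf z \<in> KP" and ev_cf: "z \<in> T \<Longrightarrow> ev (cf z) = z"
  using T_ev cf_eq by metis+

lemma T_zero: "0 \<in> T" unfolding T_def by (rule kspan.zero)
lemma T_add: "x \<in> T \<Longrightarrow> y \<in> T \<Longrightarrow> x + y \<in> T" unfolding T_def by (rule kspan_add)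
lemma T_M: "k \<in> K \<Longrightarrow> k * M c \<in> T" unfolding T_def by (rule kspan_base) auto
lemma T_uminus: "x \<in> T \<Longrightarrow> - x \<in> T" by (metis T_ev KP_uminus ev_uminus)
lemma T_diff: "x \<in> T \<Longrightarrow> y \<in> T \<Longrightarrow> x - y \<in> T" using T_add[of x "- y"] T_uminus by simp

lemma cf_add: "x \<in> T \<Longrightarrow> y \<in> T \<Longrightarrow> cf (x + y) = cf x + cf y"
  by (rule cf_eq) (auto simp: KP_add cf_KP ev_add ev_cf)
lemma cf_uminus: "x \<in> T \<Longrightarrow> cf (- x) = - cf x"
  by (rule cf_eq) (auto simp: KP_uminus cf_KP ev_uminus ev_cf)
lemma cf_M: "k \<in> K \<Longrightarrow> cf (k * M c) = Poly_Mapping.single c k"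
  by (rule cf_eq) (auto simp: KP_single ev_single)
lemma cf_zero: "cf 0 = 0" by (rule cf_eq) (auto simp: KP_zero ev_zero)
text \<open>One notion serves all gradings: half-spaces, hyperplanes, level sets of a linear
  functional and single exponents all occur as \<open>A\<close>, and \<open>pr A\<close> extracts
  the corresponding part.\<close>

definition TT :: "(int^'n) set \<Rightarrow> 'f set" where "TT A = {z \<in> T. Poly_Mapping.keys (cf z) \<subseteq> A}"
definition pr :: "(int^'n) set \<Rightarrow> 'f \<Rightarrow> 'f" where
  "pr A z = (\<Sum>c\<in>Poly_Mapping.keys (cf z) \<inter> A. Poly_Mapping.lookup (cf z) c * M c)"

lemma TT_T: "z \<in> TT A \<Longrightarrow> z \<in> T" by (simp add: TT_def)
lemma T_TT: "z \<in> T \<Longrightarrow> z \<in> TT UNIV" by (simp add: TT_def)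
lemma TT_mono: "A \<subseteq> B \<Longrightarrow> z \<in> TT A \<Longrightarrow> z \<in> TT B" by (auto simp: TT_def)
lemma TT_zero: "0 \<in> TT A" by (simp add: TT_def T_zero cf_zero)
lemma TT_add: "x \<in> TT A \<Longrightarrow> y \<in> TT A \<Longrightarrow> x + y \<in> TT A"
  using Poly_Mapping.keys_add[of "cf x" "cf y"] by (auto simp: TT_def T_add cf_add)
lemma TT_uminus: "x \<in> TT A \<Longrightarrow> - x \<in> TT A" by (auto simp: TT_def T_uminus cf_uminus)
lemma TT_diff: "x \<in> TT A \<Longrightarrow> y \<in> TT A \<Longrightarrow> x - y \<in> TT A" using TT_add[of x A "- y"] TT_uminus by simp
lemma TT_kM: "k \<in> K \<Longrightarrow> c \<in> A \<Longrightarrow> k * M c \<in> TT A"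
  using keys_single[of c k] by (auto simp: TT_def T_M cf_M)
lemma TT_M: "c \<in> A \<Longrightarrow> M c \<in> TT A" using TT_kM[OF K_one] by simp

lemma TT_kspan: "TT A = kspan K (M ` A)"
proof (intro subset_antisym subsetI)
  fix z assume "z \<in> TT A"
  then have z: "z \<in> T" "Poly_Mapping.keys (cf z) \<subseteq> A" by (auto simp: TT_def)
  have "(\<Sum>c\<in>F. Poly_Mapping.lookup (cf z) c * M c) \<in> kspan K (M ` A)" if "finite F" "F \<subseteq> A" for F
    using that by induction (use cf_KP[OF z(1)] in \<open>auto simp: KP_def intro!: kspan.intros\<close>)
  then have "ev (cf z) \<in> kspan K (M ` A)" using z unfolding ev_def by auto
  then show "z \<in> kspan K (M ` A)" using ev_cf z by simp
next
  fix z assume "z \<in> kspan K (M ` A)"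
  then show "z \<in> TT A" by induction (auto intro: TT_zero TT_add TT_kM)
qed

lemma TT_induct [consumes 1, case_names zero step]:
  assumes "z \<in> TT A" "P 0"
    "\<And>k c w. k \<in> K \<Longrightarrow> c \<in> A \<Longrightarrow> w \<in> TT A \<Longrightarrow> P w \<Longrightarrow> P (k * M c + w)"
  shows "P z"
  using assms(1) unfolding TT_kspan
  by induction (use assms(2,3) in \<open>auto simp: TT_kspan\<close>)

lemma TT_K: "z \<in> TT A \<Longrightarrow> k \<in> K \<Longrightarrow> k * z \<in> TT A"
  by (induction rule: TT_induct)
    (auto simp: distrib_left mult.assoc[symmetric] intro!: TT_zero TT_add TT_kM K_mult)

lemma TT_mult:
  assumes "x \<in> TT A" "y \<in> TT B" "\<And>a b. a \<in> A \<Longrightarrow> b \<in> B \<Longrightarrow> a + b \<in> C"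
  shows "x * y \<in> TT C"
  using assms(1)
proof (induction rule: TT_induct)
  case (step k c w)
  have "k * (M c * y) \<in> TT C"
    using assms(2)
  proof (induction rule: TT_induct)
    case (step k' c' w')
    have "k * (M c * (k' * M c')) = (k * (k' * v powi L c c')) * M (c + c')"
      using step by (simp add: K_left M_mult mult.assoc)
    then show ?case using step \<open>k \<in> K\<close> \<open>c \<in> A\<close> assms(3)
      by (auto simp: distrib_left K_mult intro!: TT_add TT_kM)
  qed (auto intro: TT_zero)
  then show ?case using step by (auto simp: distrib_right mult.assoc intro: TT_add)
qed (auto intro: TT_zero)

lemma T_mult: "x \<in> T \<Longrightarrow> y \<in> T \<Longrightarrow> x * y \<in> T"
  using TT_mult[OF T_TT T_TT, of x y UNIV] TT_T by blast

lemma pr_sup: "finite F \<Longrightarrow> Poly_Mapping.keys (cf z) \<subseteq> F \<Longrightarrow> pr A z = (\<Sum>c\<in>F \<inter> A. Poly_Mapping.lookup (cf z) c * M c)"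
  unfolding pr_def by (rule sum.mono_neutral_left) (auto simp: in_keys_iff)

lemma pr_add: "x \<in> T \<Longrightarrow> y \<in> T \<Longrightarrow> pr A (x + y) = pr A x + pr A y"
proof -
  assume a: "x \<in> T" "y \<in> T"
  let ?F = "Poly_Mapping.keys (cf x) \<union> Poly_Mapping.keys (cf y)"
  have "Poly_Mapping.keys (cf x + cf y) \<subseteq> ?F" by (rule Poly_Mapping.keys_add)
  then show ?thesis using a
    by (simp add: pr_sup[of ?F] cf_add lookup_add distrib_right sum.distrib)
qed

lemma pr_kM: "k \<in> K \<Longrightarrow> pr A (k * M c) = (if c \<in> A then k * M c else 0)"
proof -
  assume k: "k \<in> K"
  have "pr A (k * M c) = (\<Sum>c'\<in>{c} \<inter> A. Poly_Mapping.lookup (cf (k * M c)) c' * M c')"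
    by (rule pr_sup) (simp_all add: cf_M k)
  then show ?thesis by (simp add: cf_M k)
qed
lemma pr_zero [simp]: "pr A 0 = 0" by (simp add: pr_def cf_zero)
lemma pr_TT: "z \<in> T \<Longrightarrow> pr A z \<in> TT A"
  by (drule T_TT, induction rule: TT_induct) (auto simp: pr_add TT_T T_M pr_kM intro: TT_zero TT_add TT_kM)
lemma pr_TT_inter: "z \<in> TT B \<Longrightarrow> pr A z \<in> TT (A \<inter> B)"
  by (induction rule: TT_induct) (auto simp: pr_add TT_T T_M pr_kM intro: TT_zero TT_add TT_kM)
lemma pr_T: "z \<in> T \<Longrightarrow> pr A z \<in> T" using pr_TT TT_T by blast
lemma pr_id: "z \<in> TT A \<Longrightarrow> pr A z = z"
  by (induction rule: TT_induct) (auto simp: pr_add TT_T T_M pr_kM)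
lemma pr_disj: "z \<in> TT B \<Longrightarrow> A \<inter> B = {} \<Longrightarrow> pr A z = 0"
  by (induction rule: TT_induct) (auto simp: pr_add TT_T T_M pr_kM)
lemma pr_pr: "z \<in> T \<Longrightarrow> pr A (pr B z) = pr (A \<inter> B) z"
  by (drule T_TT, induction rule: TT_induct) (auto simp: pr_add TT_T T_M pr_kM pr_T)
lemma pr_uminus: "z \<in> T \<Longrightarrow> pr A (- z) = - pr A z"
  using pr_add[of z "- z" A] by (simp add: T_uminus eq_neg_iff_add_eq_0 add.commute)
lemma pr_diff: "x \<in> T \<Longrightarrow> y \<in> T \<Longrightarrow> pr A (x - y) = pr A x - pr A y"
  using pr_add[of x "- y" A] by (simp add: T_uminus pr_uminus)
lemma pr_K:
  assumes "z \<in> T" "k \<in> K"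
  shows "pr A (k * z) = k * pr A z"
  using T_TT[OF assms(1)]
proof (induction rule: TT_induct)
  case (step k' c w)
  have *: "k * (k' * M c) = (k * k') * M c" by (simp add: mult.assoc)
  have "pr A (k * (k' * M c)) = k * pr A (k' * M c)"
    using pr_kM[OF K_mult[OF assms(2) step(1)], of A c] pr_kM[OF step(1), of A c]
    by (simp add: mult.assoc)
  moreover have "k * (k' * M c) \<in> T" unfolding * using step assms by (intro T_M K_mult)
  ultimately show ?case using step assms
    by (simp add: distrib_left pr_add TT_T[OF TT_K] TT_T[OF step(3)] T_M)
qed simp
lemma pr_compl: "z \<in> T \<Longrightarrow> z - pr A z \<in> TT (- A)"
proof (drule T_TT, induction rule: TT_induct)
  case (step k c w)
  then show ?case
    by (cases "c \<in> A") (auto simp: pr_add TT_T T_M pr_kM add_diff_eq[symmetric] intro: TT_add TT_kM)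
qed (auto intro: TT_zero)

text \<open>Every shift by an exponent of \<open>y\<close> pulls \<open>A\<close> back to the same
  set \<open>A'\<close>, so a term of the product survives exactly when its left factor has its
  exponent in \<open>A'\<close>.\<close>

lemma pr_mult_right:
  assumes "x \<in> T" "y \<in> TT B" "\<And>a b. b \<in> B \<Longrightarrow> a + b \<in> A \<longleftrightarrow> a \<in> A'"
  shows "pr A (x * y) = pr A' x * y"
  using assms(2)
proof (induction rule: TT_induct)
  case (step k c w)
  have "pr A (x * (k * M c)) = pr A' x * (k * M c)"
    using T_TT[OF assms(1)]
  proof (induction rule: TT_induct)
    case (step k' c' w')
    have *: "k' * M c' * (k * M c) = (k' * k * v powi L c' c) * M (c' + c)"
      using \<open>k \<in> K\<close> by (simp add: K_left M_mult mult.assoc)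
    have "pr A (k' * M c' * (k * M c)) = pr A' (k' * M c') * (k * M c)"
      unfolding * using step \<open>k \<in> K\<close> assms(3)[OF \<open>c \<in> B\<close>]
      by (auto simp: pr_kM K_mult *)
    then show ?case using step \<open>k \<in> K\<close>
      by (simp add: distrib_right pr_add TT_T T_M T_mult)
  qed simp
  then show ?case using step assms(1)
    by (simp add: distrib_left pr_add TT_T T_M T_mult)
qed simp

lemma pr_mult_left:
  assumes "x \<in> TT B" "y \<in> T" "\<And>a b. b \<in> B \<Longrightarrow> b + a \<in> A \<longleftrightarrow> a \<in> A'"
  shows "pr A (x * y) = x * pr A' y"
  using T_TT[OF assms(2)]
proof (induction rule: TT_induct)
  case (step k c w)
  have "pr A (x * (k * M c)) = x * pr A' (k * M c)"
    using assms(1)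
  proof (induction rule: TT_induct)
    case (step k' c' w')
    have *: "k' * M c' * (k * M c) = (k' * k * v powi L c' c) * M (c' + c)"
      using \<open>k \<in> K\<close> by (simp add: K_left M_mult mult.assoc)
    have "pr A (k' * M c' * (k * M c)) = k' * M c' * pr A' (k * M c)"
      using assms(3)[OF step(2)] step(1) \<open>k \<in> K\<close>
      by (auto simp: pr_kM[OF \<open>k \<in> K\<close>] *) (auto simp: pr_kM K_mult)
    then show ?case using step \<open>k \<in> K\<close>
      by (simp add: distrib_right pr_add TT_T T_M T_mult)
  qed simp
  then show ?case using step assms(1)
    by (simp add: distrib_left pr_add TT_T T_M T_mult)
qed simp

text \<open>Setting the kth variable to zero is multiplicative in the absence of its negative
  powers: a term of positive degree in \<open>y\<close> cannot return to degree 0 after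
  multiplication by \<open>x\<close>.\<close>

lemma pr_mult_nonneg:
  assumes "x \<in> TT {c. 0 \<le> c $ k}" "y \<in> TT {c. 0 \<le> c $ k}"
  shows "pr {c. c $ k = 0} (x * y) = pr {c. c $ k = 0} x * pr {c. c $ k = 0} y"
proof -
  let ?A = "{c :: int^'n. c $ k = 0}" and ?P = "{c :: int^'n. 0 < c $ k}"
  define y' where "y' = y - pr ?A y"
  have T: "x \<in> T" "y \<in> T" "pr ?A y \<in> T" using assms TT_T pr_T by auto
  have "y' \<in> TT {c :: int^'n. 0 \<le> c $ k}" unfolding y'_def
    by (rule TT_diff[OF assms(2) TT_mono[OF _ pr_TT]]) (use T in auto)
  moreover have "y' \<in> TT (- ?A)" unfolding y'_def using T by (simp add: pr_compl)
  ultimately have "y' \<in> TT ({c :: int^'n. 0 \<le> c $ k} \<inter> - ?A)" by (simp add: TT_def)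
  also have "{c :: int^'n. 0 \<le> c $ k} \<inter> - ?A = ?P" by auto
  finally have y': "y' \<in> TT ?P" .
  have "x * y' \<in> TT ?P" using TT_mult[OF assms(1) y', of ?P] by fastforce
  then have "pr ?A (x * y') = 0" by (rule pr_disj) auto
  moreover have "pr ?A (x * pr ?A y) = pr ?A x * pr ?A y"
    by (rule pr_mult_right[OF T(1) pr_TT[OF T(2)]]) auto
  moreover have "x * y = x * pr ?A y + x * y'" by (simp add: y'_def algebra_simps)
  ultimately show ?thesis using T y' TT_T by (simp add: pr_add T_mult)
qed


end

section \<open>Mutated variables\<close>


context quantum_frame
begin

text \<open>Exponents of the two terms of the exchange relation at \<open>k\<close>; they differ by
  the column \<open>b k\<close>.\<close>

definition hi :: "'n \<Rightarrow> int^'n" where "hi k = pos (b k) - unit_vec k"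
definition lo :: "'n \<Rightarrow> int^'n" where "lo k = neg (b k) - unit_vec k"
definition xp :: "'n \<Rightarrow> 'f" where "xp k = M (hi k) + M (lo k)"

lemma hi_lo: "hi k = lo k + b k"
  by (auto simp: hi_def lo_def vec_eq_iff)
lemma hi_nth: "hi k $ i = (if i = k then - 1 else max (b k $ i) 0)"
  by (auto simp: hi_def axis_def)
lemma lo_nth: "lo k $ i = (if i = k then - 1 else max (- b k $ i) 0)"
  by (auto simp: lo_def axis_def)

lemma M_xp: "M c * xp i = v powi L c (hi i) * M (c + hi i) + v powi L c (lo i) * M (c + lo i)"
  by (simp add: xp_def distrib_left M_mult)
lemma xp_M: "xp i * M c = v powi L (hi i) c * M (hi i + c) + v powi L (lo i) c * M (lo i + c)"
  by (simp add: xp_def distrib_right M_mult)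

text \<open>The two exponents of \<open>xp i\<close> differ by \<open>b i\<close>, which pairs to
  zero with \<open>c\<close>; hence both terms pass \<open>M c\<close> with the same power of
  \<open>v\<close>.\<close>

lemma xp_M_comm: "c $ i = 0 \<Longrightarrow> xp i * M c = v powi (2 * L (lo i) c) * (M c * xp i)"
proof -
  assume "c $ i = 0"
  then have "L c (hi i) = L c (lo i)" "L (hi i) c = L (lo i) c" by (simp_all add: hi_lo L_simps)
  moreover have "L c (lo i) = - L (lo i) c" by (rule L_skew)
  ultimately show ?thesis
    by (simp add: M_xp xp_M distrib_left v_add' add.commute[of c])
qed

lemma M_xp_comm: "c $ i = 0 \<Longrightarrow> M c * xp i = v powi (- 2 * L (lo i) c) * (xp i * M c)"
  using xp_M_comm[of c i] by (simp add: v_add')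

text \<open>Three of the four products of terms commute with the same power of \<open>v\<close>. The
  fourth, with exponent \<open>lo i + hi j\<close>, gives the correction: if
  \<open>b i $ j < 0\<close>, its two entries -1 are compensated and it has no denominators; if
  \<open>b i $ j = 0\<close>, its coefficient vanishes.\<close>

lemma xp_xp_ordered:
  assumes "b i $ j \<le> 0" "i \<noteq> j"
  shows "\<exists>n. \<exists>k\<in>K. \<exists>c. (\<forall>l. 0 \<le> c $ l) \<and> xp i * xp j = v powi n * (xp j * xp i) + k * M c"
proof -
  have bji: "b j $ i = - (b i $ j)" by (rule b_skew)
  define la where "la = L (hi i) (lo j)"
  have hij: "hi i $ j = 0" and lji: "lo j $ i = 0" using assms bji by (auto simp: hi_nth lo_nth)
  have lii: "lo i $ j = - (b i $ j)" and lii': "hi j $ i = - (b i $ j)"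
    using assms bji by (auto simp: hi_nth lo_nth)
  have L1: "L (hi i) (hi j) = la" using hij by (simp add: hi_lo[of j] L_simps la_def)
  have L2: "L (lo i) (lo j) = la" using lji by (simp add: la_def hi_lo[of i] L_simps)
  have L3: "L (lo i) (hi j) = la + b i $ j" using L2 lii by (simp add: hi_lo[of j] L_simps)
  have c1: "M (hi i) * M (hi j) = v powi (2 * la) * (M (hi j) * M (hi i))"
    using M_comm[of "hi i" "hi j"] L1 by simp
  have c2: "M (hi i) * M (lo j) = v powi (2 * la) * (M (lo j) * M (hi i))"
    using M_comm[of "hi i" "lo j"] by (simp add: la_def)
  have c3: "M (lo i) * M (lo j) = v powi (2 * la) * (M (lo j) * M (lo i))"
    using M_comm[of "lo i" "lo j"] L2 by simp
  define k where "k = v powi L (lo i) (hi j) - v powi (2 * la) * v powi L (hi j) (lo i)"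
  have c4: "M (lo i) * M (hi j) = v powi (2 * la) * (M (hi j) * M (lo i)) + k * M (lo i + hi j)"
    by (simp add: M_mult k_def left_diff_distrib mult.assoc add.commute[of "hi j"])
  have e: "xp i * xp j = v powi (2 * la) * (xp j * xp i) + k * M (lo i + hi j)"
    by (simp add: xp_def distrib_left distrib_right c1 c2 c3 c4 add_ac)
  have kK: "k \<in> K" unfolding k_def by (intro K_diff K_mult vK)
  show ?thesis
  proof (cases "b i $ j = 0")
    case True
    then have "k = 0" using L3 L_skew[of "hi j" "lo i"] by (simp add: k_def flip: v_add)
    then have "xp i * xp j = v powi (2 * la) * (xp j * xp i) + 0 * M 0" using e by simp
    then show ?thesis using K_zero by (metis order_refl zero_index)
  next
    case False
    have "0 \<le> (lo i + hi j) $ l" for l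
      using False assms lii lii' by (auto simp: lo_nth hi_nth)
    then show ?thesis using e kK by blast
  qed
qed

lemma xp_xp:
  "\<exists>n. \<exists>k\<in>K. \<exists>c. (\<forall>l. 0 \<le> c $ l) \<and> xp i * xp j = v powi n * (xp j * xp i) + k * M c"
proof (cases "i = j")
  case True
  then have "xp i * xp j = v powi 0 * (xp j * xp i) + 0 * M 0" by simp
  then show ?thesis using K_zero by (metis order_refl zero_index)
next
  case False
  show ?thesis
  proof (cases "b i $ j \<le> 0")
    case True
    then show ?thesis using xp_xp_ordered False by blast
  next
    case F: False
    then have "b j $ i \<le> 0" using b_skew[of j i] by simp
    then obtain n k c where *: "k \<in> K" "\<forall>l. 0 \<le> c $ l" "xp j * xp i = v powi n * (xp i * xp j) + k * M c"
      using xp_xp_ordered[of j i] False by blast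
    then have "xp i * xp j = v powi (- n) * (xp j * xp i) + (- (v powi (- n)) * k) * M c"
      by (simp add: distrib_left v_add' mult.assoc)
    moreover have "- (v powi (- n)) * k \<in> K" using * by (intro K_mult K_uminus vK)
    ultimately show ?thesis using * by blast
  qed
qed

text \<open>\<open>J\<close> lists the variables whose inverses are forbidden, \<open>P\<close> the
  available mutated variables. Besides the bounds, where \<open>J = P\<close>, the induction uses
  \<open>J = insert k P\<close>: the kth variable is no longer invertible, but its mutation is not
  yet adjoined.\<close>

definition rng :: "'n set \<Rightarrow> 'n set \<Rightarrow> 'f set" where
  "rng J P = subring_gen (K \<union> M ` {c. \<forall>i\<in>J. 0 \<le> c $ i} \<union> xp ` P)"

lemma rng_one: "1 \<in> rng J P" unfolding rng_def by (rule subring_gen.one)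
lemma rng_mult: "x \<in> rng J P \<Longrightarrow> y \<in> rng J P \<Longrightarrow> x * y \<in> rng J P"
  unfolding rng_def by (rule subring_gen.mult)
lemma rng_diff: "x \<in> rng J P \<Longrightarrow> y \<in> rng J P \<Longrightarrow> x - y \<in> rng J P"
  unfolding rng_def by (rule subring_gen.diff)
lemma rng_add: "x \<in> rng J P \<Longrightarrow> y \<in> rng J P \<Longrightarrow> x + y \<in> rng J P"
  unfolding rng_def by (rule subring_gen_add)
lemma rng_zero: "0 \<in> rng J P" unfolding rng_def by (rule subring_gen_zero)
lemma rng_power: "x \<in> rng J P \<Longrightarrow> x ^ n \<in> rng J P" unfolding rng_def by (rule subring_gen_power)
lemma rng_K: "k \<in> K \<Longrightarrow> k \<in> rng J P" unfolding rng_def by (rule subring_gen.gen) simp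
lemma rng_v: "v powi n \<in> rng J P" by (rule rng_K) simp
lemma rng_M: "(\<And>i. i \<in> J \<Longrightarrow> 0 \<le> c $ i) \<Longrightarrow> M c \<in> rng J P"
  unfolding rng_def by (rule subring_gen.gen) simp
lemma rng_xp: "i \<in> P \<Longrightarrow> xp i \<in> rng J P" unfolding rng_def by (rule subring_gen.gen) simp
lemma rng_subset: "(\<And>c. \<forall>i\<in>J. 0 \<le> c $ i \<Longrightarrow> M c \<in> rng J' P') \<Longrightarrow> (\<And>i. i \<in> P \<Longrightarrow> xp i \<in> rng J' P')
    \<Longrightarrow> rng J P \<subseteq> rng J' P'"
  using rng_K unfolding rng_def[of J P] by (subst rng_def, intro subring_gen_subset) (auto simp flip: rng_def)

lemma T_xp: "xp i \<in> T" unfolding xp_def using T_add T_M[OF K_one] by force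

lemma rng_T: "rng J P \<subseteq> T"
proof
  fix x assume "x \<in> rng J P"
  then show "x \<in> T" unfolding rng_def
  proof induction
    case one
    then show ?case using T_M[OF K_one, of 0] M_0 by simp
  next
    case (gen x)
    then show ?case using T_xp T_M[of x 0] T_M[OF K_one] by (auto simp: M_0)
  qed (auto intro: T_diff T_mult)
qed

definition wp :: "'n list \<Rightarrow> 'f" where "wp w = prod_list (map xp w)"

lemma wp_simps [simp]: "wp [] = 1" "wp (i # w) = xp i * wp w" "wp (u @ w) = wp u * wp w"
  by (simp_all add: wp_def)

lemmas v_lefts = v_left[of "xp i" for i] v_left[of "M c" for c] v_left[of "wp w" for w]

text \<open>\<open>Fd J P d\<close> is the part of \<open>rng J P\<close> of degree less than \<open>d\<close> in the mutated variables. Modulo lower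
  degree the letters of a word commute up to a power of \<open>v\<close>.\<close>

definition Fd :: "'n set \<Rightarrow> 'n set \<Rightarrow> nat \<Rightarrow> 'f set" where
  "Fd J P d = kspan K {M c * wp w | c w. (\<forall>i\<in>J. 0 \<le> c $ i) \<and> set w \<subseteq> P \<and> length w < d}"

lemma Fd_base: "(\<And>i. i \<in> J \<Longrightarrow> 0 \<le> c $ i) \<Longrightarrow> set w \<subseteq> P \<Longrightarrow> length w < d \<Longrightarrow> k \<in> K \<Longrightarrow> k * (M c * wp w) \<in> Fd J P d"
  unfolding Fd_def by (rule kspan_base) blast+
lemma Fd_add: "x \<in> Fd J P d \<Longrightarrow> y \<in> Fd J P d \<Longrightarrow> x + y \<in> Fd J P d"
  unfolding Fd_def by (rule kspan_add)
lemma Fd_zero: "0 \<in> Fd J P d" unfolding Fd_def by (rule kspan.zero)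
lemma Fd_mono: "d \<le> d' \<Longrightarrow> Fd J P d \<subseteq> Fd J P d'"
  unfolding Fd_def by (rule kspan_mono) (use order.strict_trans2 in blast)
lemma Fd_induct [consumes 1, case_names zero step]:
  assumes "z \<in> Fd J P d" "Q 0"
    "\<And>k c w y. k \<in> K \<Longrightarrow> (\<And>i. i \<in> J \<Longrightarrow> 0 \<le> c $ i) \<Longrightarrow> set w \<subseteq> P \<Longrightarrow> length w < d \<Longrightarrow> Q y \<Longrightarrow> Q (k * (M c * wp w) + y)"
  shows "Q z"
  using assms(1) unfolding Fd_def by induction (use assms(2,3) in auto)

lemma Fd_K: "z \<in> Fd J P d \<Longrightarrow> k \<in> K \<Longrightarrow> k * z \<in> Fd J P d"
proof (induction rule: Fd_induct)
  case (step k' c w y)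
  then show ?case using Fd_base[of J c w P d "k * k'"]
    by (auto simp: distrib_left K_mult mult.assoc intro!: Fd_add)
qed (auto intro: Fd_zero)

lemma Fd_M: "z \<in> Fd J P d \<Longrightarrow> (\<And>i. i \<in> J \<Longrightarrow> 0 \<le> c $ i) \<Longrightarrow> M c * z \<in> Fd J P d"
proof (induction rule: Fd_induct)
  case (step k' c' w y)
  have "M c * (k' * (M c' * wp w)) = (k' * v powi L c c') * (M (c + c') * wp w)"
    using step by (simp add: K_left M_mult2 mult.assoc)
  also have "\<dots> \<in> Fd J P d" using step by (intro Fd_base K_mult vK) auto
  finally show ?case using step by (auto simp: distrib_left intro!: Fd_add)
qed (auto intro: Fd_zero)

text \<open>If the jth variable is absent, \<open>xp j\<close> passes the monomial and joins the
  word. If it is present, the product is a sum of two monomials whose jth exponent drops by one and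
  stays nonnegative; this is where \<open>P \<subseteq> J\<close> enters.\<close>

lemma Fd_xp:
  assumes "P \<subseteq> J" "j \<in> P" "z \<in> Fd J P d"
  shows "xp j * z \<in> Fd J P (Suc d)"
  using assms(3)
proof (induction rule: Fd_induct)
  case (step k c w y)
  have "xp j * (M c * wp w) \<in> Fd J P (Suc d)"
  proof (cases "c $ j = 0")
    case True
    have "xp j * (M c * wp w) = v powi (2 * L (lo j) c) * (M c * wp (j # w))"
      using xp_M_comm[OF True] by (simp add: mult.assoc[symmetric])
    also have "\<dots> \<in> Fd J P (Suc d)" using step assms by (intro Fd_base) auto
    finally show ?thesis .
  next
    case False
    then have c: "1 \<le> c $ j" using step(2)[of j] assms by force
    have "xp j * (M c * wp w) = v powi L (hi j) c * (M (hi j + c) * wp w) + v powi L (lo j) c * (M (lo j + c) * wp w)"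
      using xp_M by (simp add: mult.assoc[symmetric] distrib_right)
    also have "\<dots> \<in> Fd J P (Suc d)"
      by (intro Fd_add Fd_base vK) (use step c in \<open>auto simp: hi_nth lo_nth\<close>)
    finally show ?thesis .
  qed
  then show ?case using step by (auto simp: distrib_left K_left intro!: Fd_add Fd_K)
qed (auto intro: Fd_zero)

text \<open>The union of the filtration absorbs left multiplication by all generators and contains
  1, so it contains the ring.\<close>

lemma rng_Fd:
  assumes "P \<subseteq> J" "z \<in> rng J P"
  shows "\<exists>d. z \<in> Fd J P d"
proof -
  have "\<forall>d. \<forall>y\<in>Fd J P d. \<exists>d'. z * y \<in> Fd J P d'"
    using assms(2) unfolding rng_def
  proof induction
    case one
    then show ?case by auto
  next
    case (gen x)
    then consider "x \<in> K" | c where "\<forall>i\<in>J. 0 \<le> c $ i" "x = M c" | i where "i \<in> P" "x = xp i" by auto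
    then show ?case
      by cases (use Fd_K in blast, use Fd_M in blast, use Fd_xp[OF assms(1)] in blast)
  next
    case (diff x y)
    show ?case
    proof (intro allI ballI)
      fix d u assume "u \<in> Fd J P d"
      then obtain d1 d2 where "x * u \<in> Fd J P d1" "y * u \<in> Fd J P d2" using diff by blast
      then have 1: "x * u \<in> Fd J P (max d1 d2)" and 2: "y * u \<in> Fd J P (max d1 d2)"
        using Fd_mono by (meson max.cobounded1 max.cobounded2 subsetD)+
      have "x * u + (- 1) * (y * u) \<in> Fd J P (max d1 d2)"
        by (intro Fd_add 1 Fd_K 2 K_uminus K_one)
      then show "\<exists>d'. (x - y) * u \<in> Fd J P d'" by (auto simp: left_diff_distrib)
    qed
  next
    case (mult x y)
    then show ?case by (metis mult.assoc)
  qed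
  moreover have "1 \<in> Fd J P 1" using Fd_base[of J 0 "[]" P 1 1] K_one by (simp add: M_0)
  ultimately show ?thesis by fastforce
qed

text \<open>By \<open>xp_xp\<close>, each exchange with a neighbour costs a power of
  \<open>v\<close> and a term in which two letters are replaced by a nonnegative monomial, hence of
  lower degree.\<close>

lemma wp_move:
  assumes "P \<subseteq> J" "set u \<subseteq> P" "set w \<subseteq> P" "i \<in> P"
  shows "\<exists>n. wp (i # u @ w) - v powi n * wp (u @ i # w) \<in> Fd J P (Suc (length u + length w))"
  using assms(2)
proof (induction u)
  case Nil
  have "wp (i # [] @ w) - v powi 0 * wp ([] @ i # w) = 0" by simp
  then show ?case using Fd_zero by metis
next
  case (Cons j u)
  then obtain n where n: "wp (i # u @ w) - v powi n * wp (u @ i # w) \<in> Fd J P (Suc (length u + length w))" by auto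
  obtain m k c where m: "k \<in> K" "\<forall>l. 0 \<le> c $ l" "xp i * xp j = v powi m * (xp j * xp i) + k * M c"
    using xp_xp by blast
  have "wp (i # (j # u) @ w) - v powi (m + n) * wp ((j # u) @ i # w)
      = v powi m * (xp j * (wp (i # u @ w) - v powi n * wp (u @ i # w))) + k * (M c * wp (u @ w))"
  proof -
    have "wp (i # (j # u) @ w) = (xp i * xp j) * wp (u @ w)" by (simp add: mult.assoc)
    also have "\<dots> = v powi m * (xp j * wp (i # u @ w)) + k * (M c * wp (u @ w))"
      unfolding m(3) by (simp add: distrib_right mult.assoc)
    finally have 1: "wp (i # (j # u) @ w) = v powi m * (xp j * wp (i # u @ w)) + k * (M c * wp (u @ w))" .
    have 2: "v powi (m + n) * wp ((j # u) @ i # w) = v powi m * (xp j * (v powi n * wp (u @ i # w)))"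
      by (simp add: v_lefts v_add' mult.assoc)
    show ?thesis unfolding 1 2 by (simp add: right_diff_distrib)
  qed
  also have "\<dots> \<in> Fd J P (Suc (length (j # u) + length w))"
  proof (rule Fd_add)
    show "v powi m * (xp j * (wp (i # u @ w) - v powi n * wp (u @ i # w))) \<in> Fd J P (Suc (length (j # u) + length w))"
      using Fd_K[OF Fd_xp[OF assms(1) _ n] vK] Cons by auto
    show "k * (M c * wp (u @ w)) \<in> Fd J P (Suc (length (j # u) + length w))"
      by (rule Fd_base) (use m Cons assms in auto)
  qed
  finally show ?case by blast
qed

lemma wp_perm:
  assumes "P \<subseteq> J" "set w \<subseteq> P" "mset w' = mset w"
  shows "\<exists>n. wp w - v powi n * wp w' \<in> Fd J P (length w)"
  using assms(2,3)
proof (induction w arbitrary: w')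
  case Nil
  then have "wp [] - v powi 0 * wp w' = 0" by simp
  then show ?case using Fd_zero by metis
next
  case (Cons i w)
  then have "i \<in> set w'" by (metis list.set_intros(1) set_mset_mset)
  then obtain u w2 where w': "w' = u @ i # w2" by (meson split_list)
  then have ms: "mset (u @ w2) = mset w" using Cons by simp
  then have len: "length w = length u + length w2" and st: "set u \<subseteq> P" "set w2 \<subseteq> P"
    using Cons(2) by (metis length_append size_mset) (metis Cons.prems(1) le_sup_iff mset_eq_setD set_append set_subset_Cons subset_trans ms)+
  obtain n where n: "wp w - v powi n * wp (u @ w2) \<in> Fd J P (length w)"
    using Cons ms by fastforce
  obtain m where m: "wp (i # u @ w2) - v powi m * wp (u @ i # w2) \<in> Fd J P (Suc (length w))"
    using wp_move[OF assms(1) st, of i] Cons(2) len by auto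
  have "xp i * (wp w - v powi n * wp (u @ w2)) \<in> Fd J P (Suc (length w))"
    using Fd_xp[OF assms(1) _ n] Cons(2) by auto
  then have "xp i * (wp w - v powi n * wp (u @ w2)) + v powi n * (wp (i # u @ w2) - v powi m * wp (u @ i # w2))
     \<in> Fd J P (Suc (length w))" using m by (intro Fd_add Fd_K[OF m] vK)
  also have "xp i * (wp w - v powi n * wp (u @ w2)) + v powi n * (wp (i # u @ w2) - v powi m * wp (u @ i # w2))
     = wp (i # w) - v powi (n + m) * wp w'"
    by (simp add: w' right_diff_distrib v_lefts v_add')
  finally show ?case by auto
qed

end

section \<open>Upper and lower bounds\<close>


context quantum_frame
begin

section \<open>Standard monomials and their leading terms\<close>

definition rp :: "'n multiset \<Rightarrow> 'n list" where "rp X = (SOME w. mset w = X)"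

lemma mset_rp [simp]: "mset (rp X) = X"
  unfolding rp_def by (rule someI_ex) (rule ex_mset)

lemma set_rp [simp]: "set (rp X) = set_mset X" by (metis mset_rp set_mset_mset)

text \<open>In a standard monomial a variable and its mutation never occur together, because their
  product is a sum of two monomials in the other variables. Multisets suffice for the mutated
  variables, as words with the same letters agree up to a power of \<open>v\<close> and lower
  degree.\<close>

definition Std :: "'n set \<Rightarrow> 'n set \<Rightarrow> ((int^'n) \<times> 'n multiset) set" where
  "Std J P = {(c, X). (\<forall>i\<in>J. 0 \<le> c $ i) \<and> set_mset X \<subseteq> P \<and> (\<forall>i\<in>#X. c $ i = 0)}"

definition smon :: "(int^'n) \<times> 'n multiset \<Rightarrow> 'f" where "smon = (\<lambda>(c, X). M c * wp (rp X))"

text \<open>The letter \<open>i\<close> is moved to the front, where one copy of the ith variable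
  turns it into two monomials. This shortens the word, and the move costs only terms of lower
  degree.\<close>

lemma Fd_reduce:
  assumes "P \<subseteq> J" "\<And>i. i \<in> J \<Longrightarrow> 0 \<le> c $ i" "set w \<subseteq> P" "i \<in> set w" "c $ i \<noteq> 0"
  shows "M c * wp w \<in> Fd J P (length w)"
proof -
  obtain u w2 where w: "w = u @ i # w2" using assms(4) by (meson split_list)
  obtain n where n: "wp (i # u @ w2) - v powi n * wp w \<in> Fd J P (length w)"
    using wp_move[OF assms(1), of u w2 i] assms w by auto
  have c: "1 \<le> c $ i" using assms by (metis subsetD int_one_le_iff_zero_less order_le_imp_less_or_eq)
  have "M c * wp (i # u @ w2) = v powi L c (hi i) * (M (c + hi i) * wp (u @ w2))
      + v powi L c (lo i) * (M (c + lo i) * wp (u @ w2))"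
    using M_xp[of c i] by (simp add: mult.assoc[symmetric] distrib_right)
  also have "\<dots> \<in> Fd J P (length w)"
    by (intro Fd_add Fd_base vK) (use assms w c in \<open>auto simp: hi_nth lo_nth\<close>)
  finally have 1: "M c * wp (i # u @ w2) \<in> Fd J P (length w)" .
  have "M c * wp w = v powi (- n) * (M c * wp (i # u @ w2)) + (- (v powi (- n))) * (M c * (wp (i # u @ w2) - v powi n * wp w))"
    by (simp add: right_diff_distrib v_lefts v_add')
  also have "\<dots> \<in> Fd J P (length w)"
    using assms by (intro Fd_add Fd_K 1 vK K_uminus Fd_M n) auto
  finally show ?thesis .
qed

lemma Fd_std: "P \<subseteq> J \<Longrightarrow> Fd J P d \<subseteq> kspan K (smon ` Std J P)"
proof (induction d)
  case 0
  show ?case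
  proof
    fix z assume "z \<in> Fd J P 0"
    then show "z \<in> kspan K (smon ` Std J P)" by (induction rule: Fd_induct) (auto intro: kspan.zero)
  qed
next
  case (Suc d)
  let ?V = "kspan K (smon ` Std J P)"
  have VK: "k * z \<in> ?V" if "k \<in> K" "z \<in> ?V" for k z
    using that(2)
  proof induction
    case (step k' x y)
    then show ?case using that(1)
      by (auto simp: distrib_left mult.assoc[symmetric] intro!: kspan.step K_mult)
  qed (auto intro: kspan.zero)
  show ?case
  proof
    fix z assume "z \<in> Fd J P (Suc d)"
    then show "z \<in> ?V"
    proof (induction rule: Fd_induct)
      case (step k c w y)
      have IH: "\<And>x. x \<in> Fd J P d \<Longrightarrow> x \<in> ?V" using Suc by blast
      have "M c * wp w \<in> ?V"
      proof (cases "length w < d")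
        case True
        then have "1 * (M c * wp w) \<in> Fd J P d" using step by (intro Fd_base K_one) auto
        then show ?thesis using IH by simp
      next
        case False
        then have d: "length w = d" using step by simp
        show ?thesis
        proof (cases "\<exists>i\<in>set w. c $ i \<noteq> 0")
          case True
          then show ?thesis using Fd_reduce[OF Suc(2), of c w] step IH d by blast
        next
          case False
          obtain n where n: "wp w - v powi n * wp (rp (mset w)) \<in> Fd J P d"
            using wp_perm[OF Suc(2), of w "rp (mset w)"] step d by auto
          have "M c * wp w = v powi n * smon (c, mset w) + M c * (wp w - v powi n * wp (rp (mset w)))"
            by (simp add: smon_def right_diff_distrib v_lefts)
          moreover have "v powi n * smon (c, mset w) \<in> ?V"
            by (intro kspan_base vK imageI) (use step False in \<open>auto simp: Std_def\<close>)
          moreover have "M c * (wp w - v powi n * wp (rp (mset w))) \<in> ?V"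
            using step by (intro IH Fd_M n) auto
          ultimately show ?thesis by (metis kspan_add)
        qed
      qed
      then show ?case using step by (intro kspan_add[OF VK])
    qed (auto intro: kspan.zero)
  qed
qed

lemma rng_std: "P \<subseteq> J \<Longrightarrow> z \<in> rng J P \<Longrightarrow> z \<in> kspan K (smon ` Std J P)"
  using rng_Fd Fd_std by blast

text \<open>The all-ones vector is chosen because by \<open>L_b\<close> it pairs to -1 with every
  column \<open>b k\<close>; a single functional thus makes \<open>lo k\<close> the strictly
  dominant exponent of each \<open>xp k\<close>.\<close>

definition Phi :: "int^'n \<Rightarrow> int" where "Phi c = L (\<chi> i. 1) c"

lemma Phi_add: "Phi (c + d) = Phi c + Phi d" by (simp add: Phi_def L_add2)
lemma Phi_hi: "Phi (hi k) = Phi (lo k) - 1" by (simp add: hi_lo Phi_add) (simp add: Phi_def L_b)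

text \<open>Requiring the leading coefficient to be a power of \<open>v\<close> makes leading terms
  multiplicative and keeps them invertible.\<close>

definition lead :: "'f \<Rightarrow> int^'n \<Rightarrow> bool" where
  "lead z c \<longleftrightarrow> (\<exists>n. z - v powi n * M c \<in> TT {d. Phi d < Phi c})"

lemma lead_mult:
  assumes "lead z c" "lead w d"
  shows "lead (z * w) (c + d)"
proof -
  obtain n m where n: "z - v powi n * M c \<in> TT {a. Phi a < Phi c}"
    and m: "w - v powi m * M d \<in> TT {a. Phi a < Phi d}" using assms by (auto simp: lead_def)
  let ?z = "z - v powi n * M c" and ?w = "w - v powi m * M d"
  have "z * w - v powi (n + m + L c d) * M (c + d) = ?z * ?w + ?z * (v powi m * M d) + (v powi n * M c) * ?w"
  proof -
    have "(v powi n * M c) * (v powi m * M d) = v powi (n + m + L c d) * M (c + d)"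
      by (simp add: mult.assoc v_lefts M_mult v_add' add_ac)
    then show ?thesis by (simp add: left_diff_distrib right_diff_distrib)
  qed
  also have "\<dots> \<in> TT {a. Phi a < Phi (c + d)}"
  proof (intro TT_add)
    show "?z * ?w \<in> TT {a. Phi a < Phi (c + d)}" by (rule TT_mult[OF n m]) (auto simp: Phi_add)
    show "?z * (v powi m * M d) \<in> TT {a. Phi a < Phi (c + d)}"
      by (rule TT_mult[OF n TT_kM[OF vK, of d "{d}"]]) (auto simp: Phi_add)
    show "(v powi n * M c) * ?w \<in> TT {a. Phi a < Phi (c + d)}"
      by (rule TT_mult[OF TT_kM[OF vK, of c "{c}"] m]) (auto simp: Phi_add)
  qed
  finally show ?thesis unfolding lead_def by blast
qed

lemma lead_M: "lead (M c) c"
  unfolding lead_def by (rule exI[of _ 0]) (simp add: TT_zero)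

lemma lead_xp: "lead (xp i) (lo i)"
  unfolding lead_def by (rule exI[of _ 0]) (simp add: xp_def TT_M Phi_hi)

lemma lead_wp: "lead (wp w) (sum_list (map lo w))"
proof (induction w)
  case Nil
  show ?case using lead_M[of 0] by (simp add: M_0)
next
  case (Cons i w)
  then show ?case using lead_mult[OF lead_xp] by simp
qed

definition tot :: "(int^'n) \<times> 'n multiset \<Rightarrow> int^'n" where
  "tot = (\<lambda>(c, X). c + sum_list (map lo (rp X)))"

lemma lead_smon: "lead (smon a) (tot a)"
  by (cases a) (simp add: smon_def tot_def lead_mult lead_M lead_wp)

lemma sum_lo_nth: "set w \<subseteq> P \<Longrightarrow> finite P \<Longrightarrow> sum_list (map lo w) $ i = (\<Sum>j\<in>P. int (count (mset w) j) * lo j $ i)"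
proof (induction w)
  case (Cons a w)
  have "(\<Sum>j\<in>P. int (count (mset (a # w)) j) * lo j $ i)
      = (\<Sum>j\<in>P. (if j = a then lo j $ i else 0) + int (count (mset w) j) * lo j $ i)"
    by (rule sum.cong) (auto simp: algebra_simps)
  also have "\<dots> = lo a $ i + (\<Sum>j\<in>P. int (count (mset w) j) * lo j $ i)"
    using Cons by (simp add: sum.distrib)
  finally show ?case using Cons by simp
qed simp

lemma tot_nth: "set_mset X \<subseteq> P \<Longrightarrow> tot (c, X) $ i = c $ i + (\<Sum>j\<in>P. int (count X j) * lo j $ i)"
  using sum_lo_nth[of "rp X" P i] by (simp add: tot_def)

text \<open>The coordinate at a vertex \<open>i\<close> of the list is affected only by
  \<open>c $ i\<close>, by \<open>i\<close> itself and by letters at earlier vertices, because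
  \<open>lo j $ i = 0\<close> for later \<open>j\<close>. Going along the list, the difference of
  \<open>c $ i\<close> and the multiplicity of \<open>i\<close> is therefore known; one of these two
  nonnegative numbers is zero, so both are known.\<close>

lemma tot_inj:
  assumes "sorted_wrt (\<lambda>i j. b i $ j \<le> 0) l" "distinct l" "P = set l" "P \<subseteq> J"
    and a: "(c, X) \<in> Std J P" "(c', X') \<in> Std J P" "tot (c, X) = tot (c', X')"
  shows "c = c' \<and> X = X'"
proof -
  have X: "set_mset X \<subseteq> P" "set_mset X' \<subseteq> P" using a by (auto simp: Std_def)
  have "count X (l ! m) = count X' (l ! m)" if "m < length l" for m
    using that
  proof (induction m rule: less_induct)
    case (less m)
    let ?i = "l ! m"
    have iP: "?i \<in> P" using less assms by simp
    have z: "(\<Sum>j\<in>P - {?i}. int (count X j) * lo j $ ?i) = (\<Sum>j\<in>P - {?i}. int (count X' j) * lo j $ ?i)"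
    proof (rule sum.cong[OF refl])
      fix j assume "j \<in> P - {?i}"
      then obtain m' where m': "m' < length l" "l ! m' = j" "m' \<noteq> m" using assms(3) by (metis DiffE in_set_conv_nth insertI1)
      show "int (count X j) * lo j $ ?i = int (count X' j) * lo j $ ?i"
      proof (cases "m' < m")
        case True
        then show ?thesis using less m' by auto
      next
        case False
        then have "b ?i $ j \<le> 0" using m' less assms(1) by (auto simp: sorted_wrt_iff_nth_less)
        then have "lo j $ ?i = 0" using b_skew[of j ?i] m' less assms(2) by (auto simp: lo_nth nth_eq_iff_index_eq)
        then show ?thesis by simp
      qed
    qed
    have *: "tot (d, Y) $ ?i = d $ ?i - int (count Y ?i) + (\<Sum>j\<in>P - {?i}. int (count Y j) * lo j $ ?i)"
      if "set_mset Y \<subseteq> P" for d Y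
      using that iP assms(3) by (simp add: tot_nth sum.remove lo_nth)
    have "c $ ?i - int (count X ?i) = c' $ ?i - int (count X' ?i)"
      using *[OF X(1), of c] *[OF X(2), of c'] z a(3) by simp
    moreover have "0 \<le> c $ ?i" "0 \<le> c' $ ?i" using iP assms(4) a by (auto simp: Std_def)
    moreover have "count X ?i = 0 \<or> c $ ?i = 0" "count X' ?i = 0 \<or> c' $ ?i = 0"
      using a by (auto simp: Std_def count_eq_zero_iff)
    ultimately show ?case by auto
  qed
  then have "count X j = count X' j" if "j \<in> P" for j using that assms(3) by (metis in_set_conv_nth)
  then have "X = X'" using X by (intro multiset_eqI) (metis count_eq_zero_iff subsetD)
  then show ?thesis using a(3) by (simp add: tot_def)
qed

lemma TT_wp: "set w \<subseteq> P \<Longrightarrow> k \<notin> P \<Longrightarrow> wp w \<in> TT {c. 0 \<le> c $ k}"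
proof (induction w)
  case Nil
  then show ?case using TT_M[of 0 "{c. 0 \<le> c $ k}"] by (simp add: M_0)
next
  case (Cons i w)
  have "xp i \<in> TT {c. 0 \<le> c $ k}" unfolding xp_def
    using Cons by (intro TT_add TT_M) (auto simp: hi_nth lo_nth)
  then show ?case using Cons by (auto intro!: TT_mult[where A="{c. 0 \<le> c $ k}" and B="{c. 0 \<le> c $ k}"])
qed

text \<open>Here \<open>k\<close> comes first in the order. In the standard expansion of
  \<open>y\<close>, the terms free of the kth variable have distinct leading exponents with kth
  coordinate 0, so a highest one would survive in the constant term. Hence every term contains the
  kth variable and can be divided by it.\<close>

lemma kernel_divisible:
  assumes srt: "sorted_wrt (\<lambda>i j. b i $ j \<le> 0) (k # l)" and dist: "distinct (k # l)"
    and y: "y \<in> rng (insert k (set l)) (set l)" and y0: "pr {c. c $ k = 0} y = 0"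
  shows "M (- unit_vec k) * y \<in> rng (insert k (set l)) (set l)"
proof -
  let ?P = "set l" and ?J = "insert k (set l)"
  let ?S = "Std ?J ?P"
  have std: "y \<in> kspan K (smon ` ?S)" by (rule rng_std[OF _ y]) auto
  obtain A \<kappa> where A: "finite A" "A \<subseteq> smon ` ?S" "\<forall>a\<in>A. \<kappa> a \<in> K" "y = (\<Sum>a\<in>A. \<kappa> a * a)"
    using kspan_sum[OF std K_zero K_add] by metis
  have "\<forall>a\<in>A. \<exists>p. p \<in> ?S \<and> a = smon p" using A(2) by blast
  from bchoice[OF this] obtain f where f: "\<And>a. a \<in> A \<Longrightarrow> f a \<in> ?S \<and> a = smon (f a)" by blast
  have aT: "a \<in> T" if "a \<in> A" for a
  proof -
    have "smon p \<in> T" for p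
      using lead_smon[of p] unfolding lead_def by (metis T_M T_add TT_T diff_add_cancel vK)
    then show ?thesis using f that by metis
  qed
  \<comment> \<open>Terms that really occur and do not contain the kth variable; the claim is that
    there are none.\<close>
  define A0 where "A0 = {a \<in> A. \<kappa> a \<noteq> 0 \<and> fst (f a) $ k = 0}"
  have pos: "1 \<le> fst (f a) $ k" if "a \<in> A" "\<kappa> a \<noteq> 0" "a \<notin> A0" for a
  proof -
    have "0 \<le> fst (f a) $ k" using f[OF that(1)] by (auto simp: Std_def)
    then show ?thesis using that by (auto simp: A0_def)
  qed
  have "A0 = {}"
  proof (rule ccontr)
    assume "A0 \<noteq> {}"
    have fin: "finite A0" using A(1) by (simp add: A0_def)
    then have "Max ((\<lambda>a. Phi (tot (f a))) ` A0) \<in> (\<lambda>a. Phi (tot (f a))) ` A0"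
      using \<open>A0 \<noteq> {}\<close> by (intro Max_in) auto
    then obtain a0 where "a0 \<in> A0" "Max ((\<lambda>a. Phi (tot (f a))) ` A0) = Phi (tot (f a0))" by blast
    then have a0: "a0 \<in> A0" "\<And>a. a \<in> A0 \<Longrightarrow> Phi (tot (f a)) \<le> Phi (tot (f a0))"
      using fin by (metis, metis Max_ge finite_imageI imageI)
    define t where "t = tot (f a0)"
    have tk: "t $ k = 0"
    proof -
      obtain c X where cX: "f a0 = (c, X)" by force
      have "c $ k = 0" "set_mset X \<subseteq> ?P" using a0(1) f[of a0] cX by (auto simp: A0_def Std_def)
      moreover have "lo j $ k = 0" if "j \<in> ?P" for j
        using that srt dist b_skew[of j k] by (auto simp: lo_nth)
      ultimately show ?thesis unfolding t_def cX by (simp add: tot_nth)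
    qed
    have yT: "y \<in> T" using y rng_T by blast
    have "pr {t} y = 0" using pr_pr[OF yT, of "{t}" "{c. c $ k = 0}"] y0 tk by simp
    moreover have "pr {t} (\<Sum>a\<in>B. \<kappa> a * a) = (\<Sum>a\<in>B. \<kappa> a * pr {t} a) \<and> (\<Sum>a\<in>B. \<kappa> a * a) \<in> T" if "B \<subseteq> A" for B
      using finite_subset[OF that A(1)] that
    proof (induction B)
      case (insert x B)
      have "\<kappa> x * x \<in> T" using TT_T[OF TT_K[OF T_TT]] A(3) aT insert by auto
      then show ?case using insert A(3) aT by (simp add: pr_add pr_K T_add)
    qed (auto intro: T_zero)
    ultimately have s0: "(\<Sum>a\<in>A. \<kappa> a * pr {t} a) = 0" using A(4) by (metis subset_refl)
    \<comment> \<open>No other term reaches the exponent \<open>t\<close>: a term in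
      \<open>A0\<close> has a different leading exponent and otherwise only exponents below the
      maximum of \<open>Phi\<close>, and a term outside \<open>A0\<close> with nonzero coefficient
      has positive kth coordinates throughout.\<close>
    have other: "\<kappa> a * pr {t} a = 0" if "a \<in> A" "a \<noteq> a0" for a
    proof (cases "\<kappa> a = 0")
      case False
      have "pr {t} a = 0"
      proof (cases "a \<in> A0")
        case True
        note aA = that(1)
        obtain n where n: "a - v powi n * M (tot (f a)) \<in> TT {d. Phi d < Phi (tot (f a))}"
          using lead_smon[of "f a"] f[OF aA] by (auto simp: lead_def)
        have "tot (f a) \<noteq> t"
        proof
          assume "tot (f a) = t"
          moreover have "f a \<in> ?S" "f a0 \<in> ?S" using f that a0(1) by (auto simp: A0_def)
          ultimately have "f a = f a0"
            using tot_inj[of l ?P ?J "fst (f a)" "snd (f a)" "fst (f a0)" "snd (f a0)"] srt dist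
            by (auto simp: t_def prod_eq_iff)
          then show False using f that a0(1) by (metis (mono_tags, lifting) A0_def mem_Collect_eq)
        qed
        then have "pr {t} (v powi n * M (tot (f a))) = 0" by (auto simp: pr_kM)
        moreover have "pr {t} (a - v powi n * M (tot (f a))) = 0"
          by (rule pr_disj[OF n]) (use a0(2)[OF True] in \<open>auto simp: t_def\<close>)
        ultimately show ?thesis using aT[OF that(1)] by (simp add: pr_diff T_M)
      next
        case F: False
        obtain c X where cX: "f a = (c, X)" by force
        have c: "1 \<le> c $ k" using pos[OF that(1) False F] cX by simp
        have X: "set_mset X \<subseteq> ?P" using f[OF that(1)] cX by (auto simp: Std_def)
        have "M c * wp (rp X) \<in> TT {d. 1 \<le> d $ k}"
          by (rule TT_mult[OF TT_M[of c "{d. 1 \<le> d $ k}"] TT_wp[of _ ?P k]]) (use c X dist in auto)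
        then have "a \<in> TT {d. 1 \<le> d $ k}" using f[OF that(1)] cX by (simp add: smon_def)
        then show ?thesis by (rule pr_disj) (use tk in auto)
      qed
      then show ?thesis by simp
    qed simp
    have "(\<Sum>a\<in>A - {a0}. \<kappa> a * pr {t} a) = 0"
      by (rule sum.neutral) (use other in blast)
    then have "(\<Sum>a\<in>A. \<kappa> a * pr {t} a) = \<kappa> a0 * pr {t} a0"
      using A(1) a0(1) by (subst sum.remove[of A a0]) (auto simp: A0_def)
    moreover obtain n where n: "a0 - v powi n * M t \<in> TT {d. Phi d < Phi t}"
      using lead_smon[of "f a0"] f[of a0] a0(1) by (auto simp: lead_def t_def A0_def)
    moreover have "pr {t} a0 = v powi n * M t"
    proof -
      have "pr {t} (a0 - v powi n * M t) = 0" by (rule pr_disj[OF n]) auto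
      moreover have "a0 \<in> T" using aT a0(1) by (auto simp: A0_def)
      ultimately show ?thesis by (simp add: pr_diff T_M pr_kM)
    qed
    ultimately have "\<kappa> a0 = 0" using s0 by simp
    then show False using a0(1) by (simp add: A0_def)
  qed
  have "M (- unit_vec k) * (\<kappa> a * a) \<in> rng ?J ?P" if "a \<in> A" for a
  proof (cases "\<kappa> a = 0")
    case False
    obtain c X where cX: "f a = (c, X)" by force
    have c: "1 \<le> c $ k" using pos[OF that False] cX \<open>A0 = {}\<close> by simp
    have S: "(c, X) \<in> ?S" using f[OF that] cX by simp
    have "wp w \<in> rng ?J ?P" if "set w \<subseteq> ?P" for w
      using that by (induction w) (auto intro: rng_one rng_mult rng_xp)
    then have w: "wp (rp X) \<in> rng ?J ?P" using S by (auto simp: Std_def)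
    have "M (- unit_vec k) * (\<kappa> a * a) = \<kappa> a * (v powi L (- unit_vec k) c * (M (- unit_vec k + c) * wp (rp X)))"
    proof -
      have "M (- unit_vec k) * (\<kappa> a * a) = \<kappa> a * (M (- unit_vec k) * a)"
        by (rule K_left) (use A(3) that in blast)
      also have "M (- unit_vec k) * a = M (- unit_vec k) * (M c * wp (rp X))"
        using f[OF that] cX by (simp add: smon_def)
      finally show ?thesis by (simp add: M_mult2)
    qed
    also have "\<dots> \<in> rng ?J ?P"
    proof (intro rng_mult w rng_M rng_v)
      show "\<kappa> a \<in> rng ?J ?P" using A that rng_K by blast
      fix i assume "i \<in> ?J"
      then show "0 \<le> (- unit_vec k + c) $ i" using c S by (auto simp: Std_def axis_def)
    qed
    finally show ?thesis .
  qed (simp add: rng_zero)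
  then show ?thesis unfolding A(4) sum_distrib_left rng_def by (rule subring_gen_sum)
qed

end


context quantum_frame
begin

section \<open>Constant terms in one variable and the reduction of poles\<close>

lemma axis_plus: "axis k m + axis k n = (axis k (m + n) :: int^'n)"
  by (auto simp: vec_eq_iff axis_def)
lemma axis_uminus: "- axis k m = (axis k (- m) :: int^'n)"
  by (auto simp: vec_eq_iff axis_def)
lemma axis_0: "(axis k 0 :: int^'n) = 0"
  by (auto simp: vec_eq_iff axis_def)

lemma rng_TT: "k \<in> J \<Longrightarrow> k \<notin> P \<Longrightarrow> y \<in> rng J P \<Longrightarrow> y \<in> TT {c. 0 \<le> c $ k}"
proof -
  assume k: "k \<in> J" "k \<notin> P" and "y \<in> rng J P"
  from this(3) show ?thesis unfolding rng_def
  proof induction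
    case one
    then show ?case using TT_M[of 0 "{c. 0 \<le> c $ k}"] M_0 by simp
  next
    case (gen x)
    then show ?case using k TT_kM[of x 0 "{c. 0 \<le> c $ k}"]
      by (auto simp: M_0 xp_def hi_nth lo_nth intro!: TT_M TT_add)
  next
    case (mult x y)
    then show ?case by (intro TT_mult[where A="{c. 0 \<le> c $ k}" and B="{c. 0 \<le> c $ k}"]) auto
  qed (auto intro: TT_diff)
qed

text \<open>Pairing with \<open>unit_vec k\<close> kills every column \<open>b i\<close> with
  \<open>i \<noteq> k\<close>, so both terms of \<open>xp i\<close> have the same degree;
  \<open>xp k\<close> is the only mutated variable that this grading splits.\<close>

lemma xp_homogeneous: "k \<noteq> i \<Longrightarrow> xp i \<in> TT {c. L (unit_vec k) c = L (unit_vec k) (lo i)}"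
  unfolding xp_def by (intro TT_add TT_M) (auto simp: hi_lo L_simps axis_def)

lemma wp_homogeneous: "k \<notin> set w \<Longrightarrow> \<exists>m. wp w \<in> TT {c. L (unit_vec k) c = m}"
proof (induction w)
  case Nil
  then show ?case using TT_M[of 0 "{c. L (unit_vec k) c = 0}"] by (auto simp: M_0)
next
  case (Cons i w)
  then obtain m where "wp w \<in> TT {c. L (unit_vec k) c = m}" by auto
  with Cons show ?case
    by (intro exI[of _ "L (unit_vec k) (lo i) + m"])
      (auto simp: L_simps intro!: TT_mult[OF xp_homogeneous])
qed

text \<open>Monomials and words without the letter \<open>k\<close> are homogeneous, so
  \<open>M c * wp w\<close> either survives the projection as a whole or disappears.\<close>

lemma rng_graded:
  assumes "P \<subseteq> J" "k \<notin> P" "y \<in> rng J P"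
  shows "pr {c. L (unit_vec k) c = d} y \<in> rng J P"
proof -
  have wpr: "wp w \<in> rng J P" if "set w \<subseteq> P" for w
    using that by (induction w) (auto intro: rng_one rng_mult rng_xp)
  obtain e where "y \<in> Fd J P e" using rng_Fd assms by blast
  then have "y \<in> T \<and> ?thesis"
  proof (induction rule: Fd_induct)
    case (step k' c w y)
    obtain m where m: "wp w \<in> TT {c. L (unit_vec k) c = m}" using wp_homogeneous[of k w] step assms by auto
    have x: "k' * (M c * wp w) \<in> TT {a. L (unit_vec k) a = L (unit_vec k) c + m}"
      by (intro TT_K step TT_mult[OF TT_M[of c "{c}"] m]) (auto simp: L_simps)
    have "k' * (M c * wp w) \<in> rng J P" using step wpr by (intro rng_mult[OF rng_K] rng_mult[OF rng_M]) auto
    moreover have "pr {c. L (unit_vec k) c = d} (k' * (M c * wp w))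
       = (if d = L (unit_vec k) c + m then k' * (M c * wp w) else 0)"
      using pr_id[OF x] pr_disj[OF x, of "{c. L (unit_vec k) c = d}"] by auto
    ultimately show ?case using step TT_T[OF x] by (auto simp: pr_add T_add intro!: rng_add)
  qed (auto simp: T_zero rng_zero)
  then show ?thesis by simp
qed

text \<open>The ring with the kth variable set to zero, realized inside the torus by constant
  terms.\<close>

definition Cb :: "'n \<Rightarrow> 'n set \<Rightarrow> 'n set \<Rightarrow> 'f set" where "Cb k J P = pr {c. c $ k = 0} ` rng J P"

lemma Cb_mult: "k \<in> J \<Longrightarrow> k \<notin> P \<Longrightarrow> x \<in> Cb k J P \<Longrightarrow> y \<in> Cb k J P \<Longrightarrow> x * y \<in> Cb k J P"
  unfolding Cb_def by (auto simp flip: pr_mult_nonneg[OF rng_TT rng_TT] intro!: imageI rng_mult)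
lemma Cb_diff: "x \<in> Cb k J P \<Longrightarrow> y \<in> Cb k J P \<Longrightarrow> x - y \<in> Cb k J P"
  unfolding Cb_def by (auto simp flip: pr_diff[OF subsetD[OF rng_T] subsetD[OF rng_T]] intro!: imageI rng_diff)
lemma Cb_add: "x \<in> Cb k J P \<Longrightarrow> y \<in> Cb k J P \<Longrightarrow> x + y \<in> Cb k J P"
  unfolding Cb_def by (auto simp flip: pr_add[OF subsetD[OF rng_T] subsetD[OF rng_T]] intro!: imageI rng_add)
lemma Cb_zero: "0 \<in> Cb k J P"
  unfolding Cb_def by (rule image_eqI[of _ _ 0]) (auto intro: rng_zero)
lemma Cb_kM: "\<kappa> \<in> K \<Longrightarrow> c $ k = 0 \<Longrightarrow> (\<And>i. i \<in> J \<Longrightarrow> 0 \<le> c $ i) \<Longrightarrow> \<kappa> * M c \<in> Cb k J P"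
  unfolding Cb_def by (rule image_eqI[of _ _ "\<kappa> * M c"]) (auto simp: pr_kM intro!: rng_mult[OF rng_K] rng_M)

lemma Cb_graded:
  assumes "P \<subseteq> J" "k \<notin> P" "x \<in> Cb k J P"
  shows "pr {c. L (unit_vec k) c = d} x \<in> Cb k J P"
proof -
  obtain y where y: "y \<in> rng J P" "x = pr {c. c $ k = 0} y" using assms by (auto simp: Cb_def)
  then have "pr {c. L (unit_vec k) c = d} x = pr {c. c $ k = 0} (pr {c. L (unit_vec k) c = d} y)"
  proof -
    have "y \<in> T" using y rng_T by blast
    then show ?thesis using y(2) by (simp add: pr_pr Int_commute)
  qed
  then show ?thesis using rng_graded[OF assms(1,2) y(1)] by (auto simp: Cb_def)
qed

text \<open>Conjugation by \<open>M (unit_vec k)\<close> grades the ring, and the two terms of the divisor have different degrees.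
  The term \<open>M g\<close> of smaller degree is a unit, so the quotient is obtained degree by degree.\<close>

lemma Cb_divide:
  assumes "k \<in> J" "P \<subseteq> J" "k \<notin> P"
    and g: "g $ k = 0" "\<And>i. i \<in> J \<Longrightarrow> g $ i = 0" and h: "h $ k = 0" "\<And>i. i \<in> J \<Longrightarrow> 0 \<le> h $ i"
    and deg: "L (unit_vec k) h = L (unit_vec k) g + 1"
    and a: "a \<in> TT {c. c $ k = 0}" "a * (v powi m * M g + v powi n * M h) \<in> Cb k J P"
  shows "a \<in> Cb k J P"
proof -
  let ?s = "L (unit_vec k)" and ?Q = "v powi m * M g + v powi n * M h"
  have main: "a \<in> Cb k J P"
    if "a \<in> TT {c. c $ k = 0 \<and> d \<le> ?s c \<and> ?s c < d + int N}" "a * ?Q \<in> Cb k J P" for a d N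
    using that
  proof (induction N arbitrary: a d)
    case 0
    then have "a \<in> TT {}" by (auto intro: TT_mono[rotated])
    then have "a = 0" using pr_id pr_disj by fastforce
    then show ?case by (simp add: Cb_zero)
  next
    case (Suc N)
    define a0 where "a0 = pr {c. ?s c = d} a"
    have aT: "a \<in> T" using Suc TT_T by blast
    have gT: "v powi m * M g \<in> TT {g}" "v powi n * M h \<in> TT {h}" by (auto intro: TT_kM)
    \<comment> \<open>\<open>M h\<close> raises degrees by one more than \<open>M g\<close>, so in
      the lowest possible degree of the product only the part of \<open>a\<close> of degree
      \<open>d\<close>, multiplied by the term with exponent \<open>g\<close>, is left.\<close>
    have "pr {c. ?s c = d + ?s g} (a * (v powi n * M h)) = pr {c. ?s c = d - 1} a * (v powi n * M h)"
      by (rule pr_mult_right[OF aT gT(2)]) (use deg in \<open>auto simp: L_simps\<close>)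
    also have "pr {c. ?s c = d - 1} a = 0" by (rule pr_disj[OF Suc(2)]) auto
    finally have 1: "pr {c. ?s c = d + ?s g} (a * (v powi n * M h)) = 0" by simp
    have 2: "pr {c. ?s c = d + ?s g} (a * (v powi m * M g)) = a0 * (v powi m * M g)"
      unfolding a0_def by (rule pr_mult_right[OF aT gT(1)]) (auto simp: L_simps)
    have "pr {c. ?s c = d + ?s g} (a * ?Q) = a0 * (v powi m * M g)"
      using 1 2 aT gT TT_T by (simp add: distrib_left pr_add T_mult)
    then have "a0 * (v powi m * M g) \<in> Cb k J P" using Cb_graded[OF assms(2,3) Suc(3), of "d + ?s g"] by simp
    then have "a0 * (v powi m * M g) * (v powi (- m) * M (- g)) \<in> Cb k J P"
      by (rule Cb_mult[OF assms(1,3)]) (rule Cb_kM, use g in auto)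
    also have "a0 * (v powi m * M g) * (v powi (- m) * M (- g)) = a0"
      by (simp add: mult.assoc v_left[of "M g"] v_add' M_inv)
        (simp add: v_left[of "M g"] M_inv mult.assoc[symmetric] flip: v_add)
    finally have a0C: "a0 \<in> Cb k J P" .
    have "?Q \<in> Cb k J P" by (intro Cb_add Cb_kM vK) (use g h in auto)
    then have "(a - a0) * ?Q \<in> Cb k J P"
      using Cb_diff[OF Suc(3) Cb_mult[OF assms(1,3) a0C]] by (simp add: left_diff_distrib)
    moreover have "a - a0 \<in> TT {c. c $ k = 0 \<and> d + 1 \<le> ?s c \<and> ?s c < d + 1 + int N}"
    proof -
      have "a0 \<in> TT ({c. ?s c = d} \<inter> {c. c $ k = 0 \<and> d \<le> ?s c \<and> ?s c < d + int (Suc N)})"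
        unfolding a0_def by (rule pr_TT_inter[OF Suc(2)])
      then have "a - a0 \<in> TT {c. c $ k = 0 \<and> d \<le> ?s c \<and> ?s c < d + int (Suc N)}"
        by (intro TT_diff Suc(2)) (rule TT_mono[rotated], auto)
      moreover have "a - a0 \<in> TT (- {c. ?s c = d})" unfolding a0_def by (rule pr_compl[OF aT])
      ultimately have "a - a0 \<in> TT ({c. c $ k = 0 \<and> d \<le> ?s c \<and> ?s c < d + int (Suc N)} \<inter> - {c. ?s c = d})"
        by (simp add: TT_def)
      then show ?thesis by (rule TT_mono[rotated]) auto
    qed
    ultimately have "a - a0 \<in> Cb k J P" by (rule Suc.IH[rotated])
    then show ?case using Cb_add[OF _ a0C] by fastforce
  qed
  let ?S = "?s ` Poly_Mapping.keys (cf a)"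
  obtain d e where de: "\<And>x. x \<in> ?S \<Longrightarrow> d \<le> x \<and> x < e"
  proof
    fix x assume "x \<in> ?S"
    then show "Min ?S \<le> x \<and> x < Max ?S + 1" using Max_ge[of ?S x] by simp
  qed
  have "a \<in> TT {c. c $ k = 0 \<and> d \<le> ?s c \<and> ?s c < d + int (nat (e - d))}"
    using a(1) de by (fastforce simp: TT_def)
  then show ?thesis using main a(2) by blast
qed

text \<open>A power of the kth exchange relation: a product of \<open>N\<close> binomials with
  exponents \<open>pos (b k)\<close> and \<open>neg (b k)\<close> and powers of \<open>v\<close> as
  coefficients, hence free of the kth variable.\<close>

definition Pi_xp :: "'n \<Rightarrow> nat \<Rightarrow> 'f" where "Pi_xp k N = M (axis k (int N)) * xp k ^ N"

lemma Pi_xp_0: "Pi_xp k 0 = 1" by (simp add: Pi_xp_def axis_0 M_0)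

lemma Pi_xp_Suc: "\<exists>m n. Pi_xp k (Suc N) = (v powi m * M (pos (b k)) + v powi n * M (neg (b k))) * Pi_xp k N"
proof -
  have e: "axis k (int (Suc N)) + hi k = pos (b k) + axis k (int N)"
     "axis k (int (Suc N)) + lo k = neg (b k) + axis k (int N)"
    by (auto simp: vec_eq_iff hi_nth lo_nth axis_def)
  have f: "M (x + y) = v powi (- L x y) * (M x * M y)" for x y by (simp add: M_mult v_add')
  have "M (axis k (int (Suc N))) * xp k = v powi L (axis k (int (Suc N))) (hi k) * M (pos (b k) + axis k (int N))
      + v powi L (axis k (int (Suc N))) (lo k) * M (neg (b k) + axis k (int N))"
    by (simp only: M_xp e)
  also have "\<dots> = (v powi (L (axis k (int (Suc N))) (hi k) - L (pos (b k)) (axis k (int N))) * M (pos (b k))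
      + v powi (L (axis k (int (Suc N))) (lo k) - L (neg (b k)) (axis k (int N))) * M (neg (b k))) * M (axis k (int N))"
    by (simp only: f distrib_right v_add' mult.assoc diff_conv_add_uminus)
  finally have "Pi_xp k (Suc N) = (v powi (L (axis k (int (Suc N))) (hi k) - L (pos (b k)) (axis k (int N))) * M (pos (b k))
      + v powi (L (axis k (int (Suc N))) (lo k) - L (neg (b k)) (axis k (int N))) * M (neg (b k))) * Pi_xp k N"
    unfolding Pi_xp_def power_Suc by (simp only: mult.assoc[symmetric])
  then show ?thesis by blast
qed

lemma Pi_xp_TT: "Pi_xp k N \<in> TT {c. c $ k = 0}"
proof (induction N)
  case 0
  show ?case using TT_M[of 0 "{c. c $ k = 0}"] by (simp add: Pi_xp_0 M_0)
next
  case (Suc N)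
  obtain m n where *: "Pi_xp k (Suc N) = (v powi m * M (pos (b k)) + v powi n * M (neg (b k))) * Pi_xp k N"
    using Pi_xp_Suc by blast
  show ?case unfolding *
    by (rule TT_mult[where A="{c. c $ k = 0}", OF TT_add[OF TT_kM TT_kM] Suc]) auto
qed

lemma Pi_xp_rng: "Pi_xp k N \<in> rng J P"
proof (induction N)
  case 0
  show ?case by (simp add: Pi_xp_0 rng_one)
next
  case (Suc N)
  then show ?case using Pi_xp_Suc[of k N] by (auto intro!: rng_mult rng_add rng_v rng_M)
qed

text \<open>The binomials are cancelled one at a time. The sign condition makes
  \<open>pos (b k)\<close> vanish on \<open>J\<close>, so the monomial with this exponent is
  invertible in the ring, as \<open>Cb_divide\<close> requires.\<close>

lemma Cb_divide_Pi:
  assumes "k \<in> J" "P \<subseteq> J" "k \<notin> P" "\<And>j. j \<in> J \<Longrightarrow> b k $ j \<le> 0"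
    and "a \<in> TT {c. c $ k = 0}" "a * Pi_xp k N \<in> Cb k J P"
  shows "a \<in> Cb k J P"
  using assms(5,6)
proof (induction N arbitrary: a)
  case 0
  then show ?case by (simp add: Pi_xp_0)
next
  case (Suc N)
  obtain m n where *: "Pi_xp k (Suc N) = (v powi m * M (pos (b k)) + v powi n * M (neg (b k))) * Pi_xp k N"
    using Pi_xp_Suc by blast
  let ?Q = "v powi m * M (pos (b k)) + v powi n * M (neg (b k))"
  have "a * ?Q \<in> TT {c. c $ k = 0}"
    by (rule TT_mult[where B="{c. c $ k = 0}", OF Suc(2) TT_add[OF TT_kM TT_kM]]) auto
  then have Q: "a * ?Q \<in> Cb k J P" using Suc by (simp add: * mult.assoc)
  have "pos (b k) = neg (b k) + b k" by (auto simp: vec_eq_iff)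
  then have "L (unit_vec k) (neg (b k)) = L (unit_vec k) (pos (b k)) + 1" by (simp add: L_simps)
  then show ?case by (intro Cb_divide[OF assms(1-3) _ _ _ _ _ Suc(2) Q]) (use assms(4) in auto)
qed

lemma wp_single: "set w \<subseteq> {k} \<Longrightarrow> wp w = xp k ^ length w"
  by (induction w) auto

lemma xp_power_TT: "xp k ^ n \<in> TT {c. c $ k = - int n}"
proof (induction n)
  case 0
  then show ?case using TT_M[of 0 "{c. c $ k = 0}"] by (simp add: M_0)
next
  case (Suc n)
  have "xp k \<in> TT {c. c $ k = - 1}" unfolding xp_def by (intro TT_add TT_M) (auto simp: hi_nth lo_nth)
  from TT_mult[OF this Suc, of "{c. c $ k = - int (Suc n)}"] show ?case by simp
qed

text \<open>With \<open>k\<close> as the only letter, a standard monomial is a monomial times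
  \<open>xp k ^ n\<close>, homogeneous of kth degree \<open>c $ k - n\<close>, where
  \<open>n = 0\<close> or \<open>c $ k = 0\<close>. For \<open>N \<ge> 1\<close> the degree
  \<open>- N\<close> therefore forces \<open>n = N\<close>.\<close>

lemma pole_part:
  assumes "z \<in> rng {k} {k}" "1 \<le> N"
  shows "\<exists>a\<in>TT {c. c $ k = 0}. pr {c. c $ k = - int N} z = a * xp k ^ N"
proof -
  have "z \<in> kspan K (smon ` Std {k} {k})" using rng_std assms by blast
  then have "z \<in> T \<and> ?thesis"
  proof induction
    case zero
    then show ?case using T_zero TT_zero by (auto intro!: bexI[of _ 0])
  next
    case (step \<kappa> x y)
    then obtain c X where cX: "(c, X) \<in> Std {k} {k}" "x = smon (c, X)" by auto
    define n where "n = size X"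
    have w: "set (rp X) \<subseteq> {k}" "length (rp X) = n" using cX by (auto simp: Std_def n_def) (metis mset_rp size_mset)
    then have x: "\<kappa> * x = (\<kappa> * M c) * xp k ^ n" using cX(2) wp_single[of "rp X" k] by (simp add: smon_def mult.assoc)
    have cn: "0 \<le> c $ k" "n = 0 \<or> c $ k = 0" using cX(1) by (auto simp: Std_def n_def)
    have xT: "\<kappa> * x \<in> TT {d. d $ k = c $ k - int n}" unfolding x
      by (rule TT_mult[OF TT_kM[OF step(1), of c "{c}"] xp_power_TT]) auto
    obtain a where a: "a \<in> TT {c. c $ k = 0}" "pr {c. c $ k = - int N} y = a * xp k ^ N" using step by auto
    have "\<exists>a'\<in>TT {c. c $ k = 0}. pr {c. c $ k = - int N} (\<kappa> * x) = a' * xp k ^ N"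
    proof (cases "c $ k = 0 \<and> n = N")
      case True
      then show ?thesis using pr_id[OF xT] x step(1) by (auto intro!: bexI[of _ "\<kappa> * M c"] TT_kM)
    next
      case False
      then have "c $ k - int n \<noteq> - int N" using cn assms(2) by auto
      then have "pr {c. c $ k = - int N} (\<kappa> * x) = 0" by (intro pr_disj[OF xT]) auto
      then show ?thesis by (auto intro!: bexI[of _ 0] TT_zero)
    qed
    then obtain a' where "a' \<in> TT {c. c $ k = 0}" "pr {c. c $ k = - int N} (\<kappa> * x) = a' * xp k ^ N" by blast
    then show ?case using a step TT_T[OF xT]
      by (auto simp: pr_add T_add distrib_right intro!: bexI[of _ "a' + a"] TT_add)
  qed
  then show ?thesis by simp
qed

text \<open>Conjugation multiplies each generator by a power of \<open>v\<close>; for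
  \<open>xp i\<close> this needs \<open>i \<noteq> k\<close>.\<close>

lemma rng_conj:
  assumes "k \<notin> P" "w \<in> rng J P"
  shows "M (axis k n) * w * M (axis k (- n)) \<in> rng J P"
proof -
  have inv: "M (axis k (- n)) * (M (axis k n) * z) = z" for z
    using M_inv(2)[of "axis k n"] by (simp add: axis_uminus mult.assoc[symmetric])
  have inv': "M (axis k n) * (M (axis k (- n)) * z) = z" for z
    using M_inv(1)[of "axis k n"] by (simp add: axis_uminus mult.assoc[symmetric])
  from assms(2) show ?thesis unfolding rng_def
  proof induction
    case one
    then show ?case using inv'[of 1] by (simp add: subring_gen.one)
  next
    case (gen x)
    then consider "x \<in> K" | c where "\<forall>i\<in>J. 0 \<le> c $ i" "x = M c" | i where "i \<in> P" "x = xp i" by auto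
    then have "M (axis k n) * x * M (axis k (- n)) \<in> rng J P"
    proof cases
      case 1
      then have "M (axis k n) * x * M (axis k (- n)) = x" using inv'[of 1] by (simp add: K_comm mult.assoc)
      then show ?thesis using 1 rng_K by simp
    next
      case 2
      have "M (axis k n) * x * M (axis k (- n)) = v powi (2 * L (axis k n) c) * M c"
        unfolding 2(2) M_comm[of "axis k n" c] using inv'[of 1] by (simp add: mult.assoc)
      then show ?thesis using 2 by (auto intro!: rng_mult rng_v rng_M)
    next
      case 3
      then have "axis k n $ i = 0" using assms by (auto simp: axis_def)
      then have "M (axis k n) * x * M (axis k (- n)) = v powi (- 2 * L (lo i) (axis k n)) * x"
        unfolding 3(2) M_xp_comm[OF \<open>axis k n $ i = 0\<close>] using inv'[of 1] by (simp add: mult.assoc)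
      then show ?thesis using 3 by (auto intro!: rng_mult rng_v rng_xp)
    qed
    then show ?case by (simp add: rng_def)
  next
    case (diff x y)
    then show ?case by (auto simp: left_diff_distrib right_diff_distrib intro: subring_gen.diff)
  next
    case (mult x y)
    have "M (axis k n) * (x * y) * M (axis k (- n))
      = (M (axis k n) * x * M (axis k (- n))) * (M (axis k n) * y * M (axis k (- n)))"
      using inv by (simp add: mult.assoc)
    then show ?case using mult by (auto intro: subring_gen.mult)
  qed
qed

text \<open>Induction on the pole order. The polar part of order \<open>Suc N\<close> is
  \<open>a * xp k ^ Suc N\<close>. If \<open>a\<close> is replaced by an element \<open>w2\<close>
  of the ring with the same constant term and the result is subtracted from \<open>z\<close>, then
  multiplication by the kth variable to the power \<open>Suc N\<close> leaves a vanishing constant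
  term, and \<open>kernel_divisible\<close> cancels one factor.\<close>

lemma reduce_pole:
  assumes srt: "sorted_wrt (\<lambda>i j. b i $ j \<le> 0) (k # l)" and dist: "distinct (k # l)"
    and J: "J = insert k (set l)"
    and "z \<in> rng {k} {k}" "M (axis k (int N)) * z \<in> rng J (set l)"
  shows "z \<in> rng J J"
  using assms(4,5)
proof (induction N arbitrary: z)
  case 0
  have "rng J (set l) \<subseteq> rng J J" by (rule rng_subset) (auto simp: J intro: rng_M rng_xp)
  then show ?case using 0 by (auto simp: axis_0 M_0)
next
  case (Suc N)
  let ?P = "set l" and ?E = "M (axis k (int (Suc N)))" and ?E' = "M (axis k (- int (Suc N)))"
  have kP: "k \<notin> ?P" "k \<in> J" "?P \<subseteq> J" using dist J by auto
  have src: "b k $ j \<le> 0" if "j \<in> J" for j using that srt J by auto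
  have EE: "?E * (?E' * x) = x" "?E' * (?E * x) = x" for x
    using M_inv[of "axis k (int (Suc N))"] by (simp_all add: axis_uminus mult.assoc[symmetric] del: of_nat_Suc)
  have zT: "z \<in> T" using Suc(2) rng_T by blast
  obtain a where a: "a \<in> TT {c. c $ k = 0}" "pr {c. c $ k = - int (Suc N)} z = a * xp k ^ Suc N"
    using pole_part[OF Suc(2), of "Suc N"] by auto
  \<comment> \<open>Conjugation moves \<open>a\<close> past the power of the kth variable, so that
    this power meets \<open>xp k ^ Suc N\<close> and forms \<open>Pi_xp k (Suc N)\<close>.\<close>
  define a' where "a' = ?E * a * ?E'"
  have E_TT: "?E \<in> TT {c. c $ k = int (Suc N)}" "?E' \<in> TT {c. c $ k = - int (Suc N)}" by (auto intro!: TT_M)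
  have a'0: "a' \<in> TT {c. c $ k = 0}" unfolding a'_def
    by (rule TT_mult[OF TT_mult[OF E_TT(1) a(1), of "{c. c $ k = int (Suc N)}"] E_TT(2)]) auto
  have "pr {c. c $ k = 0} (?E * z) = ?E * pr {c. c $ k = - int (Suc N)} z"
    by (rule pr_mult_left[OF E_TT(1) zT]) auto
  also have "\<dots> = a' * Pi_xp k (Suc N)"
    unfolding a(2) a'_def Pi_xp_def by (simp add: mult.assoc EE del: of_nat_Suc power_Suc)
  finally have p: "pr {c. c $ k = 0} (?E * z) = a' * Pi_xp k (Suc N)" .
  then have "a' * Pi_xp k (Suc N) \<in> Cb k J ?P" using Suc(3) unfolding Cb_def by (metis imageI)
  then have "a' \<in> Cb k J ?P" by (intro Cb_divide_Pi[of k J ?P a' "Suc N"] kP src a'0)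
  then obtain w where w: "w \<in> rng J ?P" "a' = pr {c. c $ k = 0} w" by (auto simp: Cb_def)
  define w2 where "w2 = ?E' * w * ?E"
  have w2: "w2 \<in> rng J ?P" using rng_conj[OF kP(1) w(1), of "- int (Suc N)"] by (simp add: w2_def del: of_nat_Suc)
  define z1 where "z1 = z - w2 * xp k ^ Suc N"
  have Ez1: "?E * z1 = ?E * z - w * Pi_xp k (Suc N)"
    by (simp add: z1_def w2_def Pi_xp_def right_diff_distrib mult.assoc EE del: of_nat_Suc power_Suc)
  have inr: "?E * z1 \<in> rng J ?P" unfolding Ez1 by (intro rng_diff Suc(3) rng_mult w Pi_xp_rng)
  have "pr {c. c $ k = 0} (w * Pi_xp k (Suc N)) = pr {c. c $ k = 0} w * Pi_xp k (Suc N)"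
    by (rule pr_mult_right[OF _ Pi_xp_TT]) (use w rng_T in auto)
  moreover have "?E * z \<in> T" "w * Pi_xp k (Suc N) \<in> T"
    using Suc(3) w(1) rng_T TT_T[OF Pi_xp_TT] T_mult by blast+
  ultimately have "pr {c. c $ k = 0} (?E * z1) = 0"
    unfolding Ez1 using p w(2) by (simp only: pr_diff) simp
  then have "M (- unit_vec k) * (?E * z1) \<in> rng J ?P"
    using kernel_divisible[OF srt dist] inr J by auto
  moreover have "M (- unit_vec k) * (?E * z1) = v powi L (- unit_vec k) (axis k (int (Suc N))) * (M (axis k (int N)) * z1)"
    unfolding M_mult2 axis_uminus axis_plus by simp
  ultimately have "v powi (- L (- unit_vec k) (axis k (int (Suc N)))) *
     (v powi L (- unit_vec k) (axis k (int (Suc N))) * (M (axis k (int N)) * z1)) \<in> rng J ?P"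
    by (metis rng_K rng_mult vK)
  then have 1: "M (axis k (int N)) * z1 \<in> rng J ?P" by (simp add: v_add')
  have "rng J ?P \<subseteq> rng {k} {k}"
    by (rule rng_subset) (use kP in \<open>auto simp: xp_def hi_nth lo_nth intro!: rng_M rng_add\<close>)
  then have "z1 \<in> rng {k} {k}" unfolding z1_def using w2 by (intro rng_diff Suc(2) rng_mult rng_power rng_xp) auto
  then have "z1 \<in> rng J J" using 1 Suc.IH by blast
  moreover have "rng J ?P \<subseteq> rng J J" by (rule rng_subset) (auto simp: J intro: rng_M rng_xp)
  then have "w2 * xp k ^ Suc N \<in> rng J J" using w2 J by (intro rng_mult rng_power rng_xp) auto
  ultimately have "z1 + w2 * xp k ^ Suc N \<in> rng J J" by (rule rng_add)
  then show ?case by (simp add: z1_def)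
qed

text \<open>Only the monomial generators can contain inverse powers of the kth variable, and an
  element involves finitely many of them. Products need the stability of the target ring under
  conjugation by that variable.\<close>

lemma rng_pole_bound:
  assumes "k \<notin> P" "z \<in> rng P P"
  shows "\<exists>N. M (axis k (int N)) * z \<in> rng (insert k P) P"
  using assms(2) unfolding rng_def[of P]
proof induction
  case one
  then show ?case by (auto intro!: exI[of _ 0] simp: axis_0 M_0 rng_one)
next
  case (gen x)
  then consider "x \<in> K" | c where "\<forall>i\<in>P. 0 \<le> c $ i" "x = M c" | i where "i \<in> P" "x = xp i" by auto
  then show ?case
  proof cases
    case 2
    show ?thesis unfolding 2(2) M_mult
      by (intro exI[of _ "nat (- c $ k)"] rng_mult rng_v rng_M) (use 2 in \<open>auto simp: axis_def\<close>)
  qed (auto intro!: exI[of _ 0] simp: axis_0 M_0 intro: rng_K rng_xp)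
next
  case (diff x y)
  then obtain N N' where N: "M (axis k (int N)) * x \<in> rng (insert k P) P" "M (axis k (int N')) * y \<in> rng (insert k P) P"
    unfolding rng_def by blast
  have *: "M (axis k (int (n + n'))) * u \<in> rng (insert k P) P"
    if "M (axis k (int n)) * u \<in> rng (insert k P) P" for n n' u
  proof -
    have "M (axis k (int (n + n'))) * u
        = v powi (- L (axis k (int n')) (axis k (int n))) * (M (axis k (int n')) * (M (axis k (int n)) * u))"
      unfolding M_mult2 axis_plus by (simp add: v_add' add.commute)
    also have "\<dots> \<in> rng (insert k P) P"
      by (intro rng_mult rng_v that rng_M) (auto simp: axis_def)
    finally show ?thesis .
  qed
  have "M (axis k (int (N + N'))) * x - M (axis k (int (N' + N))) * y \<in> rng (insert k P) P"
    by (intro rng_diff * N)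
  then show ?case by (auto intro!: exI[of _ "N + N'"] simp: right_diff_distrib add.commute)
next
  case (mult x y)
  then obtain N N' where N: "M (axis k (int N)) * x \<in> rng (insert k P) P" "M (axis k (int N')) * y \<in> rng (insert k P) P"
    by blast
  have inv: "M (axis k (- int N')) * (M (axis k (int N')) * z) = z" for z
    using M_inv(2)[of "axis k (int N')"] by (simp add: axis_uminus mult.assoc[symmetric])
  have "M (axis k (int (N + N'))) * (x * y)
      = v powi (- L (axis k (int N')) (axis k (int N))) * (M (axis k (int N')) * (M (axis k (int N)) * (x * y)))"
    unfolding M_mult2 axis_plus by (simp add: v_add' add.commute)
  \<comment> \<open>Inserting a power of the kth variable and its inverse between the factors turns
    the first factor into a conjugate of an element of the ring.\<close>
  also have "M (axis k (int N')) * (M (axis k (int N)) * (x * y)) =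
     (M (axis k (int N')) * (M (axis k (int N)) * x) * M (axis k (- int N'))) * (M (axis k (int N')) * y)"
    by (simp add: mult.assoc inv)
  also have "v powi (- L (axis k (int N')) (axis k (int N))) * \<dots> \<in> rng (insert k P) P"
    by (intro rng_mult rng_v N rng_conj assms)
  finally show ?case by blast
qed

lemma T_rng: "T \<subseteq> rng {} {}"
proof
  fix z assume "z \<in> T"
  then show "z \<in> rng {} {}" unfolding T_def
    by induction (auto intro!: rng_zero rng_add rng_mult[OF rng_K] rng_M)
qed

text \<open>For the empty list the ring is the whole torus. Prepending \<open>k\<close> trades the
  invertibility of the kth variable for its mutation: \<open>rng_pole_bound\<close> bounds the pole
  and \<open>reduce_pole\<close> removes it. Lists need not exhaust the vertices, because
  \<open>upper_bound_mutate\<close> works with pairs.\<close>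

theorem upper_bound_subset_lower_bound:
  assumes "sorted_wrt (\<lambda>i j. b i $ j \<le> 0) l" "distinct l" "z \<in> T" "\<And>k. k \<in> set l \<Longrightarrow> z \<in> rng {k} {k}"
  shows "z \<in> rng (set l) (set l)"
  using assms
proof (induction l)
  case Nil
  then show ?case using T_rng by auto
next
  case (Cons k l)
  then have "z \<in> rng (set l) (set l)" by simp
  then obtain N where "M (axis k (int N)) * z \<in> rng (insert k (set l)) (set l)"
    using rng_pole_bound[of k "set l" z] Cons by auto
  then show ?case using reduce_pole[of k l "set (k # l)" z N] Cons by auto
qed

end

section \<open>Mutation invariance of the upper bound\<close>


context quantum_frame
begin

lemma axis_Suc: "axis k (int (Suc n)) = axis k (int n) + (unit_vec k :: int^'n)"
  by (simp add: axis_plus add.commute)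

lemma L_scale: "L (n *s c) d = n * L c d"
proof -
  have *: "L (int m *s c) d = int m * L c d" for m
    by (induction m) (simp_all add: vector_sadd_rdistrib L_add algebra_simps)
  show ?thesis
  proof (cases "0 \<le> n")
    case True
    then show ?thesis using *[of "nat n"] by simp
  next
    case False
    then have "L (- (n *s c)) d = - n * L c d" using *[of "nat (- n)"] by (simp add: vector_sneg_minus1)
    then show ?thesis by (simp add: L_uminus)
  qed
qed

lemma L_scale2: "L c (n *s d) = n * L c d"
  using L_skew[of c "n *s d"] L_skew[of c d] by (simp add: L_scale)

lemma M_plus: "M (c + d) = v powi (- L c d) * (M c * M d)"
  by (simp add: M_mult v_add')

lemma M_axis_nat: "M (axis k (int n)) = M (unit_vec k) ^ n"
proof (induction n)
  case (Suc n)
  have "axis k (int n) = int n *s unit_vec k" by (auto simp: vec_eq_iff axis_def)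
  then have "L (axis k (int n)) (unit_vec k) = 0" by (simp add: L_scale)
  then have "M (axis k (int (Suc n))) = M (axis k (int n)) * M (unit_vec k)" unfolding axis_Suc by (simp add: M_plus)
  then show ?case using Suc by (simp add: power_Suc2 del: power_Suc)
qed (simp add: axis_0 M_0)

lemma TT_rng: "z \<in> TT {c. \<forall>i\<in>J. 0 \<le> c $ i} \<Longrightarrow> z \<in> rng J P"
  by (induction rule: TT_induct) (auto intro!: rng_zero rng_add rng_mult[OF rng_K] rng_M)

end

text \<open>\<open>L'\<close> is \<open>L\<close> pulled back along the matrix that sends the kth
  unit vector to \<open>lo k\<close> and fixes the others. Of the new frame only the multiplication
  rule, the normalization and the values on unit vectors are assumed; independence of its monomials
  and compatibility with \<open>b'\<close> are derived below.\<close>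

locale frame_mutation = quantum_frame +
  fixes k :: "'b" and L' b' M'
  assumes L'_eq: "L' c d = L (c + (c $ k) *s (lo k - unit_vec k)) (d + (d $ k) *s (lo k - unit_vec k))"
    and M'_mult: "M' c * M' d = v powi L' c d * M' (c + d)"
    and M'_0: "M' 0 = 1"
    and M'_axis: "i \<noteq> k \<Longrightarrow> M' (unit_vec i) = M (unit_vec i)"
    and M'_k: "M' (unit_vec k) = xp k"
    and b'_eq: "b' j $ i = (if i = k \<or> j = k then - b j $ i
                  else b j $ i + sgn (b k $ i) * max (b k $ i * b j $ k) 0)"
begin

definition E where "E c = c + (c $ k) *s (lo k - unit_vec k)"

lemma E_add: "E (c + d) = E c + E d" by (auto simp: E_def vec_eq_iff algebra_simps)
lemma E_fix: "c $ k = 0 \<Longrightarrow> E c = c" by (simp add: E_def)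
lemma E_nth_k: "E c $ k = - (c $ k)" by (simp add: E_def lo_nth algebra_simps)
lemma E_axis: "E (axis k n) = n *s lo k" by (auto simp: E_def vec_eq_iff axis_def algebra_simps)
lemma L'_E: "L' c d = L (E c) (E d)" by (simp add: L'_eq E_def)

lemma L'_add: "L' (c + c') d = L' c d + L' c' d" by (simp add: L'_E E_add L_add)
lemma L'_skew: "L' c d = - L' d c" unfolding L'_E by (rule L_skew)
lemma L'_fix: "c $ k = 0 \<Longrightarrow> d $ k = 0 \<Longrightarrow> L' c d = L c d" by (simp add: L'_E E_fix)

text \<open>The factorization of matrix mutation as \<open>E B F\<close>, read column by column;
  since \<open>E\<close> is an involution it takes the form \<open>E B' = B F\<close>.\<close>

lemma E_b': "E (b' j) = (if j = k then - b k else b j + max (b j $ k) 0 *s b k)"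
proof (cases "j = k")
  case True
  then have "b' j = - b k" by (auto simp: vec_eq_iff b'_eq)
  then show ?thesis using True by (simp add: E_fix)
next
  case False
  have "E (b' j) $ i = (b j + max (b j $ k) 0 *s b k) $ i" for i
  proof (cases "i = k")
    case True
    then show ?thesis using False by (simp add: E_nth_k b'_eq)
  next
    case i: False
    show ?thesis
      using i False
      by (cases "b k $ i" "0 :: int" rule: linorder_cases; cases "0 \<le> b j $ k")
        (auto simp: E_def b'_eq lo_nth axis_def max_def zero_less_mult_iff mult_le_0_iff zero_le_mult_iff algebra_simps)
  qed
  then show ?thesis using False by (simp add: vec_eq_iff)
qed

lemma L'_b': "L' c (b' j) = - (c $ j)"
proof (cases "j = k")
  case True
  then show ?thesis by (simp add: L'_E E_b' L_simps E_nth_k)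
next
  case False
  have "E c $ j = c $ j + c $ k * max (b j $ k) 0"
    using False b_skew[of j k] by (simp add: E_def lo_nth axis_def)
  then show ?thesis using False by (simp add: L'_E E_b' L_simps L_scale2 E_nth_k)
qed

lemma M'_plus: "M' (c + d) = v powi (- L' c d) * (M' c * M' d)"
  by (simp add: M'_mult v_add')

text \<open>Both frames are determined by their values on unit vectors and by their forms, and on
  exponents with kth coordinate 0 these data agree.\<close>

lemma M'_fix: "c $ k = 0 \<Longrightarrow> M' c = M c"
proof -
  have nat: "M' (axis i (int n)) = M (axis i (int n))" if "i \<noteq> k" for i n
  proof (induction n)
    case (Suc n)
    have "L' (axis i (int n)) (unit_vec i) = L (axis i (int n)) (unit_vec i)"
      using that by (intro L'_fix) (auto simp: axis_def)
    then show ?case using Suc M'_axis[OF that] by (simp only: axis_Suc M'_plus M_plus)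
  qed (simp add: axis_0 M_0 M'_0)
  have ax: "M' (axis i n) = M (axis i n)" if "i \<noteq> k" for i n
  proof (cases "0 \<le> n")
    case True
    then show ?thesis using nat[OF that, of "nat n"] by simp
  next
    case False
    then have p: "M' (axis i (- n)) = M (axis i (- n))" using nat[OF that, of "nat (- n)"] by simp
    have "L' (axis i (- n)) (axis i n) = L (axis i (- n)) (axis i n)"
      using that by (intro L'_fix) (auto simp: axis_def)
    then have "M' (axis i (- n)) * M' (axis i n) = M (axis i (- n)) * M (axis i n)"
      by (simp add: M_mult M'_mult axis_plus axis_0 M_0 M'_0)
    then show ?thesis using p by simp
  qed
  have "M' c = M c" if "finite S" "k \<notin> S" "\<And>i. i \<notin> S \<Longrightarrow> c $ i = 0" for S c
    using that
  proof (induction S arbitrary: c)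
    case empty
    then have "c = 0" by (auto simp: vec_eq_iff)
    then show ?case by (simp add: M_0 M'_0)
  next
    case (insert i S)
    define d where "d = c - axis i (c $ i)"
    have "M' d = M d" by (rule insert.IH) (use insert in \<open>auto simp: d_def axis_def\<close>)
    moreover have c: "c = axis i (c $ i) + d" by (simp add: d_def)
    moreover have "L' (axis i (c $ i)) d = L (axis i (c $ i)) d"
      by (rule L'_fix) (use insert in \<open>auto simp: d_def axis_def\<close>)
    moreover have "i \<noteq> k" using insert by auto
    ultimately show ?case using M'_plus[of "axis i (c $ i)" d] M_plus[of "axis i (c $ i)" d] ax by metis
  qed
  then show "c $ k = 0 \<Longrightarrow> M' c = M c" by (metis Diff_iff UNIV_I finite insertCI singletonD)
qed

lemma M'_axis_k: "M' (axis k (int n)) = xp k ^ n"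
proof (induction n)
  case (Suc n)
  have "L' (axis k (int n)) (unit_vec k) = 0" by (simp add: L'_E E_axis L_scale L_scale2)
  then have "M' (axis k (int (Suc n))) = M' (axis k (int n)) * xp k" unfolding axis_Suc using M'_k by (simp add: M'_plus)
  then show ?case using Suc by (simp add: power_Suc2 del: power_Suc)
qed (simp add: axis_0 M'_0)

lemma xp_nz: "xp k \<noteq> 0"
proof
  assume "xp k = 0"
  then have "v powi L' (unit_vec k) (- unit_vec k) * M' 0 = 0"
    using M'_mult[of "unit_vec k" "- unit_vec k"] M'_k by simp
  then show False by (simp add: M'_0)
qed

lemma M'_nonneg:
  assumes "0 \<le> c $ k"
  shows "M' c = v powi (- L' (c - axis k (c $ k)) (axis k (c $ k))) * (M (c - axis k (c $ k)) * xp k ^ nat (c $ k))"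
  using M'_plus[of "c - axis k (c $ k)" "axis k (c $ k)"] M'_fix[of "c - axis k (c $ k)"]
    M'_axis_k[of "nat (c $ k)"] assms by simp

text \<open>After multiplication by a large power of \<open>xp k\<close> only nonnegative powers of
  it occur. Different powers have different kth degrees in the old frame, so the relation splits by
  degree; within one degree the power of \<open>xp k\<close> is cancelled and the old monomials are
  independent.\<close>

lemma M'_indep:
  assumes "finite F" "\<And>c. c \<in> F \<Longrightarrow> \<kappa> c \<in> K" "(\<Sum>c\<in>F. \<kappa> c * M' c) = 0" "e \<in> F"
  shows "\<kappa> e = 0"
proof -
  obtain N where N: "\<And>c. c \<in> F \<Longrightarrow> 0 \<le> c $ k + int N"
  proof
    fix c assume "c \<in> F"
    then have "\<bar>c $ k\<bar> \<le> (\<Sum>c\<in>F. \<bar>c $ k\<bar>)" using assms(1) by (intro member_le_sum) auto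
    then show "0 \<le> c $ k + int (nat (\<Sum>c\<in>F. \<bar>c $ k\<bar>))" by linarith
  qed
  define n where "n c = nat (c $ k + int N)" for c
  define r where "r c = c - axis k (c $ k)" for c :: "int^'b"
  define u where "u c = v powi (L' c (axis k (int N)) - L' (r c) (axis k (c $ k + int N)))" for c
  have rk: "r c $ k = 0" for c by (simp add: r_def)
  have eq: "M' c * M' (axis k (int N)) = u c * (M (r c) * xp k ^ n c)" if "c \<in> F" for c
  proof -
    have "c + axis k (int N) - axis k ((c + axis k (int N)) $ k) = r c"
      by (auto simp: r_def vec_eq_iff axis_def)
    then have "M' (c + axis k (int N)) = v powi (- L' (r c) (axis k (c $ k + int N))) * (M (r c) * xp k ^ n c)"
      using M'_nonneg[of "c + axis k (int N)"] N[OF that] by (simp add: n_def)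
    then show ?thesis by (simp add: M'_mult v_add' u_def)
  qed
  have "0 = (\<Sum>c\<in>F. \<kappa> c * M' c) * M' (axis k (int N))" using assms(3) by simp
  also have "\<dots> = (\<Sum>c\<in>F. (\<kappa> c * u c) * M (r c) * xp k ^ n c)"
    unfolding sum_distrib_right by (rule sum.cong[OF refl]) (simp add: mult.assoc eq)
  finally have s0: "(\<Sum>c\<in>F. (\<kappa> c * u c) * M (r c) * xp k ^ n c) = 0" by simp
  have uK: "u c \<in> K" "u c \<noteq> 0" for c by (auto simp: u_def)
  define G where "G = {c \<in> F. c $ k = e $ k}"
  have prs: "pr {d. d $ k = - int (n e)} (\<Sum>c\<in>F'. (\<kappa> c * u c) * M (r c) * xp k ^ n c)
      = (\<Sum>c\<in>F'. if c \<in> G then (\<kappa> c * u c) * M (r c) * xp k ^ n c else 0)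
      \<and> (\<Sum>c\<in>F'. (\<kappa> c * u c) * M (r c) * xp k ^ n c) \<in> T" if "F' \<subseteq> F" for F'
    using finite_subset[OF that assms(1)] that
  proof (induction F')
    case (insert c F')
    have t: "(\<kappa> c * u c) * M (r c) * xp k ^ n c \<in> TT {d. d $ k = - int (n c)}"
      by (rule TT_mult[OF TT_kM[of _ "r c" "{r c}"] xp_power_TT]) (use insert assms uK in \<open>auto simp: rk intro: K_mult\<close>)
    have "c \<in> G \<longleftrightarrow> n c = n e" using insert N[of c] N[OF assms(4)] by (auto simp: G_def n_def)
    then have "pr {d. d $ k = - int (n e)} ((\<kappa> c * u c) * M (r c) * xp k ^ n c)
      = (if c \<in> G then (\<kappa> c * u c) * M (r c) * xp k ^ n c else 0)"
    proof (cases "n c = n e")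
      case False
      then have "{d :: int^'b. d $ k = - int (n e)} \<inter> {d. d $ k = - int (n c)} = {}" by auto
      from pr_disj[OF t this] show ?thesis using \<open>c \<in> G \<longleftrightarrow> n c = n e\<close> False by simp
    qed (use pr_id[OF t] in auto)
    then show ?case using insert TT_T[OF t] by (simp add: pr_add T_add)
  qed (auto intro: T_zero)
  have "0 = (\<Sum>c\<in>F. if c \<in> G then (\<kappa> c * u c) * M (r c) * xp k ^ n c else 0)"
    using prs[of F] s0 by simp
  also have "\<dots> = (\<Sum>c\<in>G. (\<kappa> c * u c) * M (r c) * xp k ^ n c)"
    using assms(1) by (simp add: sum.If_cases G_def Int_def)
  also have "\<dots> = (\<Sum>c\<in>G. (\<kappa> c * u c) * M (r c)) * xp k ^ n e"
    unfolding sum_distrib_right by (rule sum.cong) (auto simp: G_def n_def)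
  finally have "(\<Sum>c\<in>G. (\<kappa> c * u c) * M (r c)) = 0" using xp_nz by simp
  also have "(\<Sum>c\<in>G. (\<kappa> c * u c) * M (r c)) = (\<Sum>d\<in>r ` G. (\<lambda>d. \<kappa> (d + axis k (e $ k)) * u (d + axis k (e $ k))) d * M d)"
    by (subst sum.reindex) (auto simp: inj_on_def r_def G_def intro!: sum.cong)
  finally have s: "(\<Sum>d\<in>r ` G. (\<lambda>d. \<kappa> (d + axis k (e $ k)) * u (d + axis k (e $ k))) d * M d) = 0" .
  have "\<kappa> (d + axis k (e $ k)) * u (d + axis k (e $ k)) \<in> K" if "d \<in> r ` G" for d
    using that assms(2) uK by (auto simp: G_def r_def intro: K_mult)
  moreover have "finite (r ` G)" "r e \<in> r ` G" using assms by (auto simp: G_def)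
  ultimately have "(\<lambda>d. \<kappa> (d + axis k (e $ k)) * u (d + axis k (e $ k))) (r e) = 0"
    using M_indep[of "r ` G" "\<lambda>d. \<kappa> (d + axis k (e $ k)) * u (d + axis k (e $ k))" "r e"] s by blast
  then show ?thesis using uK by (simp add: r_def)
qed

sublocale S': quantum_frame K v L' b' M'
  by unfold_locales (fact K_one K_diff K_mult K_comm v_K inv_v_K v_nz L'_add L'_skew L'_b' M'_mult M'_0 M'_indep)+

lemma E_lo': "E (S'.lo k) = b k + unit_vec k" and E_hi': "E (S'.hi k) = unit_vec k"
  by (auto simp: vec_eq_iff E_def S'.lo_nth S'.hi_nth lo_nth axis_def b'_eq max_def)

text \<open>Mutation at \<open>k\<close> is an involution: multiplied by \<open>xp k\<close>, the
  new exchange binomial becomes the old one, and \<open>xp k\<close> can be cancelled.\<close>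

lemma xp'_k: "S'.xp k = M (unit_vec k)"
proof -
  have h1: "S'.hi k + unit_vec k = unit_vec k + lo k" and h2: "S'.lo k + unit_vec k = unit_vec k + hi k"
    by (auto simp: vec_eq_iff S'.lo_nth S'.hi_nth lo_nth hi_nth axis_def b'_eq)
  have z: "(unit_vec k + lo k) $ k = 0" "(unit_vec k + hi k) $ k = 0" by (simp_all add: lo_nth hi_nth)
  have Ek: "E (unit_vec k) = lo k" by (simp add: E_axis)
  have l1: "L' (S'.hi k) (unit_vec k) = L (unit_vec k) (lo k)" by (simp add: L'_E E_hi' Ek)
  have l2: "L' (S'.lo k) (unit_vec k) = L (unit_vec k) (hi k)"
    by (simp add: L'_E E_lo' Ek hi_lo L_simps lo_nth)
  have "S'.xp k * xp k = v powi L (unit_vec k) (lo k) * M (unit_vec k + lo k) + v powi L (unit_vec k) (hi k) * M (unit_vec k + hi k)"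
    by (simp only: S'.xp_def distrib_right M'_k[symmetric] M'_mult l1 l2 h1 h2 M'_fix[OF z(1)] M'_fix[OF z(2)])
  also have "\<dots> = M (unit_vec k) * xp k" unfolding M_xp by (rule add.commute)
  finally have "S'.xp k * xp k = M (unit_vec k) * xp k" .
  then show ?thesis using xp_nz by simp
qed

lemma rng_k_mutate: "rng {k} {k} \<subseteq> S'.rng {k} {k}" and
  M_rng': "0 \<le> c $ k \<Longrightarrow> (\<And>i. i \<in> J \<Longrightarrow> i \<noteq> k \<Longrightarrow> 0 \<le> c $ i) \<Longrightarrow> S'.xp k \<in> S'.rng J P \<Longrightarrow> M c \<in> S'.rng J P"
proof -
  show *: "M c \<in> S'.rng J P"
    if "0 \<le> c $ k" "\<And>i. i \<in> J \<Longrightarrow> i \<noteq> k \<Longrightarrow> 0 \<le> c $ i" "S'.xp k \<in> S'.rng J P" for c J P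
  proof -
    have "M c = v powi (- L (c - axis k (c $ k)) (axis k (c $ k))) * (M' (c - axis k (c $ k)) * S'.xp k ^ nat (c $ k))"
      using M_plus[of "c - axis k (c $ k)" "axis k (c $ k)"] M'_fix[of "c - axis k (c $ k)"]
        M_axis_nat[of k "nat (c $ k)"] that(1) by (simp add: xp'_k)
    also have "\<dots> \<in> S'.rng J P"
      by (intro S'.rng_mult S'.rng_v S'.rng_power that S'.rng_M) (use that in \<open>auto simp: axis_def\<close>)
    finally show ?thesis .
  qed
  show "rng {k} {k} \<subseteq> S'.rng {k} {k}"
    unfolding rng_def[of "{k}"] S'.rng_def[of "{k}"]
  proof (intro subring_gen_subset Un_least)
    have "M c \<in> S'.rng {k} {k}" if "0 \<le> c $ k" for c using that by (intro *) (auto intro: S'.rng_xp)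
    then show "M ` {c. \<forall>i\<in>{k}. 0 \<le> c $ i} \<subseteq> subring_gen (K \<union> M' ` {c. \<forall>i\<in>{k}. 0 \<le> c $ i} \<union> S'.xp ` {k})"
      by (auto simp: S'.rng_def)
    have "xp k \<in> S'.rng {k} {k}" unfolding M'_k[symmetric] by (rule S'.rng_M) auto
    then show "xp ` {k} \<subseteq> subring_gen (K \<union> M' ` {c. \<forall>i\<in>{k}. 0 \<le> c $ i} \<union> S'.xp ` {k})"
      by (auto simp: S'.rng_def)
  qed (auto intro: subring_gen.gen)
qed

text \<open>The kth variable is a sum of two monomials of the new frame. In the expansion of its
  power, every term but the pure power of \<open>M' g\<close> contains \<open>M' g'\<close>, whose
  lth exponent is positive and cancels the single pole in the lth variable.\<close>

lemma M_lowest_term: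
  assumes g: "S'.xp k = M' g + M' g'" "g $ l = 0" "\<And>x. x $ k = 0 \<Longrightarrow> L' x g = L x (unit_vec k)"
    and d: "d $ k = 0" "d $ l = - 1" "l \<noteq> k" and n: "n = 0 \<or> 1 \<le> g' $ l"
  shows "M (d + axis k (int n)) - M' (d + int n *s g) \<in> S'.TT {c. \<forall>i\<in>{l}. 0 \<le> c $ i}"
  using n
proof (induction n)
  case 0
  then show ?case using d by (simp add: axis_0 M'_fix S'.TT_zero)
next
  case (Suc n)
  let ?T = "S'.TT {c. \<forall>i\<in>{l}. 0 \<le> c $ i}"
  let ?d = "d + axis k (int n)" and ?p = "d + int n *s g"
  define t where "t = M ?d - M' ?p"
  have t: "t \<in> ?T" using Suc by (auto simp: t_def)
  have gl: "1 \<le> g' $ l" using Suc by simp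
  have Lax: "L (axis k (int n)) (unit_vec k) = 0"
  proof -
    have "axis k (int n) = int n *s unit_vec k" by (auto simp: vec_eq_iff axis_def)
    then show ?thesis by (simp add: L_scale)
  qed
  have LL: "L' ?p g = L ?d (unit_vec k)"
    using g(3)[OF d(1)] by (simp add: S'.L_simps S'.L_scale L_simps Lax)
  have "d + axis k (int (Suc n)) = ?d + unit_vec k" unfolding axis_Suc by (simp add: add.assoc)
  then have "M (d + axis k (int (Suc n))) = v powi (- L ?d (unit_vec k)) * (M ?d * S'.xp k)"
    by (simp only: M_plus[of ?d "unit_vec k"] xp'_k)
  also have "M ?d * S'.xp k = M' ?p * M' g + M' ?p * M' g' + t * S'.xp k"
    unfolding g(1) by (simp add: t_def distrib_left left_diff_distrib)
  also have "M' ?p * M' g = v powi (L ?d (unit_vec k)) * M' (?p + g)" by (simp add: M'_mult LL)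
  finally have "M (d + axis k (int (Suc n))) - M' (?p + g)
     = v powi (- L ?d (unit_vec k)) * (M' ?p * M' g' + t * S'.xp k)"
    by (simp add: distrib_left v_add')
  moreover have "?p + g = d + int (Suc n) *s g" by (simp add: vector_sadd_rdistrib)
  moreover have "M' ?p * M' g' + t * S'.xp k \<in> ?T"
  proof (rule S'.TT_add)
    show "M' ?p * M' g' \<in> ?T"
      by (rule S'.TT_mult[OF S'.TT_M[of _ "{?p}"] S'.TT_M[of _ "{g'}"]]) (use gl g d in auto)
    have "S'.xp k \<in> ?T" unfolding g(1) using gl g by (intro S'.TT_add S'.TT_M) auto
    then show "t * S'.xp k \<in> ?T" by (rule S'.TT_mult[OF t]) auto
  qed
  ultimately show ?case by (metis S'.TT_K vK)
qed

text \<open>By the sign of \<open>b l $ k\<close>, at most one of the two terms of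
  \<open>xp l\<close> contains the kth variable. Its lowest term in the new frame and the other term
  together form a monomial times the new mutated variable at \<open>l\<close>; the rest is regular
  in the lth variable by \<open>M_lowest_term\<close>.\<close>

lemma xp_other_mutate:
  assumes "l \<noteq> k"
  shows "xp l \<in> S'.rng {l} {l}"
proof -
  let ?R = "S'.rng {l} {l}"
  have bkl: "b k $ l = - (b l $ k)" by (rule b_skew)
  have TR: "z \<in> S'.TT {c. \<forall>i\<in>{l}. 0 \<le> c $ i} \<Longrightarrow> z \<in> ?R" for z by (rule S'.TT_rng)
  show ?thesis
  proof (cases "0 \<le> b l $ k")
    case True
    define n where "n = nat (b l $ k)"
    have n: "int n = b l $ k" using True by (simp add: n_def)
    define d where "d = hi l - axis k (int n)"
    have 1: "M (d + axis k (int n)) - M' (d + int n *s S'.lo k) \<in> S'.TT {c. \<forall>i\<in>{l}. 0 \<le> c $ i}"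
    proof (rule M_lowest_term)
      show "S'.xp k = M' (S'.lo k) + M' (S'.hi k)" by (simp add: S'.xp_def)
      show "S'.lo k $ l = 0" using assms True bkl by (simp add: S'.lo_nth b'_eq)
      show "L' x (S'.lo k) = L x (unit_vec k)" if "x $ k = 0" for x
        using that by (simp add: L'_E E_lo' E_fix L_simps)
      show "d $ k = 0" "d $ l = - 1" using assms True n by (auto simp: d_def hi_nth axis_def)
      show "n = 0 \<or> 1 \<le> S'.hi k $ l" using assms n bkl by (auto simp: S'.hi_nth b'_eq)
    qed (rule assms)
    have e: "d + int n *s S'.lo k = lo l + b' l"
    proof -
      have "(d + int n *s S'.lo k) $ i = (lo l + b' l) $ i" for i
        using assms True n bkl b_skew[of l i] b_skew[of k l]
        by (cases "b k $ i" "0 :: int" rule: linorder_cases; cases "b l $ k = 0")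
          (auto simp: d_def hi_nth lo_nth S'.lo_nth axis_def b'_eq max_def zero_less_mult_iff mult_le_0_iff
            zero_le_mult_iff mult_less_0_iff algebra_simps)
      then show ?thesis by (simp add: vec_eq_iff)
    qed
    have lo: "M (lo l) = M' (lo l)" by (rule M'_fix[symmetric]) (use assms True in \<open>auto simp: lo_nth\<close>)
    \<comment> \<open>\<open>w\<close> has lth coordinate 0, so \<open>M' w\<close> lies in the
      local algebra and the remaining two terms are a multiple of \<open>S'.xp l\<close>.\<close>
    define w where "w = lo l - S'.lo l"
    have wl: "w $ l = 0" by (simp add: w_def lo_nth S'.lo_nth)
    have "M' w * S'.xp l = v powi L' w (S'.lo l) * (M' (lo l + b' l) + M' (lo l))"
      using wl by (simp add: S'.M_xp S'.hi_lo S'.L_simps distrib_left) (simp add: w_def add.assoc[symmetric])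
    then have "M' (lo l + b' l) + M' (lo l) = v powi (- L' w (S'.lo l)) * (M' w * S'.xp l)" by (simp add: v_add')
    also have "\<dots> \<in> ?R" using wl by (intro S'.rng_mult S'.rng_v S'.rng_M S'.rng_xp) auto
    finally have "M' (lo l + b' l) + M' (lo l) \<in> ?R" .
    from S'.rng_add[OF this TR[OF 1]]
    have "M' (lo l + b' l) + M' (lo l) + (M (d + axis k (int n)) - M' (d + int n *s S'.lo k)) \<in> ?R" .
    moreover have "d + axis k (int n) = hi l" by (simp add: d_def)
    ultimately show ?thesis unfolding xp_def e lo by (simp add: algebra_simps)
  next
    case False
    define n where "n = nat (- b l $ k)"
    have n: "int n = - b l $ k" using False by (simp add: n_def)
    define d where "d = lo l - axis k (int n)"
    have 1: "M (d + axis k (int n)) - M' (d + int n *s S'.hi k) \<in> S'.TT {c. \<forall>i\<in>{l}. 0 \<le> c $ i}"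
    proof (rule M_lowest_term)
      show "S'.xp k = M' (S'.hi k) + M' (S'.lo k)" by (simp add: S'.xp_def)
      show "S'.hi k $ l = 0" using assms False bkl by (simp add: S'.hi_nth b'_eq)
      show "L' x (S'.hi k) = L x (unit_vec k)" if "x $ k = 0" for x
        using that by (simp add: L'_E E_hi' E_fix L_simps)
      show "d $ k = 0" "d $ l = - 1" using assms False n by (auto simp: d_def lo_nth axis_def)
      show "n = 0 \<or> 1 \<le> S'.lo k $ l" using assms n bkl by (auto simp: S'.lo_nth b'_eq)
    qed (rule assms)
    have e: "d + int n *s S'.hi k = hi l - b' l"
    proof -
      have "(d + int n *s S'.hi k) $ i = (hi l - b' l) $ i" for i
        using assms False n bkl b_skew[of l i] b_skew[of k l]
        by (cases "b k $ i" "0 :: int" rule: linorder_cases)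
          (auto simp: d_def hi_nth lo_nth S'.hi_nth axis_def b'_eq max_def zero_less_mult_iff mult_le_0_iff
            zero_le_mult_iff mult_less_0_iff algebra_simps)
      then show ?thesis by (simp add: vec_eq_iff)
    qed
    have hi: "M (hi l) = M' (hi l)" by (rule M'_fix[symmetric]) (use assms False in \<open>auto simp: hi_nth\<close>)
    define w where "w = hi l - S'.hi l"
    have wl: "w $ l = 0" by (simp add: w_def hi_nth S'.hi_nth)
    have lo': "S'.lo l = S'.hi l - b' l" by (simp add: S'.hi_lo)
    have "M' w * S'.xp l = v powi L' w (S'.hi l) * (M' (hi l) + M' (hi l - b' l))"
      using wl by (simp add: S'.M_xp lo' S'.L_simps distrib_left) (simp add: w_def)
    then have "M' (hi l) + M' (hi l - b' l) = v powi (- L' w (S'.hi l)) * (M' w * S'.xp l)" by (simp add: v_add')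
    also have "\<dots> \<in> ?R" using wl by (intro S'.rng_mult S'.rng_v S'.rng_M S'.rng_xp) auto
    finally have "M' (hi l) + M' (hi l - b' l) \<in> ?R" .
    from S'.rng_add[OF this TR[OF 1]]
    have "M' (hi l) + M' (hi l - b' l) + (M (d + axis k (int n)) - M' (d + int n *s S'.hi k)) \<in> ?R" .
    moreover have "d + axis k (int n) = lo l" by (simp add: d_def)
    ultimately show ?thesis unfolding xp_def e hi by (simp add: algebra_simps)
  qed
qed

text \<open>For \<open>l \<noteq> k\<close>, membership in the kth and lth old local algebras
  already gives \<open>rng {k, l} {k, l}\<close>, and each generator of that ring can be rewritten
  in the lth local algebra of the new seed.\<close>

lemma upper_bound_mutate:
  assumes "\<And>j. z \<in> rng {j} {j}"
  shows "z \<in> S'.rng {l} {l}"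
proof (cases "l = k")
  case True
  then show ?thesis using assms rng_k_mutate by blast
next
  case False
  have zT: "z \<in> T" using assms rng_T by blast
  \<comment> \<open>Two vertices can always be ordered according to the sign of
    \<open>b k $ l\<close>; longer lists may fail at a seed with oriented cycles.\<close>
  have "z \<in> rng {k, l} {k, l}"
  proof (cases "b k $ l \<le> 0")
    case True
    then show ?thesis using upper_bound_subset_lower_bound[of "[k, l]" z] zT assms False by simp
  next
    case F: False
    then have "b l $ k \<le> 0" using b_skew[of k l] by simp
    then show ?thesis using upper_bound_subset_lower_bound[of "[l, k]" z] zT assms False by (simp add: insert_commute)
  qed
  also have "rng {k, l} {k, l} \<subseteq> S'.rng {l} {l}"
    unfolding rng_def[of "{k, l}"] S'.rng_def[of "{l}"]
  proof (intro subring_gen_subset Un_least)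
    have xk: "S'.xp k \<in> S'.rng {l} {l}" unfolding S'.xp_def
      using False by (intro S'.rng_add S'.rng_M) (auto simp: S'.hi_nth S'.lo_nth)
    have "M c \<in> S'.rng {l} {l}" if "0 \<le> c $ k" "0 \<le> c $ l" for c using that xk by (intro M_rng') auto
    then show "M ` {c. \<forall>i\<in>{k, l}. 0 \<le> c $ i} \<subseteq> subring_gen (K \<union> M' ` {c. \<forall>i\<in>{l}. 0 \<le> c $ i} \<union> S'.xp ` {l})"
      by (auto simp: S'.rng_def)
    have "xp k \<in> S'.rng {l} {l}" unfolding M'_k[symmetric] using False by (intro S'.rng_M) (auto simp: axis_def)
    moreover have "xp l \<in> S'.rng {l} {l}" by (rule xp_other_mutate[OF False])
    ultimately show "xp ` {k, l} \<subseteq> subring_gen (K \<union> M' ` {c. \<forall>i\<in>{l}. 0 \<le> c $ i} \<union> S'.xp ` {l})"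
      by (auto simp: S'.rng_def)
  qed (auto intro: subring_gen.gen)
  finally show ?thesis .
qed

text \<open>Gives the reverse inclusion of upper bounds, which carries cluster variables back to the
  initial seed.\<close>

lemma mutation_sym: "frame_mutation K v L' b' M' k L b M"
proof (unfold_locales)
  show "L c d = L' (c + (c $ k) *s (S'.lo k - unit_vec k)) (d + (d $ k) *s (S'.lo k - unit_vec k))" for c d
  proof -
    have "E (c + (c $ k) *s (S'.lo k - unit_vec k)) = c + (c $ k) *s b k" for c
      by (auto simp: E_def vec_eq_iff S'.lo_nth lo_nth axis_def b'_eq max_def algebra_simps)
    then show ?thesis by (simp add: L'_E L_simps L_scale L_scale2)
  qed
  show "M (unit_vec i) = M' (unit_vec i)" if "i \<noteq> k" for i using M'_axis[OF that] by simp
  show "M (unit_vec k) = S'.xp k" by (simp add: xp'_k)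
  show "b j $ i = (if i = k \<or> j = k then - b' j $ i
                  else b' j $ i + sgn (b' k $ i) * max (b' k $ i * b' j $ k) 0)" for i j
    by (auto simp: b'_eq)
qed (fact M_mult M_0)+

end

section \<open>Finite vector spaces\<close>


text \<open>The counting form of the isomorphism theorem, from which the dimension formulas follow
  over a finite field. \<open>D\<close> merely has to separate the cosets of \<open>K\<close>, so
  quotient spaces are never constructed.\<close>

lemma card_quotient:
  fixes X K :: "'g::ab_group_add set"
  assumes "finite X" "K \<subseteq> X" "\<And>x y. x \<in> X \<Longrightarrow> y \<in> X \<Longrightarrow> x + y \<in> X"
    and D: "\<And>x y. x \<in> X \<Longrightarrow> y \<in> X \<Longrightarrow> D x = D y \<longleftrightarrow> x - y \<in> K"
  shows "card X = card (D ` X) * card K"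
proof -
  have fib: "card {x \<in> X. D x = d} = card K" if "d \<in> D ` X" for d
  proof -
    from that obtain x0 where x0: "x0 \<in> X" "d = D x0" by blast
    have "{x \<in> X. D x = d} = (\<lambda>k. x0 + k) ` K"
    proof (intro equalityI subsetI)
      fix x assume "x \<in> {x \<in> X. D x = d}"
      then have "x - x0 \<in> K" using D x0 by auto
      then show "x \<in> (\<lambda>k. x0 + k) ` K" by (intro image_eqI[of _ _ "x - x0"]) auto
    next
      fix x assume "x \<in> (\<lambda>k. x0 + k) ` K"
      then obtain k where k: "k \<in> K" "x = x0 + k" by blast
      then have "x \<in> X" using assms x0 by auto
      then show "x \<in> {x \<in> X. D x = d}" using D[of x x0] x0 k by simp
    qed
    then show ?thesis by (simp add: card_image)
  qed
  have "X = (\<Union>d\<in>D ` X. {x \<in> X. D x = d})" by auto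
  then have "card X = card (\<Union>d\<in>D ` X. {x \<in> X. D x = d})" by simp
  also have "\<dots> = (\<Sum>d\<in>D ` X. card {x \<in> X. D x = d})"
    by (rule card_UN_disjoint) (use assms(1) in auto)
  also have "\<dots> = (\<Sum>d\<in>D ` X. card K)" by (rule sum.cong) (use fib in auto)
  finally show ?thesis by simp
qed

context vector_space
begin

lemma card_span:
  assumes "finite (UNIV :: 'a set)" "finite B"
  shows "finite (span B) \<and> (independent B \<longrightarrow> card (span B) = card (UNIV :: 'a set) ^ card B)"
  using assms(2)
proof induction
  case (insert b B)
  have img: "span (insert b B) = (\<lambda>(k, x). scale k b + x) ` (UNIV \<times> span B)" (is "_ = ?f ` _")
  proof (intro equalityI subsetI)
    fix x assume "x \<in> span (insert b B)"
    then obtain k where "x - scale k b \<in> span B" by (auto simp: span_insert)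
    then show "x \<in> ?f ` (UNIV \<times> span B)" by (intro image_eqI[of _ _ "(k, x - scale k b)"]) auto
  next
    fix x assume "x \<in> ?f ` (UNIV \<times> span B)"
    then obtain k y where "y \<in> span B" "x = scale k b + y" by auto
    then show "x \<in> span (insert b B)" by (auto simp: span_insert intro!: exI[of _ k])
  qed
  have "card (span (insert b B)) = card (UNIV :: 'a set) ^ card (insert b B)" if ind: "independent (insert b B)"
  proof -
    have nb: "b \<notin> span B" "independent B" using ind insert by (auto simp: independent_insert)
    have "inj_on ?f (UNIV \<times> span B)"
    proof (rule inj_onI, clarsimp)
      fix k x k' x' assume *: "x \<in> span B" "x' \<in> span B" "scale k b + x = scale k' b + x'"
      then have e: "scale (k - k') b = x' - x" by (simp add: scale_left_diff_distrib algebra_simps)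
      have "k = k'"
      proof (rule ccontr)
        assume "k \<noteq> k'"
        then have "b = scale (inverse (k - k')) (x' - x)" by (simp flip: e)
        then show False using nb * by (metis span_diff span_scale)
      qed
      then show "k = k' \<and> x = x'" using * by simp
    qed
    then have "card (span (insert b B)) = card (UNIV \<times> span B :: ('a \<times> 'b) set)"
      unfolding img by (rule card_image)
    then show ?thesis using insert nb by (simp add: card_cartesian_product)
  qed
  then show ?case unfolding img using insert assms(1) by auto
qed (auto)

lemma card_subspace:
  assumes "finite (UNIV :: 'a set)" "subspace V" "finite V"
  shows "card V = card (UNIV :: 'a set) ^ dim V"
proof -
  obtain B where B: "B \<subseteq> V" "independent B" "V \<subseteq> span B" "card B = dim V" using basis_exists by blast
  then have "span B = V" using assms by (meson span_minimal subset_antisym)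
  moreover have "finite B" using B assms finite_subset by blast
  ultimately show ?thesis using card_span[OF assms(1), of B] B by simp
qed

end

global_interpretation kvp: vector_space_pair "kscale :: 'k::field \<Rightarrow> 'k kvec \<Rightarrow> 'k kvec"
  "kscale :: 'k::field \<Rightarrow> 'k kvec \<Rightarrow> 'k kvec"
  by unfold_locales

section \<open>Finite subspaces and linear maps between them\<close>

definition fsub :: "'k::field kvec set \<Rightarrow> bool" where "fsub V \<longleftrightarrow> kvec.subspace V \<and> finite V"

text \<open>Vanishing outside \<open>V\<close>, as in \<open>Hom\<close>, makes equality of
  functions the same as equality of linear maps.\<close>

definition Lin :: "'k::field kvec set \<Rightarrow> 'k kvec set \<Rightarrow> ('k kvec \<Rightarrow> 'k kvec) set" where
  "Lin V W = {f. linear_between V W f \<and> (\<forall>x. x \<notin> V \<longrightarrow> f x = 0)}"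

lemma fsub_zero: "fsub V \<Longrightarrow> 0 \<in> V" and fsub_add: "fsub V \<Longrightarrow> x \<in> V \<Longrightarrow> y \<in> V \<Longrightarrow> x + y \<in> V"
  and fsub_scale: "fsub V \<Longrightarrow> x \<in> V \<Longrightarrow> kscale c x \<in> V" and fsub_diff: "fsub V \<Longrightarrow> x \<in> V \<Longrightarrow> y \<in> V \<Longrightarrow> x - y \<in> V"
  and fsub_uminus: "fsub V \<Longrightarrow> x \<in> V \<Longrightarrow> - x \<in> V"
  and fsub_finite: "fsub V \<Longrightarrow> finite V" and fsub_subspace: "fsub V \<Longrightarrow> kvec.subspace V"
  by (auto simp: fsub_def kvec.subspace_0 kvec.subspace_add kvec.subspace_scale kvec.subspace_diff kvec.subspace_neg)

lemma fsubI:
  assumes "finite V" "0 \<in> V" "\<And>x y. x \<in> V \<Longrightarrow> y \<in> V \<Longrightarrow> x + y \<in> V" "\<And>c x. x \<in> V \<Longrightarrow> kscale c x \<in> V"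
  shows "fsub V"
  using assms by (auto simp: fsub_def kvec.subspace_def)

lemma fsub_subset: "kvec.subspace U \<Longrightarrow> U \<subseteq> V \<Longrightarrow> fsub V \<Longrightarrow> fsub U"
  by (auto simp: fsub_def intro: finite_subset)

lemma fsub_card: "fsub (V :: 'k::{field,finite} kvec set) \<Longrightarrow> card V = CARD('k) ^ kvec.dim V"
  by (simp add: fsub_def kvec.card_subspace)

lemma fsub_span: "finite S \<Longrightarrow> fsub (kvec.span (S :: 'k::{field,finite} kvec set))"
  by (simp add: fsub_def kvec.card_span)

lemma fsub_basis:
  assumes "fsub V"
  obtains B where "B \<subseteq> V" "finite B" "kvec.independent B" "kvec.span B = V" "card B = kvec.dim V"
proof -
  obtain B where B: "B \<subseteq> V" "kvec.independent B" "V \<subseteq> kvec.span B" "card B = kvec.dim V"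
    using kvec.basis_exists by blast
  moreover have "kvec.span B = V" using B assms by (meson fsub_subspace kvec.span_minimal subset_antisym)
  moreover have "finite B" using B assms finite_subset fsub_finite by blast
  ultimately show ?thesis using that by blast
qed

lemma card_UNIV_field_gt1: "1 < CARD('k::{field,finite})"
  using card_mono[of "UNIV :: 'k set" "{0, 1}"] by simp

lemma power_CARD_cancel: "CARD('k::{field,finite}) ^ m = CARD('k) ^ n \<longleftrightarrow> m = n"
  using card_UNIV_field_gt1 by (intro power_inject_exp) auto

lemma lb_in: "linear_between V W f \<Longrightarrow> x \<in> V \<Longrightarrow> f x \<in> W"
  and lb_add: "linear_between V W f \<Longrightarrow> x \<in> V \<Longrightarrow> y \<in> V \<Longrightarrow> f (x + y) = f x + f y"
  and lb_scale: "linear_between V W f \<Longrightarrow> x \<in> V \<Longrightarrow> f (kscale c x) = kscale c (f x)"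
  by (auto simp: linear_between_def)

lemma linear_betweenI:
  "(\<And>x. x \<in> V \<Longrightarrow> f x \<in> W) \<Longrightarrow> (\<And>x y. x \<in> V \<Longrightarrow> y \<in> V \<Longrightarrow> f (x + y) = f x + f y) \<Longrightarrow>
   (\<And>c x. x \<in> V \<Longrightarrow> f (kscale c x) = kscale c (f x)) \<Longrightarrow> linear_between V W f"
  by (auto simp: linear_between_def)

lemma lb_zero: "linear_between V W f \<Longrightarrow> fsub V \<Longrightarrow> f 0 = 0"
  using lb_add[of V W f 0 0] fsub_zero by fastforce

lemma lb_uminus: "linear_between V W f \<Longrightarrow> fsub V \<Longrightarrow> x \<in> V \<Longrightarrow> f (- x) = - f x"
  using lb_add[of V W f x "- x"] fsub_uminus[of V x] lb_zero[of V W f] by (simp add: eq_neg_iff_add_eq_0 add.commute)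

lemma lb_diff: "linear_between V W f \<Longrightarrow> fsub V \<Longrightarrow> x \<in> V \<Longrightarrow> y \<in> V \<Longrightarrow> f (x - y) = f x - f y"
  using lb_add[of V W f x "- y"] fsub_uminus[of V y] lb_uminus[of V W f y] by simp

lemma fsub_image:
  assumes "linear_between V W f" "fsub V"
  shows "fsub (f ` V)"
proof (rule fsubI)
  show "finite (f ` V)" using assms by (simp add: fsub_finite)
  show "0 \<in> f ` V" using lb_zero[OF assms] fsub_zero[OF assms(2)] by (metis imageI)
  fix x y assume "x \<in> f ` V" "y \<in> f ` V"
  then obtain x' y' where *: "x' \<in> V" "y' \<in> V" "x = f x'" "y = f y'" by blast
  show "x + y \<in> f ` V"
    unfolding * lb_add[OF assms(1) *(1,2), symmetric] by (intro imageI fsub_add assms *)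
next
  fix c x assume "x \<in> f ` V"
  then obtain x' where *: "x' \<in> V" "x = f x'" by blast
  show "kscale c x \<in> f ` V"
    unfolding * lb_scale[OF assms(1) *(1), symmetric] by (intro imageI fsub_scale assms *)
qed

lemma card_lb:
  assumes "linear_between V W f" "fsub V"
  shows "card V = card (f ` V) * card {x \<in> V. f x = 0}"
proof (rule card_quotient)
  show "f x = f y \<longleftrightarrow> x - y \<in> {x \<in> V. f x = 0}" if "x \<in> V" "y \<in> V" for x y
    using lb_diff[OF assms that] fsub_diff[OF assms(2) that] by simp
qed (use assms in \<open>auto simp: fsub_finite fsub_add\<close>)

lemma lb_eq_on_span:
  assumes "linear_between V W f" "linear_between V W' g" "kvec.span B = V" "fsub V"
    and "\<And>x. x \<in> B \<Longrightarrow> f x = g x" "x \<in> V"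
  shows "f x = g x"
proof -
  have "x \<in> kvec.span B" using assms by simp
  then have "x \<in> V \<and> f x = g x"
  proof (induction rule: kvec.span_induct_alt)
    case base
    then show ?case using assms lb_zero fsub_zero by metis
  next
    case (step c x y)
    have "x \<in> V" using step assms kvec.span_base by blast
    then have c: "kscale c x \<in> V" "y \<in> V" using step fsub_scale[OF assms(4)] by auto
    have "f (kscale c x + y) = g (kscale c x + y)"
      unfolding lb_add[OF assms(1) c] lb_add[OF assms(2) c] lb_scale[OF assms(1) \<open>x \<in> V\<close>] lb_scale[OF assms(2) \<open>x \<in> V\<close>]
      using step assms(5) by presburger
    then show ?case using fsub_add[OF assms(4) c] by blast
  qed
  then show ?thesis by simp
qed

lemma lb_construct:
  assumes "kvec.independent B" "g ` B \<subseteq> W" "kvec.subspace W"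
  shows "linear_between V W (kvp.construct B g)"
proof -
  interpret c: Vector_Spaces.linear kscale kscale "kvp.construct B g" by (rule kvp.linear_construct) fact
  have "kvp.construct B g x \<in> W" for x
    using kvp.construct_in_span[OF assms(1), of g x] assms kvec.span_minimal by blast
  then show ?thesis by (intro linear_betweenI) (auto simp: c.add c.scale)
qed

text \<open>The map that \<open>g\<close> induces on the image of \<open>f\<close> is prescribed on
  a basis of that image and extended to the entire ambient space, still with values in
  \<open>W\<close>.\<close>

lemma linear_extend:
  assumes "fsub A" "fsub W" "linear_between A V f" "inj_on f A" "linear_between A W g"
  obtains h where "linear_between UNIV W h" "\<And>x. x \<in> A \<Longrightarrow> h (f x) = g x"
proof -
  obtain B where B: "B \<subseteq> f ` A" "finite B" "kvec.independent B" "kvec.span B = f ` A"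
    by (rule fsub_basis[OF fsub_image[OF assms(3,1)]])
  define g' where "g' y = g (inv_into A f y)" for y
  have g': "g' (f x) = g x" if "x \<in> A" for x using that assms(4) by (simp add: g'_def)
  have lg': "linear_between (f ` A) W g'"
  proof (rule linear_betweenI)
    fix y assume "y \<in> f ` A"
    then show "g' y \<in> W" using g' assms lb_in by fastforce
  next
    fix x y assume "x \<in> f ` A" "y \<in> f ` A"
    then obtain x' y' where *: "x' \<in> A" "y' \<in> A" "x = f x'" "y = f y'" by blast
    have "g' (f (x' + y')) = g' (f x') + g' (f y')"
      using * assms by (simp only: g' fsub_add lb_add[OF assms(5)])
    then show "g' (x + y) = g' x + g' y" using * lb_add[OF assms(3)] by simp
  next
    fix c x assume "x \<in> f ` A"
    then obtain x' where *: "x' \<in> A" "x = f x'" by blast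
    have "g' (f (kscale c x')) = kscale c (g' (f x'))"
      using * assms by (simp only: g' fsub_scale lb_scale[OF assms(5)])
    then show "g' (kscale c x) = kscale c (g' x)" using * lb_scale[OF assms(3)] by simp
  qed
  have gB: "g' ` B \<subseteq> W" using B(1) lb_in[OF lg'] by blast
  let ?h = "kvp.construct B g'"
  have 1: "linear_between V' W ?h" for V' by (rule lb_construct[OF B(3) gB fsub_subspace[OF assms(2)]])
  have "?h (f x) = g x" if "x \<in> A" for x
  proof -
    have "?h (f x) = g' (f x)"
      by (rule lb_eq_on_span[OF 1 lg' B(4)])
        (use that B assms fsub_image kvp.construct_basis[OF B(3)] in auto)
    then show ?thesis using g' that by simp
  qed
  then show ?thesis using that 1 by blast
qed

lemma card_Lin:
  assumes V: "fsub (V :: 'k::{field,finite} kvec set)" and W: "fsub (W :: 'k kvec set)"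
  shows "finite (Lin V W) \<and> card (Lin V W) = CARD('k) ^ (kvec.dim V * kvec.dim W)"
proof -
  obtain B where B: "B \<subseteq> V" "finite B" "kvec.independent B" "kvec.span B = V" "card B = kvec.dim V"
    by (rule fsub_basis[OF V])
  have "bij_betw (\<lambda>f. restrict f B) (Lin V W) (PiE B (\<lambda>_. W))"
  proof (rule bij_betw_imageI)
    show "inj_on (\<lambda>f. restrict f B) (Lin V W)"
    proof (rule inj_onI, rule ext)
      fix f g x assume *: "f \<in> Lin V W" "g \<in> Lin V W" "restrict f B = restrict g B"
      have e: "f y = g y" if "y \<in> B" for y using *(3) that by (metis restrict_apply')
      show "f x = g x"
      proof (cases "x \<in> V")
        case True
        show ?thesis by (rule lb_eq_on_span[OF _ _ B(4) V e True]) (use * in \<open>auto simp: Lin_def\<close>)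
      next
        case False
        then show ?thesis using * by (simp add: Lin_def)
      qed
    qed
    show "(\<lambda>f. restrict f B) ` Lin V W = PiE B (\<lambda>_. W)"
    proof (intro equalityI subsetI)
      fix h assume "h \<in> (\<lambda>f. restrict f B) ` Lin V W"
      then show "h \<in> PiE B (\<lambda>_. W)" using B(1) by (auto simp: Lin_def dest: lb_in)
    next
      fix h assume h: "h \<in> PiE B (\<lambda>_. W)"
      define f where "f x = (if x \<in> V then kvp.construct B h x else 0)" for x
      have "linear_between V W (kvp.construct B h)"
        by (rule lb_construct) (use h B W fsub_subspace in auto)
      then have "f \<in> Lin V W" unfolding Lin_def
        by (auto simp: f_def linear_between_def V fsub_add fsub_scale)
      moreover have "restrict f B = h"
        using h B kvp.construct_basis[OF B(3)] by (auto simp: fun_eq_iff f_def PiE_def extensional_def restrict_def)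
      ultimately show "h \<in> (\<lambda>f. restrict f B) ` Lin V W" by blast
    qed
  qed
  moreover have "finite (PiE B (\<lambda>_. W))" "card (PiE B (\<lambda>_. W)) = CARD('k) ^ (kvec.dim V * kvec.dim W)"
    using B W by (auto simp: finite_PiE card_PiE fsub_finite fsub_card power_mult[symmetric] mult.commute)
  ultimately show ?thesis by (metis bij_betw_finite bij_betw_same_card)
qed

lemma Lin_zero: "fsub W \<Longrightarrow> (\<lambda>_. 0) \<in> Lin V W"
  by (auto simp: Lin_def linear_between_def fsub_zero kscale_def fun_eq_iff)

lemma Lin_add: "fsub W \<Longrightarrow> f \<in> Lin V W \<Longrightarrow> g \<in> Lin V W \<Longrightarrow> f + g \<in> Lin V W"
  by (auto simp: Lin_def linear_between_def fsub_add image_subset_iff kvec.scale_right_distrib algebra_simps)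

lemma Lin_diff: "fsub W \<Longrightarrow> f \<in> Lin V W \<Longrightarrow> g \<in> Lin V W \<Longrightarrow> f - g \<in> Lin V W"
  by (auto simp: Lin_def linear_between_def fsub_diff image_subset_iff kvec.scale_right_diff_distrib algebra_simps)

lemma Lin_lb: "f \<in> Lin V W \<Longrightarrow> linear_between V W f" by (simp add: Lin_def)

definition cut :: "'k::field kvec set \<Rightarrow> ('k kvec \<Rightarrow> 'k kvec) \<Rightarrow> 'k kvec \<Rightarrow> 'k kvec" where
  "cut V f = (\<lambda>x. if x \<in> V then f x else 0)"

lemma cut_in [simp]: "x \<in> V \<Longrightarrow> cut V f x = f x" and cut_out [simp]: "x \<notin> V \<Longrightarrow> cut V f x = 0"
  by (simp_all add: cut_def)

lemma cut_Lin: "fsub V \<Longrightarrow> linear_between V W f \<Longrightarrow> cut V f \<in> Lin V W"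
  by (auto simp: Lin_def linear_between_def fsub_add fsub_scale)

section \<open>The Euler form\<close>


text \<open>Ringel's combinatorial expression for the Euler form of the path algebra.\<close>

definition chi :: "('n::finite, 'a) pre_digraph \<Rightarrow> int^'n \<Rightarrow> int^'n \<Rightarrow> int" where
  "chi Q x y = (\<Sum>i\<in>UNIV. x $ i * y $ i) - (\<Sum>a\<in>arcs Q. x $ tail Q a * y $ head Q a)"

lemma chi_add_left: "chi Q (x + y) z = chi Q x z + chi Q y z"
  and chi_add_right: "chi Q x (y + z) = chi Q x y + chi Q x z"
  by (simp_all add: chi_def distrib_left distrib_right sum.distrib)

lemma is_rep_iff:
  fixes M :: "('n, 'a, 'k::{field,finite}) rep"
  shows "is_rep Q M \<longleftrightarrow> (\<forall>i. fsub (space_at M i)) \<and>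
     (\<forall>a\<in>arcs Q. linear_between (space_at M (tail Q a)) (space_at M (head Q a)) (map_at M a))"
proof -
  have "(\<exists>S. finite S \<and> V = kvec.span S) \<longleftrightarrow> fsub V" for V :: "'k kvec set"
    using fsub_span by (metis fsub_def kvec.span_eq_iff)
  then show ?thesis by (simp add: is_rep_def)
qed

lemma rep_fsub: "is_rep Q M \<Longrightarrow> fsub (space_at (M :: ('n, 'a, 'k::{field,finite}) rep) i)"
  and rep_map: "is_rep Q M \<Longrightarrow> a \<in> arcs Q \<Longrightarrow> linear_between (space_at M (tail Q a)) (space_at M (head Q a)) (map_at M a)"
  by (auto simp: is_rep_iff)

lemma rep_map_in: "is_rep Q M \<Longrightarrow> a \<in> arcs Q \<Longrightarrow> x \<in> space_at (M :: ('n, 'a, 'k::{field,finite}) rep) (tail Q a)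
    \<Longrightarrow> map_at M a x \<in> space_at M (head Q a)"
  using rep_map lb_in by fast

lemma Hom_iff: "f \<in> Hom Q M N \<longleftrightarrow> (\<forall>i. f i \<in> Lin (space_at M i) (space_at N i)) \<and>
    (\<forall>a\<in>arcs Q. \<forall>x\<in>space_at M (tail Q a). f (head Q a) (map_at M a x) = map_at N a (f (tail Q a) x))"
  by (auto simp: Hom_def Lin_def)

lemma Hom_lb: "f \<in> Hom Q M N \<Longrightarrow> linear_between (space_at M i) (space_at N i) (f i)"
  and Hom_out: "f \<in> Hom Q M N \<Longrightarrow> x \<notin> space_at M i \<Longrightarrow> f i x = 0"
  and Hom_in: "f \<in> Hom Q M N \<Longrightarrow> x \<in> space_at M i \<Longrightarrow> f i x \<in> space_at N i"
  and Hom_comm: "f \<in> Hom Q M N \<Longrightarrow> a \<in> arcs Q \<Longrightarrow> x \<in> space_at M (tail Q a) \<Longrightarrow>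
    f (head Q a) (map_at M a x) = map_at N a (f (tail Q a) x)"
  by (auto simp: Hom_def dest: lb_in)

lemma Lin_scale: "fsub W \<Longrightarrow> f \<in> Lin V W \<Longrightarrow> (\<lambda>x. kscale c (f x)) \<in> Lin V W"
  by (auto simp: Lin_def linear_between_def fsub_scale image_subset_iff kvec.scale_right_distrib mult.commute)

lemma Hom_subspace:
  fixes M N :: "('n, 'a, 'k::{field,finite}) rep"
  assumes "is_rep Q M" "is_rep Q N"
  shows "hom.subspace (Hom Q M N)"
proof (rule hom.subspaceI)
  show "0 \<in> Hom Q M N"
    using Lin_zero[OF rep_fsub[OF assms(2)]] lb_zero[OF rep_map[OF assms(2)] rep_fsub[OF assms(2)]]
    by (auto simp: Hom_iff zero_fun_def)
next
  fix f g assume f: "f \<in> Hom Q M N" and g: "g \<in> Hom Q M N"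
  have "(f + g) (head Q a) (map_at M a x) = map_at N a ((f + g) (tail Q a) x)"
    if "a \<in> arcs Q" "x \<in> space_at M (tail Q a)" for a x
    using Hom_comm[OF f that] Hom_comm[OF g that]
      lb_add[OF rep_map[OF assms(2) that(1)] Hom_in[OF f that(2)] Hom_in[OF g that(2)]] by simp
  then show "f + g \<in> Hom Q M N" using f g Lin_add[OF rep_fsub[OF assms(2)]] by (simp add: Hom_iff)
next
  fix c f assume f: "f \<in> Hom Q M N"
  have "hscale c f (head Q a) (map_at M a x) = map_at N a (hscale c f (tail Q a) x)"
    if "a \<in> arcs Q" "x \<in> space_at M (tail Q a)" for a x
    using Hom_comm[OF f that] lb_scale[OF rep_map[OF assms(2) that(1)] Hom_in[OF f that(2)]]
    by (simp add: hscale_def)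
  then show "hscale c f \<in> Hom Q M N" using f Lin_scale[OF rep_fsub[OF assms(2)]]
    by (simp add: Hom_iff) (simp add: hscale_def)
qed

lemma Lin_fam:
  fixes M N :: "('n::finite, 'a, 'k::{field,finite}) rep"
  assumes "is_rep Q M" "is_rep Q N"
  shows "finite {h. \<forall>i. h i \<in> Lin (space_at M i) (space_at N i)} \<and>
    card {h. \<forall>i. h i \<in> Lin (space_at M i) (space_at N i)}
      = CARD('k) ^ (\<Sum>i\<in>UNIV. kvec.dim (space_at M i) * kvec.dim (space_at N i))"
proof -
  have "{h. \<forall>i. h i \<in> Lin (space_at M i) (space_at N i)} = PiE UNIV (\<lambda>i. Lin (space_at M i) (space_at N i))"
    by (auto simp: PiE_def)
  then show ?thesis using card_Lin[OF rep_fsub[OF assms(1)] rep_fsub[OF assms(2)]]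
    by (simp add: finite_PiE card_PiE power_sum)
qed

lemma Hom_finite:
  fixes M N :: "('n::finite, 'a, 'k::{field,finite}) rep"
  assumes "is_rep Q M" "is_rep Q N"
  shows "finite (Hom Q M N)"
  by (rule finite_subset[OF _ conjunct1[OF Lin_fam[OF assms]]]) (auto simp: Hom_iff)

lemma card_Hom:
  fixes M N :: "('n::finite, 'a, 'k::{field,finite}) rep"
  assumes "is_rep Q M" "is_rep Q N"
  shows "card (Hom Q M N) = CARD('k) ^ hom.dim (Hom Q M N)"
  using hom.card_subspace[OF _ Hom_subspace[OF assms] Hom_finite[OF assms]] by simp

text \<open>\<open>unobstructed Q M N\<close> says that \<open>Ext\<^sup>1(M, N) = 0\<close>, read off from the two-term complex
  \<open>\<Oplus>\<^sub>i Hom(M\<^sub>i, N\<^sub>i) \<rightarrow> \<Oplus>\<^sub>a Hom(M\<^bsub>tail a\<^esub>, N\<^bsub>head a\<^esub>)\<close> whose kernel is \<open>Hom(M, N)\<close>.\<close>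

definition unobstructed ::
  "('n::finite, 'a) pre_digraph \<Rightarrow> ('n, 'a, 'k::{field,finite}) rep \<Rightarrow> ('n, 'a, 'k) rep \<Rightarrow> bool" where
  "unobstructed Q M N \<longleftrightarrow>
     (\<forall>\<eta>. (\<forall>a\<in>arcs Q. linear_between (space_at M (tail Q a)) (space_at N (head Q a)) (\<eta> a)) \<longrightarrow>
       (\<exists>h. (\<forall>i. h i \<in> Lin (space_at M i) (space_at N i)) \<and>
          (\<forall>a\<in>arcs Q. \<forall>x\<in>space_at M (tail Q a).
             map_at N a (h (tail Q a) x) - h (head Q a) (map_at M a x) = \<eta> a x)))"

lemma diff_eq_diff_iff: "p - q = r - t \<longleftrightarrow> q - t = p - (r :: 'g::ab_group_add)"
  by (auto simp: algebra_simps)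

text \<open>The differential of the two-term complex is onto by assumption, so counting its source,
  target and kernel gives the dimension of \<open>Hom\<close> as an Euler characteristic.\<close>

lemma hom_dim_unobstructed:
  fixes M N :: "('n::finite, 'a, 'k::{field,finite}) rep"
  assumes M: "is_rep Q M" and N: "is_rep Q N" and fin: "finite (arcs Q)" and un: "unobstructed Q M N"
  shows "int (hom.dim (Hom Q M N)) = chi Q (rep_dim M) (rep_dim N)"
proof -
  let ?X = "{h. \<forall>i. h i \<in> Lin (space_at M i) (space_at N i)}"
  let ?F = "\<lambda>a. Lin (space_at M (tail Q a)) (space_at N (head Q a))"
  define d where "d h a = cut (space_at M (tail Q a)) (\<lambda>x. map_at N a (h (tail Q a) x) - h (head Q a) (map_at M a x))"
    for h a
  define D where "D h = restrict (d h) (arcs Q)" for h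
  have Xl: "linear_between (space_at M i) (space_at N i) (h i)" if "h \<in> ?X" for h i
    using that by (auto simp: Lin_def)
  have dF: "d h a \<in> ?F a" if h: "h \<in> ?X" and a: "a \<in> arcs Q" for h a
    unfolding d_def
  proof (rule cut_Lin[OF rep_fsub[OF M]], rule linear_betweenI)
    fix x assume x: "x \<in> space_at M (tail Q a)"
    show "map_at N a (h (tail Q a) x) - h (head Q a) (map_at M a x) \<in> space_at N (head Q a)"
      by (intro fsub_diff rep_fsub[OF N] rep_map_in[OF N a] lb_in[OF Xl[OF h]] x rep_map_in[OF M a])
    show "map_at N a (h (tail Q a) (kscale c x)) - h (head Q a) (map_at M a (kscale c x))
        = kscale c (map_at N a (h (tail Q a) x) - h (head Q a) (map_at M a x))" for c
      by (simp only: lb_scale[OF rep_map[OF M a] x] lb_scale[OF Xl[OF h] x]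
        lb_scale[OF rep_map[OF N a] lb_in[OF Xl[OF h] x]] lb_scale[OF Xl[OF h] rep_map_in[OF M a x]] kvec.scale_right_diff_distrib)
    fix y assume y: "y \<in> space_at M (tail Q a)"
    show "map_at N a (h (tail Q a) (x + y)) - h (head Q a) (map_at M a (x + y))
        = map_at N a (h (tail Q a) x) - h (head Q a) (map_at M a x)
          + (map_at N a (h (tail Q a) y) - h (head Q a) (map_at M a y))"
      by (simp only: lb_add[OF rep_map[OF M a] x y] lb_add[OF Xl[OF h] x y]
        lb_add[OF rep_map[OF N a] lb_in[OF Xl[OF h] x] lb_in[OF Xl[OF h] y]]
        lb_add[OF Xl[OF h] rep_map_in[OF M a x] rep_map_in[OF M a y]] add_diff_add)
  qed
  have DX: "D ` ?X = PiE (arcs Q) ?F"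
  proof (intro equalityI subsetI)
    fix e assume "e \<in> D ` ?X"
    then show "e \<in> PiE (arcs Q) ?F" using dF by (auto simp: D_def)
  next
    fix e assume e: "e \<in> PiE (arcs Q) ?F"
    then have "\<forall>a\<in>arcs Q. linear_between (space_at M (tail Q a)) (space_at N (head Q a)) (e a)"
      by (auto simp: Lin_def PiE_def Pi_def)
    then obtain h where h: "h \<in> ?X" "\<And>a x. a \<in> arcs Q \<Longrightarrow> x \<in> space_at M (tail Q a) \<Longrightarrow>
        map_at N a (h (tail Q a) x) - h (head Q a) (map_at M a x) = e a x"
      using un unfolding unobstructed_def by blast
    have "D h = e"
    proof
      fix a
      show "D h a = e a"
      proof (cases "a \<in> arcs Q")
        case True
        have "d h a x = e a x" for x
          using h(2)[OF True] e True by (auto simp: d_def cut_def PiE_def Pi_def Lin_def)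
        then show ?thesis using True by (simp add: D_def fun_eq_iff)
      next
        case False
        then show ?thesis using e by (simp add: D_def PiE_def extensional_def)
      qed
    qed
    then show "e \<in> D ` ?X" using h(1) by blast
  qed
  have cX: "card ?X = card (D ` ?X) * card (Hom Q M N)"
  proof (rule card_quotient)
    show "finite ?X" using Lin_fam[OF M N] by simp
    show "Hom Q M N \<subseteq> ?X" by (auto simp: Hom_iff)
    show "f + g \<in> ?X" if "f \<in> ?X" "g \<in> ?X" for f g
      using that Lin_add[OF rep_fsub[OF N]] by simp
    show "D f = D g \<longleftrightarrow> f - g \<in> Hom Q M N" if f: "f \<in> ?X" and g: "g \<in> ?X" for f g
    proof -
      have e: "d f a x = d g a x \<longleftrightarrow> (f - g) (head Q a) (map_at M a x) = map_at N a ((f - g) (tail Q a) x)"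
        if a: "a \<in> arcs Q" "x \<in> space_at M (tail Q a)" for a x
      proof -
        have du: "d u a x = map_at N a (u (tail Q a) x) - u (head Q a) (map_at M a x)" for u
          unfolding d_def by (rule cut_in[OF a(2)])
        have fg: "(f - g) i y = f i y - g i y" for i y by simp
        show ?thesis
          unfolding du fg lb_diff[OF rep_map[OF N a(1)] rep_fsub[OF N] lb_in[OF Xl[OF f] a(2)] lb_in[OF Xl[OF g] a(2)]]
          by (rule diff_eq_diff_iff)
      qed
      have "D f = D g \<longleftrightarrow> (\<forall>a\<in>arcs Q. \<forall>x\<in>space_at M (tail Q a). d f a x = d g a x)"
      proof
        assume *: "D f = D g"
        have "d f a = d g a" if "a \<in> arcs Q" for a using fun_cong[OF *, of a] that by (simp add: D_def)
        then show "\<forall>a\<in>arcs Q. \<forall>x\<in>space_at M (tail Q a). d f a x = d g a x" by simp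
      next
        assume *: "\<forall>a\<in>arcs Q. \<forall>x\<in>space_at M (tail Q a). d f a x = d g a x"
        have "d f a = d g a" if a: "a \<in> arcs Q" for a
        proof
          fix x
          show "d f a x = d g a x"
          proof (cases "x \<in> space_at M (tail Q a)")
            case True
            then show ?thesis using * a by blast
          next
            case False
            then show ?thesis by (simp only: d_def cut_out not_False_eq_True)
          qed
        qed
        then show "D f = D g" unfolding D_def by (rule restrict_ext)
      qed
      also have "\<dots> \<longleftrightarrow> f - g \<in> Hom Q M N"
        using e f g Lin_diff[OF rep_fsub[OF N]] by (simp add: Hom_iff)
      finally show ?thesis .
    qed
  qed
  have cF: "card (PiE (arcs Q) ?F) = CARD('k) ^ (\<Sum>a\<in>arcs Q. kvec.dim (space_at M (tail Q a)) * kvec.dim (space_at N (head Q a)))"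
    using card_Lin[OF rep_fsub[OF M] rep_fsub[OF N]] fin by (simp add: card_PiE power_sum)
  have "CARD('k) ^ (\<Sum>i\<in>UNIV. kvec.dim (space_at M i) * kvec.dim (space_at N i))
     = CARD('k) ^ ((\<Sum>a\<in>arcs Q. kvec.dim (space_at M (tail Q a)) * kvec.dim (space_at N (head Q a))) + hom.dim (Hom Q M N))"
    using cX unfolding DX cF card_Hom[OF M N] by (simp add: Lin_fam[OF M N] power_add)
  then have "(\<Sum>i\<in>UNIV. kvec.dim (space_at M i) * kvec.dim (space_at N i))
     = (\<Sum>a\<in>arcs Q. kvec.dim (space_at M (tail Q a)) * kvec.dim (space_at N (head Q a))) + hom.dim (Hom Q M N)"
    by (simp only: power_CARD_cancel)
  from arg_cong[OF this, of int] show ?thesis by (simp add: chi_def dimvec_def)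
qed

text \<open>Interleaving coordinates realizes the direct sum of two subspaces inside the same
  ambient space.\<close>

definition jn :: "'k kvec \<Rightarrow> 'k kvec \<Rightarrow> 'k kvec" where
  "jn x y = (\<lambda>m. if even m then x (m div 2) else y (m div 2))"
definition l1 :: "'k kvec \<Rightarrow> 'k kvec" where "l1 z = (\<lambda>m. z (2 * m))"
definition l2 :: "'k kvec \<Rightarrow> 'k kvec" where "l2 z = (\<lambda>m. z (2 * m + 1))"

lemma jn_simps [simp]: "l1 (jn x y) = x" "l2 (jn x y) = y" "jn (l1 z) (l2 z) = z"
  by (auto simp: jn_def l1_def l2_def fun_eq_iff)
lemma jn_eq_iff: "z = w \<longleftrightarrow> l1 z = l1 w \<and> l2 z = l2 w" by (metis jn_simps(3))
lemma l_add [simp]: "l1 (z + w) = l1 z + l1 w" "l2 (z + w) = l2 z + l2 w" "l1 0 = 0" "l2 0 = 0"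
  "l1 (kscale c z) = kscale c (l1 z)" "l2 (kscale c z) = kscale c (l2 z)"
  by (auto simp: l1_def l2_def fun_eq_iff kscale_def)

text \<open>A cochain \<open>\<eta>\<close> defines an extension of \<open>P\<close> by
  \<open>N\<close> with off-diagonal part \<open>- \<eta>\<close>. Projectivity splits it, and the
  second component of the splitting is a preimage of \<open>\<eta>\<close> under the
  differential.\<close>

lemma projective_unobstructed:
  fixes P N :: "('n::finite, 'a, 'k::{field,finite}) rep"
  assumes "projective_rep Q P" and N: "is_rep Q N"
  shows "unobstructed Q P N"
  unfolding unobstructed_def
proof (intro allI impI)
  fix \<eta> assume "\<forall>a\<in>arcs Q. linear_between (space_at P (tail Q a)) (space_at N (head Q a)) (\<eta> a)"
  then have \<eta>: "linear_between (space_at P (tail Q a)) (space_at N (head Q a)) (\<eta> a)" if "a \<in> arcs Q" for a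
    using that by blast
  have P: "is_rep Q P" using assms by (simp add: projective_rep_def)
  define E :: "('n, 'a, 'k) rep" where
    "E = \<lparr>space_at = (\<lambda>i. {z. l1 z \<in> space_at P i \<and> l2 z \<in> space_at N i}),
          map_at = (\<lambda>a z. jn (map_at P a (l1 z)) (map_at N a (l2 z) - \<eta> a (l1 z)))\<rparr>"
  have Ein: "z \<in> space_at E i \<longleftrightarrow> l1 z \<in> space_at P i \<and> l2 z \<in> space_at N i" for z i by (simp add: E_def)
  have Emap: "map_at E a z = jn (map_at P a (l1 z)) (map_at N a (l2 z) - \<eta> a (l1 z))" for a z by (simp add: E_def)
  have E: "is_rep Q E"
    unfolding is_rep_iff
  proof (intro conjI allI ballI)
    fix i
    have "space_at E i \<subseteq> (\<lambda>(x, y). jn x y) ` (space_at P i \<times> space_at N i)"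
    proof
      fix z assume "z \<in> space_at E i"
      then show "z \<in> (\<lambda>(x, y). jn x y) ` (space_at P i \<times> space_at N i)"
        by (intro image_eqI[of _ _ "(l1 z, l2 z)"]) (auto simp: Ein)
    qed
    then have "finite (space_at E i)"
      by (rule finite_subset) (simp add: fsub_finite[OF rep_fsub[OF P]] fsub_finite[OF rep_fsub[OF N]])
    then show "fsub (space_at E i)"
      by (rule fsubI) (use rep_fsub[OF P] rep_fsub[OF N] in \<open>auto simp: Ein fsub_zero fsub_add fsub_scale\<close>)
  next
    fix a assume a: "a \<in> arcs Q"
    show "linear_between (space_at E (tail Q a)) (space_at E (head Q a)) (map_at E a)"
    proof (rule linear_betweenI)
      fix z assume "z \<in> space_at E (tail Q a)"
      then have z: "l1 z \<in> space_at P (tail Q a)" "l2 z \<in> space_at N (tail Q a)" by (auto simp: Ein)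
      show "map_at E a z \<in> space_at E (head Q a)"
        using rep_map_in[OF P a z(1)] fsub_diff[OF rep_fsub[OF N] rep_map_in[OF N a z(2)] lb_in[OF \<eta>[OF a] z(1)]]
        by (simp add: Ein Emap)
      show "map_at E a (kscale c z) = kscale c (map_at E a z)" for c
        unfolding Emap l_add lb_scale[OF rep_map[OF P a] z(1)] lb_scale[OF rep_map[OF N a] z(2)] lb_scale[OF \<eta>[OF a] z(1)]
        by (simp only: jn_eq_iff[of "jn u u'" for u u'] jn_simps(1,2) l_add kvec.scale_right_diff_distrib)
      fix w assume "w \<in> space_at E (tail Q a)"
      then have w: "l1 w \<in> space_at P (tail Q a)" "l2 w \<in> space_at N (tail Q a)" by (auto simp: Ein)
      show "map_at E a (z + w) = map_at E a z + map_at E a w"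
        unfolding Emap l_add lb_add[OF rep_map[OF P a] z(1) w(1)] lb_add[OF rep_map[OF N a] z(2) w(2)] lb_add[OF \<eta>[OF a] z(1) w(1)]
        by (simp only: jn_eq_iff[of "jn u u'" for u u'] jn_simps(1,2) l_add add_diff_add)
    qed
  qed
  define f where "f i = cut (space_at E i) l1" for i
  define g where "g i = cut (space_at P i) (\<lambda>x. x)" for i
  have f: "f \<in> Hom Q E P"
    unfolding Hom_iff
  proof (intro conjI allI ballI)
    show "f i \<in> Lin (space_at E i) (space_at P i)" for i unfolding f_def
      by (rule cut_Lin[OF rep_fsub[OF E]], rule linear_betweenI) (simp_all add: Ein)
    show "f (head Q a) (map_at E a x) = map_at P a (f (tail Q a) x)"
      if "a \<in> arcs Q" "x \<in> space_at E (tail Q a)" for a x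
      using that rep_map_in[OF E that] by (simp add: f_def) (simp add: Emap)
  qed
  have epi: "epi_hom E P f"
    unfolding epi_hom_def
  proof (intro allI equalityI subsetI)
    fix i x assume "x \<in> space_at P i"
    moreover from this have "jn x 0 \<in> space_at E i" using fsub_zero[OF rep_fsub[OF N]] by (simp add: Ein)
    ultimately show "x \<in> f i ` space_at E i" by (intro image_eqI[of _ _ "jn x 0"]) (simp_all add: f_def)
  qed (use Hom_in[OF f] in blast)
  have g: "g \<in> Hom Q P P"
    unfolding Hom_iff
  proof (intro conjI allI ballI)
    show "g i \<in> Lin (space_at P i) (space_at P i)" for i unfolding g_def
      by (rule cut_Lin[OF rep_fsub[OF P]], rule linear_betweenI) simp_all
    show "g (head Q a) (map_at P a x) = map_at P a (g (tail Q a) x)"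
      if "a \<in> arcs Q" "x \<in> space_at P (tail Q a)" for a x
      using that rep_map_in[OF P that] by (simp add: g_def)
  qed
  obtain h where h: "h \<in> Hom Q P E" "comp_hom f h = g"
    using assms(1) E P f epi g unfolding projective_rep_def by blast
  have l1h: "l1 (h i x) = x" if "x \<in> space_at P i" for i x
    using fun_cong[OF fun_cong[OF h(2), of i], of x] that Hom_in[OF h(1) that]
    by (simp add: comp_hom_def f_def g_def)
  define u where "u i = cut (space_at P i) (\<lambda>x. l2 (h i x))" for i
  have "u i \<in> Lin (space_at P i) (space_at N i)" for i
    unfolding u_def
  proof (rule cut_Lin[OF rep_fsub[OF P]], rule linear_betweenI)
    fix x y c assume x: "x \<in> space_at P i"
    show "l2 (h i x) \<in> space_at N i" using Hom_in[OF h(1) x] by (simp add: Ein)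
    show "l2 (h i (kscale c x)) = kscale c (l2 (h i x))" using lb_scale[OF Hom_lb[OF h(1)] x] by simp
    assume y: "y \<in> space_at P i"
    show "l2 (h i (x + y)) = l2 (h i x) + l2 (h i y)" using lb_add[OF Hom_lb[OF h(1)] x y] by simp
  qed
  moreover have "map_at N a (u (tail Q a) x) - u (head Q a) (map_at P a x) = \<eta> a x"
    if a: "a \<in> arcs Q" and x: "x \<in> space_at P (tail Q a)" for a x
  proof -
    have e: "l2 (h (head Q a) (map_at P a x)) = map_at N a (l2 (h (tail Q a) x)) - \<eta> a x"
      unfolding Hom_comm[OF h(1) a x] Emap jn_simps l1h[OF x] ..
    have u: "u i y = l2 (h i y)" if "y \<in> space_at P i" for i y unfolding u_def by (rule cut_in[OF that])
    show ?thesis unfolding u[OF x] u[OF rep_map_in[OF P a x]] e by (simp only: diff_diff_eq2 add_diff_cancel_left')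
  qed
  ultimately show "\<exists>h. (\<forall>i. h i \<in> Lin (space_at P i) (space_at N i)) \<and>
      (\<forall>a\<in>arcs Q. \<forall>x\<in>space_at P (tail Q a). map_at N a (h (tail Q a) x) - h (head Q a) (map_at P a x) = \<eta> a x)"
    by blast
qed

text \<open>The path algebra is hereditary: a cochain on a submodule extends to the larger module
  arrow by arrow, since only linear extension at the tails is required.\<close>

lemma unobstructed_sub:
  fixes K P N :: "('n::finite, 'a, 'k::{field,finite}) rep"
  assumes "is_rep Q K" "is_rep Q P" "is_rep Q N" and f: "f \<in> Hom Q K P" "mono_hom K f" and un: "unobstructed Q P N"
  shows "unobstructed Q K N"
  unfolding unobstructed_def
proof (intro allI impI)
  fix \<eta> assume \<eta>: "\<forall>a\<in>arcs Q. linear_between (space_at K (tail Q a)) (space_at N (head Q a)) (\<eta> a)"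
  have "\<forall>a\<in>arcs Q. \<exists>e. linear_between UNIV (space_at N (head Q a)) e \<and>
      (\<forall>x\<in>space_at K (tail Q a). e (f (tail Q a) x) = \<eta> a x)"
  proof
    fix a assume a: "a \<in> arcs Q"
    have inj: "inj_on (f (tail Q a)) (space_at K (tail Q a))" using f(2) by (simp add: mono_hom_def)
    obtain e where "linear_between UNIV (space_at N (head Q a)) e"
      "\<And>x. x \<in> space_at K (tail Q a) \<Longrightarrow> e (f (tail Q a) x) = \<eta> a x"
      by (rule linear_extend[OF rep_fsub[OF assms(1)] rep_fsub[OF assms(3)] Hom_lb[OF f(1)] inj bspec[OF \<eta> a]]) blast
    then show "\<exists>e. linear_between UNIV (space_at N (head Q a)) e \<and>
      (\<forall>x\<in>space_at K (tail Q a). e (f (tail Q a) x) = \<eta> a x)" by blast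
  qed
  from bchoice[OF this] obtain e where
    e: "\<And>a. a \<in> arcs Q \<Longrightarrow> linear_between UNIV (space_at N (head Q a)) (e a)"
      "\<And>a x. a \<in> arcs Q \<Longrightarrow> x \<in> space_at K (tail Q a) \<Longrightarrow> e a (f (tail Q a) x) = \<eta> a x" by blast
  have "\<forall>a\<in>arcs Q. linear_between (space_at P (tail Q a)) (space_at N (head Q a)) (e a)"
    using e(1) by (auto simp: linear_between_def image_subset_iff)
  then obtain h where h: "\<And>i. h i \<in> Lin (space_at P i) (space_at N i)"
    "\<And>a x. a \<in> arcs Q \<Longrightarrow> x \<in> space_at P (tail Q a) \<Longrightarrow>
        map_at N a (h (tail Q a) x) - h (head Q a) (map_at P a x) = e a x"
    using un unfolding unobstructed_def by blast
  define u where "u i = cut (space_at K i) (\<lambda>x. h i (f i x))" for i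
  have "u i \<in> Lin (space_at K i) (space_at N i)" for i
    unfolding u_def
  proof (rule cut_Lin[OF rep_fsub[OF assms(1)]], rule linear_betweenI)
    fix x y c assume x: "x \<in> space_at K i"
    note hi = Lin_lb[OF h(1)[of i]]
    show "h i (f i x) \<in> space_at N i" by (rule lb_in[OF hi Hom_in[OF f(1) x]])
    show "h i (f i (kscale c x)) = kscale c (h i (f i x))"
      by (simp only: lb_scale[OF Hom_lb[OF f(1)] x] lb_scale[OF hi Hom_in[OF f(1) x]])
    assume y: "y \<in> space_at K i"
    show "h i (f i (x + y)) = h i (f i x) + h i (f i y)"
      by (simp only: lb_add[OF Hom_lb[OF f(1)] x y] lb_add[OF hi Hom_in[OF f(1) x] Hom_in[OF f(1) y]])
  qed
  moreover have "map_at N a (u (tail Q a) x) - u (head Q a) (map_at K a x) = \<eta> a x"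
    if a: "a \<in> arcs Q" and x: "x \<in> space_at K (tail Q a)" for a x
    using h(2)[OF a Hom_in[OF f(1) x]] e(2)[OF a x] Hom_comm[OF f(1) a x] x rep_map_in[OF assms(1) a x]
    by (simp add: u_def)
  ultimately show "\<exists>h. (\<forall>i. h i \<in> Lin (space_at K i) (space_at N i)) \<and>
      (\<forall>a\<in>arcs Q. \<forall>x\<in>space_at K (tail Q a). map_at N a (h (tail Q a) x) - h (head Q a) (map_at K a x) = \<eta> a x)"
    by blast
qed

lemma comp_hom_Hom:
  assumes "f \<in> Hom Q K P" "h \<in> Hom Q P N" "\<And>i. fsub (space_at P i)"
  shows "comp_hom h f \<in> Hom Q K N"
  unfolding Hom_iff
proof (intro conjI allI ballI)
  fix i
  have "linear_between (space_at K i) (space_at N i) (comp_hom h f i)"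
  proof (rule linear_betweenI)
    fix x y c assume x: "x \<in> space_at K i"
    show "comp_hom h f i x \<in> space_at N i" by (simp add: comp_hom_def Hom_in[OF assms(2)] Hom_in[OF assms(1)] x)
    show "comp_hom h f i (kscale c x) = kscale c (comp_hom h f i x)"
      by (simp only: comp_hom_def comp_def lb_scale[OF Hom_lb[OF assms(1)] x]
          lb_scale[OF Hom_lb[OF assms(2)] Hom_in[OF assms(1) x]])
    assume y: "y \<in> space_at K i"
    show "comp_hom h f i (x + y) = comp_hom h f i x + comp_hom h f i y"
      by (simp only: comp_hom_def comp_def lb_add[OF Hom_lb[OF assms(1)] x y]
          lb_add[OF Hom_lb[OF assms(2)] Hom_in[OF assms(1) x] Hom_in[OF assms(1) y]])
  qed
  moreover have "comp_hom h f i x = 0" if "x \<notin> space_at K i" for x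
    using Hom_out[OF assms(1) that] lb_zero[OF Hom_lb[OF assms(2)] assms(3)] by (simp add: comp_hom_def)
  ultimately show "comp_hom h f i \<in> Lin (space_at K i) (space_at N i)" by (simp add: Lin_def)
next
  fix a x assume a: "a \<in> arcs Q" "x \<in> space_at K (tail Q a)"
  show "comp_hom h f (head Q a) (map_at K a x) = map_at N a (comp_hom h f (tail Q a) x)"
    using Hom_comm[OF assms(1) a] Hom_comm[OF assms(2) a(1) Hom_in[OF assms(1) a(2)]] by (simp add: comp_hom_def)
qed

text \<open>Left exactness of \<open>Hom\<close> in its first argument, counted: the kernel of
  restriction along \<open>f\<close> consists of the homomorphisms that factor through
  \<open>g\<close>.\<close>

lemma card_Hom_exact:
  fixes K P M N :: "('n::finite, 'a, 'k::{field,finite}) rep"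
  assumes ex: "short_exact Q K f P g M" and N: "is_rep Q N"
  shows "card (Hom Q P N) = card ((\<lambda>h. comp_hom h f) ` Hom Q P N) * card (Hom Q M N)"
proof -
  have K: "is_rep Q K" and P: "is_rep Q P" and M: "is_rep Q M" and f: "f \<in> Hom Q K P" and g: "g \<in> Hom Q P M"
    and epi: "\<And>i. g i ` space_at P i = space_at M i"
    and ker: "\<And>i. f i ` space_at K i = {x \<in> space_at P i. g i x = 0}"
    using ex by (auto simp: short_exact_def epi_hom_def)
  let ?K0 = "{h \<in> Hom Q P N. \<forall>i. \<forall>x\<in>space_at K i. h i (f i x) = 0}"
  have "card (Hom Q P N) = card ((\<lambda>h. comp_hom h f) ` Hom Q P N) * card ?K0"
  proof (rule card_quotient[OF Hom_finite[OF P N]])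
    fix h h' assume h: "h \<in> Hom Q P N" "h' \<in> Hom Q P N"
    show "h + h' \<in> Hom Q P N" by (intro hom.subspace_add Hom_subspace P N h)
    have d: "h - h' \<in> Hom Q P N" by (intro hom.subspace_diff Hom_subspace P N h)
    have "comp_hom h f = comp_hom h' f \<longleftrightarrow> (\<forall>i x. h i (f i x) = h' i (f i x))"
      by (auto simp: comp_hom_def fun_eq_iff)
    also have "\<dots> \<longleftrightarrow> (\<forall>i. \<forall>x\<in>space_at K i. h i (f i x) = h' i (f i x))"
      using Hom_out[OF f] lb_zero[OF Hom_lb[OF h(1)] rep_fsub[OF P]] lb_zero[OF Hom_lb[OF h(2)] rep_fsub[OF P]]
      by metis
    finally show "comp_hom h f = comp_hom h' f \<longleftrightarrow> h - h' \<in> ?K0" using d by simp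
  qed auto
  moreover have "bij_betw (\<lambda>h. comp_hom h g) (Hom Q M N) ?K0"
  proof (rule bij_betw_imageI)
    show "inj_on (\<lambda>h. comp_hom h g) (Hom Q M N)"
    proof (rule inj_onI, rule ext, rule ext)
      fix h h' i y assume h: "h \<in> Hom Q M N" "h' \<in> Hom Q M N" "comp_hom h g = comp_hom h' g"
      show "h i y = h' i y"
      proof (cases "y \<in> space_at M i")
        case True
        then obtain x where "x \<in> space_at P i" "y = g i x" using epi[of i] by blast
        then show ?thesis using fun_cong[OF fun_cong[OF h(3), of i], of x] by (simp add: comp_hom_def)
      next
        case False
        then show ?thesis using Hom_out[OF h(1)] Hom_out[OF h(2)] by metis
      qed
    qed
    show "(\<lambda>h. comp_hom h g) ` Hom Q M N = ?K0"
    proof (intro equalityI subsetI)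
      fix e assume "e \<in> (\<lambda>h. comp_hom h g) ` Hom Q M N"
      then obtain h where h: "h \<in> Hom Q M N" "e = comp_hom h g" by blast
      have "g i (f i x) = 0" if "x \<in> space_at K i" for i x using ker[of i] that by blast
      then show "e \<in> ?K0" using h comp_hom_Hom[OF g h(1) rep_fsub[OF M]] lb_zero[OF Hom_lb[OF h(1)] rep_fsub[OF M]]
        by (simp add: comp_hom_def)
    next
      fix h assume "h \<in> ?K0"
      then have h: "h \<in> Hom Q P N" "\<And>i x. x \<in> space_at K i \<Longrightarrow> h i (f i x) = 0" by auto
      \<comment> \<open>Values are taken on chosen preimages under \<open>g\<close>; they do not
        depend on the choice, because \<open>h\<close> vanishes on the kernel of
        \<open>g\<close>.\<close>
      define e where "e i = cut (space_at M i) (\<lambda>y. h i (inv_into (space_at P i) (g i) y))" for i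
      have eg: "e i (g i x) = h i x" if x: "x \<in> space_at P i" for i x
      proof -
        define x' where "x' = inv_into (space_at P i) (g i) (g i x)"
        have x': "x' \<in> space_at P i" "g i x' = g i x" using x by (auto simp: x'_def inv_into_into f_inv_into_f)
        have "g i (x' - x) = 0" using lb_diff[OF Hom_lb[OF g] rep_fsub[OF P] x'(1) x] x'(2) by simp
        then have "x' - x \<in> f i ` space_at K i" using ker[of i] fsub_diff[OF rep_fsub[OF P] x'(1) x] by simp
        then have "h i (x' - x) = 0" using h(2) by auto
        then have "h i x' = h i x" using lb_diff[OF Hom_lb[OF h(1)] rep_fsub[OF P] x'(1) x] by simp
        then show ?thesis using Hom_in[OF g x] by (simp add: e_def x'_def)
      qed
      have "e \<in> Hom Q M N"
        unfolding Hom_iff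
      proof (intro conjI allI ballI)
        fix i
        have "linear_between (space_at M i) (space_at N i) (e i)"
        proof (rule linear_betweenI)
          fix y y' c assume "y \<in> space_at M i"
          then obtain x where x: "x \<in> space_at P i" "y = g i x" using epi[of i] by blast
          show "e i y \<in> space_at N i" using eg[OF x(1)] Hom_in[OF h(1) x(1)] x(2) by simp
          have "e i (g i (kscale c x)) = kscale c (e i (g i x))"
            by (simp only: eg[OF x(1)] eg[OF fsub_scale[OF rep_fsub[OF P] x(1)]] lb_scale[OF Hom_lb[OF h(1)] x(1)])
          then show "e i (kscale c y) = kscale c (e i y)" unfolding x(2) lb_scale[OF Hom_lb[OF g] x(1)] .
          assume "y' \<in> space_at M i"
          then obtain x' where x': "x' \<in> space_at P i" "y' = g i x'" using epi[of i] by blast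
          have "e i (g i (x + x')) = e i (g i x) + e i (g i x')"
            by (simp only: eg[OF x(1)] eg[OF x'(1)] eg[OF fsub_add[OF rep_fsub[OF P] x(1) x'(1)]]
              lb_add[OF Hom_lb[OF h(1)] x(1) x'(1)])
          then show "e i (y + y') = e i y + e i y'" unfolding x(2) x'(2) lb_add[OF Hom_lb[OF g] x(1) x'(1)] .
        qed
        then show "e i \<in> Lin (space_at M i) (space_at N i)" by (simp add: Lin_def e_def)
      next
        fix a y assume a: "a \<in> arcs Q" "y \<in> space_at M (tail Q a)"
        then obtain x where x: "x \<in> space_at P (tail Q a)" "y = g (tail Q a) x" using epi[of "tail Q a"] by blast
        show "e (head Q a) (map_at M a y) = map_at N a (e (tail Q a) y)"
          unfolding x(2) Hom_comm[OF g a(1) x(1), symmetric] eg[OF x(1)] eg[OF rep_map_in[OF P a(1) x(1)]]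
          by (rule Hom_comm[OF h(1) a(1) x(1)])
      qed
      moreover have "comp_hom e g = h"
      proof (rule ext, rule ext)
        fix i x
        show "comp_hom e g i x = h i x"
        proof (cases "x \<in> space_at P i")
          case True
          then show ?thesis using eg by (simp add: comp_hom_def)
        next
          case False
          have "e i 0 = 0" by (rule lb_zero[OF Hom_lb[OF \<open>e \<in> Hom Q M N\<close>] rep_fsub[OF M]])
          then show ?thesis using False Hom_out[OF g False] Hom_out[OF h(1) False] by (simp add: comp_hom_def)
        qed
      qed
      ultimately show "h \<in> (\<lambda>h. comp_hom h g) ` Hom Q M N" by blast
    qed
  qed
  ultimately show ?thesis by (simp add: bij_betw_same_card)
qed


lemma dim_exact:
  fixes K P M :: "('n::finite, 'a, 'k::{field,finite}) rep"
  assumes "short_exact Q K f P g M"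
  shows "rep_dim P = rep_dim K + rep_dim M"
proof -
  have K: "is_rep Q K" and P: "is_rep Q P" and M: "is_rep Q M" and f: "f \<in> Hom Q K P" and g: "g \<in> Hom Q P M"
    and epi: "\<And>i. g i ` space_at P i = space_at M i" and inj: "\<And>i. inj_on (f i) (space_at K i)"
    and ker: "\<And>i. f i ` space_at K i = {x \<in> space_at P i. g i x = 0}"
    using assms by (auto simp: short_exact_def epi_hom_def mono_hom_def)
  have "kvec.dim (space_at P i) = kvec.dim (space_at K i) + kvec.dim (space_at M i)" for i
  proof -
    have "card (space_at P i) = card (space_at M i) * card (space_at K i)"
      using card_lb[OF Hom_lb[OF g] rep_fsub[OF P], of i] epi[of i] ker[of i] card_image[OF inj[of i]] by simp
    then have "CARD('k) ^ kvec.dim (space_at P i) = CARD('k) ^ (kvec.dim (space_at K i) + kvec.dim (space_at M i))"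
      by (simp add: fsub_card[OF rep_fsub[OF P]] fsub_card[OF rep_fsub[OF K]] fsub_card[OF rep_fsub[OF M]] power_add)
    then show ?thesis by (simp only: power_CARD_cancel)
  qed
  then show ?thesis by (simp add: dimvec_def vec_eq_iff)
qed

text \<open>Both \<open>P\<close> and its submodule \<open>K\<close> are unobstructed, so the
  dimensions of their \<open>Hom\<close> spaces are values of \<open>chi\<close>; additivity of
  \<open>chi\<close> along the sequence then removes \<open>K\<close> and \<open>P\<close> from the
  result.\<close>

lemma ext_formula:
  fixes K P M N :: "('n::finite, 'a, 'k::{field,finite}) rep"
  assumes ex: "short_exact Q K f P g M" and P: "projective_rep Q P" and N: "is_rep Q N" and fin: "finite (arcs Q)"
  shows "int (hom.dim (Hom Q K N) - hom.dim ((\<lambda>h. comp_hom h f) ` Hom Q P N))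
      = int (hom.dim (Hom Q M N)) - chi Q (rep_dim M) (rep_dim N)"
proof -
  have rK: "is_rep Q K" and rP: "is_rep Q P" and rM: "is_rep Q M" and f: "f \<in> Hom Q K P" "mono_hom K f"
    using ex by (auto simp: short_exact_def)
  let ?I = "(\<lambda>h. comp_hom h f) ` Hom Q P N"
  have unP: "unobstructed Q P N" by (rule projective_unobstructed[OF P N])
  have unK: "unobstructed Q K N" by (rule unobstructed_sub[OF rK rP N f unP])
  have dP: "int (hom.dim (Hom Q P N)) = chi Q (rep_dim P) (rep_dim N)"
    by (rule hom_dim_unobstructed[OF rP N fin unP])
  have dK: "int (hom.dim (Hom Q K N)) = chi Q (rep_dim K) (rep_dim N)"
    by (rule hom_dim_unobstructed[OF rK N fin unK])
  have sub: "hom.subspace ?I"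
  proof (rule hom.subspaceI)
    have "0 = comp_hom 0 f" by (rule ext, rule ext) (simp add: comp_hom_def)
    then show "0 \<in> ?I" using hom.subspace_0[OF Hom_subspace[OF rP N]] by blast
  next
    fix x y assume "x \<in> ?I" "y \<in> ?I"
    then obtain h h' where h: "h \<in> Hom Q P N" "h' \<in> Hom Q P N" "x = comp_hom h f" "y = comp_hom h' f" by blast
    have "x + y = comp_hom (h + h') f" unfolding h by (rule ext, rule ext) (simp add: comp_hom_def)
    then show "x + y \<in> ?I" using hom.subspace_add[OF Hom_subspace[OF rP N] h(1,2)] by blast
  next
    fix c x assume "x \<in> ?I"
    then obtain h where h: "h \<in> Hom Q P N" "x = comp_hom h f" by blast
    have "hscale c x = comp_hom (hscale c h) f" unfolding h by (rule ext, rule ext) (simp add: comp_hom_def hscale_def)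
    then show "hscale c x \<in> ?I" using hom.subspace_scale[OF Hom_subspace[OF rP N] h(1)] by blast
  qed
  have finI: "finite ?I" using Hom_finite[OF rP N] by simp
  have cI: "card ?I = CARD('k) ^ hom.dim ?I" using hom.card_subspace[OF _ sub finI] by simp
  have "CARD('k) ^ hom.dim (Hom Q P N) = CARD('k) ^ (hom.dim ?I + hom.dim (Hom Q M N))"
    using card_Hom_exact[OF ex N] unfolding cI card_Hom[OF rP N] card_Hom[OF rM N] by (simp add: power_add)
  then have dI: "hom.dim (Hom Q P N) = hom.dim ?I + hom.dim (Hom Q M N)" by (simp only: power_CARD_cancel)
  have "?I \<subseteq> Hom Q K N" using comp_hom_Hom[OF f(1) _ rep_fsub[OF rP]] by blast
  then have "CARD('k) ^ hom.dim ?I \<le> CARD('k) ^ hom.dim (Hom Q K N)"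
    using card_mono[OF Hom_finite[OF rK N]] cI card_Hom[OF rK N] by metis
  then have "hom.dim ?I \<le> hom.dim (Hom Q K N)" using card_UNIV_field_gt1[where 'k='k] by (simp add: power_increasing_iff)
  then show ?thesis using dI dK dP by (simp add: dim_exact[OF ex] chi_add_left)
qed

lemma ext1_dim_eq:
  fixes M N :: "('n::finite, 'a, 'k::{field,finite}) rep"
  assumes "short_exact Q K f P g M" "projective_rep Q P" "is_rep Q N" "finite (arcs Q)"
  shows "int (ext1_dim Q M N) = int (hom.dim (Hom Q M N)) - chi Q (rep_dim M) (rep_dim N)"
proof -
  have "ext1_dim Q M N = hom.dim (Hom Q K N) - hom.dim ((\<lambda>h. comp_hom h f) ` Hom Q P N)"
    unfolding ext1_dim_def
  proof (rule the_equality)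
    fix d assume "\<exists>K f P g. short_exact Q K f P g M \<and> projective_rep Q P \<and>
        d = hom.dim (Hom Q K N) - hom.dim ((\<lambda>h. comp_hom h f) ` Hom Q P N)"
    then have "int d = int (hom.dim (Hom Q M N)) - chi Q (rep_dim M) (rep_dim N)"
      using ext_formula assms(3,4) by blast
    then show "d = hom.dim (Hom Q K N) - hom.dim ((\<lambda>h. comp_hom h f) ` Hom Q P N)"
      using ext_formula[OF assms] by linarith
  qed (use assms in blast)
  then show ?thesis using ext_formula[OF assms] by simp
qed

section \<open>Simple modules and uniqueness of the Euler form\<close>

definition supp_space :: "nat set \<Rightarrow> 'k::field kvec set" where
  "supp_space B = {x. \<forall>m. m \<notin> B \<longrightarrow> x m = 0}"

lemma fsub_supp_space: "finite B \<Longrightarrow> fsub (supp_space B :: 'k::{field,finite} kvec set)"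
proof (rule fsubI)
  assume "finite B"
  then have "finite {f :: 'k kvec. \<forall>x. (x \<in> B \<longrightarrow> f x \<in> UNIV) \<and> (x \<notin> B \<longrightarrow> f x = 0)}"
    by (intro finite_set_of_finite_funs) auto
  then show "finite (supp_space B :: 'k kvec set)" by (simp add: supp_space_def)
qed (auto simp: supp_space_def kscale_def)

lemma card_supp_single: "card (supp_space {m} :: 'k::{field,finite} kvec set) = CARD('k)"
proof -
  have "bij_betw (\<lambda>c i. if i = m then c else 0) (UNIV :: 'k set) (supp_space {m})"
  proof (rule bij_betwI')
    fix y :: "'k kvec" assume "y \<in> supp_space {m}"
    then show "\<exists>x\<in>UNIV. y = (\<lambda>i. if i = m then x else 0)"
      by (intro bexI[of _ "y m"]) (auto simp: supp_space_def fun_eq_iff)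
  qed (auto simp: supp_space_def fun_eq_iff)
  then show ?thesis by (simp add: bij_betw_same_card)
qed

lemma dim_supp_single: "kvec.dim (supp_space {m} :: 'k::{field,finite} kvec set) = 1"
  using fsub_card[OF fsub_supp_space[of "{m}"]] card_supp_single[of m]
  by (metis finite.emptyI finite_insert power_CARD_cancel power_one_right)

lemma dim_zero_space: "kvec.dim ({0} :: 'k::field kvec set) = 0"
  using kvec.dim_span_eq_card_independent[OF kvec.independent_empty] by simp

lemma fsub_zero_space: "fsub ({0} :: 'k::field kvec set)"
  by (rule fsubI) (auto simp: kscale_def fun_eq_iff)

definition simple_rep :: "'n \<Rightarrow> ('n, 'a, 'k::field) rep" where
  "simple_rep i = \<lparr>space_at = (\<lambda>j. if j = i then supp_space {0} else {0}), map_at = (\<lambda>_ _. 0)\<rparr>"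

lemma simple_rep: "is_rep Q (simple_rep i :: ('n::finite, 'a, 'k::{field,finite}) rep)"
  unfolding is_rep_iff
proof (intro conjI allI ballI)
  let ?S = "simple_rep i :: ('n, 'a, 'k) rep"
  show f: "fsub (space_at ?S j)" for j
    by (simp add: simple_rep_def fsub_supp_space fsub_zero_space)
  show "linear_between (space_at ?S (tail Q a)) (space_at ?S (head Q a)) (map_at ?S a)" for a
  proof (rule linear_betweenI)
    show "map_at ?S a x \<in> space_at ?S (head Q a)" for x
      using fsub_zero[OF f] by (simp add: simple_rep_def)
  qed (simp_all add: simple_rep_def)
qed

lemma simple_rep_dim: "rep_dim (simple_rep i :: ('n::finite, 'a, 'k::{field,finite}) rep) = axis i 1"
  by (auto simp: vec_eq_iff dimvec_def simple_rep_def axis_def dim_supp_single dim_zero_space)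

lemma additive_expand:
  fixes g :: "int^'n::finite \<Rightarrow> int"
  assumes "Modules.additive g"
  shows "g x = (\<Sum>i\<in>UNIV. x $ i * g (axis i 1))"
proof -
  interpret Modules.additive g by fact
  have ax: "axis i m + axis i n = (axis i (m + n) :: int^'n)" for i m n by (auto simp: vec_eq_iff axis_def)
  have nat: "g (axis i (int m)) = int m * g (axis i 1)" for i m
  proof (induction m)
    case 0
    have "(axis i (int 0) :: int^'n) = 0" by (auto simp: vec_eq_iff axis_def)
    then show ?case using zero by (metis mult_zero_left of_nat_0)
  next
    case (Suc m)
    then show ?case using add[of "axis i (int m)" "axis i 1"] by (simp add: ax algebra_simps)
  qed
  have int: "g (axis i m) = m * g (axis i 1)" for i m
  proof (cases "0 \<le> m")
    case True
    then show ?thesis using nat[of i "nat m"] by simp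
  next
    case False
    have "axis i m = - (axis i (- m) :: int^'n)" by (auto simp: vec_eq_iff axis_def)
    then show ?thesis using nat[of i "nat (- m)"] False by (simp add: minus)
  qed
  have "x = (\<Sum>i\<in>UNIV. axis i (x $ i))" by (auto simp: vec_eq_iff axis_def)
  then have "g x = (\<Sum>i\<in>UNIV. g (axis i (x $ i)))" using sum[of "\<lambda>i. axis i (x $ i)" UNIV] by simp
  also have "\<dots> = (\<Sum>i\<in>UNIV. x $ i * g (axis i 1))" by (rule sum.cong[OF refl]) (rule int)
  finally show ?thesis .
qed

text \<open>The presentations give the definite description in \<open>ext1_dim\<close> its value.
  Uniqueness holds because a biadditive form is determined on unit vectors, and these are the
  dimension vectors of the simple modules.\<close>

lemma euler_form_eq_chi:
  fixes Q :: "('n::finite, 'a) pre_digraph"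
  assumes "finite (arcs Q)"
    and pres: "\<And>M :: ('n, 'a, 'k::{field,finite}) rep. is_rep Q M \<Longrightarrow>
      \<exists>K f P g. short_exact Q K f P g M \<and> projective_rep Q P"
  shows "euler_form TYPE('k) Q = chi Q"
  unfolding euler_form_def
proof (rule the_equality)
  have "chi Q (rep_dim M) (rep_dim N) = int (hom.dim (Hom Q M N)) - int (ext1_dim Q M N)"
    if M: "is_rep Q M" and N: "is_rep Q N" for M N :: "('n, 'a, 'k) rep"
  proof -
    obtain K f P g where "short_exact Q K f P g M" "projective_rep Q P" using pres[OF M] by blast
    then show ?thesis using ext1_dim_eq[OF _ _ N assms(1)] by simp
  qed
  then show *: "(\<forall>x. Modules.additive (chi Q x)) \<and> (\<forall>y. Modules.additive (\<lambda>x. chi Q x y)) \<and>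
     (\<forall>M N :: ('n, 'a, 'k) rep. is_rep Q M \<and> is_rep Q N \<longrightarrow>
        chi Q (rep_dim M) (rep_dim N) = int (hom.dim (Hom Q M N)) - int (ext1_dim Q M N))"
    by (auto simp: Modules.additive_def chi_add_left chi_add_right)
  fix \<beta> assume \<beta>: "(\<forall>x. Modules.additive (\<beta> x)) \<and> (\<forall>y. Modules.additive (\<lambda>x. \<beta> x y)) \<and>
     (\<forall>M N :: ('n, 'a, 'k) rep. is_rep Q M \<and> is_rep Q N \<longrightarrow>
        \<beta> (rep_dim M) (rep_dim N) = int (hom.dim (Hom Q M N)) - int (ext1_dim Q M N))"
  have e: "\<beta> (axis i 1) (axis j 1) = chi Q (axis i 1) (axis j 1)" for i j
    using \<beta> * simple_rep[where 'k='k, of Q i] simple_rep[where 'k='k, of Q j] simple_rep_dim[where 'k='k and 'a='a]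
    by metis
  show "\<beta> = chi Q"
  proof (rule ext, rule ext)
    fix x y
    have exp: "B x y = (\<Sum>i\<in>UNIV. x $ i * (\<Sum>j\<in>UNIV. y $ j * B (axis i 1) (axis j 1)))"
      if "\<forall>x. Modules.additive (B x)" "\<forall>y. Modules.additive (\<lambda>x. B x y)" for B :: "int^'n \<Rightarrow> int^'n \<Rightarrow> int"
      using additive_expand[of "\<lambda>x. B x y" x] additive_expand[of "B (axis i 1)" y for i] that by simp
    show "\<beta> x y = chi Q x y" using exp[of \<beta>] exp[of "chi Q"] \<beta> * e by simp
  qed
qed

text \<open>The rank of a vertex counts the vertices from which a nonempty directed walk leads to
  it. This set grows along an arrow, and strictly so, because a closed walk would contain a
  cycle.\<close>

lemma acyclic_rank:
  fixes Q :: "('n::finite, 'a) pre_digraph"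
  assumes fin: "fin_digraph Q" and ac: "acyclic_quiver Q"
  obtains ht :: "'n \<Rightarrow> nat" where "\<And>a. a \<in> arcs Q \<Longrightarrow> ht (tail Q a) < ht (head Q a)"
proof -
  interpret fin_digraph Q by fact
  define r where "r = {(tail Q a, head Q a) | a. a \<in> arcs Q}"
  have walk: "\<exists>p. awalk u p w \<and> p \<noteq> []" if "(u, w) \<in> r\<^sup>+" for u w
    using that
  proof induction
    case (base y)
    then show ?case using arc_implies_awalk by (auto simp: r_def)
  next
    case (step y z)
    then obtain p a where "awalk u p y" "p \<noteq> []" "a \<in> arcs Q" "tail Q a = y" "head Q a = z" by (auto simp: r_def)
    then show ?case using arc_implies_awalk[of a] awalk_appendI[of u p "tail Q a" "[a]" "head Q a"] by blast
  qed
  have irr: "(u, u) \<notin> r\<^sup>+" for u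
  proof
    assume "(u, u) \<in> r\<^sup>+"
    then obtain p where "closed_w p" using walk closed_w_def by blast
    then have "\<exists>p. cycle p" using closed_w_imp_cycle by blast
    then show False using ac by (simp add: acyclic_quiver_def)
  qed
  define ht where "ht w = card {u. (u, w) \<in> r\<^sup>+}" for w
  have "ht (tail Q a) < ht (head Q a)" if "a \<in> arcs Q" for a
    unfolding ht_def
  proof (rule psubset_card_mono)
    have e: "(tail Q a, head Q a) \<in> r" using that by (auto simp: r_def)
    then have "{u. (u, tail Q a) \<in> r\<^sup>+} \<subseteq> {u. (u, head Q a) \<in> r\<^sup>+}" by (auto intro: trancl_into_trancl)
    then show "{u. (u, tail Q a) \<in> r\<^sup>+} \<subset> {u. (u, head Q a) \<in> r\<^sup>+}" using e irr[of "tail Q a"] by blast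
  qed simp
  then show ?thesis using that by blast
qed

section \<open>Projective modules\<close>


definition delta :: "nat \<Rightarrow> 'k::field kvec" where "delta c = (\<lambda>m. if m = c then 1 else 0)"

lemma delta_supp: "c \<in> B \<Longrightarrow> delta c \<in> supp_space B"
  by (auto simp: delta_def supp_space_def)

lemma span_delta:
  assumes "finite B"
  shows "kvec.span (delta ` B) = (supp_space B :: 'k::{field,finite} kvec set)"
proof
  show "kvec.span (delta ` B) \<subseteq> (supp_space B :: 'k kvec set)"
    by (rule kvec.span_minimal) (use assms in \<open>auto simp: delta_supp fsub_subspace[OF fsub_supp_space]\<close>)
  show "(supp_space B :: 'k kvec set) \<subseteq> kvec.span (delta ` B)"
    using assms
  proof (induction B)
    case empty
    have "(x :: 'k kvec) = 0" if "x \<in> supp_space {}" for x using that by (auto simp: supp_space_def fun_eq_iff)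
    then show ?case by auto
  next
    case (insert c B)
    show ?case
    proof
      fix x :: "'k kvec" assume x: "x \<in> supp_space (insert c B)"
      have "x - kscale (x c) (delta c) \<in> supp_space B"
        using x by (auto simp: supp_space_def kscale_def delta_def)
      then have "x - kscale (x c) (delta c) \<in> kvec.span (delta ` B)" using insert by blast
      then have "x - kscale (x c) (delta c) \<in> kvec.span (delta ` insert c B)"
        using kvec.span_mono[of "delta ` B" "delta ` insert c B"] by blast
      moreover have "kscale (x c) (delta c) \<in> kvec.span (delta ` insert c B)"
        by (intro kvec.span_scale kvec.span_base) simp
      ultimately have "(x - kscale (x c) (delta c)) + kscale (x c) (delta c) \<in> kvec.span (delta ` insert c B)"
        by (rule kvec.span_add)
      then show "x \<in> kvec.span (delta ` insert c B)" by (simp only: diff_add_cancel)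
    qed
  qed
qed

lemma lb_comp: "linear_between U V f \<Longrightarrow> linear_between V W g \<Longrightarrow> linear_between U W (\<lambda>x. g (f x))"
  by (auto simp: linear_between_def image_subset_iff)

lemma lb_eq_on_delta:
  assumes "finite B" "linear_between (supp_space B) W f" "linear_between (supp_space B) W' g"
    "\<And>c. c \<in> B \<Longrightarrow> f (delta c) = g (delta c)" "x \<in> (supp_space B :: 'k::{field,finite} kvec set)"
  shows "f x = g x"
  by (rule lb_eq_on_span[OF assms(2,3) span_delta[OF assms(1)] fsub_supp_space[OF assms(1)]]) (use assms in auto)

lemma lb_lift:
  assumes "fsub W" "finite B" "\<And>c. c \<in> B \<Longrightarrow> G c \<in> W"
  obtains h where "h \<in> Lin (supp_space B :: 'k::{field,finite} kvec set) W" "\<And>c. c \<in> B \<Longrightarrow> h (delta c) = G c"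
proof -
  have inj: "inj_on (delta :: nat \<Rightarrow> 'k kvec) B"
    by (rule inj_onI) (auto simp: delta_def fun_eq_iff split: if_splits dest: spec[where x="_"])
  \<comment> \<open>Independence by counting: the coordinate vectors span a space whose dimension
    equals their number, so a maximal independent subset is all of them.\<close>
  have ind: "kvec.independent (delta ` B :: 'k kvec set)"
  proof -
    have "CARD('k) ^ card (delta ` B :: 'k kvec set) = CARD('k) ^ kvec.dim (supp_space B :: 'k kvec set)"
    proof -
      have "bij_betw (\<lambda>x :: 'k kvec. restrict x B) (supp_space B) (PiE B (\<lambda>_. UNIV))"
      proof (rule bij_betwI')
        fix x y :: "'k kvec" assume "x \<in> supp_space B" "y \<in> supp_space B"
        then show "restrict x B = restrict y B \<longleftrightarrow> x = y"
          by (auto simp: supp_space_def fun_eq_iff restrict_def) metis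
      next
        fix y :: "nat \<Rightarrow> 'k" assume "y \<in> PiE B (\<lambda>_. UNIV)"
        then show "\<exists>x\<in>supp_space B. y = restrict x B"
          by (intro bexI[of _ "\<lambda>m. if m \<in> B then y m else 0"])
            (auto simp: supp_space_def fun_eq_iff restrict_def PiE_def extensional_def)
      qed auto
      then have "card (supp_space B :: 'k kvec set) = CARD('k) ^ card B"
        using assms(2) by (simp add: bij_betw_same_card card_PiE)
      then show ?thesis using fsub_card[OF fsub_supp_space[OF assms(2)], where 'k='k] card_image[OF inj] by simp
    qed
    then have "card (delta ` B :: 'k kvec set) = kvec.dim (supp_space B :: 'k kvec set)" by (simp only: power_CARD_cancel)
    moreover obtain B' where B': "B' \<subseteq> (delta ` B :: 'k kvec set)" "kvec.independent B'" "delta ` B \<subseteq> kvec.span B'"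
      by (rule kvec.maximal_independent_subset)
    moreover have "kvec.span B' = (supp_space B :: 'k kvec set)"
      using B' by (metis kvec.span_mono kvec.span_span span_delta[OF assms(2)] subset_antisym)
    then have "card B' = kvec.dim (supp_space B :: 'k kvec set)"
      using kvec.dim_span_eq_card_independent[OF B'(2)] by simp
    ultimately have "B' = delta ` B" using assms(2) by (intro card_subset_eq) auto
    then show ?thesis using B' by simp
  qed
  define g where "g y = G (inv_into B delta y)" for y :: "'k kvec"
  have g: "g (delta c) = G c" if "c \<in> B" for c unfolding g_def inv_into_f_f[OF inj that] ..
  let ?h = "kvp.construct (delta ` B) g"
  have "linear_between (supp_space B) W ?h"
    by (rule lb_construct[OF ind]) (use g assms in \<open>auto intro: fsub_subspace\<close>)
  then have "cut (supp_space B) ?h \<in> Lin (supp_space B) W"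
    using cut_Lin[OF fsub_supp_space[OF assms(2)]] by blast
  moreover have "cut (supp_space B) ?h (delta c) = G c" if "c \<in> B" for c
    unfolding cut_in[OF delta_supp[OF that]] using kvp.construct_basis[OF ind, of "delta c" g] g[OF that] that by simp
  ultimately show ?thesis using that by blast
qed

lemma Hom_eqI:
  assumes "f \<in> Hom Q M N" "g \<in> Hom Q M N'" "\<And>i x. x \<in> space_at M i \<Longrightarrow> f i x = g i x"
  shows "f = g"
  by (rule ext, rule ext) (metis assms Hom_out)

text \<open>\<open>en\<close> encodes arrows by numbers, so that paths become lists of numbers and
  can index coordinates of the ambient space; \<open>ht\<close> drives the inductions along
  arrows.\<close>

locale ranked_quiver =
  fixes Q :: "('n::finite, 'a) pre_digraph" and en :: "'a \<Rightarrow> nat" and ht :: "'n \<Rightarrow> nat"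
  assumes fin: "finite (arcs Q)" and en_inj: "inj_on en (arcs Q)"
    and ht: "a \<in> arcs Q \<Longrightarrow> ht (tail Q a) < ht (head Q a)"
begin

definition de :: "nat \<Rightarrow> 'a" where "de e = inv_into (arcs Q) en e"

lemma de_en [simp]: "a \<in> arcs Q \<Longrightarrow> de (en a) = a" by (simp add: de_def en_inj)

text \<open>Basis of the projective module with \<open>r j\<close> generators at each vertex \<open>j\<close>: \<open>(j, m, p)\<close> stands for the
  \<open>m\<close>-th generator at the start of the path \<open>p\<close>, moved along \<open>p\<close>, which ends in \<open>j\<close> and is listed backwards.\<close>

inductive_set PF :: "('n \<Rightarrow> nat) \<Rightarrow> ('n \<times> nat \<times> nat list) set" for r where
  base: "m < r j \<Longrightarrow> (j, m, []) \<in> PF r"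
| step: "a \<in> arcs Q \<Longrightarrow> (tail Q a, m, p) \<in> PF r \<Longrightarrow> (head Q a, m, en a # p) \<in> PF r"

definition cd :: "nat \<Rightarrow> nat list \<Rightarrow> nat" where "cd m p = to_nat (m, p)"
lemma cd_eq [simp]: "cd m p = cd m' p' \<longleftrightarrow> m = m' \<and> p = p'" by (simp add: cd_def)

definition CF :: "('n \<Rightarrow> nat) \<Rightarrow> 'n \<Rightarrow> nat set" where "CF r j = {cd m p | m p. (j, m, p) \<in> PF r}"

definition dc :: "nat \<Rightarrow> nat \<times> nat list" where "dc c = from_nat c"
lemma dc_cd [simp]: "dc (cd m p) = (m, p)" by (simp add: dc_def cd_def)

definition bump :: "'a \<Rightarrow> nat \<Rightarrow> nat" where "bump a c = cd (fst (dc c)) (en a # snd (dc c))"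
definition unbump :: "nat \<Rightarrow> nat" where "unbump c = cd (fst (dc c)) (tl (snd (dc c)))"

lemma bump_cd [simp]: "bump a (cd m p) = cd m (en a # p)" and unbump_cd [simp]: "unbump (cd m p) = cd m (tl p)"
  by (simp_all add: bump_def unbump_def)

lemma bump_CF: "a \<in> arcs Q \<Longrightarrow> c \<in> CF r (tail Q a) \<Longrightarrow> bump a c \<in> CF r (head Q a)"
  by (auto simp: CF_def intro: PF.step)

lemma CF_finite: "finite (CF r j)"
proof (induction "ht j" arbitrary: j rule: less_induct)
  case less
  have "CF r j \<subseteq> (\<lambda>m. cd m []) ` {..<r j} \<union> (\<Union>a\<in>{a \<in> arcs Q. head Q a = j}. bump a ` CF r (tail Q a))"
  proof
    fix c assume "c \<in> CF r j"
    then obtain m p where c: "c = cd m p" "(j, m, p) \<in> PF r" by (auto simp: CF_def)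
    from c(2) show "c \<in> (\<lambda>m. cd m []) ` {..<r j} \<union> (\<Union>a\<in>{a \<in> arcs Q. head Q a = j}. bump a ` CF r (tail Q a))"
    proof cases
      case base
      then show ?thesis using c by auto
    next
      case (step a p')
      then have "cd m p' \<in> CF r (tail Q a)" "c = bump a (cd m p')" using c by (auto simp: CF_def)
      then show ?thesis using step by blast
    qed
  qed
  moreover have "finite (CF r (tail Q a))" if "a \<in> arcs Q" "head Q a = j" for a
    using less ht[OF that(1)] that(2) by simp
  ultimately show ?case using fin by (auto intro: finite_subset)
qed

definition PM :: "('n \<Rightarrow> nat) \<Rightarrow> ('n, 'a, 'k::{field,finite}) rep" where
  "PM r = \<lparr>space_at = (\<lambda>j. supp_space (CF r j)),
     map_at = (\<lambda>a x c. if c \<in> bump a ` CF r (tail Q a) then x (unbump c) else 0)\<rparr>"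

lemma PM_space: "space_at (PM r) j = supp_space (CF r j)" by (simp add: PM_def)

lemma PM_rep: "is_rep Q (PM r :: ('n, 'a, 'k::{field,finite}) rep)"
  unfolding is_rep_iff
proof (intro conjI allI ballI)
  fix a assume a: "a \<in> arcs Q"
  show "linear_between (space_at (PM r :: ('n, 'a, 'k) rep) (tail Q a)) (space_at (PM r :: ('n, 'a, 'k) rep) (head Q a)) (map_at (PM r) a)"
    by (rule linear_betweenI)
      (use bump_CF[OF a] in \<open>auto simp: PM_def supp_space_def kscale_def fun_eq_iff\<close>)
qed (simp add: PM_space fsub_supp_space CF_finite)

lemma PM_map_delta: "a \<in> arcs Q \<Longrightarrow> (tail Q a, m, p) \<in> PF r \<Longrightarrow> map_at (PM r) a (delta (cd m p)) = delta (cd m (en a # p))"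
proof (rule ext)
  fix c
  assume a: "a \<in> arcs Q" "(tail Q a, m, p) \<in> PF r"
  then have "cd m p \<in> CF r (tail Q a)" by (auto simp: CF_def)
  then have "bump a (cd m p) \<in> bump a ` CF r (tail Q a)" by (rule imageI)
  moreover have "unbump c = cd m p \<longleftrightarrow> c = cd m (en a # p)" if "c \<in> bump a ` CF r (tail Q a)"
    using that by (auto simp: CF_def)
  ultimately show "map_at (PM r) a (delta (cd m p)) c = delta (cd m (en a # p)) c"
    by (auto simp: PM_def delta_def)
qed

text \<open>Freeness: the images of the generators may be prescribed arbitrarily. \<open>pv\<close>
  carries such an image along a path, undoing the backward listing by recursion.\<close>

lemma PM_hom:
  fixes N :: "('n, 'a, 'k::{field,finite}) rep"
  assumes N: "is_rep Q N" and n: "\<And>j m. m < r j \<Longrightarrow> n j m \<in> space_at N j"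
  obtains h where "h \<in> Hom Q (PM r) N" "\<And>j m. m < r j \<Longrightarrow> h j (delta (cd m [])) = n j m"
proof -
  define pv where "pv = rec_list (\<lambda>j m. n j m) (\<lambda>e p rec j m. map_at N (de e) (rec (tail Q (de e)) m))"
  have pv: "pv [] j m = n j m" "pv (e # p) j m = map_at N (de e) (pv p (tail Q (de e)) m)" for j m e p
    by (simp_all add: pv_def)
  have pv_in: "pv p j m \<in> space_at N j" if "(j, m, p) \<in> PF r" for j m p
    using that by induction (auto simp: pv n rep_map_in[OF N])
  have "\<exists>h. h \<in> Lin (supp_space (CF r j)) (space_at N j) \<and> (\<forall>c\<in>CF r j. h (delta c) = pv (snd (dc c)) j (fst (dc c)))" for j
    by (rule lb_lift[OF rep_fsub[OF N, of j] CF_finite, of r j "\<lambda>c. pv (snd (dc c)) j (fst (dc c))"])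
      (auto simp: CF_def pv_in)
  then obtain h where h: "\<And>j. h j \<in> Lin (supp_space (CF r j)) (space_at N j)"
     "\<And>j c. c \<in> CF r j \<Longrightarrow> h j (delta c) = pv (snd (dc c)) j (fst (dc c))" by metis
  have hd: "h j (delta (cd m p)) = pv p j m" if "(j, m, p) \<in> PF r" for j m p
    using h(2)[of "cd m p" j] that by (auto simp: CF_def)
  have "h \<in> Hom Q (PM r) N"
    unfolding Hom_iff
  proof (intro conjI allI ballI)
    show "h i \<in> Lin (space_at (PM r) i) (space_at N i)" for i using h(1) by (simp add: PM_space)
    fix a x assume a: "a \<in> arcs Q" and x: "x \<in> space_at (PM r :: ('n, 'a, 'k) rep) (tail Q a)"
    show "h (head Q a) (map_at (PM r) a x) = map_at N a (h (tail Q a) x)"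
    proof (rule lb_eq_on_delta[OF CF_finite, where f = "\<lambda>x. h (head Q a) (map_at (PM r) a x)"
          and g = "\<lambda>x. map_at N a (h (tail Q a) x)"])
      show "linear_between (supp_space (CF r (tail Q a))) (space_at N (head Q a)) (\<lambda>x. h (head Q a) (map_at (PM r) a x))"
        using lb_comp[OF rep_map[OF PM_rep a] Lin_lb[OF h(1)[of "head Q a", folded PM_space]]] by (simp add: PM_space)
      show "linear_between (supp_space (CF r (tail Q a))) (space_at N (head Q a)) (\<lambda>x. map_at N a (h (tail Q a) x))"
        by (rule lb_comp[OF Lin_lb[OF h(1)] rep_map[OF N a]])
      fix c assume "c \<in> CF r (tail Q a)"
      then obtain m p where c: "c = cd m p" "(tail Q a, m, p) \<in> PF r" by (auto simp: CF_def)
      show "h (head Q a) (map_at (PM r) a (delta c)) = map_at N a (h (tail Q a) (delta c))"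
        unfolding c(1) PM_map_delta[OF a c(2)] hd[OF c(2)] hd[OF PF.step[where r=r, OF a c(2)]] pv de_en[OF a] ..
    qed (use x in \<open>simp add: PM_space\<close>)
  qed
  moreover have "h j (delta (cd m [])) = n j m" if "m < r j" for j m
    using hd[OF PF.base[where r=r, OF that]] by (simp add: pv)
  ultimately show ?thesis using that by blast
qed

lemma PM_hom_unique:
  fixes N :: "('n, 'a, 'k::{field,finite}) rep"
  assumes f: "f \<in> Hom Q (PM r) N" and g: "g \<in> Hom Q (PM r) N"
    and eq: "\<And>j m. m < r j \<Longrightarrow> f j (delta (cd m [])) = g j (delta (cd m []))"
  shows "f = g"
proof (rule Hom_eqI[OF f g])
  have d: "f j (delta (cd m p)) = g j (delta (cd m p))" if "(j, m, p) \<in> PF r" for j m p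
    using that
  proof induction
    case (step a m p)
    have "delta (cd m p) \<in> space_at (PM r :: ('n, 'a, 'k) rep) (tail Q a)"
      using step by (auto simp: PM_space CF_def intro!: delta_supp)
    then show ?case
      using Hom_comm[OF f step(1)] Hom_comm[OF g step(1)] step PM_map_delta[OF step(1,2)] by metis
  qed (rule eq)
  fix i x assume x: "x \<in> space_at (PM r :: ('n, 'a, 'k) rep) i"
  show "f i x = g i x"
    by (rule lb_eq_on_delta[OF CF_finite Hom_lb[OF f, of i, unfolded PM_space] Hom_lb[OF g, of i, unfolded PM_space]])
      (use x d in \<open>auto simp: CF_def PM_space\<close>)
qed

lemma PM_projective: "projective_rep Q (PM r :: ('n, 'a, 'k::{field,finite}) rep)"
  unfolding projective_rep_def
proof (intro conjI PM_rep allI impI, elim conjE)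
  fix L N :: "('n, 'a, 'k) rep" and q g
  assume L: "is_rep Q L" and N: "is_rep Q N" and q: "q \<in> Hom Q L N" and epi: "epi_hom L N q" and g: "g \<in> Hom Q (PM r) N"
  define n where "n j m = (SOME y. y \<in> space_at L j \<and> q j y = g j (delta (cd m [])))" for j m
  have n: "n j m \<in> space_at L j \<and> q j (n j m) = g j (delta (cd m []))" if m: "m < r j" for j m
  proof -
    have "delta (cd m []) \<in> space_at (PM r :: ('n, 'a, 'k) rep) j"
      using PF.base[where r=r, OF m] by (auto simp: PM_space CF_def intro!: delta_supp)
    then have "g j (delta (cd m [])) \<in> q j ` space_at L j" using Hom_in[OF g] epi by (simp add: epi_hom_def)
    then have "\<exists>y. y \<in> space_at L j \<and> q j y = g j (delta (cd m []))" by force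
    then show ?thesis unfolding n_def by (rule someI_ex)
  qed
  obtain h where h: "h \<in> Hom Q (PM r) L" "\<And>j m. m < r j \<Longrightarrow> h j (delta (cd m [])) = n j m"
    by (rule PM_hom[OF L, of r n]) (use n in blast)+
  have "comp_hom q h = g"
    by (rule PM_hom_unique[OF comp_hom_Hom[OF h(1) q rep_fsub[OF L]] g]) (use h n in \<open>simp add: comp_hom_def\<close>)
  then show "\<exists>h\<in>Hom Q (PM r) L. comp_hom q h = g" using h(1) by blast
qed

text \<open>Every element of \<open>M\<close> is used as a generator, which makes the map onto
  without any choice of a generating set.\<close>

lemma projective_presentation:
  fixes M :: "('n, 'a, 'k::{field,finite}) rep"
  assumes M: "is_rep Q M"
  shows "\<exists>K f P g. short_exact Q K f P g M \<and> projective_rep Q P"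
proof -
  define r where "r j = card (space_at M j)" for j
  have "\<exists>n. bij_betw n {0..<r j} (space_at M j)" for j
    unfolding r_def by (rule ex_bij_betw_nat_finite[OF fsub_finite[OF rep_fsub[OF M]]])
  then obtain n where n: "\<And>j. bij_betw (n j) {0..<r j} (space_at M j)" by metis
  have nin: "n j m \<in> space_at M j" if "m < r j" for j m using bij_betwE[OF n[of j]] that by simp
  obtain g where g: "g \<in> Hom Q (PM r) M" "\<And>j m. m < r j \<Longrightarrow> g j (delta (cd m [])) = n j m"
    by (rule PM_hom[OF M nin]) blast+
  let ?P = "PM r :: ('n, 'a, 'k) rep"
  have epi: "epi_hom ?P M g"
    unfolding epi_hom_def
  proof (intro allI equalityI subsetI)
    fix j y assume "y \<in> space_at M j"
    then have "y \<in> n j ` {0..<r j}" using n[of j] by (simp add: bij_betw_def)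
    then obtain m where m: "m < r j" "y = n j m" by auto
    then show "y \<in> g j ` space_at ?P j"
      using g(2)[OF m(1)] PF.base[where r=r, OF m(1)]
      by (intro image_eqI[of _ _ "delta (cd m [])"]) (auto simp: PM_space CF_def intro!: delta_supp)
  qed (use Hom_in[OF g(1)] in blast)
  define K :: "('n, 'a, 'k) rep" where "K = \<lparr>space_at = (\<lambda>j. {x \<in> space_at ?P j. g j x = 0}), map_at = map_at ?P\<rparr>"
  have Kin: "x \<in> space_at K j \<longleftrightarrow> x \<in> space_at ?P j \<and> g j x = 0" for x j by (simp add: K_def)
  have Kmap: "map_at K = map_at ?P" by (simp add: K_def)
  note P = PM_rep[where 'k='k, of r]
  have K: "is_rep Q K"
    unfolding is_rep_iff
  proof (intro conjI allI ballI)
    show "fsub (space_at K i)" for i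
    proof (rule fsubI)
      show "finite (space_at K i)" using fsub_finite[OF rep_fsub[OF P, of i]] by (simp add: K_def)
      show "0 \<in> space_at K i" using fsub_zero[OF rep_fsub[OF P, of i]] lb_zero[OF Hom_lb[OF g(1)] rep_fsub[OF P, of i]]
        by (simp add: Kin)
      show "x + y \<in> space_at K i" if "x \<in> space_at K i" "y \<in> space_at K i" for x y
        using that fsub_add[OF rep_fsub[OF P, of i]] lb_add[OF Hom_lb[OF g(1)], of x i y] by (simp add: Kin)
      show "kscale c x \<in> space_at K i" if "x \<in> space_at K i" for c x
        using that fsub_scale[OF rep_fsub[OF P, of i]] lb_scale[OF Hom_lb[OF g(1)], of x i c] by (simp add: Kin)
    qed
    fix a assume a: "a \<in> arcs Q"
    show "linear_between (space_at K (tail Q a)) (space_at K (head Q a)) (map_at K a)"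
    proof (rule linear_betweenI)
      fix x y c assume "x \<in> space_at K (tail Q a)"
      then have x: "x \<in> space_at ?P (tail Q a)" "g (tail Q a) x = 0" by (auto simp: Kin)
      show "map_at K a x \<in> space_at K (head Q a)"
        using rep_map_in[OF P a x(1)] Hom_comm[OF g(1) a x(1)] x(2) lb_zero[OF rep_map[OF M a] rep_fsub[OF M]]
        by (simp add: Kin Kmap)
      show "map_at K a (kscale c x) = kscale c (map_at K a x)" unfolding Kmap by (rule lb_scale[OF rep_map[OF P a] x(1)])
      assume "y \<in> space_at K (tail Q a)"
      then show "map_at K a (x + y) = map_at K a x + map_at K a y"
        unfolding Kmap by (intro lb_add[OF rep_map[OF P a] x(1)]) (simp add: Kin)
    qed
  qed
  define f where "f i = cut (space_at K i) (\<lambda>x. x)" for i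
  have fx: "f i x = x" if "x \<in> space_at K i" for i x unfolding f_def by (rule cut_in[OF that])
  have f: "f \<in> Hom Q K ?P"
    unfolding Hom_iff
  proof (intro conjI allI ballI)
    show "f i \<in> Lin (space_at K i) (space_at ?P i)" for i
      unfolding f_def by (rule cut_Lin[OF rep_fsub[OF K]], rule linear_betweenI) (auto simp: Kin)
    show "f (head Q a) (map_at K a x) = map_at ?P a (f (tail Q a) x)" if "a \<in> arcs Q" "x \<in> space_at K (tail Q a)" for a x
      unfolding fx[OF that(2)] fx[OF rep_map_in[OF K that]] unfolding Kmap ..
  qed
  have "f i ` space_at K i = {x \<in> space_at ?P i. g i x = 0}" for i
  proof -
    have "f i ` space_at K i = space_at K i" using fx by simp
    then show ?thesis by (auto simp: Kin)
  qed
  moreover have "mono_hom K f" unfolding mono_hom_def using fx by (auto intro: inj_onI)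
  ultimately have "short_exact Q K f ?P g M"
    unfolding short_exact_def using K P M f g(1) epi by blast
  then show ?thesis using PM_projective by blast
qed

end

section \<open>Injective modules and socles\<close>


context ranked_quiver
begin

text \<open>Basis of the injective module at the vertex \<open>i\<close>: the paths from \<open>j\<close> to \<open>i\<close>.\<close>

inductive_set PT :: "'n \<Rightarrow> ('n \<times> nat list) set" for i where
  base: "(i, []) \<in> PT i"
| step: "a \<in> arcs Q \<Longrightarrow> (head Q a, p) \<in> PT i \<Longrightarrow> (tail Q a, en a # p) \<in> PT i"

definition CT :: "'n \<Rightarrow> 'n \<Rightarrow> nat set" where "CT i j = {cd 0 p | p. (j, p) \<in> PT i}"

lemma CT_finite: "finite (CT i j)"
proof (induction "Max (range ht) - ht j" arbitrary: j rule: less_induct)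
  case less
  have "CT i j \<subseteq> {cd 0 []} \<union> (\<Union>a\<in>{a \<in> arcs Q. tail Q a = j}. bump a ` CT i (head Q a))"
  proof
    fix c assume "c \<in> CT i j"
    then obtain p where c: "c = cd 0 p" "(j, p) \<in> PT i" by (auto simp: CT_def)
    from c(2) show "c \<in> {cd 0 []} \<union> (\<Union>a\<in>{a \<in> arcs Q. tail Q a = j}. bump a ` CT i (head Q a))"
    proof cases
      case base
      then show ?thesis using c by auto
    next
      case (step a p')
      then have "cd 0 p' \<in> CT i (head Q a)" "c = bump a (cd 0 p')" using c by (auto simp: CT_def)
      then show ?thesis using step by blast
    qed
  qed
  moreover have "finite (CT i (head Q a))" if "a \<in> arcs Q" "tail Q a = j" for a
  proof (rule less)
    have "ht (head Q a) \<le> Max (range ht)" by simp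
    moreover have "ht j < ht (head Q a)" using ht[OF that(1)] that(2) by simp
    ultimately show "Max (range ht) - ht (head Q a) < Max (range ht) - ht j" by linarith
  qed
  ultimately show ?case using fin by (auto intro: finite_subset)
qed

text \<open>A vector at \<open>j\<close> is a function on the paths from \<open>j\<close> to
  \<open>i\<close>, and an arrow acts by restricting it to the paths that begin with that arrow: the
  dual of a space of paths.\<close>

definition IM :: "'n \<Rightarrow> ('n, 'a, 'k::{field,finite}) rep" where
  "IM i = \<lparr>space_at = (\<lambda>j. supp_space (CT i j)),
     map_at = (\<lambda>a x c. if c \<in> CT i (head Q a) then x (bump a c) else 0)\<rparr>"

lemma IM_space: "space_at (IM i) j = supp_space (CT i j)" by (simp add: IM_def)

lemma IM_map: "map_at (IM i) a x c = (if c \<in> CT i (head Q a) then x (bump a c) else 0)" by (simp add: IM_def)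

lemma IM_rep: "is_rep Q (IM i :: ('n, 'a, 'k::{field,finite}) rep)"
  unfolding is_rep_iff
proof (intro conjI allI ballI)
  fix a assume a: "a \<in> arcs Q"
  show "linear_between (space_at (IM i :: ('n, 'a, 'k) rep) (tail Q a)) (space_at (IM i :: ('n, 'a, 'k) rep) (head Q a)) (map_at (IM i) a)"
    by (rule linear_betweenI) (auto simp: IM_def supp_space_def kscale_def fun_eq_iff)
qed (simp add: IM_space fsub_supp_space CT_finite)

text \<open>A homomorphism into \<open>IM i\<close> is governed by one linear functional on the
  space at \<open>i\<close>: its coordinate at a path is this functional after transport along the
  path. Extending the functional from \<open>L\<close> to \<open>N\<close> extends the
  homomorphism.\<close>

lemma IM_injective: "injective_rep Q (IM i :: ('n, 'a, 'k::{field,finite}) rep)"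
  unfolding injective_rep_def
proof (intro conjI IM_rep allI impI, elim conjE)
  fix L N :: "('n, 'a, 'k) rep" and f g
  assume L: "is_rep Q L" and N: "is_rep Q N" and f: "f \<in> Hom Q L N" and mono: "mono_hom L f" and g: "g \<in> Hom Q L (IM i)"
  let ?I = "IM i :: ('n, 'a, 'k) rep"
  have inj: "inj_on (f i) (space_at L i)" using mono by (simp add: mono_hom_def)
  \<comment> \<open>The coordinate of \<open>e\<close> at the empty path is the extended
    functional.\<close>
  obtain e where e: "linear_between UNIV (space_at ?I i) e" "\<And>x. x \<in> space_at L i \<Longrightarrow> e (f i x) = g i x"
    by (rule linear_extend[OF rep_fsub[OF L] rep_fsub[OF IM_rep] Hom_lb[OF f] inj Hom_lb[OF g]]) blast
  define wv :: "('n, 'a, 'k) rep \<Rightarrow> nat list \<Rightarrow> 'k kvec \<Rightarrow> 'k kvec"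
    where "wv R = rec_list (\<lambda>x. x) (\<lambda>a p rec x. rec (map_at R (de a) x))" for R
  have wv: "wv R [] x = x" "wv R (a # p) x = wv R p (map_at R (de a) x)" for R a p x by (simp_all add: wv_def)
  have wv_lb: "linear_between (space_at R j) (space_at R i) (wv R p)" if "(j, p) \<in> PT i" "is_rep Q R" for R j p
    using that
  proof induction
    case base
    show ?case by (rule linear_betweenI) (auto simp: wv)
  next
    case (step a p)
    have "wv R (en a # p) = (\<lambda>x. wv R p (map_at R a x))" using step by (simp add: wv fun_eq_iff)
    then show ?case using lb_comp[OF rep_map[OF step(4,1)] step(3)[OF step(4)]] by simp
  qed
  define h where "h j = cut (space_at N j) (\<lambda>x c. if c \<in> CT i j then e (wv N (snd (dc c)) x) (cd 0 []) else 0)" for j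
  have hval: "h j x (cd 0 p) = e (wv N p x) (cd 0 [])" if "x \<in> space_at N j" "(j, p) \<in> PT i" for j x p
    using that by (auto simp: h_def CT_def)
  have hout: "h j x c = 0" if "c \<notin> CT i j" for j x c using that by (auto simp: h_def cut_def)
  have hH: "h \<in> Hom Q N ?I"
    unfolding Hom_iff
  proof (intro conjI allI ballI)
    fix j
    have "linear_between (space_at N j) (space_at ?I j)
       (\<lambda>x c. if c \<in> CT i j then e (wv N (snd (dc c)) x) (cd 0 []) else 0)"
    proof (rule linear_betweenI)
      fix x y k assume x: "x \<in> space_at N j"
      show "(\<lambda>c. if c \<in> CT i j then e (wv N (snd (dc c)) x) (cd 0 []) else 0) \<in> space_at ?I j"
        by (simp add: IM_space supp_space_def)
      have lbe: "linear_between (space_at N j) (space_at ?I i) (\<lambda>x. e (wv N p x))" if "(j, p) \<in> PT i" for p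
        using lb_comp[OF wv_lb[OF that N], of "space_at ?I i" e] e(1) by (auto simp: linear_between_def)
      show "(\<lambda>c. if c \<in> CT i j then e (wv N (snd (dc c)) (kscale k x)) (cd 0 []) else 0)
        = kscale k (\<lambda>c. if c \<in> CT i j then e (wv N (snd (dc c)) x) (cd 0 []) else 0)"
        by (rule ext) (use lb_scale[OF lbe x] in \<open>auto simp: CT_def kscale_def\<close>)
      assume y: "y \<in> space_at N j"
      show "(\<lambda>c. if c \<in> CT i j then e (wv N (snd (dc c)) (x + y)) (cd 0 []) else 0)
        = (\<lambda>c. if c \<in> CT i j then e (wv N (snd (dc c)) x) (cd 0 []) else 0)
          + (\<lambda>c. if c \<in> CT i j then e (wv N (snd (dc c)) y) (cd 0 []) else 0)"
        by (rule ext) (use lb_add[OF lbe x y] in \<open>auto simp: CT_def\<close>)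
    qed
    then show "h j \<in> Lin (space_at N j) (space_at ?I j)" unfolding h_def by (rule cut_Lin[OF rep_fsub[OF N]])
  next
    fix a x assume a: "a \<in> arcs Q" and x: "x \<in> space_at N (tail Q a)"
    show "h (head Q a) (map_at N a x) = map_at ?I a (h (tail Q a) x)"
    proof
      fix c
      show "h (head Q a) (map_at N a x) c = map_at ?I a (h (tail Q a) x) c"
      proof (cases "c \<in> CT i (head Q a)")
        case True
        then obtain p where p: "c = cd 0 p" "(head Q a, p) \<in> PT i" by (auto simp: CT_def)
        have "h (head Q a) (map_at N a x) c = e (wv N p (map_at N a x)) (cd 0 [])"
          unfolding p(1) by (rule hval[OF rep_map_in[OF N a x] p(2)])
        also have "\<dots> = h (tail Q a) x (cd 0 (en a # p))"
          using hval[OF x PT.step[OF a p(2)]] a by (simp add: wv)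
        finally show ?thesis using True p(1) by (simp add: IM_map)
      next
        case False
        then show ?thesis by (simp add: IM_map hout)
      qed
    qed
  qed
  have gval: "g i (wv L p x) (cd 0 []) = g j x (cd 0 p)" if "(j, p) \<in> PT i" "x \<in> space_at L j" for j p x
    using that
  proof (induction arbitrary: x)
    case (step a p)
    have "g i (wv L (en a # p) x) (cd 0 []) = g (head Q a) (map_at L a x) (cd 0 p)"
      using step rep_map_in[OF L step(1,4)] by (simp add: wv)
    also have "\<dots> = g (tail Q a) x (cd 0 (en a # p))"
      using Hom_comm[OF g step(1,4)] step(2) by (auto simp: IM_map CT_def)
    finally show ?case .
  qed (simp add: wv)
  have wvf: "wv N p (f j x) = f i (wv L p x)" if "(j, p) \<in> PT i" "x \<in> space_at L j" for j p x
    using that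
  proof (induction arbitrary: x)
    case (step a p)
    have "wv N (en a # p) (f (tail Q a) x) = wv N p (f (head Q a) (map_at L a x))"
      using Hom_comm[OF f step(1,4)] step(1) by (simp add: wv)
    also have "\<dots> = f i (wv L (en a # p) x)" using step(3)[OF rep_map_in[OF L step(1,4)]] step(1) by (simp add: wv)
    finally show ?case .
  qed (simp add: wv)
  have "comp_hom h f = g"
  proof (rule Hom_eqI[OF comp_hom_Hom[OF f hH rep_fsub[OF N]] g])
    fix j x assume x: "x \<in> space_at L j"
    show "comp_hom h f j x = g j x"
    proof
      fix c
      show "comp_hom h f j x c = g j x c"
      proof (cases "c \<in> CT i j")
        case True
        then obtain p where p: "c = cd 0 p" "(j, p) \<in> PT i" by (auto simp: CT_def)
        have "wv L p x \<in> space_at L i" by (rule lb_in[OF wv_lb[OF p(2) L] x])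
        then show ?thesis
          using hval[OF Hom_in[OF f x] p(2)] wvf[OF p(2) x] gval[OF p(2) x] e(2) by (simp add: comp_hom_def p(1))
      next
        case False
        then show ?thesis using Hom_in[OF g x] hout by (simp add: comp_hom_def IM_space supp_space_def)
      qed
    qed
  qed
  then show "\<exists>h\<in>Hom Q N ?I. comp_hom h f = g" using hH by blast
qed

text \<open>A simple submodule is concentrated at one vertex, since its component at a vertex of
  maximal rank in its support is already a submodule. Conversely, a nonzero vector killed by all
  outgoing arrows spans a simple submodule.\<close>

lemma soc_eq:
  fixes M :: "('n, 'a, 'k::{field,finite}) rep"
  assumes M: "is_rep Q M"
  shows "soc Q M j = {x \<in> space_at M j. \<forall>a\<in>arcs Q. tail Q a = j \<longrightarrow> map_at M a x = 0}" (is "_ = ?S")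
proof
  have fS: "fsub ?S"
    by (rule fsubI)
      (use rep_fsub[OF M, of j] lb_zero[OF rep_map[OF M] rep_fsub[OF M]] lb_add[OF rep_map[OF M]] lb_scale[OF rep_map[OF M]]
        in \<open>auto simp: fsub_zero fsub_add fsub_scale fsub_finite\<close>)
  have in0: "0 \<in> space_at M i" for i using fsub_zero[OF rep_fsub[OF M]] .
  show "soc Q M j \<subseteq> ?S"
    unfolding soc_def
  proof (rule kvec.span_minimal[OF subsetI fsub_subspace[OF fS]])
    fix x assume "x \<in> (\<Union>U\<in>{U. simple_submodule Q M U}. U j)"
    then obtain U where U: "simple_submodule Q M U" and x: "x \<in> U j" by blast
    have sub: "submodule Q M U" and nz: "U \<noteq> (\<lambda>i. {0})"
      and simp: "\<And>W. submodule Q M W \<Longrightarrow> (\<And>i. W i \<subseteq> U i) \<Longrightarrow> W = (\<lambda>i. {0}) \<or> W = U"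
      using U by (auto simp: simple_submodule_def)
    have Us: "kvec.subspace (U i)" "U i \<subseteq> space_at M i" for i using sub by (auto simp: submodule_def)
    have Uz: "0 \<in> U i" for i using kvec.subspace_0[OF Us(1)] .
    define V where "V = {i. U i \<noteq> {0}}"
    have "V \<noteq> {}" using nz by (auto simp: V_def)
    then have "Max (ht ` V) \<in> ht ` V" by (intro Max_in) auto
    then obtain i where i: "i \<in> V" "ht i = Max (ht ` V)" by auto
    have out: "U (head Q a) = {0}" if "a \<in> arcs Q" "tail Q a = i" for a
    proof (rule ccontr)
      assume "U (head Q a) \<noteq> {0}"
      then have "ht (head Q a) \<le> ht i" unfolding i(2) by (intro Max_ge) (auto simp: V_def)
      then show False using ht[OF that(1)] that(2) by simp
    qed
    define W where "W = (\<lambda>l. if l = i then U i else {0})"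
    have "submodule Q M W"
      unfolding submodule_def
    proof (intro conjI allI ballI)
      show "kvec.subspace (W l)" "W l \<subseteq> space_at M l" for l using Us in0 by (auto simp: W_def)
      fix a assume a: "a \<in> arcs Q"
      have "map_at M a ` U (tail Q a) \<subseteq> U (head Q a)" using sub a by (auto simp: submodule_def)
      moreover have "map_at M a 0 = 0" by (rule lb_zero[OF rep_map[OF M a] rep_fsub[OF M]])
      moreover have "head Q a \<noteq> tail Q a" using ht[OF a] by auto
      ultimately show "map_at M a ` W (tail Q a) \<subseteq> W (head Q a)" using out[OF a] Uz by (auto simp: W_def)
    qed
    moreover have "W \<noteq> (\<lambda>i. {0})" using i by (auto simp: W_def V_def fun_eq_iff)
    moreover have "W l \<subseteq> U l" for l using Uz by (auto simp: W_def)
    ultimately have WU: "W = U" using simp by blast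
    have "map_at M a x = 0" if a: "a \<in> arcs Q" "tail Q a = j" for a
    proof (cases "j = i")
      case True
      have "map_at M a x \<in> U (head Q a)" using sub a x by (auto simp: submodule_def image_subset_iff)
      then show ?thesis using out[OF a(1)] a(2) True by simp
    next
      case False
      then have "x = 0" using x fun_cong[OF WU, of j] by (auto simp: W_def)
      then show ?thesis using lb_zero[OF rep_map[OF M a(1)] rep_fsub[OF M]] by simp
    qed
    then show "x \<in> ?S" using x Us(2) by blast
  qed
  show "?S \<subseteq> soc Q M j"
  proof
    fix x assume x: "x \<in> ?S"
    show "x \<in> soc Q M j"
    proof (cases "x = 0")
      case True
      then show ?thesis unfolding soc_def by (simp only: kvec.span_zero)
    next
      case False
      define U where "U = (\<lambda>l. if l = j then kvec.span {x} else {0})"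
      have spx: "kvec.span {x} = range (\<lambda>k. kscale k x)" by (rule kvec.span_singleton)
      have "submodule Q M U"
        unfolding submodule_def
      proof (intro conjI allI ballI)
        show "kvec.subspace (U l)" for l by (simp add: U_def fsub_subspace[OF fsub_zero_space] kvec.subspace_span)
        show "U l \<subseteq> space_at M l" for l using x in0 fsub_scale[OF rep_fsub[OF M]] by (auto simp: U_def spx)
        fix a assume a: "a \<in> arcs Q"
        have "map_at M a (kscale k x) = 0" if "tail Q a = j" for k
          using lb_scale[OF rep_map[OF M a], of x k] x a that by (simp add: kscale_def zero_fun_def)
        moreover have "map_at M a 0 = 0" by (rule lb_zero[OF rep_map[OF M a] rep_fsub[OF M]])
        ultimately show "map_at M a ` U (tail Q a) \<subseteq> U (head Q a)"
          by (auto simp: U_def spx kvec.span_zero)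
      qed
      moreover have "U \<noteq> (\<lambda>i. {0})"
      proof
        assume "U = (\<lambda>i. {0})"
        then have "kvec.span {x} = {0}" by (metis U_def)
        then show False using False kvec.span_base[of x "{x}"] by simp
      qed
      moreover have "W = (\<lambda>i. {0}) \<or> W = U" if W: "submodule Q M W" "\<forall>i. W i \<subseteq> U i" for W
      proof (cases "W j = {0}")
        case True
        have "W i = {0}" for i
        proof (cases "i = j")
          case False
          have "0 \<in> W i" using W(1) by (auto simp: submodule_def intro: kvec.subspace_0)
          moreover have "W i \<subseteq> {0}" using W(2) False by (metis U_def)
          ultimately show ?thesis by blast
        qed (simp add: True)
        then show ?thesis by auto
      next
        case F: False
        have Ws: "kvec.subspace (W i)" for i using W by (auto simp: submodule_def)
        then obtain y where y: "y \<in> W j" "y \<noteq> 0" using F kvec.subspace_0[OF Ws] by blast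
        then have "y \<in> kvec.span {x}" using W(2) by (metis U_def subsetD)
        then obtain k where k: "y = kscale k x" by (auto simp: spx)
        then have "k \<noteq> 0" using y(2) by auto
        have "kscale (inverse k) y = x" using k \<open>k \<noteq> 0\<close> by simp
        then have "x \<in> W j" using kvec.subspace_scale[OF Ws y(1), of "inverse k"] by simp
        then have "kvec.span {x} \<subseteq> W j" by (intro kvec.span_minimal Ws) simp
        then have "W j = U j" using W(2) by (metis U_def subset_antisym)
        moreover have "W i = U i" if "i \<noteq> j" for i
        proof -
          have "W i \<subseteq> {0}" using W(2) that by (metis U_def)
          then show ?thesis using that kvec.subspace_0[OF Ws, of i] by (auto simp: U_def)
        qed
        ultimately show ?thesis by (metis ext)
      qed
      ultimately have "simple_submodule Q M U" by (auto simp: simple_submodule_def)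
      moreover have "x \<in> U j" by (simp add: U_def kvec.span_base)
      ultimately show ?thesis unfolding soc_def by (intro kvec.span_base) blast
    qed
  qed
qed

lemma soc_IM: "dimvec (soc Q (IM i :: ('n, 'a, 'k::{field,finite}) rep)) = axis i 1"
proof -
  have "soc Q (IM i :: ('n, 'a, 'k) rep) j = (if j = i then supp_space {cd 0 []} else {0})" for j
  proof -
    have "(x \<in> supp_space (CT i j) \<and> (\<forall>a\<in>arcs Q. tail Q a = j \<longrightarrow> map_at (IM i) a x = 0))
      \<longleftrightarrow> x \<in> (if j = i then supp_space {cd 0 []} else {0})" for x :: "'k kvec"
    proof
      assume x: "x \<in> supp_space (CT i j) \<and> (\<forall>a\<in>arcs Q. tail Q a = j \<longrightarrow> map_at (IM i) a x = 0)"
      have z: "x c = 0" if "\<not> (c = cd 0 [] \<and> j = i)" for c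
      proof (cases "c \<in> CT i j")
        case True
        then obtain p where p: "c = cd 0 p" "(j, p) \<in> PT i" by (auto simp: CT_def)
        from p(2) show ?thesis
        proof cases
          case base
          then show ?thesis using that p by simp
        next
          case (step a p')
          then have "map_at (IM i) a x (cd 0 p') = 0" using x by (metis zero_fun_apply)
          then show ?thesis using step p by (auto simp: IM_map CT_def)
        qed
      next
        case False
        then show ?thesis using x by (simp add: supp_space_def)
      qed
      show "x \<in> (if j = i then supp_space {cd 0 []} else {0})"
        using z by (auto simp: supp_space_def fun_eq_iff)
    next
      assume x: "x \<in> (if j = i then supp_space {cd 0 []} else {0})"
      have "cd 0 [] \<in> CT i i" by (auto simp: CT_def intro: PT.base)
      then have "x \<in> supp_space (CT i j)"
        using x by (cases "j = i") (simp_all add: supp_space_def, metis)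
      moreover have "map_at (IM i) a x = 0" for a
        using x by (auto simp: IM_map fun_eq_iff supp_space_def CT_def split: if_splits)
      ultimately show "x \<in> supp_space (CT i j) \<and> (\<forall>a\<in>arcs Q. tail Q a = j \<longrightarrow> map_at (IM i) a x = 0)" by blast
    qed
    then show ?thesis unfolding soc_eq[OF IM_rep] IM_space by blast
  qed
  then show ?thesis by (auto simp: vec_eq_iff dimvec_def axis_def dim_supp_single dim_zero_space)
qed

text \<open>One vector is adjoined to \<open>I\<close> at the vertex \<open>j\<close>, with the
  images \<open>y a\<close> prescribed along the outgoing arrows. Extending the identity of
  \<open>I\<close> to this larger module sends the new vector to the wanted element.\<close>

lemma injective_surj:
  fixes I :: "('n, 'a, 'k::{field,finite}) rep"
  assumes inj: "injective_rep Q I" and y: "\<And>a. a \<in> arcs Q \<Longrightarrow> tail Q a = j \<Longrightarrow> y a \<in> space_at I (head Q a)"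
  shows "\<exists>x\<in>space_at I j. \<forall>a\<in>arcs Q. tail Q a = j \<longrightarrow> map_at I a x = y a"
proof -
  have I: "is_rep Q I" using inj by (simp add: injective_rep_def)
  define N :: "('n, 'a, 'k) rep" where
    "N = \<lparr>space_at = (\<lambda>l. {z. l1 z \<in> space_at I l \<and> l2 z \<in> (if l = j then supp_space {0} else {0})}),
      map_at = (\<lambda>a z. jn (map_at I a (l1 z) + kscale (l2 z 0) (if tail Q a = j then y a else 0)) 0)\<rparr>"
  have Nin: "z \<in> space_at N l \<longleftrightarrow> l1 z \<in> space_at I l \<and> l2 z \<in> (if l = j then supp_space {0} else {0})" for z l
    by (simp add: N_def)
  have Nmap: "map_at N a z = jn (map_at I a (l1 z) + kscale (l2 z 0) (if tail Q a = j then y a else 0)) 0" for a z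
    by (simp add: N_def)
  have S: "fsub (if l = j then supp_space {0} else {0} :: 'k kvec set)" for l
    by (simp add: fsub_supp_space fsub_zero_space)
  have N: "is_rep Q N"
    unfolding is_rep_iff
  proof (intro conjI allI ballI)
    fix l
    let ?S = "if l = j then supp_space {0} else {0} :: 'k kvec set"
    have "space_at N l \<subseteq> (\<lambda>(x, y). jn x y) ` (space_at I l \<times> ?S)"
    proof
      fix z assume "z \<in> space_at N l"
      then show "z \<in> (\<lambda>(x, y). jn x y) ` (space_at I l \<times> ?S)"
        by (intro image_eqI[of _ _ "(l1 z, l2 z)"]) (auto simp: Nin)
    qed
    then have "finite (space_at N l)"
      by (rule finite_subset) (use fsub_finite[OF rep_fsub[OF I]] fsub_finite[OF S] in blast)
    then show "fsub (space_at N l)"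
      by (rule fsubI)
        (simp_all only: Nin l_add fsub_zero[OF rep_fsub[OF I]] fsub_zero[OF S] fsub_add[OF rep_fsub[OF I]] fsub_add[OF S]
          fsub_scale[OF rep_fsub[OF I]] fsub_scale[OF S] simp_thms)
  next
    fix a assume a: "a \<in> arcs Q"
    let ?y = "if tail Q a = j then y a else 0"
    have y': "?y \<in> space_at I (head Q a)" using y[OF a] fsub_zero[OF rep_fsub[OF I]] by simp
    show "linear_between (space_at N (tail Q a)) (space_at N (head Q a)) (map_at N a)"
    proof (rule linear_betweenI)
      fix z w c assume "z \<in> space_at N (tail Q a)"
      then have z: "l1 z \<in> space_at I (tail Q a)" by (simp add: Nin)
      show "map_at N a z \<in> space_at N (head Q a)"
        unfolding Nin Nmap jn_simps
        by (intro conjI fsub_add[OF rep_fsub[OF I]] rep_map_in[OF I a z] fsub_scale[OF rep_fsub[OF I]] y' fsub_zero[OF S])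
      show "map_at N a (kscale c z) = kscale c (map_at N a z)"
        unfolding Nmap l_add lb_scale[OF rep_map[OF I a] z]
        by (rule iffD2[OF jn_eq_iff]) (auto simp: kscale_def fun_eq_iff l1_def l2_def jn_def algebra_simps)
      assume "w \<in> space_at N (tail Q a)"
      then have w: "l1 w \<in> space_at I (tail Q a)" by (simp add: Nin)
      show "map_at N a (z + w) = map_at N a z + map_at N a w"
        unfolding Nmap l_add lb_add[OF rep_map[OF I a] z w]
        by (rule iffD2[OF jn_eq_iff]) (auto simp: kscale_def fun_eq_iff l1_def l2_def jn_def algebra_simps)
    qed
  qed
  define f where "f i = cut (space_at I i) (\<lambda>x. jn x 0)" for i
  define g where "g i = cut (space_at I i) (\<lambda>x. x)" for i
  have fx: "f i x = jn x 0" if "x \<in> space_at I i" for i x unfolding f_def by (rule cut_in[OF that])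
  have gx: "g i x = x" if "x \<in> space_at I i" for i x unfolding g_def by (rule cut_in[OF that])
  have jnz: "kscale (l2 (jn x 0) 0) u = 0" for x u :: "'k kvec" by (simp add: kscale_def fun_eq_iff)
  have f: "f \<in> Hom Q I N"
    unfolding Hom_iff
  proof (intro conjI allI ballI)
    show "f i \<in> Lin (space_at I i) (space_at N i)" for i
      unfolding f_def
    proof (rule cut_Lin[OF rep_fsub[OF I]], rule linear_betweenI)
      show "jn x 0 \<in> space_at N i" if "x \<in> space_at I i" for x
        unfolding Nin jn_simps using that fsub_zero[OF S] by blast
    qed (auto simp: jn_def kscale_def fun_eq_iff)
    show "f (head Q a) (map_at I a x) = map_at N a (f (tail Q a) x)" if "a \<in> arcs Q" "x \<in> space_at I (tail Q a)" for a x
      unfolding fx[OF that(2)] fx[OF rep_map_in[OF I that]] Nmap jnz unfolding jn_simps by (simp only: add_0_right)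
  qed
  have mono: "mono_hom I f"
    unfolding mono_hom_def
  proof (intro allI inj_onI)
    fix i x x' assume "x \<in> space_at I i" "x' \<in> space_at I i" "f i x = f i x'"
    then show "x = x'" using fx jn_simps(1) by metis
  qed
  have g: "g \<in> Hom Q I I"
    unfolding Hom_iff
  proof (intro conjI allI ballI)
    show "g i \<in> Lin (space_at I i) (space_at I i)" for i
      unfolding g_def by (rule cut_Lin[OF rep_fsub[OF I]], rule linear_betweenI) auto
    show "g (head Q a) (map_at I a x) = map_at I a (g (tail Q a) x)" if "a \<in> arcs Q" "x \<in> space_at I (tail Q a)" for a x
      unfolding gx[OF that(2)] gx[OF rep_map_in[OF I that]] ..
  qed
  obtain h where h: "h \<in> Hom Q N I" "comp_hom h f = g"
    using inj I N f mono g unfolding injective_rep_def by blast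
  have hf: "h i (jn x 0) = x" if "x \<in> space_at I i" for i x
    using fun_cong[OF fun_cong[OF h(2), of i], of x] fx[OF that] gx[OF that] by (simp add: comp_hom_def)
  define u :: "'k kvec" where "u = jn 0 (delta 0)"
  have u: "u \<in> space_at N j"
    unfolding Nin u_def jn_simps using fsub_zero[OF rep_fsub[OF I]] by (auto simp: delta_supp)
  have "map_at I a (h j u) = y a" if a: "a \<in> arcs Q" "tail Q a = j" for a
  proof -
    have "map_at I a (h j u) = h (head Q a) (map_at N a u)" using Hom_comm[OF h(1) a(1), of u] u a(2) by simp
    also have "map_at N a u = jn (y a) 0"
      unfolding Nmap u_def jn_simps lb_zero[OF rep_map[OF I a(1)] rep_fsub[OF I]]
      using a(2) by (simp add: delta_def kscale_def)
    also have "h (head Q a) (jn (y a) 0) = y a" by (rule hf[OF y[OF a]])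
    finally show ?thesis .
  qed
  then show ?thesis using Hom_in[OF h(1) u] by blast
qed

text \<open>The socle at \<open>j\<close> is the kernel of the joint map along the outgoing arrows,
  which is onto by \<open>injective_surj\<close>; the rest is counting.\<close>

lemma soc_dim_injective:
  fixes I :: "('n, 'a, 'k::{field,finite}) rep"
  assumes inj: "injective_rep Q I"
  shows "int (kvec.dim (soc Q I j)) = int (kvec.dim (space_at I j))
     - (\<Sum>a\<in>{a \<in> arcs Q. tail Q a = j}. int (kvec.dim (space_at I (head Q a))))"
proof -
  have I: "is_rep Q I" using inj by (simp add: injective_rep_def)
  let ?A = "{a \<in> arcs Q. tail Q a = j}"
  let ?S = "{x \<in> space_at I j. \<forall>a\<in>arcs Q. tail Q a = j \<longrightarrow> map_at I a x = 0}"
  define D where "D x = restrict (\<lambda>a. map_at I a x) ?A" for x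
  have finA: "finite ?A" using fin by simp
  have "D ` space_at I j = PiE ?A (\<lambda>a. space_at I (head Q a))"
  proof (intro equalityI subsetI)
    fix e assume "e \<in> D ` space_at I j"
    then show "e \<in> PiE ?A (\<lambda>a. space_at I (head Q a))" using rep_map_in[OF I] by (auto simp: D_def)
  next
    fix e assume e: "e \<in> PiE ?A (\<lambda>a. space_at I (head Q a))"
    then obtain x where x: "x \<in> space_at I j" "\<And>a. a \<in> arcs Q \<Longrightarrow> tail Q a = j \<Longrightarrow> map_at I a x = e a"
      using injective_surj[OF inj, of j e] by (auto simp: PiE_def Pi_def)
    have "D x = e"
      unfolding D_def by (rule ext) (use x e in \<open>auto simp: PiE_def extensional_def restrict_def\<close>)
    then show "e \<in> D ` space_at I j" using x by blast
  qed
  moreover have "card (space_at I j) = card (D ` space_at I j) * card ?S"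
  proof (rule card_quotient)
    show "finite (space_at I j)" by (rule fsub_finite[OF rep_fsub[OF I]])
    show "x + y \<in> space_at I j" if "x \<in> space_at I j" "y \<in> space_at I j" for x y
      using that by (rule fsub_add[OF rep_fsub[OF I]])
    fix x y assume xy: "x \<in> space_at I j" "y \<in> space_at I j"
    have "D x = D y \<longleftrightarrow> (\<forall>a\<in>?A. map_at I a x = map_at I a y)"
      unfolding D_def by (metis (no_types, lifting) restrict_apply' restrict_ext)
    also have "\<dots> \<longleftrightarrow> (\<forall>a\<in>?A. map_at I a (x - y) = 0)"
      using lb_diff[OF rep_map[OF I] rep_fsub[OF I], of _ x y] xy by auto
    finally show "D x = D y \<longleftrightarrow> x - y \<in> ?S" using fsub_diff[OF rep_fsub[OF I] xy] by auto
  qed auto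
  ultimately have c: "card (space_at I j) = (\<Prod>a\<in>?A. card (space_at I (head Q a))) * card ?S"
    using finA by (simp add: card_PiE)
  have "fsub ?S"
    by (rule fsub_subset[OF _ _ rep_fsub[OF I]]) (simp only: soc_eq[OF I, symmetric] soc_def kvec.subspace_span, auto)
  then have cS: "card ?S = CARD('k) ^ kvec.dim ?S" by (rule fsub_card)
  have "CARD('k) ^ kvec.dim (space_at I j) = CARD('k) ^ ((\<Sum>a\<in>?A. kvec.dim (space_at I (head Q a))) + kvec.dim ?S)"
    using c unfolding cS by (simp add: fsub_card[OF rep_fsub[OF I]] power_add power_sum)
  then have "kvec.dim (space_at I j) = (\<Sum>a\<in>?A. kvec.dim (space_at I (head Q a))) + kvec.dim ?S"
    by (simp only: power_CARD_cancel)
  then show ?thesis unfolding soc_eq[OF I] by simp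
qed

end

section \<open>Subspace counts between two subspaces\<close>


definition interval :: "'k::field kvec set \<Rightarrow> 'k kvec set \<Rightarrow> 'k kvec set set" where
  "interval A C = {W. kvec.subspace W \<and> A \<subseteq> W \<and> W \<subseteq> C}"

lemma finite_interval: "finite C \<Longrightarrow> finite (interval A C)"
  by (rule finite_subset[of _ "Pow C"]) (auto simp: interval_def)

lemma span_insert_span: "kvec.span (insert x (kvec.span S)) = kvec.span (insert x S)"
  unfolding kvec.span_insert kvec.span_span ..

lemma fsub_dim_insert:
  fixes V :: "'k::{field,finite} kvec set"
  assumes "fsub V" "x \<notin> V"
  shows "kvec.dim (kvec.span (insert x V)) = Suc (kvec.dim V)"
proof -
  obtain B where B: "B \<subseteq> V" "finite B" "kvec.independent B" "kvec.span B = V" "card B = kvec.dim V"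
    by (rule fsub_basis[OF assms(1)])
  have "kvec.independent (insert x B)" using B assms by (intro kvec.independent_insertI) auto
  moreover have "kvec.span (insert x V) = kvec.span (insert x B)"
    using B(4) span_insert_span[of x B] by simp
  moreover have "x \<notin> B" using assms B(1) by blast
  ultimately show ?thesis using B kvec.dim_span_eq_card_independent[of "insert x B"] by simp
qed

text \<open>The q-Pascal recursion without binomial coefficients: a subspace of \<open>C\<close> not
  inside the hyperplane \<open>C'\<close> meets it in a subspace \<open>V\<close> of one dimension
  less, and over each \<open>V\<close> there is one such subspace for every coset of
  \<open>V\<close> in \<open>C'\<close>.\<close>

lemma interval_sum:
  fixes g :: "nat \<Rightarrow> 'f::ring_1" and C :: "'k::{field,finite} kvec set"
  assumes C': "fsub C'" and A: "kvec.subspace A" "A \<subseteq> C'" and e: "e \<notin> C'" and C: "C = kvec.span (insert e C')"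
  shows "(\<Sum>W\<in>interval A C. g (kvec.dim W))
    = (\<Sum>W\<in>interval A C'. g (kvec.dim W) + of_nat (CARD('k) ^ (kvec.dim C' - kvec.dim W)) * g (Suc (kvec.dim W)))"
proof -
  have finC': "finite C'" by (rule fsub_finite[OF C'])
  have sC': "kvec.subspace C'" by (rule fsub_subspace[OF C'])
  have finC: "finite C" unfolding C by (rule fsub_finite[OF fsub_span]) (simp add: finC')
  have spC': "kvec.span C' = C'" using sC' by simp
  have Cmem: "x \<in> C \<longleftrightarrow> (\<exists>k. x - kscale k e \<in> C')" for x
    unfolding C by (simp add: kvec.span_insert spC')
  have C'C: "C' \<subseteq> C" unfolding C by (meson kvec.span_superset subset_insertI subset_trans)
  let ?N = "{W \<in> interval A C. \<not> W \<subseteq> C'}"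
  have split: "interval A C = interval A C' \<union> ?N" "interval A C' \<inter> ?N = {}"
    using C'C by (auto simp: interval_def)
  have grp: "(\<Sum>W\<in>?N. g (kvec.dim W)) = (\<Sum>V\<in>interval A C'. \<Sum>W\<in>{W \<in> ?N. W \<inter> C' = V}. g (kvec.dim W))"
  proof (rule sum.group[symmetric])
    show "finite ?N" using finite_interval[OF finC] by simp
    show "finite (interval A C')" by (rule finite_interval[OF finC'])
    show "(\<lambda>W. W \<inter> C') ` ?N \<subseteq> interval A C'"
      using A sC' by (auto simp: interval_def intro: kvec.subspace_inter)
  qed
  have fib: "(\<Sum>W\<in>{W \<in> ?N. W \<inter> C' = V}. g (kvec.dim W))
      = of_nat (CARD('k) ^ (kvec.dim C' - kvec.dim V)) * g (Suc (kvec.dim V))" if "V \<in> interval A C'" for V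
  proof -
    have V: "kvec.subspace V" "A \<subseteq> V" "V \<subseteq> C'" using that by (auto simp: interval_def)
    have fV: "fsub V" by (rule fsub_subset[OF V(1,3) C'])
    have spV: "kvec.span V = V" using V(1) by simp
    \<comment> \<open>All subspaces over \<open>V\<close> outside the hyperplane have this form, and
      \<open>D u\<close> depends only on the coset of \<open>u\<close> modulo
      \<open>V\<close>.\<close>
    define D where "D u = kvec.span (insert (e + u) V)" for u
    have Dmem: "x \<in> D u \<longleftrightarrow> (\<exists>k. x - kscale k (e + u) \<in> V)" for x u
      by (simp add: D_def kvec.span_insert spV)
    have eu: "e + u \<notin> C'" if "u \<in> C'" for u
      using kvec.subspace_diff[OF sC' _ that, of "e + u"] e by auto
    have DC': "D u \<inter> C' = V" if u: "u \<in> C'" for u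
    proof (intro equalityI subsetI IntI)
      fix x assume x: "x \<in> D u \<inter> C'"
      then obtain k where k: "x - kscale k (e + u) \<in> V" using Dmem by auto
      have "k = 0"
      proof (rule ccontr)
        assume "k \<noteq> 0"
        have "kscale k (e + u) \<in> C'" using kvec.subspace_diff[OF sC', of x "x - kscale k (e + u)"] x k V(3)
          by (auto simp: algebra_simps)
        then have "kscale (inverse k) (kscale k (e + u)) \<in> C'" by (rule kvec.subspace_scale[OF sC'])
        then show False using eu[OF u] \<open>k \<noteq> 0\<close> by simp
      qed
      then show "x \<in> V" using k by (simp only: kvec.scale_zero_left diff_0_right)
    next
      fix x assume "x \<in> V"
      then show "x \<in> D u" "x \<in> C'" using V(3) kvec.span_base[of x "insert (e + u) V"] by (auto simp: D_def)
    qed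
    have DN: "D u \<in> {W \<in> ?N. W \<inter> C' = V}" if u: "u \<in> C'" for u
    proof -
      have "e + u \<in> C" unfolding Cmem using u by (intro exI[of _ 1]) simp
      then have "D u \<subseteq> C" unfolding D_def using V(3) C'C C by (intro kvec.span_minimal) (auto simp: kvec.subspace_span)
      moreover have "e + u \<in> D u" by (simp add: D_def kvec.span_base)
      moreover have "A \<subseteq> D u" using V(2) DC'[OF u] by blast
      ultimately show ?thesis using eu[OF u] DC'[OF u] by (auto simp: interval_def D_def kvec.subspace_span)
    qed
    have img: "{W \<in> ?N. W \<inter> C' = V} = D ` C'"
    proof (intro equalityI subsetI)
      fix W assume "W \<in> {W \<in> ?N. W \<inter> C' = V}"
      then have W: "kvec.subspace W" "W \<subseteq> C" "\<not> W \<subseteq> C'" "W \<inter> C' = V" by (auto simp: interval_def)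
      then obtain w where w: "w \<in> W" "w \<notin> C'" by blast
      then obtain k where k: "w - kscale k e \<in> C'" using W(2) Cmem by blast
      have "k \<noteq> 0"
      proof
        assume "k = 0"
        then show False using k w(2) by (simp only: kvec.scale_zero_left diff_0_right)
      qed
      define u where "u = kscale (inverse k) (w - kscale k e)"
      have u: "u \<in> C'" unfolding u_def by (rule kvec.subspace_scale[OF sC' k])
      have eu': "e + u = kscale (inverse k) w"
        using \<open>k \<noteq> 0\<close> by (simp only: u_def kvec.scale_right_diff_distrib kvec.scale_scale) simp
      have euW: "e + u \<in> W" unfolding eu' by (rule kvec.subspace_scale[OF W(1) w(1)])
      have "D u \<subseteq> W" unfolding D_def using euW W by (intro kvec.span_minimal) auto
      moreover have "W \<subseteq> D u"
      proof
        fix z assume z: "z \<in> W"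
        then obtain l where l: "z - kscale l e \<in> C'" using W(2) Cmem by blast
        have eq: "z - kscale l (e + u) = (z - kscale l e) - kscale l u" by (simp add: kvec.scale_right_distrib)
        have "z - kscale l (e + u) \<in> C'"
          unfolding eq by (rule kvec.subspace_diff[OF sC' l kvec.subspace_scale[OF sC' u]])
        moreover have "z - kscale l (e + u) \<in> W"
          by (rule kvec.subspace_diff[OF W(1) z kvec.subspace_scale[OF W(1) euW]])
        ultimately show "z \<in> D u" unfolding Dmem using W(4) by blast
      qed
      ultimately show "W \<in> D ` C'" using u by blast
    qed (use DN in blast)
    have "card C' = card (D ` C') * card V"
    proof (rule card_quotient[OF finC' V(3)])
      show "x + y \<in> C'" if "x \<in> C'" "y \<in> C'" for x y using that by (rule kvec.subspace_add[OF sC'])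
      fix x y assume x: "x \<in> C'" and y: "y \<in> C'"
      have one: "D x \<subseteq> D y" if "x - y \<in> V" for x y
      proof -
        have "e + x \<in> D y" unfolding Dmem using that by (intro exI[of _ 1]) simp
        then show ?thesis unfolding D_def[of x]
          by (intro kvec.span_minimal) (auto simp: D_def kvec.subspace_span kvec.span_base)
      qed
      show "D x = D y \<longleftrightarrow> x - y \<in> V"
      proof
        assume xy: "D x = D y"
        have "e + u \<in> D u" for u unfolding D_def by (rule kvec.span_base) simp
        then have "e + x \<in> D y" "e + y \<in> D y" using xy by (metis, metis)
        then have "(e + x) - (e + y) \<in> D y" unfolding D_def by (rule kvec.span_diff)
        then have "x - y \<in> D y" by simp
        moreover have "x - y \<in> C'" by (rule kvec.subspace_diff[OF sC' x y])
        ultimately show "x - y \<in> V" using DC'[OF y] by blast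
      next
        assume xy: "x - y \<in> V"
        then have "y - x \<in> V" using kvec.subspace_neg[OF V(1) xy] by simp
        then show "D x = D y" using one xy by blast
      qed
    qed
    then have "CARD('k) ^ kvec.dim C' = card (D ` C') * CARD('k) ^ kvec.dim V" by (simp add: fsub_card[OF C'] fsub_card[OF fV])
    moreover have "kvec.dim V \<le> kvec.dim C'"
    proof -
      have "CARD('k) ^ kvec.dim V \<le> CARD('k) ^ kvec.dim C'"
        using card_mono[OF finC' V(3)] by (simp only: fsub_card[OF C'] fsub_card[OF fV])
      then show ?thesis using card_UNIV_field_gt1[where 'k='k] by (simp add: power_increasing_iff)
    qed
    ultimately have "card (D ` C') = CARD('k) ^ (kvec.dim C' - kvec.dim V)"
      by (metis le_add_diff_inverse2 mult_cancel_right power_add power_not_zero zero_less_card_finite less_numeral_extra(3))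
    moreover have "kvec.dim W = Suc (kvec.dim V)" if "W \<in> D ` C'" for W
    proof -
      from that obtain u where u: "u \<in> C'" "W = D u" by blast
      have "e + u \<notin> V" using eu[OF u(1)] V(3) by blast
      then show ?thesis unfolding u(2) D_def by (rule fsub_dim_insert[OF fV])
    qed
    ultimately show ?thesis unfolding img by simp
  qed
  have "(\<Sum>W\<in>interval A C. g (kvec.dim W)) = (\<Sum>W\<in>interval A C'. g (kvec.dim W)) + (\<Sum>W\<in>?N. g (kvec.dim W))"
    by (subst split(1), rule sum.union_disjoint)
      (use finite_interval[OF finC'] finite_interval[OF finC] split(2) in auto)
  also have "(\<Sum>W\<in>?N. g (kvec.dim W)) = (\<Sum>V\<in>interval A C'. of_nat (CARD('k) ^ (kvec.dim C' - kvec.dim V)) * g (Suc (kvec.dim V)))"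
    unfolding grp by (rule sum.cong[OF refl]) (rule fib)
  finally show ?thesis by (simp add: sum.distrib)
qed

lemma interval_self: "kvec.subspace A \<Longrightarrow> interval A A = {A}"
  by (auto simp: interval_def)

lemma hyperplane_exists:
  fixes C :: "'k::{field,finite} kvec set"
  assumes C: "fsub C" and A: "kvec.subspace A" "A \<subseteq> C" and d: "kvec.dim C = kvec.dim A + Suc d"
  obtains C' e where "fsub C'" "A \<subseteq> C'" "e \<notin> C'" "C = kvec.span (insert e C')" "kvec.dim C' = kvec.dim A + d"
proof -
  obtain BA where BA: "BA \<subseteq> A" "kvec.independent BA" "A \<subseteq> kvec.span BA" "card BA = kvec.dim A"
    by (rule kvec.basis_exists)
  have "BA \<subseteq> C" using BA(1) A(2) by blast
  obtain B where B: "BA \<subseteq> B" "B \<subseteq> C" "kvec.independent B" "C \<subseteq> kvec.span B"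
    by (rule kvec.maximal_independent_subset_extend[OF \<open>BA \<subseteq> C\<close> BA(2)])
  have finB: "finite B" using B(2) fsub_finite[OF C] finite_subset by blast
  have spB: "kvec.span B = C" using B(2,4) fsub_subspace[OF C] by (meson kvec.span_minimal subset_antisym)
  have cB: "card B = kvec.dim A + Suc d" using kvec.dim_span_eq_card_independent[OF B(3)] spB d by simp
  have "BA \<noteq> B" using cB BA(4) by auto
  then obtain e where e: "e \<in> B" "e \<notin> BA" using B(1) by blast
  let ?C' = "kvec.span (B - {e})"
  have ind: "kvec.independent (B - {e})" using B(3) by (rule kvec.independent_mono) auto
  show ?thesis
  proof
    show "fsub ?C'" by (rule fsub_span) (simp add: finB)
    have "BA \<subseteq> B - {e}" using B(1) e by blast
    then show "A \<subseteq> ?C'" using BA(3) kvec.span_mono by blast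
    show "e \<notin> ?C'" using B(3) e(1) by (auto simp: kvec.dependent_def)
    show "C = kvec.span (insert e ?C')" unfolding span_insert_span using e spB by (simp add: insert_absorb)
    show "kvec.dim ?C' = kvec.dim A + d" using kvec.dim_span_eq_card_independent[OF ind] cB e finB by simp
  qed
qed

context quantum_frame
begin

text \<open>The \<open>q\<close>-binomial theorem, with the coefficients replaced by a sum over subspaces.\<close>

lemma xp_power_interval:
  fixes C :: "'k::{field,finite} kvec set"
  assumes q: "of_nat CARD('k) = v powi 2"
    and C: "fsub C" and A: "kvec.subspace A" "A \<subseteq> C" and d: "kvec.dim C = kvec.dim A + d"
  shows "(\<Sum>W\<in>interval A C. v powi ((int (kvec.dim W) - int (kvec.dim A)) ^ 2 - int d * (int (kvec.dim W) - int (kvec.dim A)))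
      * M (int d *s hi k - (int (kvec.dim W) - int (kvec.dim A)) *s b k)) = xp k ^ d"
  using C A(2) d
proof (induction d arbitrary: C)
  case 0
  have "fsub A" by (rule fsub_subset[OF A(1) 0(2,1)])
  then have "card A = card C" using 0 by (simp add: fsub_card)
  then have "A = C" using 0 by (intro card_subset_eq) (auto simp: fsub_finite)
  then show ?case using A(1) by (simp add: interval_self M_0)
next
  case (Suc d)
  obtain C' e where C': "fsub C'" "A \<subseteq> C'" "e \<notin> C'" "C = kvec.span (insert e C')" "kvec.dim C' = kvec.dim A + d"
    by (rule hyperplane_exists[OF Suc(2) A(1) Suc(3,4)])
  define G where "G d w = v powi ((int w - int (kvec.dim A)) ^ 2 - int d * (int w - int (kvec.dim A)))
      * M (int d *s hi k - (int w - int (kvec.dim A)) *s b k)" for d w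
  \<comment> \<open>Multiplication by the two terms of \<open>xp k\<close> turns the summand of
    dimension \<open>w\<close> into the summands of dimensions \<open>w\<close> and
    \<open>w + 1\<close> for the next power; the number of subspaces is absorbed as an even power of
    \<open>v\<close>.\<close>
  have step: "G (Suc d) w + of_nat (CARD('k) ^ (kvec.dim C' - w)) * G (Suc d) (Suc w) = xp k * G d w"
    if w: "w \<le> kvec.dim C'" for w
  proof -
    define p where "p = int w - int (kvec.dim A)"
    define y where "y = int d *s hi k - p *s b k"
    have qq: "of_nat (CARD('k) ^ (kvec.dim C' - w)) = v powi (2 * (int d - p))"
    proof -
      have "2 * (int d - p) = 2 * int (kvec.dim C' - w)" using w C'(5) by (simp add: p_def)
      then show ?thesis by (simp add: q power_int_mult)
    qed
    have hik: "hi k $ k = - 1" by (simp add: hi_nth)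
    have lo: "lo k = hi k - b k" by (simp add: hi_lo)
    have L1: "L (hi k) y = - p * 1" unfolding y_def by (simp add: L_simps L_scale2 hik)
    have L2: "L (lo k) y = int d - p" unfolding lo L_diff L1 by (simp add: y_def L_b2 hik)
    have e1: "hi k + y = int (Suc d) *s hi k - p *s b k" by (simp add: y_def vec_eq_iff algebra_simps)
    have e2: "lo k + y = int (Suc d) *s hi k - (p + 1) *s b k" by (simp add: y_def lo vec_eq_iff algebra_simps)
    have Gd: "G d w = v powi (p\<^sup>2 - int d * p) * M y" by (simp add: G_def p_def y_def)
    have G1: "G (Suc d) w = v powi (p\<^sup>2 - int (Suc d) * p) * M (int (Suc d) *s hi k - p *s b k)"
      by (simp add: G_def p_def)
    have p1: "int (Suc w) - int (kvec.dim A) = p + 1" by (simp add: p_def)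
    have G2: "G (Suc d) (Suc w) = v powi ((p + 1)\<^sup>2 - int (Suc d) * (p + 1)) * M (int (Suc d) *s hi k - (p + 1) *s b k)"
      unfolding G_def p1 ..
    have "xp k * G d w = v powi (p\<^sup>2 - int d * p) * (xp k * M y)" unfolding Gd by (rule v_left)
    also have "\<dots> = v powi (p\<^sup>2 - int d * p - p) * M (int (Suc d) *s hi k - p *s b k)
        + v powi (p\<^sup>2 - int d * p + (int d - p)) * M (int (Suc d) *s hi k - (p + 1) *s b k)"
      unfolding xp_M L1 L2 e1 e2 by (simp add: distrib_left v_add')
    also have "p\<^sup>2 - int d * p - p = p\<^sup>2 - int (Suc d) * p" by (simp add: algebra_simps)
    also have "p\<^sup>2 - int d * p + (int d - p) = 2 * (int d - p) + ((p + 1)\<^sup>2 - int (Suc d) * (p + 1))"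
      by (simp add: algebra_simps power2_eq_square)
    finally show ?thesis unfolding G1 G2 qq v_add' ..
  qed
  have "(\<Sum>W\<in>interval A C. G (Suc d) (kvec.dim W))
    = (\<Sum>W\<in>interval A C'. G (Suc d) (kvec.dim W) + of_nat (CARD('k) ^ (kvec.dim C' - kvec.dim W)) * G (Suc d) (Suc (kvec.dim W)))"
    by (rule interval_sum[OF C'(1) A(1) C'(2-4)])
  also have "\<dots> = (\<Sum>W\<in>interval A C'. xp k * G d (kvec.dim W))"
  proof (rule sum.cong[OF refl], rule step)
    fix W assume "W \<in> interval A C'"
    then have W: "kvec.subspace W" "W \<subseteq> C'" by (auto simp: interval_def)
    have "CARD('k) ^ kvec.dim W \<le> CARD('k) ^ kvec.dim C'"
      using card_mono[OF fsub_finite[OF C'(1)] W(2)] by (simp only: fsub_card[OF C'(1)] fsub_card[OF fsub_subset[OF W C'(1)]])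
    then show "kvec.dim W \<le> kvec.dim C'" using card_UNIV_field_gt1[where 'k='k] by (simp add: power_increasing_iff)
  qed
  also have "\<dots> = xp k * xp k ^ d"
    unfolding sum_distrib_left[symmetric] using Suc.IH[OF C'(1,2,5)] by (simp add: G_def)
  finally show ?case by (simp add: G_def)
qed

text \<open>Up to a power of \<open>v\<close> the sum is \<open>M c1 * xp k ^ d * M c2\<close>. The
  kth coordinates \<open>s\<close> and \<open>t\<close> of the outer exponents are forced: their sum
  by the total exponent, their difference by the linear term in the power of \<open>v\<close>. That
  both are nonnegative puts the product into the local algebra.\<close>

lemma interval_sum_rng:
  fixes C :: "'k::{field,finite} kvec set"
  assumes q: "of_nat CARD('k) = v powi 2"
    and C: "fsub C" and A: "kvec.subspace A" "A \<subseteq> C" and d: "kvec.dim C = kvec.dim A + d"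
    and s: "0 \<le> s" and t: "0 \<le> t" and st: "s + t = int d + c $ k" "s - t = 2 * int (kvec.dim A) + l + int d"
  shows "(\<Sum>W\<in>interval A C. v powi ((int (kvec.dim W))\<^sup>2 + l * int (kvec.dim W)) * M (c - int (kvec.dim W) *s b k)) \<in> rng {k} {k}"
proof -
  define r where "r = int (kvec.dim A)"
  define c1 where "c1 = (axis k s :: int^'n)"
  define c2 where "c2 = c - r *s b k - int d *s hi k - c1"
  have ck: "c1 $ k = s" "c2 $ k = t" using st(1) by (auto simp: c1_def c2_def hi_nth)
  define u where "u = L c1 (int d *s hi k) + L (c1 + int d *s hi k) c2"
  have trm: "v powi ((int w)\<^sup>2 + l * int w) * M (c - int w *s b k)
     = v powi (r\<^sup>2 + l * r - u) * (M c1 * (v powi ((int w - r)\<^sup>2 - int d * (int w - r)) * M (int d *s hi k - (int w - r) *s b k)) * M c2)"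
    for w
  proof -
    define p where "p = int w - r"
    define y where "y = int d *s hi k - p *s b k"
    have "L c1 y = L c1 (int d *s hi k) + p * s" by (simp add: y_def L_simps L_scale2 ck)
    moreover have "L (c1 + y) c2 = L (c1 + int d *s hi k) c2 - p * t" by (simp add: y_def L_simps L_scale ck algebra_simps)
    ultimately have uu: "L c1 y + L (c1 + y) c2 = u + p * (s - t)" by (simp add: u_def algebra_simps)
    have sum: "c1 + y + c2 = c - int w *s b k" by (simp add: c2_def y_def p_def vec_eq_iff algebra_simps)
    have "M c1 * (v powi (p\<^sup>2 - int d * p) * M y) * M c2 = v powi (p\<^sup>2 - int d * p + (L c1 y + L (c1 + y) c2)) * M (c1 + y + c2)"
      by (simp add: mult.assoc v_left[of "M c1"] M_mult M_mult2 v_left[of "M (c1 + y)"] v_add' add.assoc)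
    moreover have "(int w)\<^sup>2 + l * int w = (r\<^sup>2 + l * r - u) + (p\<^sup>2 - int d * p + (u + p * (s - t)))"
    proof -
      have "int w = r + p" by (simp add: p_def)
      then show ?thesis using st(2) unfolding r_def[symmetric] by (simp add: power2_eq_square algebra_simps)
    qed
    ultimately show ?thesis unfolding p_def[symmetric] y_def[symmetric] uu sum by (simp add: v_add')
  qed
  have "(\<Sum>W\<in>interval A C. v powi ((int (kvec.dim W))\<^sup>2 + l * int (kvec.dim W)) * M (c - int (kvec.dim W) *s b k))
     = v powi (r\<^sup>2 + l * r - u) * (M c1 * xp k ^ d * M c2)"
    unfolding trm sum_distrib_left[symmetric] sum_distrib_right[symmetric]
    unfolding r_def xp_power_interval[OF q C A d] ..
  also have "\<dots> \<in> rng {k} {k}"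
    by (intro rng_mult rng_v rng_power rng_xp rng_M) (use ck s t in auto)
  finally show ?thesis .
qed

end

section \<open>Generators of the lower bound\<close>


context quantum_frame
begin

text \<open>The two exponents differ because \<open>b k\<close> pairs nontrivially with
  \<open>unit_vec k\<close>, so independence of the monomials applies.\<close>

lemma xp_neq_0: "xp k \<noteq> 0"
proof
  assume 0: "xp k = 0"
  have "hi k \<noteq> lo k"
  proof
    assume "hi k = lo k"
    then have "b k = 0" by (simp add: hi_lo)
    then show False using L_b2[of k "unit_vec k"] by simp
  qed
  then have "(\<Sum>c\<in>{hi k, lo k}. 1 * M c) = 0" using 0 by (simp add: xp_def)
  then have "(1 :: 'f) = 0" by (intro M_indep[where F="{hi k, lo k}" and \<kappa>="\<lambda>_. 1" and c="hi k"]) (auto simp: K_one)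
  then show False by simp
qed

lemma xp_powi_M:
  assumes "c $ k = 0"
  shows "xp k powi n * M c = v powi (2 * n * L (lo k) c) * (M c * xp k powi n)"
proof -
  have nat: "xp k ^ m * M c = v powi (2 * int m * L (lo k) c) * (M c * xp k ^ m)" for m
  proof (induction m)
    case (Suc m)
    have "xp k ^ Suc m * M c = xp k ^ m * (xp k * M c)" by (simp add: power_Suc2 mult.assoc del: power_Suc)
    also have "\<dots> = v powi (2 * L (lo k) c) * ((xp k ^ m * M c) * xp k)"
      unfolding xp_M_comm[OF assms] v_left[of "xp k ^ m"] by (simp add: mult.assoc)
    also have "\<dots> = v powi (2 * L (lo k) c + 2 * int m * L (lo k) c) * (M c * (xp k ^ m * xp k))"
      unfolding Suc by (simp add: v_add' mult.assoc)
    finally show ?case by (simp add: power_Suc2 algebra_simps del: power_Suc)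
  qed simp
  show ?thesis
  proof (cases "0 \<le> n")
    case True
    then show ?thesis using nat[of "nat n"] by (simp add: power_int_def)
  next
    case False
    define m where "m = nat (- n)"
    have n: "n = - int m" using False by (simp add: m_def)
    define X where "X = xp k ^ m"
    have X: "X \<noteq> 0" "X * M c = v powi (2 * int m * L (lo k) c) * (M c * X)"
      using xp_neq_0 nat by (simp_all add: X_def)
    have "M c * inverse X = inverse X * (X * M c) * inverse X" using X(1) by (simp add: mult.assoc[symmetric])
    also have "\<dots> = v powi (2 * int m * L (lo k) c) * (inverse X * M c)"
      unfolding X(2) v_left[of "inverse X"] using X(1) by (simp add: mult.assoc)
    finally have "inverse X * M c = v powi (- (2 * int m * L (lo k) c)) * (M c * inverse X)" by (simp add: v_add')
    then have "inverse (xp k ^ m) * M c = v powi (- (2 * int m * L (lo k) c)) * (M c * inverse (xp k ^ m))"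
      unfolding X_def .
    then show ?thesis unfolding n by (simp add: power_int_minus)
  qed
qed

text \<open>Seeds are generated by a relation, so a neighbouring seed contributes its variables only
  once a frame for it is exhibited. Here it is written down directly; the power of \<open>v\<close>
  in front is the normalization that gives the multiplication rule for \<open>L'\<close>.\<close>

lemma mutated_frame_exists:
  fixes k :: 'n
  defines "L' \<equiv> \<lambda>c d. L (c + (c $ k) *s (lo k - unit_vec k)) (d + (d $ k) *s (lo k - unit_vec k))"
  obtains M' where "\<And>c d. M' c * M' d = v powi L' c d * M' (c + d)" "M' 0 = 1"
    "\<And>i. i \<noteq> k \<Longrightarrow> M' (unit_vec i) = M (unit_vec i)" "M' (unit_vec k) = xp k"
proof
  define r where "r c = c - axis k (c $ k)" for c :: "int^'n"
  define M' where "M' c = v powi (- (c $ k * L (r c) (lo k))) * (M (r c) * xp k powi (c $ k))" for c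
  have rk: "r c $ k = 0" for c by (simp add: r_def)
  have r_add: "r (c + d) = r c + r d" for c d by (auto simp: r_def vec_eq_iff axis_def)
  have E: "c + (c $ k) *s (lo k - unit_vec k) = r c + (c $ k) *s lo k" for c
    by (auto simp: r_def vec_eq_iff axis_def algebra_simps)
  show "M' c * M' d = v powi L' c d * M' (c + d)" for c d
  proof -
    let ?m = "c $ k" and ?n = "d $ k"
    have "M' c * M' d = v powi (- (?m * L (r c) (lo k)) - ?n * L (r d) (lo k)) * (M (r c) * (xp k powi ?m * M (r d)) * xp k powi ?n)"
      by (simp add: M'_def mult.assoc v_left[of "M (r c)"] v_left[of "xp k powi ?m"] v_add')
    also have "M (r c) * (xp k powi ?m * M (r d)) * xp k powi ?n
      = v powi (2 * ?m * L (lo k) (r d) + L (r c) (r d)) * (M (r c + r d) * (xp k powi ?m * xp k powi ?n))"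
      by (simp add: xp_powi_M[OF rk] mult.assoc v_left[of "M (r c)"] M_mult2 v_add')
    also have "xp k powi ?m * xp k powi ?n = xp k powi (?m + ?n)"
      using xp_neq_0[of k] by (simp add: power_int_add)
    finally have 1: "M' c * M' d = v powi (- (?m * L (r c) (lo k)) - ?n * L (r d) (lo k) + (2 * ?m * L (lo k) (r d) + L (r c) (r d)))
       * (M (r c + r d) * xp k powi (?m + ?n))" by (simp only: v_add')
    have 2: "v powi L' c d * M' (c + d) = v powi (L' c d - (?m + ?n) * L (r c + r d) (lo k)) * (M (r c + r d) * xp k powi (?m + ?n))"
      unfolding M'_def r_add v_add' by simp
    have "L' c d = L (r c) (r d) + ?n * L (r c) (lo k) + ?m * L (lo k) (r d)"
      unfolding L'_def E by (simp add: L_simps L_scale L_scale2)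
    moreover have "L (r d) (lo k) = - L (lo k) (r d)" by (rule L_skew)
    ultimately have "- (?m * L (r c) (lo k)) - ?n * L (r d) (lo k) + (2 * ?m * L (lo k) (r d) + L (r c) (r d))
      = L' c d - (?m + ?n) * L (r c + r d) (lo k)"
      by (simp add: L_add algebra_simps)
    then show ?thesis unfolding 1 2 by simp
  qed
  show "M' 0 = 1" by (simp add: M'_def r_def axis_0 M_0)
  show "M' (unit_vec i) = M (unit_vec i)" if "i \<noteq> k" for i
  proof -
    have "(unit_vec i :: int^'n) $ k = 0" using that by (simp add: axis_def)
    then show ?thesis by (simp add: M'_def r_def axis_0)
  qed
  have "r (unit_vec k) = 0" by (simp add: r_def)
  then show "M' (unit_vec k) = xp k" by (simp add: M'_def M_0)
qed

lemma M_nonneg_generated: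
  assumes "\<And>i. 0 \<le> c $ i"
  shows "M c \<in> subring_gen (K \<union> range (\<lambda>i. M (unit_vec i)))"
  using assms
proof (induction "nat (\<Sum>i\<in>UNIV. c $ i)" arbitrary: c)
  case 0
  have "(\<Sum>i\<in>UNIV. c $ i) = 0" using 0 sum_nonneg[of UNIV "\<lambda>i. c $ i"] by simp
  then have "c = 0" using 0(2) by (subst (asm) sum_nonneg_eq_0_iff) (auto simp: vec_eq_iff)
  then show ?case by (simp add: M_0 subring_gen.one)
next
  case (Suc n)
  have "\<exists>i. c $ i \<noteq> 0"
  proof (rule ccontr)
    assume "\<not> ?thesis"
    then show False using Suc(2) by simp
  qed
  then obtain i where i: "1 \<le> c $ i" using Suc(3) by (metis int_one_le_iff_zero_less order_le_less)
  define d where "d = c - unit_vec i"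
  have d0: "0 \<le> d $ j" for j using i Suc(3) by (auto simp: d_def axis_def)
  have "(\<Sum>j\<in>UNIV. (unit_vec i :: int^'n) $ j) = 1" by (simp add: axis_def)
  then have "n = nat (\<Sum>j\<in>UNIV. d $ j)" using Suc(2) by (simp add: d_def sum_subtractf)
  from Suc(1)[OF this d0] have "M d \<in> subring_gen (K \<union> range (\<lambda>i. M (unit_vec i)))" .
  moreover have "c = d + unit_vec i" by (simp add: d_def)
  then have "M c = v powi (- L d (unit_vec i)) * (M d * M (unit_vec i))" by (simp add: M_plus)
  ultimately show ?case
    by (auto intro!: subring_gen.mult subring_gen.gen[of "v powi n" for n] intro: subring_gen.gen)
qed

lemma rng_subset_generated:
  assumes "K \<subseteq> G" "\<And>i. M (unit_vec i) \<in> G" "\<And>i. xp i \<in> G"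
  shows "rng UNIV UNIV \<subseteq> subring_gen G"
  unfolding rng_def
proof (rule subring_gen_subset, intro Un_least)
  have "subring_gen (K \<union> range (\<lambda>i. M (unit_vec i))) \<subseteq> subring_gen G"
    by (rule subring_gen_subset) (use assms in \<open>auto intro: subring_gen.gen\<close>)
  then show "M ` {c. \<forall>i\<in>UNIV. 0 \<le> c $ i} \<subseteq> subring_gen G" using M_nonneg_generated by blast
qed (use assms in \<open>auto intro: subring_gen.gen\<close>)

end

section \<open>Cluster characters in the upper bound\<close>


lemma sum_num_arrows_out:
  assumes "finite (arcs Q)"
  shows "(\<Sum>j\<in>UNIV. int (num_arrows Q k j) * y j) = (\<Sum>a\<in>{a \<in> arcs Q. tail Q a = k}. y (head Q a :: 'n::finite))"
proof -
  have "(\<Sum>a\<in>{a \<in> arcs Q. tail Q a = k}. y (head Q a))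
      = (\<Sum>j\<in>UNIV. \<Sum>a\<in>{a \<in> {a \<in> arcs Q. tail Q a = k}. head Q a = j}. y (head Q a))"
    by (rule sum.group[symmetric]) (use assms in auto)
  also have "\<dots> = (\<Sum>j\<in>UNIV. \<Sum>a\<in>{a \<in> arcs Q. tail Q a = k \<and> head Q a = j}. y j)"
    by (intro sum.cong) auto
  finally show ?thesis by (simp add: num_arrows_def)
qed

lemma sum_num_arrows_in:
  assumes "finite (arcs Q)"
  shows "(\<Sum>j\<in>UNIV. int (num_arrows Q j k) * y j) = (\<Sum>a\<in>{a \<in> arcs Q. head Q a = k}. y (tail Q a :: 'n::finite))"
proof -
  have "(\<Sum>a\<in>{a \<in> arcs Q. head Q a = k}. y (tail Q a))
      = (\<Sum>j\<in>UNIV. \<Sum>a\<in>{a \<in> {a \<in> arcs Q. head Q a = k}. tail Q a = j}. y (tail Q a))"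
    by (rule sum.group[symmetric]) (use assms in auto)
  also have "\<dots> = (\<Sum>j\<in>UNIV. \<Sum>a\<in>{a \<in> arcs Q. tail Q a = j \<and> head Q a = k}. y j)"
    by (intro sum.cong) auto
  finally show ?thesis by (simp add: num_arrows_def)
qed

lemma B_matrix_mult_nth:
  assumes "finite (arcs Q)"
  shows "(B_matrix Q *v y) $ k = (\<Sum>a\<in>{a \<in> arcs Q. tail Q a = k}. y $ head Q a) - (\<Sum>a\<in>{a \<in> arcs Q. head Q a = k}. y $ tail Q a)"
  using sum_num_arrows_out[OF assms, of k "\<lambda>j. y $ j"] sum_num_arrows_in[OF assms, of k "\<lambda>j. y $ j"]
  by (simp add: B_matrix_def matrix_vector_mult_def left_diff_distrib sum_subtractf)

lemma I_minus_R_mult_nth: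
  assumes "finite (arcs Q)"
  shows "((mat 1 - transpose (R_matrix Q)) *v y) $ k = y $ k - (\<Sum>a\<in>{a \<in> arcs Q. tail Q a = k}. y $ head Q a)"
proof -
  have "(\<Sum>j\<in>UNIV. (if k = j then 1 else 0 :: int) * y $ j) = (\<Sum>j\<in>UNIV. if k = j then y $ j else 0)"
    by (rule sum.cong) auto
  then show ?thesis
    using sum_num_arrows_out[OF assms, of k "\<lambda>j. y $ j"]
    by (simp add: R_matrix_def matrix_vector_mult_def left_diff_distrib sum_subtractf transpose_def mat_def)
qed

lemma chi_scale_left: "chi Q (n *s x) y = n * chi Q x y"
  and chi_scale_right: "chi Q x (n *s y) = n * chi Q x y"
  by (simp_all add: chi_def sum_distrib_left right_diff_distrib mult.assoc mult.left_commute)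

lemma chi_uminus_right: "chi Q x (- y) = - chi Q x y"
  by (simp add: chi_def sum_negf)

lemma chi_axis_left:
  assumes "finite (arcs Q)"
  shows "chi Q (axis k 1) y = y $ k - (\<Sum>a\<in>{a \<in> arcs Q. tail Q a = k}. y $ head Q a)"
proof -
  have "(\<Sum>i\<in>UNIV. axis k (1 :: int) $ i * y $ i) = (\<Sum>i\<in>UNIV. if k = i then y $ i else 0)"
    by (rule sum.cong) (auto simp: axis_def)
  moreover have "(\<Sum>a\<in>arcs Q. axis k (1 :: int) $ tail Q a * y $ head Q a) = (\<Sum>a\<in>arcs Q. if tail Q a = k then y $ head Q a else 0)"
    by (rule sum.cong) (auto simp: axis_def)
  ultimately show ?thesis using assms by (simp add: chi_def sum.If_cases Int_def conj_commute)
qed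

lemma chi_axis_right:
  assumes "finite (arcs Q)"
  shows "chi Q x (axis k 1) = x $ k - (\<Sum>a\<in>{a \<in> arcs Q. head Q a = k}. x $ tail Q a)"
proof -
  have "(\<Sum>i\<in>UNIV. x $ i * axis k (1 :: int) $ i) = (\<Sum>i\<in>UNIV. if k = i then x $ i else 0)"
    by (rule sum.cong) (auto simp: axis_def)
  moreover have "(\<Sum>a\<in>arcs Q. x $ tail Q a * axis k (1 :: int) $ head Q a) = (\<Sum>a\<in>arcs Q. if head Q a = k then x $ tail Q a else 0)"
    by (rule sum.cong) (auto simp: axis_def)
  ultimately show ?thesis using assms by (simp add: chi_def sum.If_cases Int_def conj_commute)
qed

text \<open>Bounds the smallest possible component of a submodule at a vertex; this yields one of
  the two nonnegativity conditions of \<open>interval_sum_rng\<close>.\<close>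

lemma dim_span_images:
  fixes U :: "'a \<Rightarrow> 'k::{field,finite} kvec set"
  assumes "finite S" and U: "\<And>a. a \<in> S \<Longrightarrow> fsub (U a)" and f: "\<And>a. a \<in> S \<Longrightarrow> linear_between (U a) (V a) (f a)"
  shows "kvec.dim (kvec.span (\<Union>a\<in>S. f a ` U a)) \<le> (\<Sum>a\<in>S. kvec.dim (U a))"
proof -
  have "\<exists>B. B \<subseteq> U a \<and> finite B \<and> kvec.span B = U a \<and> card B = kvec.dim (U a)" if "a \<in> S" for a
    by (rule fsub_basis[OF U[OF that]]) blast
  then have "\<forall>a\<in>S. \<exists>B. B \<subseteq> U a \<and> finite B \<and> kvec.span B = U a \<and> card B = kvec.dim (U a)" by blast
  from bchoice[OF this] obtain B where B: "\<And>a. a \<in> S \<Longrightarrow> B a \<subseteq> U a" "\<And>a. a \<in> S \<Longrightarrow> finite (B a)"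
    "\<And>a. a \<in> S \<Longrightarrow> kvec.span (B a) = U a" "\<And>a. a \<in> S \<Longrightarrow> card (B a) = kvec.dim (U a)" by blast
  let ?W = "\<Union>a\<in>S. f a ` B a"
  have finW: "finite ?W" using assms(1) B(2) by simp
  have "f a x \<in> kvec.span ?W" if a: "a \<in> S" and x: "x \<in> U a" for a x
  proof -
    have "x \<in> kvec.span (B a)" using B(3)[OF a] x by simp
    then have "x \<in> U a \<and> f a x \<in> kvec.span ?W"
    proof (induction rule: kvec.span_induct_alt)
      case base
      show ?case unfolding lb_zero[OF f[OF a] U[OF a]] using fsub_zero[OF U[OF a]] kvec.span_zero by blast
    next
      case (step c x y)
      have x: "x \<in> U a" using step(1) B(1)[OF a] by blast
      have y: "y \<in> U a" "f a y \<in> kvec.span ?W" using step(2) by auto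
      have eq: "f a (kscale c x + y) = kscale c (f a x) + f a y"
        by (simp only: lb_add[OF f[OF a] fsub_scale[OF U[OF a] x] y(1)] lb_scale[OF f[OF a] x])
      have "f a x \<in> kvec.span ?W" using step(1) a by (intro kvec.span_base) blast
      then have "kscale c (f a x) + f a y \<in> kvec.span ?W" using y(2) by (intro kvec.span_add kvec.span_scale)
      then show ?case unfolding eq using fsub_add[OF U[OF a] fsub_scale[OF U[OF a] x] y(1)] by blast
    qed
    then show ?thesis by simp
  qed
  then have "(\<Union>a\<in>S. f a ` U a) \<subseteq> kvec.span ?W" by blast
  then have "kvec.dim (\<Union>a\<in>S. f a ` U a) \<le> card ?W" by (rule kvec.dim_le_card[OF _ finW])
  also have "\<dots> \<le> (\<Sum>a\<in>S. card (f a ` B a))" by (rule card_UN_le[OF assms(1)])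
  also have "\<dots> \<le> (\<Sum>a\<in>S. kvec.dim (U a))"
    by (rule sum_mono) (metis B(2,4) card_image_le)
  finally show ?thesis by simp
qed

lemma restrict_eq_iff: "restrict f S = restrict g S \<longleftrightarrow> (\<forall>a\<in>S. f a = g a)"
  by (metis restrict_apply' restrict_ext)

text \<open>The dual bound, for the largest possible component, which yields the other nonnegativity
  condition. The maps to the quotients of \<open>W a\<close> by \<open>U a\<close> are replaced by
  maps to sets of cosets, which are counted.\<close>

lemma dim_preimages:
  fixes V :: "'k::{field,finite} kvec set"
  assumes S: "finite S" and V: "fsub V" and W: "\<And>a. a \<in> S \<Longrightarrow> fsub (W a)" and f: "\<And>a. a \<in> S \<Longrightarrow> linear_between V (W a) (f a)"
    and U: "\<And>a. a \<in> S \<Longrightarrow> kvec.subspace (U a)" "\<And>a. a \<in> S \<Longrightarrow> U a \<subseteq> W a"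
  defines "C \<equiv> {x \<in> V. \<forall>a\<in>S. f a x \<in> U a}"
  shows "fsub C \<and> int (kvec.dim V) - (\<Sum>a\<in>S. int (kvec.dim (W a)) - int (kvec.dim (U a))) \<le> int (kvec.dim C)"
proof
  have fU: "fsub (U a)" if "a \<in> S" for a by (rule fsub_subset[OF U(1)[OF that] U(2)[OF that] W[OF that]])
  show fC: "fsub C"
  proof (rule fsubI)
    show "finite C" using fsub_finite[OF V] by (simp add: C_def)
    show "0 \<in> C" using fsub_zero[OF V] lb_zero[OF f V] fsub_zero[OF fU] by (simp add: C_def)
    show "x + y \<in> C" if "x \<in> C" "y \<in> C" for x y
      using that fsub_add[OF V] lb_add[OF f, of _ x y] fsub_add[OF fU] by (simp add: C_def)
    show "kscale c x \<in> C" if "x \<in> C" for c x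
      using that fsub_scale[OF V] lb_scale[OF f, of _ x c] fsub_scale[OF fU] by (simp add: C_def)
  qed
  define cs where "cs a y = (\<lambda>u. y + u) ` U a" for a y
  have cs: "cs a x = cs a y \<longleftrightarrow> x - y \<in> U a" if a: "a \<in> S" for a x y
  proof
    assume "cs a x = cs a y"
    moreover have "x + 0 \<in> cs a x" unfolding cs_def using fsub_zero[OF fU[OF a]] by (rule imageI)
    ultimately obtain u where "u \<in> U a" "x + 0 = y + u" by (auto simp: cs_def)
    then show "x - y \<in> U a" by simp
  next
    assume xy: "x - y \<in> U a"
    have sub: "cs a x \<subseteq> cs a y" if "x - y \<in> U a" for x y
    proof
      fix z assume "z \<in> cs a x"
      then obtain u where u: "u \<in> U a" "z = x + u" by (auto simp: cs_def)
      have "z = y + ((x - y) + u)" using u by simp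
      then show "z \<in> cs a y" unfolding cs_def using fsub_add[OF fU[OF a] that u(1)] by blast
    qed
    have "y - x \<in> U a" using fsub_uminus[OF fU[OF a] xy] by simp
    then show "cs a x = cs a y" using sub xy by blast
  qed
  define D where "D x = restrict (\<lambda>a. cs a (f a x)) S" for x
  have cW: "card (cs a ` W a) * CARD('k) ^ kvec.dim (U a) = CARD('k) ^ kvec.dim (W a)" if a: "a \<in> S" for a
  proof -
    have "card (W a) = card (cs a ` W a) * card (U a)"
      by (rule card_quotient[OF fsub_finite[OF W[OF a]] U(2)[OF a] fsub_add[OF W[OF a]] cs[OF a]])
    then show ?thesis by (simp add: fsub_card[OF W[OF a]] fsub_card[OF fU[OF a]])
  qed
  have "card V = card (D ` V) * card C"
  proof (rule card_quotient[OF fsub_finite[OF V] _ fsub_add[OF V]])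
    show "C \<subseteq> V" by (auto simp: C_def)
    fix x y assume xy: "x \<in> V" "y \<in> V"
    have "D x = D y \<longleftrightarrow> (\<forall>a\<in>S. cs a (f a x) = cs a (f a y))"
      unfolding D_def by (rule restrict_eq_iff)
    also have "\<dots> \<longleftrightarrow> (\<forall>a\<in>S. f a (x - y) \<in> U a)" using cs lb_diff[OF f V xy] by simp
    finally show "D x = D y \<longleftrightarrow> x - y \<in> C" using fsub_diff[OF V xy] by (simp add: C_def)
  qed
  moreover have "card (D ` V) \<le> (\<Prod>a\<in>S. card (cs a ` W a))"
  proof -
    have "D ` V \<subseteq> PiE S (\<lambda>a. cs a ` W a)" using lb_in[OF f] by (auto simp: D_def)
    then have "card (D ` V) \<le> card (PiE S (\<lambda>a. cs a ` W a))"
      by (rule card_mono[rotated]) (use S W in \<open>auto intro!: finite_PiE simp: fsub_finite\<close>)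
    then show ?thesis using S by (simp add: card_PiE)
  qed
  ultimately have "card V * (\<Prod>a\<in>S. CARD('k) ^ kvec.dim (U a)) \<le> (\<Prod>a\<in>S. card (cs a ` W a)) * card C * (\<Prod>a\<in>S. CARD('k) ^ kvec.dim (U a))"
    by simp
  also have "\<dots> = (\<Prod>a\<in>S. CARD('k) ^ kvec.dim (W a)) * card C"
    using cW by (simp add: prod.distrib[symmetric] mult.commute mult.left_commute)
  finally have "CARD('k) ^ (kvec.dim V + (\<Sum>a\<in>S. kvec.dim (U a))) \<le> CARD('k) ^ ((\<Sum>a\<in>S. kvec.dim (W a)) + kvec.dim C)"
    by (simp add: fsub_card[OF V] fsub_card[OF fC] power_add power_sum)
  then have "kvec.dim V + (\<Sum>a\<in>S. kvec.dim (U a)) \<le> (\<Sum>a\<in>S. kvec.dim (W a)) + kvec.dim C"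
    using card_UNIV_field_gt1[where 'k='k] by (simp add: power_increasing_iff)
  then have "int (kvec.dim V + (\<Sum>a\<in>S. kvec.dim (U a))) \<le> int ((\<Sum>a\<in>S. kvec.dim (W a)) + kvec.dim C)" by (simp only: of_nat_le_iff)
  then show "int (kvec.dim V) - (\<Sum>a\<in>S. int (kvec.dim (W a)) - int (kvec.dim (U a))) \<le> int (kvec.dim C)"
    by (simp add: sum_subtractf)
qed

lemma finite_submodules:
  fixes R :: "('n::finite, 'a, 'k::{field,finite}) rep"
  assumes "is_rep Q R"
  shows "finite {U. submodule Q R U}"
proof (rule finite_subset)
  show "{U. submodule Q R U} \<subseteq> PiE UNIV (\<lambda>i. Pow (space_at R i))" by (auto simp: submodule_def)
  show "finite (PiE UNIV (\<lambda>i. Pow (space_at R i)))"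
    using fsub_finite[OF rep_fsub[OF assms]] by (intro finite_PiE) auto
qed

locale quiver_frame = quantum_frame K v L b M + ranked_quiver Q en ht
  for K :: "'f::division_ring set" and v and L :: "int^'n::finite \<Rightarrow> int^'n \<Rightarrow> int" and b :: "'n \<Rightarrow> int^'n"
    and M :: "int^'n \<Rightarrow> 'f" and Q :: "('n, 'a) pre_digraph" and en ht +
  assumes b_eq: "b k = (\<chi> i. B_matrix Q $ i $ k)"
begin

lemma B_mult_axis: "B_matrix Q *v (x + w *s axis k 1) = B_matrix Q *v x + w *s b k"
proof -
  have "(\<Sum>j\<in>UNIV. B_matrix Q $ i $ j * axis k (1 :: int) $ j) = (\<Sum>j\<in>UNIV. if k = j then B_matrix Q $ i $ j else 0)" for i
    by (rule sum.cong) (auto simp: axis_def)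
  then have "B_matrix Q *v axis k 1 = b k" by (simp add: b_eq matrix_vector_mult_def vec_eq_iff)
  moreover have "B_matrix Q *v (w *s axis k 1) = w *s (B_matrix Q *v axis k 1)"
    by (simp add: matrix_vector_mult_def vec_eq_iff sum_distrib_left mult.left_commute)
  ultimately show ?thesis by (simp add: matrix_vector_right_distrib)
qed

text \<open>Within a group of submodules that agree away from \<open>k\<close>, the power of
  \<open>v\<close> is quadratic in the dimension of the component at \<open>k\<close>, in exactly
  the shape that \<open>interval_sum_rng\<close> requires.\<close>

lemma character_sum_rng:
  fixes R :: "('n, 'a, 'k::{field,finite}) rep"
  assumes q: "of_nat CARD('k) = v powi 2" and R: "is_rep Q R"
    and g: "\<And>k. g $ k = - rep_dim R $ k + (\<Sum>a\<in>{a \<in> arcs Q. tail Q a = k}. rep_dim R $ head Q a)"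
  shows "(\<Sum>U\<in>{U. submodule Q R U}. v powi (- chi Q (dimvec U) (rep_dim R - dimvec U)) * M (g - B_matrix Q *v dimvec U))
    \<in> rng {k} {k}"
proof -
  let ?F = "{U. submodule Q R U}"
  let ?In = "{a \<in> arcs Q. head Q a = k}" and ?Out = "{a \<in> arcs Q. tail Q a = k}"
  define f where "f U = v powi (- chi Q (dimvec U) (rep_dim R - dimvec U)) * M (g - B_matrix Q *v dimvec U)"
    for U :: "'n \<Rightarrow> 'k kvec set"
  define rest where "rest U = U(k := ({0} :: 'k kvec set))" for U
  have loop: "head Q a \<noteq> tail Q a" if "a \<in> arcs Q" for a using ht[OF that] by auto
  have grp: "(\<Sum>U\<in>?F. f U) = (\<Sum>V\<in>rest ` ?F. \<Sum>U\<in>{U \<in> ?F. rest U = V}. f U)"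
    by (rule sum.group[symmetric]) (use finite_submodules[OF R] in auto)
  have "(\<Sum>U\<in>{U \<in> ?F. rest U = V}. f U) \<in> rng {k} {k}" if "V \<in> rest ` ?F" for V
  proof -
    from that obtain U where U: "submodule Q R U" "V = rest U" by blast
    have Us: "kvec.subspace (U i)" "U i \<subseteq> space_at R i" for i using U by (auto simp: submodule_def)
    have Um: "map_at R a x \<in> U (head Q a)" if "a \<in> arcs Q" "x \<in> U (tail Q a)" for a x
      using U that by (auto simp: submodule_def image_subset_iff)
    have fU: "fsub (U i)" for i by (rule fsub_subset[OF Us rep_fsub[OF R]])
    \<comment> \<open>\<open>A\<close> is what the incoming arrows force into the component at
      \<open>k\<close>, and \<open>C\<close> is the largest component that the outgoing arrows
      permit.\<close>
    define A where "A = kvec.span (\<Union>a\<in>?In. map_at R a ` U (tail Q a))"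
    define C where "C = {x \<in> space_at R k. \<forall>a\<in>?Out. map_at R a x \<in> U (head Q a)}"
    have "A \<subseteq> U k" unfolding A_def by (rule kvec.span_minimal[OF _ Us(1)]) (use Um in blast)
    moreover have "U k \<subseteq> C" unfolding C_def using Um Us(2)[of k] by blast
    ultimately have Uk: "A \<subseteq> U k" "U k \<subseteq> C" by auto
    have AC: "A \<subseteq> C" using Uk by blast
    have sA: "kvec.subspace A" by (simp add: A_def kvec.subspace_span)
    define e where "e = dimvec V"
    have ek: "e $ k = 0" by (simp add: e_def U(2) rest_def dimvec_def dim_zero_space)
    have ei: "e $ i = int (kvec.dim (U i))" if "i \<noteq> k" for i using that by (simp add: e_def U(2) rest_def dimvec_def)
    define m where "m = rep_dim R"
    have mi: "m $ i = int (kvec.dim (space_at R i))" for i by (simp add: m_def dimvec_def)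
    have Cd: "fsub C \<and> int (kvec.dim (space_at R k)) - (\<Sum>a\<in>?Out. int (kvec.dim (space_at R (head Q a))) - int (kvec.dim (U (head Q a)))) \<le> int (kvec.dim C)"
      unfolding C_def
      by (rule dim_preimages[OF _ rep_fsub[OF R] rep_fsub[OF R]]) (use fin rep_map[OF R] Us in auto)
    then have fC: "fsub C" by blast
    have lbU: "linear_between (U (tail Q a)) (space_at R (head Q a)) (map_at R a)" if "a \<in> arcs Q" for a
    proof (rule linear_betweenI)
      fix x y c assume "x \<in> U (tail Q a)"
      then have x: "x \<in> space_at R (tail Q a)" using Us(2) by blast
      show "map_at R a x \<in> space_at R (head Q a)" by (rule rep_map_in[OF R that x])
      show "map_at R a (kscale c x) = kscale c (map_at R a x)" by (rule lb_scale[OF rep_map[OF R that] x])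
      assume "y \<in> U (tail Q a)"
      then show "map_at R a (x + y) = map_at R a x + map_at R a y"
        using Us(2) by (intro lb_add[OF rep_map[OF R that] x]) blast
    qed
    have Ad: "kvec.dim A \<le> (\<Sum>a\<in>?In. kvec.dim (U (tail Q a)))"
      unfolding A_def by (rule dim_span_images[where V="\<lambda>a. space_at R (head Q a)"]) (use fin fU lbU in auto)
    have fibre: "{U' \<in> ?F. rest U' = V} = (\<lambda>W. U(k := W)) ` interval A C"
    proof (intro equalityI subsetI)
      fix U' assume "U' \<in> {U' \<in> ?F. rest U' = V}"
      then have U': "submodule Q R U'" "rest U' = rest U" using U by auto
      have oth: "U' i = U i" if "i \<noteq> k" for i using fun_cong[OF U'(2), of i] that by (simp add: rest_def)
      have s: "kvec.subspace (U' k)" "U' k \<subseteq> space_at R k" using U'(1) by (auto simp: submodule_def)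
      have m': "map_at R a x \<in> U' (head Q a)" if "a \<in> arcs Q" "x \<in> U' (tail Q a)" for a x
        using U'(1) that by (auto simp: submodule_def image_subset_iff)
      have "A \<subseteq> U' k" unfolding A_def
      proof (rule kvec.span_minimal[OF _ s(1)], safe)
        fix a x assume a: "a \<in> arcs Q" "k = head Q a" and x: "x \<in> U (tail Q a)"
        then have "x \<in> U' (tail Q a)" using oth[of "tail Q a"] loop[OF a(1)] by metis
        then show "map_at R a x \<in> U' (head Q a)" by (rule m'[OF a(1)])
      qed
      moreover have "U' k \<subseteq> C"
      proof
        fix x assume x: "x \<in> U' k"
        have "map_at R a x \<in> U (head Q a)" if "a \<in> arcs Q" "tail Q a = k" for a
          using m'[OF that(1)] x that oth[of "head Q a"] loop[OF that(1)] by metis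
        then show "x \<in> C" using x s(2) by (auto simp: C_def)
      qed
      ultimately have "U' k \<in> interval A C" using s by (simp add: interval_def)
      moreover have "U' = U(k := U' k)" using oth by (auto simp: fun_eq_iff)
      ultimately show "U' \<in> (\<lambda>W. U(k := W)) ` interval A C" by blast
    next
      fix U' assume "U' \<in> (\<lambda>W. U(k := W)) ` interval A C"
      then obtain W where W: "kvec.subspace W" "A \<subseteq> W" "W \<subseteq> C" "U' = U(k := W)" by (auto simp: interval_def)
      have "submodule Q R U'"
        unfolding submodule_def
      proof (intro conjI allI ballI subsetI)
        show "kvec.subspace (U' i)" for i using W Us by simp
        show "x \<in> space_at R i" if "x \<in> U' i" for i x
          using that W Us(2)[of i] by (auto simp: C_def split: if_splits)
        fix a y assume a: "a \<in> arcs Q" and "y \<in> map_at R a ` U' (tail Q a)"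
        then obtain x where x: "x \<in> U' (tail Q a)" "y = map_at R a x" by blast
        show "y \<in> U' (head Q a)"
        proof (cases "head Q a = k")
          case True
          then have "x \<in> U (tail Q a)" using x(1) W(4) loop[OF a] by (simp split: if_splits)
          then have "y \<in> A" unfolding A_def x(2) using a True by (intro kvec.span_base) blast
          then show ?thesis using W True by auto
        next
          case False
          then show ?thesis using x W Um[OF a] a by (cases "tail Q a = k") (auto simp: C_def)
        qed
      qed
      moreover have "rest U' = V" by (simp add: W(4) U(2) rest_def)
      ultimately show "U' \<in> {U' \<in> ?F. rest U' = V}" by simp
    qed
    have inj: "inj_on (\<lambda>W. U(k := W)) (interval A C)" by (rule inj_onI) (metis fun_upd_same)
    define c where "c = g - B_matrix Q *v e"
    \<comment> \<open>\<open>mo\<close> is the Euler form of the unit vector at \<open>k\<close>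
      with \<open>m - e\<close>, and \<open>- ai\<close> that of \<open>e\<close> with the unit
      vector; together they give the term linear in the dimension of \<open>W\<close>.\<close>
    define mo where "mo = m $ k - (\<Sum>a\<in>?Out. m $ head Q a - e $ head Q a)"
    define ai where "ai = (\<Sum>a\<in>?In. e $ tail Q a)"
    have val: "f (U(k := W)) = v powi (- chi Q e (m - e)) * (v powi ((int (kvec.dim W))\<^sup>2 + (- mo - ai) * int (kvec.dim W)) * M (c - int (kvec.dim W) *s b k))"
      for W
    proof -
      define w where "w = int (kvec.dim W)"
      have dv: "dimvec (U(k := W)) = e + w *s axis k 1"
        by (auto simp: vec_eq_iff dimvec_def e_def U(2) rest_def w_def axis_def dim_zero_space)
      have "chi Q (axis k 1) (m - e) = mo" by (simp add: chi_axis_left[OF fin] mo_def ek sum_subtractf)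
      moreover have "chi Q e (axis k 1) = - ai" by (simp add: chi_axis_right[OF fin] ai_def ek)
      moreover have "chi Q (axis k 1) (axis k (1 :: int)) = 1"
      proof -
        have "axis k (1 :: int) $ head Q a = 0" if "a \<in> ?Out" for a
          using loop[of a] that by (auto simp: axis_def)
        then have "(\<Sum>a\<in>?Out. axis k (1 :: int) $ head Q a) = 0" by (rule sum.neutral[OF ballI])
        then show ?thesis by (simp add: chi_axis_left[OF fin])
      qed
      moreover have "m - (e + w *s axis k 1) = (m - e) + - (w *s axis k 1)" by simp
      ultimately have "chi Q (e + w *s axis k 1) (m - (e + w *s axis k 1)) = chi Q e (m - e) + w * ai + w * mo - w * w"
        by (simp only: chi_add_left chi_add_right chi_scale_left chi_scale_right chi_uminus_right) (simp add: algebra_simps)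
      then have ch: "- chi Q (e + w *s axis k 1) (m - (e + w *s axis k 1)) = - chi Q e (m - e) + (w\<^sup>2 + (- mo - ai) * w)"
        by (simp add: power2_eq_square algebra_simps)
      have cc: "g - B_matrix Q *v (e + w *s axis k 1) = c - w *s b k" by (simp add: c_def B_mult_axis)
      show ?thesis unfolding f_def dv m_def[symmetric] ch cc w_def[symmetric] by (simp only: v_add mult.assoc)
    qed
    have "(\<Sum>U\<in>{U \<in> ?F. rest U = V}. f U)
       = v powi (- chi Q e (m - e)) * (\<Sum>W\<in>interval A C. v powi ((int (kvec.dim W))\<^sup>2 + (- mo - ai) * int (kvec.dim W)) * M (c - int (kvec.dim W) *s b k))"
      unfolding fibre by (simp only: sum.reindex[OF inj] comp_def val sum_distrib_left)
    also have "\<dots> \<in> rng {k} {k}"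
    proof (intro rng_mult rng_v)
      have le: "kvec.dim A \<le> kvec.dim C"
      proof -
        have "CARD('k) ^ kvec.dim A \<le> CARD('k) ^ kvec.dim C"
          using card_mono[OF fsub_finite[OF fC] AC] by (simp only: fsub_card[OF fC] fsub_card[OF fsub_subset[OF sA AC fC]])
        then show ?thesis using card_UNIV_field_gt1[where 'k='k] by (simp add: power_increasing_iff)
      qed
      define d where "d = kvec.dim C - kvec.dim A"
      have mo: "mo = int (kvec.dim (space_at R k)) - (\<Sum>a\<in>?Out. int (kvec.dim (space_at R (head Q a))) - int (kvec.dim (U (head Q a))))"
        unfolding mo_def mi using loop ei by (auto intro!: arg_cong2[of _ _ _ _ minus] sum.cong)
      have ai: "ai = int (\<Sum>a\<in>?In. kvec.dim (U (tail Q a)))"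
        unfolding ai_def of_nat_sum by (rule sum.cong[OF refl]) (use loop ei in force)
      have ck: "c $ k = - mo + ai"
        by (simp add: c_def g m_def[symmetric] B_matrix_mult_nth[OF fin] mo_def ai_def sum_subtractf)
      show "(\<Sum>W\<in>interval A C. v powi ((int (kvec.dim W))\<^sup>2 + (- mo - ai) * int (kvec.dim W)) * M (c - int (kvec.dim W) *s b k)) \<in> rng {k} {k}"
      \<comment> \<open>\<open>s\<close> and \<open>t\<close> are the solutions of the two
        equations; they are nonnegative by the lower bound on the dimension of \<open>C\<close> and
        the upper bound on that of \<open>A\<close>.\<close>
      proof (rule interval_sum_rng[OF q fC sA AC, where s = "int (kvec.dim C) - mo" and t = "ai - int (kvec.dim A)"])
        show "kvec.dim C = kvec.dim A + d" using le by (simp add: d_def)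
        have di: "int d = int (kvec.dim C) - int (kvec.dim A)" using le by (simp add: d_def)
        have "int (kvec.dim A) \<le> ai" unfolding ai using Ad by (simp only: of_nat_le_iff)
        then show "0 \<le> ai - int (kvec.dim A)" by simp
        have "mo \<le> int (kvec.dim C)" unfolding mo using Cd by blast
        then show "0 \<le> int (kvec.dim C) - mo" by simp
        show "int (kvec.dim C) - mo + (ai - int (kvec.dim A)) = int d + c $ k" unfolding ck di by simp
        show "int (kvec.dim C) - mo - (ai - int (kvec.dim A)) = 2 * int (kvec.dim A) + (- mo - ai) + int d"
          unfolding di by simp
      qed
    qed
    finally show ?thesis .
  qed
  then have "(\<Sum>U\<in>?F. f U) \<in> rng {k} {k}"
    unfolding grp rng_def by (rule subring_gen_sum)
  then show ?thesis by (simp add: f_def)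
qed

end

section \<open>Seeds in the skew-field of fractions\<close>


lemma transpose_dot: "(\<Sum>i\<in>UNIV. (A *v c) $ i * w $ i) = (\<Sum>i\<in>UNIV. c $ i * (transpose A *v w) $ i)"
  for A :: "int^'n^'n::finite"
proof -
  have "(\<Sum>i\<in>UNIV. (A *v c) $ i * w $ i) = (\<Sum>i\<in>UNIV. \<Sum>j\<in>UNIV. A $ i $ j * c $ j * w $ i)"
    by (simp add: matrix_vector_mult_def sum_distrib_right)
  also have "\<dots> = (\<Sum>j\<in>UNIV. \<Sum>i\<in>UNIV. A $ i $ j * c $ j * w $ i)" by (rule sum.swap)
  finally show ?thesis
    by (simp add: matrix_vector_mult_def transpose_def sum_distrib_left mult.commute mult.left_commute)
qed

lemma Lambda_form_add: "Lambda_form \<Lambda> (c + c') d = Lambda_form \<Lambda> c d + Lambda_form \<Lambda> c' d"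
  by (simp add: Lambda_form_def distrib_right sum.distrib)

lemma Lambda_form_skew: "transpose \<Lambda> = - \<Lambda> \<Longrightarrow> Lambda_form \<Lambda> c d = - Lambda_form \<Lambda> d (c :: int^'n::finite)"
  using transpose_dot[of \<Lambda> c d]
  by (simp add: Lambda_form_def mult.commute) (simp add: matrix_vector_mult_def sum_negf)

lemma Lambda_form_axis: "Lambda_form \<Lambda> (axis i 1) (axis j 1) = \<Lambda> $ i $ j"
proof -
  have "(\<Sum>l\<in>UNIV. \<Lambda> $ k $ l * axis j 1 $ l) = (\<Sum>l\<in>UNIV. if l = j then \<Lambda> $ k $ l else 0)" for k
    by (rule sum.cong) (auto simp: axis_def)
  then have "(\<Lambda> *v axis j 1) $ k = \<Lambda> $ k $ j" for k by (simp add: matrix_vector_mult_def)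
  moreover have "(\<Sum>k\<in>UNIV. axis i 1 $ k * \<Lambda> $ k $ j) = (\<Sum>k\<in>UNIV. if k = i then \<Lambda> $ k $ j else 0)"
    by (rule sum.cong) (auto simp: axis_def)
  ultimately show ?thesis by (simp add: Lambda_form_def)
qed

lemma Lambda_form_mutate: "Lambda_form (mutate_Lambda p B \<Lambda>) c d = Lambda_form \<Lambda> (E_matrix p B *v c) (E_matrix p B *v d)"
  using transpose_dot[of "E_matrix p B" c "\<Lambda> *v (E_matrix p B *v d)"]
  by (simp add: Lambda_form_def mutate_Lambda_def matrix_vector_mul_assoc[symmetric] matrix_mul_assoc)

text \<open>Brings the mutation of the form into the shape assumed in
  \<open>frame_mutation\<close>.\<close>

lemma E_matrix_mult: "E_matrix p B *v c = c + (c $ p) *s ((\<chi> i. if i = p then - 1 else max (- B $ i $ p) 0) - axis p 1)"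
proof -
  have "(E_matrix p B *v c) $ i = (c + (c $ p) *s ((\<chi> i. if i = p then - 1 else max (- B $ i $ p) 0) - axis p 1)) $ i" for i
  proof -
    have "(E_matrix p B *v c) $ i = E_matrix p B $ i $ p * c $ p + (\<Sum>j\<in>UNIV - {p}. E_matrix p B $ i $ j * c $ j)"
      by (simp add: matrix_vector_mult_def sum.remove[of UNIV p])
    also have "(\<Sum>j\<in>UNIV - {p}. E_matrix p B $ i $ j * c $ j) = (\<Sum>j\<in>UNIV - {p}. if j = i then c $ j else 0)"
      by (rule sum.cong) (auto simp: E_matrix_def)
    finally show ?thesis by (auto simp: E_matrix_def axis_def max.commute algebra_simps)
  qed
  then show ?thesis by (simp add: vec_eq_iff)
qed

lemma coeff_ring_basic: "s \<in> coeff_ring s" "inverse s \<in> coeff_ring s" "0 \<in> coeff_ring s" "1 \<in> coeff_ring s"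
  by (auto simp: coeff_ring_def subring_gen_zero intro: subring_gen.intros)
lemma coeff_ring_diff: "x \<in> coeff_ring s \<Longrightarrow> y \<in> coeff_ring s \<Longrightarrow> x - y \<in> coeff_ring s"
  and coeff_ring_mult: "x \<in> coeff_ring s \<Longrightarrow> y \<in> coeff_ring s \<Longrightarrow> x * y \<in> coeff_ring s"
  and coeff_ring_add: "x \<in> coeff_ring s \<Longrightarrow> y \<in> coeff_ring s \<Longrightarrow> x + y \<in> coeff_ring s"
  and coeff_ring_sum: "(\<And>i. i \<in> A \<Longrightarrow> f i \<in> coeff_ring s) \<Longrightarrow> sum f A \<in> coeff_ring s"
  and coeff_ring_power: "x \<in> coeff_ring s \<Longrightarrow> x ^ n \<in> coeff_ring s"
  by (auto simp: coeff_ring_def intro: subring_gen.intros subring_gen_add subring_gen_sum subring_gen_power)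
lemma coeff_ring_powi: "s powi n \<in> coeff_ring s"
  by (auto simp: power_int_def coeff_ring_basic intro: coeff_ring_power)
lemma coeff_ring_of_nat: "real n \<in> coeff_ring s"
  by (induction n) (auto simp: coeff_ring_basic intro: coeff_ring_add)

locale torus_fractions =
  fixes s :: real and \<Lambda> :: "int^'n^'n::finite" and \<iota> :: "'n torus \<Rightarrow> 'f::division_ring"
  assumes sk: "skew_field_of_fractions s \<Lambda> \<iota>" and s_nz: "s \<noteq> 0"
begin

abbreviation mono :: "int^'n \<Rightarrow> real \<Rightarrow> 'n torus" where "mono \<equiv> Poly_Mapping.single"

lemma carrier_single: "r \<in> coeff_ring s \<Longrightarrow> mono c r \<in> torus_carrier s"
  by (auto simp: torus_carrier_def lookup_single when_def coeff_ring_basic)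
lemma carrier_zero: "0 \<in> torus_carrier s" by (simp add: torus_carrier_def coeff_ring_basic)
lemma carrier_sum: "(\<And>i. i \<in> A \<Longrightarrow> f i \<in> torus_carrier s) \<Longrightarrow> sum f A \<in> torus_carrier s"
  by (simp add: torus_carrier_def lookup_sum coeff_ring_sum)

lemma iota_inj: "inj_on \<iota> (torus_carrier s)"
  and iota_add: "x \<in> torus_carrier s \<Longrightarrow> y \<in> torus_carrier s \<Longrightarrow> \<iota> (x + y) = \<iota> x + \<iota> y"
  and iota_mult: "x \<in> torus_carrier s \<Longrightarrow> y \<in> torus_carrier s \<Longrightarrow> \<iota> (torus_mult s \<Lambda> x y) = \<iota> x * \<iota> y"
  and iota_one: "\<iota> (mono 0 1) = 1"
  and iota_frac: "\<exists>x\<in>torus_carrier s. \<exists>y\<in>torus_carrier s. y \<noteq> 0 \<and> z = \<iota> x * inverse (\<iota> y)"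
  using sk by (auto simp: skew_field_of_fractions_def)

lemma iota_zero: "\<iota> 0 = 0" using iota_add[OF carrier_zero carrier_zero] by simp

lemma iota_sum: "finite A \<Longrightarrow> (\<And>i. i \<in> A \<Longrightarrow> f i \<in> torus_carrier s) \<Longrightarrow> \<iota> (sum f A) = (\<Sum>i\<in>A. \<iota> (f i))"
  by (induction A rule: finite_induct) (simp_all add: iota_zero iota_add carrier_sum)

lemma torus_mult_single: "torus_mult s \<Lambda> (mono c r) (mono d r') = mono (c + d) (r * r' * s powi Lambda_form \<Lambda> c d)"
  by (cases "r = 0"; cases "r' = 0") (simp_all add: torus_mult_def)

lemma iota_mult_single: "r \<in> coeff_ring s \<Longrightarrow> r' \<in> coeff_ring s \<Longrightarrow>
    \<iota> (mono c r) * \<iota> (mono d r') = \<iota> (mono (c + d) (r * r' * s powi Lambda_form \<Lambda> c d))"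
  by (simp add: iota_mult[symmetric] carrier_single torus_mult_single)

lemma Lambda_form_zero [simp]: "Lambda_form \<Lambda>' 0 d = 0" "Lambda_form \<Lambda>' d 0 = 0"
  by (simp_all add: Lambda_form_def matrix_vector_mult_def)

lemma scalar_mult: "r \<in> coeff_ring s \<Longrightarrow> r' \<in> coeff_ring s \<Longrightarrow> scalar \<iota> (r * r') = scalar \<iota> r * scalar \<iota> r'"
  by (simp add: scalar_def iota_mult_single)
lemma scalar_add: "r \<in> coeff_ring s \<Longrightarrow> r' \<in> coeff_ring s \<Longrightarrow> scalar \<iota> (r + r') = scalar \<iota> r + scalar \<iota> r'"
  by (simp add: scalar_def single_add iota_add carrier_single)
lemma scalar_zero: "scalar \<iota> 0 = 0" by (simp add: scalar_def iota_zero)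
lemma scalar_one: "scalar \<iota> 1 = 1" unfolding scalar_def by (rule iota_one)
lemma scalar_diff: "r \<in> coeff_ring s \<Longrightarrow> r' \<in> coeff_ring s \<Longrightarrow> scalar \<iota> (r - r') = scalar \<iota> r - scalar \<iota> r'"
  using scalar_add[of "r - r'" r'] by (simp add: coeff_ring_diff)
lemma scalar_M: "r \<in> coeff_ring s \<Longrightarrow> scalar \<iota> r * \<iota> (mono c 1) = \<iota> (mono c r)"
  by (simp add: scalar_def iota_mult_single coeff_ring_basic)
lemma scalar_of_nat: "scalar \<iota> (real n) = of_nat n"
  by (induction n) (simp_all add: scalar_zero scalar_one scalar_add coeff_ring_of_nat coeff_ring_basic)

lemma scalar_power: "r \<in> coeff_ring s \<Longrightarrow> scalar \<iota> (r ^ n) = scalar \<iota> r ^ n"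
  by (induction n) (simp_all add: scalar_one scalar_mult coeff_ring_power)
lemma scalar_inverse: "scalar \<iota> (inverse s) = inverse (scalar \<iota> s)"
proof -
  have "scalar \<iota> s * scalar \<iota> (inverse s) = 1"
    using scalar_mult[OF coeff_ring_basic(1,2)] s_nz by (simp add: scalar_one)
  then show ?thesis by (metis inverse_unique)
qed
lemma scalar_powi: "scalar \<iota> (s powi n) = scalar \<iota> s powi n"
  by (simp add: power_int_def scalar_power coeff_ring_basic scalar_inverse)

text \<open>Centrality in the torus passes to fractions by conjugating with the denominator.\<close>

lemma scalar_central: "r \<in> coeff_ring s \<Longrightarrow> z * scalar \<iota> r = scalar \<iota> r * z"
proof -
  assume r: "r \<in> coeff_ring s"
  have c: "\<iota> x * scalar \<iota> r = scalar \<iota> r * \<iota> x" if x: "x \<in> torus_carrier s" for x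
  proof -
    have "torus_mult s \<Lambda> x (mono 0 r) = torus_mult s \<Lambda> (mono 0 r) x"
      by (cases "r = 0") (simp_all add: torus_mult_def mult.commute)
    then show ?thesis using x r by (simp add: scalar_def iota_mult[symmetric] carrier_single)
  qed
  obtain x y where xy: "x \<in> torus_carrier s" "y \<in> torus_carrier s" "y \<noteq> 0" "z = \<iota> x * inverse (\<iota> y)"
    using iota_frac by blast
  have y0: "\<iota> y \<noteq> 0" using inj_onD[OF iota_inj _ xy(2) carrier_zero] xy(3) iota_zero by auto
  have "inverse (\<iota> y) * scalar \<iota> r = inverse (\<iota> y) * (scalar \<iota> r * \<iota> y) * inverse (\<iota> y)"
    using y0 by (simp add: mult.assoc)
  also have "\<dots> = scalar \<iota> r * inverse (\<iota> y)"
    unfolding c[OF xy(2), symmetric] using y0 by (simp add: mult.assoc[symmetric])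
  finally show ?thesis using c[OF xy(1)] unfolding xy(4) by (metis mult.assoc)
qed

text \<open>Independence of the monomials comes from injectivity of the embedding of the torus, and
  the pairing with the columns from the compatibility of \<open>\<Lambda>\<close> and
  \<open>B\<close>.\<close>

lemma initial_frame:
  assumes "transpose \<Lambda> = - \<Lambda>" "\<Lambda> ** (- B) = mat 1"
  shows "quantum_frame (scalar \<iota> ` coeff_ring s) (scalar \<iota> s) (Lambda_form \<Lambda>) (\<lambda>k. \<chi> i. B $ i $ k) (\<lambda>c. \<iota> (mono c 1))"
proof
  let ?K = "scalar \<iota> ` coeff_ring s"
  show "1 \<in> ?K" using scalar_one coeff_ring_basic by (metis imageI)
  show "x - y \<in> ?K" if "x \<in> ?K" "y \<in> ?K" for x y
    using that by (auto simp: scalar_diff[symmetric] coeff_ring_diff)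
  show "x * y \<in> ?K" if "x \<in> ?K" "y \<in> ?K" for x y
    using that by (auto simp: scalar_mult[symmetric] coeff_ring_mult)
  show "z * x = x * z" if "x \<in> ?K" for x z using that scalar_central by blast
  show "scalar \<iota> s \<in> ?K" by (simp add: coeff_ring_basic)
  show "inverse (scalar \<iota> s) \<in> ?K" by (metis scalar_inverse coeff_ring_basic(2) imageI)
  show "scalar \<iota> s \<noteq> 0"
    using scalar_mult[OF coeff_ring_basic(1,2)] s_nz by (auto simp: scalar_one)
  show "Lambda_form \<Lambda> (c + c') d = Lambda_form \<Lambda> c d + Lambda_form \<Lambda> c' d" for c c' d by (rule Lambda_form_add)
  show "Lambda_form \<Lambda> c d = - Lambda_form \<Lambda> d c" for c d by (rule Lambda_form_skew[OF assms(1)])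
  show "Lambda_form \<Lambda> c (\<chi> i. B $ i $ k) = - (c $ k)" for c k
  proof -
    have "(\<Lambda> *v (\<chi> i. B $ i $ k)) $ i = - ((\<Lambda> ** (- B)) $ i $ k)" for i
      by (simp add: matrix_vector_mult_def matrix_matrix_mult_def sum_negf)
    then have "Lambda_form \<Lambda> c (\<chi> i. B $ i $ k) = (\<Sum>i\<in>UNIV. if i = k then - (c $ i) else 0)"
      unfolding Lambda_form_def assms(2) by (intro sum.cong) (auto simp: mat_def)
    then show ?thesis by simp
  qed
  show "\<iota> (mono c 1) * \<iota> (mono d 1) = scalar \<iota> s powi Lambda_form \<Lambda> c d * \<iota> (mono (c + d) 1)" for c d
    by (simp add: iota_mult_single coeff_ring_basic scalar_powi[symmetric] scalar_M coeff_ring_powi)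
  show "\<iota> (mono 0 1) = 1" by (rule iota_one)
  show "\<kappa> c = 0" if F: "finite F" "\<And>c. c \<in> F \<Longrightarrow> \<kappa> c \<in> ?K" "(\<Sum>c\<in>F. \<kappa> c * \<iota> (mono c 1)) = 0" "c \<in> F" for F \<kappa> c
  proof -
    have "\<forall>c\<in>F. \<exists>r. r \<in> coeff_ring s \<and> \<kappa> c = scalar \<iota> r" using F(2) by blast
    from bchoice[OF this] obtain r where r: "\<And>c. c \<in> F \<Longrightarrow> r c \<in> coeff_ring s \<and> \<kappa> c = scalar \<iota> (r c)" by blast
    have "\<iota> (\<Sum>c\<in>F. mono c (r c)) = (\<Sum>c\<in>F. \<kappa> c * \<iota> (mono c 1))"
      using F(1) r by (simp add: iota_sum carrier_single scalar_M)
    then have "(\<Sum>c\<in>F. mono c (r c)) = 0"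
      using inj_onD[OF iota_inj _ carrier_sum carrier_zero, of "\<lambda>c. mono c (r c)" F] F(3) iota_zero r carrier_single by simp
    then have "Poly_Mapping.lookup (\<Sum>c\<in>F. mono c (r c)) c = 0" by simp
    moreover have "Poly_Mapping.lookup (\<Sum>c\<in>F. mono c (r c)) c = (\<Sum>d\<in>F. if d = c then r d else 0)"
      unfolding lookup_sum by (rule sum.cong) (auto simp: lookup_single when_def)
    ultimately have "r c = 0" using F(1,4) by simp
    then show ?thesis using r[OF F(4)] scalar_zero by simp
  qed
qed

definition good_seed :: "('n, 'f) seed \<Rightarrow> bool" where
  "good_seed = (\<lambda>(M, \<Lambda>', B'). quantum_frame (scalar \<iota> ` coeff_ring s) (scalar \<iota> s) (Lambda_form \<Lambda>') (\<lambda>k. \<chi> i. B' $ i $ k) M)"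

definition upper :: "('n, 'f) seed \<Rightarrow> 'f set" where
  "upper = (\<lambda>(M, \<Lambda>', B'). {z. \<forall>k. z \<in> quantum_frame.rng (scalar \<iota> ` coeff_ring s) (\<lambda>k. \<chi> i. B' $ i $ k) M {k} {k}})"

text \<open>The inclusion of upper bounds is \<open>upper_bound_mutate\<close> for the inverse
  mutation; that the new seed is again a frame allows the argument to be iterated.\<close>

lemma mutation_good:
  assumes good: "good_seed S" and mut: "is_mutation s \<iota> p S S'"
  shows "good_seed S' \<and> upper S' \<subseteq> upper S"
proof -
  obtain M1 \<Lambda>1 B1 where S: "S = (M1, \<Lambda>1, B1)" by (cases S) auto
  obtain M2 \<Lambda>2 B2 where S': "S' = (M2, \<Lambda>2, B2)" by (cases S') auto
  let ?K = "scalar \<iota> ` coeff_ring s" and ?v = "scalar \<iota> s"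
  let ?b1 = "\<lambda>k. \<chi> i. B1 $ i $ k" and ?b2 = "\<lambda>k. \<chi> i. B2 $ i $ k"
  interpret S1: quantum_frame ?K ?v "Lambda_form \<Lambda>1" ?b1 M1 using good by (simp add: good_seed_def S)
  have m: "\<Lambda>2 = mutate_Lambda p B1 \<Lambda>1" "B2 = mutate_B p B1" "toric_frame s \<iota> \<Lambda>2 M2"
    "\<And>i. i \<noteq> p \<Longrightarrow> M2 (axis i 1) = M1 (axis i 1)"
    "M2 (axis p 1) = M1 ((\<chi> i. max (B1 $ i $ p) 0) - axis p 1) + M1 ((\<chi> i. max (- B1 $ i $ p) 0) - axis p 1)"
    using mut by (auto simp: is_mutation_def S S')
  have lo: "S1.lo p = (\<chi> i. if i = p then - 1 else max (- B1 $ i $ p) 0)"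
    by (simp add: vec_eq_iff S1.lo_nth)
  have fm: "frame_mutation ?K ?v (Lambda_form \<Lambda>1) ?b1 M1 p (Lambda_form \<Lambda>2) ?b2 M2"
  proof unfold_locales
    show "Lambda_form \<Lambda>2 c d = Lambda_form \<Lambda>1 (c + (c $ p) *s (S1.lo p - unit_vec p)) (d + (d $ p) *s (S1.lo p - unit_vec p))" for c d
      unfolding m(1) Lambda_form_mutate E_matrix_mult lo ..
    show "M2 c * M2 d = ?v powi Lambda_form \<Lambda>2 c d * M2 (c + d)" for c d
      using m(3) by (simp add: toric_frame_def scalar_powi)
    show "M2 0 = 1" using m(3) by (simp add: toric_frame_def)
    show "M2 (unit_vec i) = M1 (unit_vec i)" if "i \<noteq> p" for i by (rule m(4)[OF that])
    show "M2 (unit_vec p) = S1.xp p"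
      unfolding m(5) S1.xp_def S1.hi_def S1.lo_def pos_def neg_def by simp
    show "?b2 j $ i = (if i = p \<or> j = p then - ?b1 j $ i
        else ?b1 j $ i + sgn (?b1 p $ i) * max (?b1 p $ i * ?b1 j $ p) 0)" for i j
      by (simp add: m(2) mutate_B_def)
  qed
  interpret F: frame_mutation ?K ?v "Lambda_form \<Lambda>1" ?b1 M1 p "Lambda_form \<Lambda>2" ?b2 M2 by (rule fm)
  have "good_seed S'" using F.S'.quantum_frame_axioms by (simp add: good_seed_def S')
  moreover have "upper S' \<subseteq> upper S"
    using frame_mutation.upper_bound_mutate[OF F.mutation_sym] by (auto simp: upper_def S S')
  ultimately show ?thesis by blast
qed

lemma seeds_good:
  assumes "transpose \<Lambda> = - \<Lambda>" "\<Lambda> ** (- B) = mat 1" "S \<in> seeds s \<iota> \<Lambda> B"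
  shows "good_seed S \<and> upper S \<subseteq> upper (\<lambda>c. \<iota> (mono c 1), \<Lambda>, B)"
  using assms(3)
proof induction
  case initial
  show ?case using initial_frame[OF assms(1,2)] by (simp add: good_seed_def)
next
  case (mutation S p S')
  then show ?case using mutation_good by blast
qed

text \<open>A strengthened Laurent phenomenon: a variable lies in the upper bound of its own seed,
  which is contained in the initial one.\<close>

lemma cluster_variables_upper:
  assumes "transpose \<Lambda> = - \<Lambda>" "\<Lambda> ** (- B) = mat 1" "x \<in> cluster_variables s \<iota> \<Lambda> B"
  shows "x \<in> upper (\<lambda>c. \<iota> (mono c 1), \<Lambda>, B)"
proof -
  obtain M \<Lambda>' B' i where S: "(M, \<Lambda>', B') \<in> seeds s \<iota> \<Lambda> B" "x = M (axis i 1)"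
    using assms(3) by (auto simp: cluster_variables_def)
  have g: "good_seed (M, \<Lambda>', B')" "upper (M, \<Lambda>', B') \<subseteq> upper (\<lambda>c. \<iota> (mono c 1), \<Lambda>, B)"
    using seeds_good[OF assms(1,2) S(1)] by auto
  interpret S1: quantum_frame "scalar \<iota> ` coeff_ring s" "scalar \<iota> s" "Lambda_form \<Lambda>'" "\<lambda>k. \<chi> i. B' $ i $ k" M
    using g(1) by (simp add: good_seed_def)
  have "x \<in> S1.rng {k} {k}" for k unfolding S(2) by (rule S1.rng_M) (simp add: axis_def)
  then show ?thesis using g(2) by (auto simp: upper_def)
qed

lemma initial_cluster_variables:
  assumes "transpose \<Lambda> = - \<Lambda>" "\<Lambda> ** (- B) = mat 1"
  shows "\<iota> (mono (axis i 1) 1) \<in> cluster_variables s \<iota> \<Lambda> B"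
    and "quantum_frame.xp (\<lambda>k. \<chi> i. B $ i $ k) (\<lambda>c. \<iota> (mono c 1)) i \<in> cluster_variables s \<iota> \<Lambda> B"
proof -
  show "\<iota> (mono (axis i 1) 1) \<in> cluster_variables s \<iota> \<Lambda> B"
    unfolding cluster_variables_def mem_Collect_eq
    by (rule exI[of _ "\<lambda>c. \<iota> (mono c 1)"], rule exI[of _ \<Lambda>], rule exI[of _ B], rule exI[of _ i], rule conjI,
        rule refl, rule seeds.initial)
  interpret S1: quantum_frame "scalar \<iota> ` coeff_ring s" "scalar \<iota> s" "Lambda_form \<Lambda>" "\<lambda>k. \<chi> i. B $ i $ k" "\<lambda>c. \<iota> (mono c 1)"
    by (rule initial_frame[OF assms])
  obtain M' where M': "\<And>c d. M' c * M' d = scalar \<iota> s powi Lambda_form \<Lambda> (c + (c $ i) *s (S1.lo i - unit_vec i)) (d + (d $ i) *s (S1.lo i - unit_vec i)) * M' (c + d)"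
    "M' 0 = 1" "\<And>j. j \<noteq> i \<Longrightarrow> M' (unit_vec j) = \<iota> (mono (unit_vec j) 1)" "M' (unit_vec i) = S1.xp i"
    by (rule S1.mutated_frame_exists[of i]) blast
  let ?L = "mutate_Lambda i B \<Lambda>"
  have lo: "S1.lo i = (\<chi> j. if j = i then - 1 else max (- B $ j $ i) 0)"
    by (simp add: vec_eq_iff S1.lo_nth)
  have L: "Lambda_form ?L c d = Lambda_form \<Lambda> (c + (c $ i) *s (S1.lo i - unit_vec i)) (d + (d $ i) *s (S1.lo i - unit_vec i))" for c d
    unfolding Lambda_form_mutate E_matrix_mult lo ..
  have sk: "Lambda_form ?L c d = - Lambda_form ?L d c" for c d unfolding L by (rule Lambda_form_skew[OF assms(1)])
  have "M' c \<noteq> 0" for c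
  proof
    assume "M' c = 0"
    then have "scalar \<iota> s powi Lambda_form ?L c (- c) * M' 0 = 0" using M'(1)[of c "- c"] by (simp add: L)
    then show False using M'(2) S1.v_nz by simp
  qed
  moreover have "transpose ?L = - ?L"
  proof -
    have e: "?L $ j $ i = - ?L $ i $ j" for i j
      using sk[of "axis j 1" "axis i 1"] unfolding Lambda_form_axis .
    show ?thesis
      unfolding vec_eq_iff transpose_def vec_lambda_beta uminus_vec_def by (intro allI e)
  qed
  moreover have "M' c * M' d = scalar \<iota> (s powi Lambda_form ?L c d) * M' (c + d)" for c d
    unfolding scalar_powi L by (rule M'(1))
  ultimately have "toric_frame s \<iota> ?L M'"
    unfolding toric_frame_def using M'(2) by blast
  then have "is_mutation s \<iota> i (\<lambda>c. \<iota> (mono c 1), \<Lambda>, B) (M', ?L, mutate_B i B)"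
    using M'(3,4) by (simp add: is_mutation_def S1.xp_def S1.hi_def S1.lo_def pos_def neg_def)
  then have "(M', ?L, mutate_B i B) \<in> seeds s \<iota> \<Lambda> B" by (rule seeds.mutation[OF seeds.initial])
  then show "S1.xp i \<in> cluster_variables s \<iota> \<Lambda> B"
    unfolding cluster_variables_def M'(4)[symmetric] by blast
qed

end

section \<open>Characters generating the lower bound\<close>


definition zero_rep :: "('n, 'a, 'k::field) rep" where
  "zero_rep = \<lparr>space_at = (\<lambda>_. {0}), map_at = (\<lambda>_ _. 0)\<rparr>"

lemma zero_rep_is_rep: "is_rep Q (zero_rep :: ('n::finite, 'a, 'k::{field,finite}) rep)"
  unfolding is_rep_iff
proof (intro conjI allI ballI)
  fix a
  show "linear_between (space_at zero_rep (tail Q a)) (space_at zero_rep (head Q a)) (map_at (zero_rep :: ('n, 'a, 'k) rep) a)"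
    by (rule linear_betweenI) (auto simp: zero_rep_def kscale_def fun_eq_iff)
qed (simp add: zero_rep_def fsub_zero_space)

lemma zero_rep_injective: "injective_rep Q (zero_rep :: ('n::finite, 'a, 'k::{field,finite}) rep)"
  unfolding injective_rep_def
proof (intro conjI zero_rep_is_rep allI impI, elim conjE)
  fix L N :: "('n, 'a, 'k) rep" and f g
  assume f: "f \<in> Hom Q L N" and g: "g \<in> Hom Q L zero_rep"
  let ?h = "\<lambda>(i :: 'n) (x :: 'k kvec). 0 :: 'k kvec"
  have "linear_between (space_at N i) (space_at zero_rep i) (?h i)" for i
    by (rule linear_betweenI) (auto simp: zero_rep_def kscale_def fun_eq_iff)
  then have "?h \<in> Hom Q N zero_rep" by (simp add: Hom_def zero_rep_def)
  moreover have "g i x = 0" for i x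
    using Hom_in[OF g, of x i] Hom_out[OF g, of x i] by (cases "x \<in> space_at L i") (auto simp: zero_rep_def)
  then have "comp_hom ?h f = g" unfolding comp_hom_def by (intro ext) simp
  ultimately show "\<exists>h\<in>Hom Q N zero_rep. comp_hom h f = g" by blast
qed

lemma dimvec_zero: "dimvec (\<lambda>_. {0 :: 'k::field kvec}) = 0"
  by (simp add: dimvec_def vec_eq_iff dim_zero_space)

lemma rep_dim_zero_rep: "rep_dim (zero_rep :: ('n::finite, 'a, 'k::field) rep) = 0"
  by (simp add: zero_rep_def dimvec_zero)

lemma submodules_zero_rep:
  "{U. submodule Q (zero_rep :: ('n::finite, 'a, 'k::field) rep) U} = {\<lambda>_. {0}}"
proof -
  have "submodule Q (zero_rep :: ('n, 'a, 'k) rep) U \<longleftrightarrow> U = (\<lambda>_. {0})" for U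
  proof
    assume U: "submodule Q (zero_rep :: ('n, 'a, 'k) rep) U"
    have "U i = {0}" for i using U kvec.subspace_0[of "U i"] by (auto simp: submodule_def zero_rep_def)
    then show "U = (\<lambda>_. {0})" by (intro ext)
  next
    assume U: "U = (\<lambda>_. {0})"
    show "submodule Q (zero_rep :: ('n, 'a, 'k) rep) U"
      unfolding submodule_def U by (simp add: zero_rep_def)
  qed
  then show ?thesis by auto
qed

lemma submodules_simple_rep:
  fixes Q :: "('n::finite, 'a) pre_digraph"
  shows "{U. submodule Q (simple_rep i :: ('n, 'a, 'k::{field,finite}) rep) U} =
    {\<lambda>_. {0}, space_at (simple_rep i :: ('n, 'a, 'k) rep)}"
proof -
  let ?S = "simple_rep i :: ('n, 'a, 'k) rep"
  have "submodule Q ?S U \<longleftrightarrow> U = (\<lambda>_. {0}) \<or> U = space_at ?S" for U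
  proof
    assume U: "submodule Q ?S U"
    have s: "kvec.subspace (U j)" "U j \<subseteq> space_at ?S j" for j using U by (auto simp: submodule_def)
    have j: "U j = {0}" if "j \<noteq> i" for j
      using s[of j] kvec.subspace_0[OF s(1)] that by (auto simp: simple_rep_def)
    have i: "U i \<subseteq> supp_space {0}" using s(2)[of i] by (simp add: simple_rep_def)
    show "U = (\<lambda>_. {0}) \<or> U = space_at ?S"
    proof (cases "U i = {0}")
      case True
      then have "U j = {0}" for j using j by (cases "j = i") auto
      then have "U = (\<lambda>_. {0})" by (intro ext)
      then show ?thesis ..
    next
      case False
      then obtain x where x: "x \<in> U i" "x \<noteq> 0" using kvec.subspace_0[OF s(1)] by blast
      have xm: "x m = 0" if "m \<noteq> 0" for m using x(1) i that by (auto simp: supp_space_def)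
      then have x0: "x 0 \<noteq> 0" using x(2) by (metis ext zero_fun_def)
      have "y \<in> U i" if "y \<in> supp_space {0}" for y
      proof -
        have "y m = kscale (y 0 / x 0) x m" for m
          using that x0 xm[of m] by (cases "m = 0") (auto simp: supp_space_def kscale_def)
        then have "y = kscale (y 0 / x 0) x" by (rule ext)
        then show ?thesis using kvec.subspace_scale[OF s(1) x(1)] by metis
      qed
      then have "U i = supp_space {0}" using i by blast
      then have "U k = space_at ?S k" for k using j by (simp add: simple_rep_def)
      then have "U = space_at ?S" by (rule ext)
      then show ?thesis ..
    qed
  next
    have f: "fsub (space_at ?S j)" for j by (rule rep_fsub[OF simple_rep])
    have z: "0 \<in> space_at ?S j" for j by (rule fsub_zero[OF f])
    have m: "map_at ?S a x = 0" for a x by (simp add: simple_rep_def)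
    assume "U = (\<lambda>_. {0}) \<or> U = space_at ?S"
    then show "submodule Q ?S U"
      unfolding submodule_def using fsub_subspace[OF f] z m by auto
  qed
  then show ?thesis by (intro set_eqI) (simp only: mem_Collect_eq insert_iff empty_iff simp_thms)
qed

context quiver_frame
begin

lemma num_arrows_eq_0: "ht i \<le> ht j \<Longrightarrow> num_arrows Q j i = 0"
proof -
  assume "ht i \<le> ht j"
  then have "{a \<in> arcs Q. tail Q a = j \<and> head Q a = i} = {}" using ht by fastforce
  then show ?thesis unfolding num_arrows_def by (simp only: card.empty)
qed

text \<open>Sorting by rank gives the required order: arrows raise the rank, so none runs from a
  later vertex to an earlier one.\<close>

lemma upper_bound_eq_lower_bound:
  assumes "\<And>k. z \<in> rng {k} {k}"
  shows "z \<in> rng UNIV UNIV"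
proof -
  obtain xs where xs: "set xs = (UNIV :: 'n set)" "distinct xs" using finite_distinct_list[OF finite] by blast
  define l where "l = sort_key ht xs"
  have "sorted_wrt (\<lambda>i j. ht i \<le> ht j) l" using sorted_sort_key[of ht xs] by (simp add: l_def sorted_map)
  moreover have "b i $ j \<le> 0" if "ht i \<le> ht j" for i j
    using num_arrows_eq_0[OF that] by (simp add: b_eq B_matrix_def)
  ultimately have "sorted_wrt (\<lambda>i j. b i $ j \<le> 0) l" by (auto elim: sorted_wrt_mono_rel[rotated])
  moreover have "distinct l" using xs by (simp add: l_def)
  moreover have "z \<in> T" using rng_T assms by blast
  ultimately have "z \<in> rng (set l) (set l)" by (rule upper_bound_subset_lower_bound) (rule assms)
  then show ?thesis by (simp add: l_def xs)
qed

definition g_vec :: "('n, 'a, 'k::field) rep \<Rightarrow> int^'n" where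
  "g_vec R = - ((mat 1 - transpose (R_matrix Q)) *v rep_dim R)"

text \<open>The cluster character inside the frame, regrouped as a sum over submodules instead of
  dimension vectors and with \<open>chi\<close> in place of the Euler form.\<close>

definition character :: "('n, 'a, 'k::field) rep \<Rightarrow> ('n, 'a, 'k) rep \<Rightarrow> 'f" where
  "character R I = (\<Sum>U\<in>{U. submodule Q R U}. v powi (- chi Q (dimvec U) (rep_dim R - dimvec U - rep_dim I)) *
     M (- (B_matrix Q *v dimvec U) + g_vec R + dimvec (soc Q I)))"

lemma g_vec_nth: "g_vec R $ k = - rep_dim R $ k + (\<Sum>a\<in>{a \<in> arcs Q. tail Q a = k}. rep_dim R $ head Q a)"
  unfolding g_vec_def uminus_vec_def vec_lambda_beta I_minus_R_mult_nth[OF fin] by simp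

lemma B_axis: "B_matrix Q *v axis k 1 = b k"
  using B_mult_axis[of 0 1 k] by simp

lemma L_B_mult: "L c (B_matrix Q *v e) = - (\<Sum>k\<in>UNIV. e $ k * c $ k)"
proof -
  have "Modules.additive (\<lambda>e. L c (B_matrix Q *v e))"
    by unfold_locales (simp add: matrix_vector_right_distrib L_add2)
  from additive_expand[OF this] show ?thesis by (simp add: B_axis L_b sum_negf)
qed

text \<open>On unit vectors this is \<open>soc_dim_injective\<close>: the simple module at
  \<open>k\<close> maps into \<open>I\<close> only through the socle and has no extensions with
  it.\<close>

lemma chi_soc:
  assumes "injective_rep Q (I :: ('n, 'a, 'k::{field,finite}) rep)"
  shows "chi Q e (rep_dim I) = (\<Sum>k\<in>UNIV. e $ k * dimvec (soc Q I) $ k)"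
proof -
  have "Modules.additive (\<lambda>e. chi Q e (rep_dim I))" by unfold_locales (simp add: chi_add_left)
  from additive_expand[OF this] have "chi Q e (rep_dim I) = (\<Sum>k\<in>UNIV. e $ k * chi Q (axis k 1) (rep_dim I))" .
  moreover have "chi Q (axis k 1) (rep_dim I) = dimvec (soc Q I) $ k" for k
    unfolding chi_axis_left[OF fin] using soc_dim_injective[OF assms, of k] by (simp add: dimvec_def)
  ultimately show ?thesis by simp
qed

text \<open>By \<open>L_B_mult\<close> and \<open>chi_soc\<close>, moving the monomial of the socle
  to the front cancels the dependence of the power of \<open>v\<close> on \<open>I\<close>. What
  remains of \<open>I\<close> is, up to a power of \<open>v\<close>, a monomial without
  denominators.\<close>

lemma character_factor:
  assumes "injective_rep Q (I :: ('n, 'a, 'k::{field,finite}) rep)"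
  shows "character R I = v powi (- L (dimvec (soc Q I)) (g_vec R)) * (M (dimvec (soc Q I)) *
    (\<Sum>U\<in>{U. submodule Q R U}. v powi (- chi Q (dimvec U) (rep_dim R - dimvec U)) * M (g_vec R - B_matrix Q *v dimvec U)))"
proof -
  let ?s = "dimvec (soc Q I)" and ?g = "g_vec R" and ?m = "rep_dim R" and ?i = "rep_dim I"
  have "v powi (- chi Q e (?m - e - ?i)) * M (- (B_matrix Q *v e) + ?g + ?s)
    = v powi (- L ?s ?g) * (M ?s * (v powi (- chi Q e (?m - e)) * M (?g - B_matrix Q *v e)))" for e
  proof -
    have "chi Q e (?m - e - ?i) = chi Q e (?m - e) - chi Q e ?i"
      using chi_add_right[of Q e "?m - e" "- ?i"] by (simp add: chi_uminus_right)
    moreover have "L ?s (B_matrix Q *v e) = - chi Q e ?i" by (simp add: L_B_mult chi_soc[OF assms])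
    ultimately have ex: "- chi Q e (?m - e - ?i) - L ?s (?g - B_matrix Q *v e) = - L ?s ?g - chi Q e (?m - e)"
      by (simp add: L_diff2)
    have "- (B_matrix Q *v e) + ?g + ?s = ?s + (?g - B_matrix Q *v e)" by simp
    then have "v powi (- chi Q e (?m - e - ?i)) * M (- (B_matrix Q *v e) + ?g + ?s)
      = v powi (- chi Q e (?m - e - ?i) - L ?s (?g - B_matrix Q *v e)) * (M ?s * M (?g - B_matrix Q *v e))"
      by (simp only: M_plus v_add' diff_conv_add_uminus)
    also have "\<dots> = v powi (- L ?s ?g) * (v powi (- chi Q e (?m - e)) * (M ?s * M (?g - B_matrix Q *v e)))"
      unfolding ex v_add' by simp
    finally show ?thesis unfolding v_left[of "M ?s"] .
  qed
  then show ?thesis by (simp add: character_def sum_distrib_left)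
qed

lemma character_rng:
  assumes "of_nat CARD('k) = v powi 2" "is_rep Q (R :: ('n, 'a, 'k::{field,finite}) rep)" "injective_rep Q I"
  shows "character R I \<in> rng UNIV UNIV"
proof (rule upper_bound_eq_lower_bound)
  fix k
  show "character R I \<in> rng {k} {k}"
    unfolding character_factor[OF assms(3)]
    by (intro rng_mult rng_v rng_M character_sum_rng[OF assms(1,2) g_vec_nth]) (simp add: dimvec_def)
qed

lemma character_zero_IM: "character (zero_rep :: ('n, 'a, 'k::{field,finite}) rep) (IM i) = M (unit_vec i)"
proof -
  have "chi Q 0 y = 0" for y by (simp add: chi_def)
  moreover have "g_vec (zero_rep :: ('n, 'a, 'k) rep) = 0" by (simp add: g_vec_def rep_dim_zero_rep)
  ultimately show ?thesis by (simp add: character_def submodules_zero_rep dimvec_zero soc_IM)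
qed

text \<open>The two submodules of a simple module give the two terms of the exchange relation. The
  zero submodule gives \<open>hi i\<close>, because no vertex is joined to \<open>i\<close> by
  arrows in both directions.\<close>

lemma character_simple: "character (simple_rep i :: ('n, 'a, 'k::{field,finite}) rep) zero_rep = xp i"
proof -
  let ?S = "simple_rep i :: ('n, 'a, 'k) rep"
  have "soc Q (zero_rep :: ('n, 'a, 'k) rep) = (\<lambda>_. {0})"
    by (rule ext) (simp add: soc_eq[OF zero_rep_is_rep], simp add: zero_rep_def)
  then have s: "dimvec (soc Q (zero_rep :: ('n, 'a, 'k) rep)) = 0" by (simp add: dimvec_zero)
  have g: "g_vec ?S = hi i"
  proof -
    have "g_vec ?S $ k = hi i $ k" for k
    proof -
      have "(\<Sum>j\<in>UNIV. int (num_arrows Q k j) * axis i 1 $ j) = (\<Sum>j\<in>UNIV. if j = i then int (num_arrows Q k j) else 0)"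
        by (rule sum.cong) (auto simp: axis_def)
      then have "g_vec ?S $ k = - axis i 1 $ k + int (num_arrows Q k i)"
        unfolding g_vec_nth simple_rep_dim sum_num_arrows_out[OF fin, symmetric] by simp
      moreover have "num_arrows Q i i = 0" by (rule num_arrows_eq_0) simp
      moreover have "num_arrows Q k i = 0 \<or> num_arrows Q i k = 0"
        using num_arrows_eq_0[of i k] num_arrows_eq_0[of k i] by linarith
      ultimately show ?thesis by (auto simp: hi_nth b_eq B_matrix_def axis_def)
    qed
    then show ?thesis by (simp add: vec_eq_iff)
  qed
  have d: "rep_dim ?S = axis i 1" by (rule simple_rep_dim)
  have c0: "chi Q x 0 = 0" "chi Q 0 x = 0" for x by (simp_all add: chi_def)
  have "(axis i 1 :: int^'n) \<noteq> 0" by (simp add: axis_eq_0_iff)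
  then have "(\<lambda>_. {0}) \<noteq> space_at ?S" using d dimvec_zero by metis
  then have "character ?S zero_rep
    = v powi (- chi Q 0 (axis i 1 - 0 - 0)) * M (- (B_matrix Q *v 0) + hi i + 0)
      + v powi (- chi Q (axis i 1) (axis i 1 - axis i 1 - 0)) * M (- (B_matrix Q *v axis i 1) + hi i + 0)"
    unfolding character_def submodules_simple_rep
    by (simp only: sum.insert sum.empty finite.intros singleton_iff empty_iff not_False_eq_True dimvec_zero d s g rep_dim_zero_rep simp_thms add_0_right)
  also have "\<dots> = M (hi i) + M (lo i)"
    unfolding B_axis by (simp add: c0 hi_lo)
  finally show ?thesis by (simp add: xp_def)
qed

end

context torus_fractions
begin

text \<open>The cardinality of each Grassmannian is unfolded into a sum over its members.\<close>

lemma iota_qcc: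
  fixes Q :: "('n, 'a) pre_digraph" and R I :: "('n, 'a, 'k::{field,finite}) rep"
  assumes "quiver_frame (scalar \<iota> ` coeff_ring s) (scalar \<iota> s) (Lambda_form \<Lambda>) (\<lambda>k. \<chi> i. B_matrix Q $ i $ k)
      (\<lambda>c. \<iota> (mono c 1)) Q en ht"
    and R: "is_rep Q R"
  shows "\<iota> (qcc s Q (R, I)) = quiver_frame.character (scalar \<iota> s) (\<lambda>c. \<iota> (mono c 1)) Q R I"
proof -
  interpret quiver_frame "scalar \<iota> ` coeff_ring s" "scalar \<iota> s" "Lambda_form \<Lambda>" "\<lambda>k. \<chi> i. B_matrix Q $ i $ k"
    "\<lambda>c. \<iota> (mono c 1)" Q en ht by fact
  have eu: "euler_form TYPE('k) Q = chi Q" by (rule euler_form_eq_chi[OF fin projective_presentation])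
  let ?S = "{U. submodule Q R U}"
  let ?c = "\<lambda>e. - (B_matrix Q *v e) - ((mat 1 - transpose (R_matrix Q)) *v rep_dim R) + dimvec (soc Q I)"
  let ?x = "\<lambda>e. - chi Q e (rep_dim R - e - rep_dim I)"
  have fS: "finite ?S" by (rule finite_submodules[OF R])
  have cr: "real (card (Gr Q e R)) * s powi ?x e \<in> coeff_ring s" for e
    by (intro coeff_ring_mult coeff_ring_of_nat coeff_ring_powi)
  have "\<iota> (qcc s Q (R, I)) = (\<Sum>e\<in>dimvec ` ?S. \<iota> (mono (?c e) (real (card (Gr Q e R)) * s powi ?x e)))"
    unfolding qcc_def eu prod.case by (rule iota_sum) (auto intro: fS carrier_single cr)
  also have "\<dots> = (\<Sum>e\<in>dimvec ` ?S. of_nat (card (Gr Q e R)) * (scalar \<iota> s powi ?x e * \<iota> (mono (?c e) 1)))"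
    by (simp add: scalar_M[OF cr, symmetric] scalar_mult[OF coeff_ring_of_nat coeff_ring_powi] scalar_of_nat scalar_powi mult.assoc)
  also have "\<dots> = (\<Sum>e\<in>dimvec ` ?S. \<Sum>U\<in>{U \<in> ?S. dimvec U = e}. scalar \<iota> s powi ?x (dimvec U) * \<iota> (mono (?c (dimvec U)) 1))"
    by (rule sum.cong) (auto simp: Gr_def)
  also have "\<dots> = (\<Sum>U\<in>?S. scalar \<iota> s powi ?x (dimvec U) * \<iota> (mono (?c (dimvec U)) 1))"
    by (rule sum.image_gen[OF fS, symmetric])
  finally show ?thesis unfolding character_def g_vec_def diff_conv_add_uminus .
qed

end

theorem theorem4p5:
  fixes Q :: "('n::finite, 'a) pre_digraph"
    and \<Lambda> :: "int^'n^'n"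
    and s :: real
    and \<iota> :: "'n torus \<Rightarrow> 'f::division_ring"
  assumes "fin_digraph Q" and "verts Q = UNIV"
    and "acyclic_quiver Q"
    and "bipartite_quiver Q"
    and "rank (map_matrix real_of_int (B_matrix Q)) = CARD('n)"
    and "transpose \<Lambda> = - \<Lambda>"
    and "\<Lambda> ** (- B_matrix Q) = mat 1"
    and "s\<^sup>2 = real CARD('k::{field,finite})"
    and "skew_field_of_fractions s \<Lambda> \<iota>"
  shows "cluster_character_algebra TYPE('k) s \<iota> Q = quantum_cluster_algebra s \<iota> \<Lambda> (B_matrix Q)"
proof -
  have "s \<noteq> 0" using assms(8) by auto
  then interpret torus_fractions s \<Lambda> \<iota> using assms(9) by unfold_locales
  obtain ht where ht: "\<And>a. a \<in> arcs Q \<Longrightarrow> ht (tail Q a) < (ht (head Q a) :: nat)"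
    by (rule acyclic_rank[OF assms(1,3)]) (rule that)
  have fin: "finite (arcs Q)" using assms(1) by (rule fin_digraph.finite_arcs)
  obtain en :: "'a \<Rightarrow> nat" where en: "inj_on en (arcs Q)" using finite_imp_inj_to_nat_seg[OF fin] by blast
  let ?K = "scalar \<iota> ` coeff_ring s" and ?v = "scalar \<iota> s" and ?M = "\<lambda>c. \<iota> (mono c 1)" and ?B = "B_matrix Q"
  let ?b = "\<lambda>k. \<chi> i. ?B $ i $ k"
  have qf: "quiver_frame ?K ?v (Lambda_form \<Lambda>) ?b ?M Q en ht"
    using initial_frame[OF assms(6,7)]
    by (intro quiver_frame.intro quiver_frame_axioms.intro ranked_quiver.intro fin en ht refl)
  interpret quiver_frame ?K ?v "Lambda_form \<Lambda>" ?b ?M Q en ht by (rule qf)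
  have q: "of_nat CARD('k) = ?v powi 2"
    unfolding scalar_powi[symmetric] scalar_of_nat[symmetric] using assms(8) by simp
  \<comment> \<open>Both algebras are treated alike: a set inside the lower bound that contains the
    initial and the once mutated variables generates exactly the lower bound.\<close>
  have gen: "subring_gen (?K \<union> G) = rng UNIV UNIV"
    if G: "G \<subseteq> rng UNIV UNIV" "\<And>i. ?M (unit_vec i) \<in> G" "\<And>i. xp i \<in> G" for G
  proof
    have "?K \<union> G \<subseteq> rng UNIV UNIV" using G(1) rng_K by blast
    then have "?K \<union> G \<subseteq> subring_gen (?K \<union> ?M ` {c. \<forall>i\<in>UNIV. 0 \<le> c $ i} \<union> xp ` UNIV)" unfolding rng_def .
    from subring_gen_subset[OF this] show "subring_gen (?K \<union> G) \<subseteq> rng UNIV UNIV" unfolding rng_def .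
    show "rng UNIV UNIV \<subseteq> subring_gen (?K \<union> G)"
      by (rule rng_subset_generated) (use G(2,3) in auto)
  qed
  have "quantum_cluster_algebra s \<iota> \<Lambda> ?B = rng UNIV UNIV"
    unfolding quantum_cluster_algebra_def subalgebra_gen_def
  proof (rule gen)
    show "cluster_variables s \<iota> \<Lambda> ?B \<subseteq> rng UNIV UNIV"
      using cluster_variables_upper[OF assms(6,7)] upper_bound_eq_lower_bound by (auto simp: upper_def)
  qed (rule initial_cluster_variables[OF assms(6,7)])+
  moreover have "cluster_character_algebra TYPE('k) s \<iota> Q = rng UNIV UNIV"
    unfolding cluster_character_algebra_def subalgebra_gen_def
  proof (rule gen)
    let ?C = "(\<lambda>L. \<iota> (qcc s Q L)) ` (cluster_objects Q :: (('n, 'a, 'k) rep \<times> ('n, 'a, 'k) rep) set)"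
    have mem: "character R I \<in> ?C" if "is_rep Q R" "injective_rep Q I" for R I :: "('n, 'a, 'k) rep"
      unfolding iota_qcc[OF qf that(1), symmetric]
      by (rule imageI) (simp add: cluster_objects_def that)
    show "?M (unit_vec i) \<in> ?C" for i
      using mem[OF zero_rep_is_rep IM_injective] unfolding character_zero_IM .
    show "xp i \<in> ?C" for i
      using mem[OF simple_rep zero_rep_injective] unfolding character_simple .
    show "?C \<subseteq> rng UNIV UNIV"
    proof (rule image_subsetI)
      fix L :: "('n, 'a, 'k) rep \<times> ('n, 'a, 'k) rep" assume "L \<in> cluster_objects Q"
      then obtain R I where L: "L = (R, I)" "is_rep Q R" "injective_rep Q I" by (auto simp: cluster_objects_def)
      show "\<iota> (qcc s Q L) \<in> rng UNIV UNIV"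
        unfolding L(1) iota_qcc[OF qf L(2)] by (rule character_rng[OF q L(2,3)])
    qed
  qed
  ultimately show ?thesis by simp
qed

end
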